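(* Let $A\subset\mathbb R^q$ be Borel with $p_A:=\mathbb P(\mathbf Z\in A)>0$, and assume Conditions (C) and (W) below hold. Let $M\ge 2$. Then the process $$\overline{\mathcal D}^*_{n,M,A}(\mathbf u_0,\dots,\mathbf u_M):=\big(\overline{\mathbb D}_n(\mathbf u_0,A),\widetilde{\mathbb D}^*_{n,1}(\mathbf u_1,A),\dots,\widetilde{\mathbb D}^*_{n,M}(\mathbf u_M,A)\big)$$ converges weakly in $\ell^\infty([0,1]^{p(M+1)},\mathbb R^{M+1})$ to a process that concatenates $M+1$ independent copies of $$\mathbb D_\infty(\mathbf u,A):=\mathbb B(\mathbf u,A)-p_A^{-1}\sum_{k=1}^p\partial_kD(\mathbf u,A)\Big(\mathbb B\big((u_k,\mathbf 1_{-k}),A\big)-u_k\mathbb B(\mathbf 1,A)\Big),$$ where $\mathbb B(\cdot,A)$ is a centered Gaussian process on $[0,1]^p$ with covariance $\mathbb E[\mathbb B(\mathbf u,A)\mathbb B(\mathbf u',A)]=p_AC(\mathbf u\wedge\mathbf u'|A)-p_A^2C(\mathbf u|A)C(\mathbf u'|A)$.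
   Context: Let $(\mathbf X,\mathbf Z)$ be a random vector in $\mathbb R^p\times\mathbb R^q$ and $(\mathbf X_1,\mathbf Z_1),\dots,(\mathbf X_n,\mathbf Z_n)$ i.i.d. copies. Vector inequalities and $\wedge$ are componentwise. The conditional margins $F_k(t|A):=\mathbb P(X_k\le t\mid\mathbf Z\in A)$ are continuous (standing assumption); $C(\cdot|A)$ is the conditional copula of $\mathbf X$ given $\mathbf Z\in A$. Let $\mathbf U^A:=(F_1(X_1|A),\dots,F_p(X_p|A))$, $D(\mathbf u,A):=\mathbb P(\mathbf U^A\le\mathbf u,\mathbf Z\in A)$. Let $\hat p_A:=n^{-1}\sum_i\mathbf 1(\mathbf Z_i\in A)$, $F_{n,k}(t|A):=\frac1{n\hat p_A}\sum_i\mathbf 1(X_{i,k}\le t,\mathbf Z_i\in A)$, generalized inverse $F^{-1}(u):=\inf\{t:F(t)\ge u\}$, $\overline D_n(\mathbf u,A):=n^{-1}\sum_i\mathbf 1\big(X_{i,k}\le F^{-1}_{n,k}(u_k|A)\ \forall k,\ \mathbf Z_i\in A\big)$ and $\overline{\mathbb D}_n(\mathbf u,A):=\sqrt n(\overline D_n-D)(\mathbf u,A)$. $(u_k,\mathbf 1_{-k})$ is the vector with $k$-th coordinate $u_k$ and other coordinates $1$. Condition (C): for every $k$, the partial derivative $\partial_kD(\mathbf u,A)$ w.r.t. $u_k$ exists and is continuous on $\{\mathbf u:0<u_k<1\}$. Exchangeable bootstrap: $\mathbf W_n=(W_{n,1},\dots,W_{n,n})$ exchangeable nonnegative, independent of the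 sample, $\overline W_n:=n^{-1}\sum_iW_{n,i}$, $\mathbb D^*_n(\mathbf u,A):=n^{-1/2}\sum_iW_{n,i}\mathbf 1\big(X_{i,k}\le F^{-1}_{n,k}(u_k|A)\ \forall k,\mathbf Z_i\in A\big)-\sqrt n\,\overline W_n\overline D_n(\mathbf u,A)$. Condition (W): $\sup_n\int_0^\infty\sqrt{\mathbb P(|W_{n,1}-\overline W_n|>t)}dt<\infty$, $n^{-1/2}\mathbb E[\max_i|W_{n,i}-\overline W_n|]\to0$ in probability, $n^{-1}\sum_i(W_{n,i}-\overline W_n)^2\to1$ in probability. Estimated derivatives: with $u^+_{k,n}:=\min(u_k+n^{-1/2},1)$, $u^-_{k,n}:=\max(u_k-n^{-1/2},0)$, $\widehat{\partial_kD}(\mathbf u,A):=\big(\overline D_n(\mathbf u_{-k},u^+_{k,n},A)-\overline D_n(\mathbf u_{-k},u^-_{k,n},A)\big)/(u^+_{k,n}-u^-_{k,n})$, where $(\mathbf u_{-k},t)$ is $\mathbf u$ with its $k$-th coordinate replaced by $t$. Then $$\widetilde{\mathbb D}^*_n(\mathbf u,A):=\mathbb D^*_n(\mathbf u,A)-\hat p_A^{-1}\sum_{k=1}^p\widehat{\partial_kD}(\mathbf u,A)\Big(\mathbb D^*_n\big((u_k,\mathbf 1_{-k}),A\big)-u_k\mathbb D^*_n(\mathbf 1,A)\Big),$$ and $\widetilde{\mathbb D}^*_{n,1},\dots,\widetilde{\mathbb D}^*_{n,M}$ are computed from $M$ mutually independent realizations of $\mathbf W_n$, independent of the sample. *)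

theory Defs
  imports "HOL-Probability.Probability"
begin

definition cube :: "(real^'p) set" where
  "cube = {u. \<forall>k. 0 \<le> u $ k \<and> u $ k \<le> 1}"

definition vupd :: "real^'p \<Rightarrow> 'p \<Rightarrow> real \<Rightarrow> real^'p" where
  "vupd u k t = (\<chi> i. if i = k then t else u $ i)"

definition vmin :: "real^'p \<Rightarrow> real^'p \<Rightarrow> real^'p" where
  "vmin u v = (\<chi> i. min (u $ i) (v $ i))"

section \<open>Population quantities; (X,Z) is the generic copy V 0 = (X_1,Z_1)\<close>

definition pA :: "'w measure \<Rightarrow> (nat \<Rightarrow> 'w \<Rightarrow> (real^'p) \<times> (real^'q)) \<Rightarrow> (real^'q) set \<Rightarrow> real" where
  "pA P V A = measure P {\<omega> \<in> space P. snd (V 0 \<omega>) \<in> A}"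

definition condF :: "'w measure \<Rightarrow> (nat \<Rightarrow> 'w \<Rightarrow> (real^'p) \<times> (real^'q)) \<Rightarrow> (real^'q) set
    \<Rightarrow> 'p \<Rightarrow> real \<Rightarrow> real" where
  "condF P V A k t = measure P {\<omega> \<in> space P. fst (V 0 \<omega>) $ k \<le> t \<and> snd (V 0 \<omega>) \<in> A} / pA P V A"

definition DD :: "'w measure \<Rightarrow> (nat \<Rightarrow> 'w \<Rightarrow> (real^'p) \<times> (real^'q)) \<Rightarrow> (real^'q) set
    \<Rightarrow> real^'p \<Rightarrow> real" where
  "DD P V A u = measure P {\<omega> \<in> space P.
      (\<forall>k. condF P V A k (fst (V 0 \<omega>) $ k) \<le> u $ k) \<and> snd (V 0 \<omega>) \<in> A}"

text \<open>conditional copula C(u|A) of X given Z in A: the conditional distribution function of U^A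
  given Z in A (margins continuous, so this is the copula)\<close>
definition cond_copula :: "'w measure \<Rightarrow> (nat \<Rightarrow> 'w \<Rightarrow> (real^'p) \<times> (real^'q)) \<Rightarrow> (real^'q) set
    \<Rightarrow> real^'p \<Rightarrow> real" where
  "cond_copula P V A u = measure P {\<omega> \<in> space P.
      (\<forall>k. condF P V A k (fst (V 0 \<omega>) $ k) \<le> u $ k) \<and> snd (V 0 \<omega>) \<in> A} / pA P V A"

definition pdD :: "'w measure \<Rightarrow> (nat \<Rightarrow> 'w \<Rightarrow> (real^'p) \<times> (real^'q)) \<Rightarrow> (real^'q) set
    \<Rightarrow> 'p \<Rightarrow> real^'p \<Rightarrow> real" where
  "pdD P V A k u = (if 0 < u $ k \<and> u $ k < 1
      then deriv (\<lambda>t. DD P V A (vupd u k t)) (u $ k) else 0)"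

definition condC :: "'w measure \<Rightarrow> (nat \<Rightarrow> 'w \<Rightarrow> (real^'p) \<times> (real^'q)) \<Rightarrow> (real^'q) set \<Rightarrow> bool" where
  "condC P V A \<longleftrightarrow> (\<forall>k.
     (\<forall>u\<in>cube. 0 < u $ k \<and> u $ k < 1 \<longrightarrow>
        (\<lambda>t. DD P V A (vupd u k t)) differentiable (at (u $ k)))
   \<and> continuous_on {u \<in> cube. 0 < u $ k \<and> u $ k < 1} (pdD P V A k))"

definition covB :: "'w measure \<Rightarrow> (nat \<Rightarrow> 'w \<Rightarrow> (real^'p) \<times> (real^'q)) \<Rightarrow> (real^'q) set
    \<Rightarrow> real^'p \<Rightarrow> real^'p \<Rightarrow> real" where
  "covB P V A u u' = pA P V A * cond_copula P V A (vmin u u')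
      - (pA P V A)\<^sup>2 * cond_copula P V A u * cond_copula P V A u'"

definition Dinf :: "'w measure \<Rightarrow> (nat \<Rightarrow> 'w \<Rightarrow> (real^'p) \<times> (real^'q)) \<Rightarrow> (real^'q) set
    \<Rightarrow> (real^'p \<Rightarrow> real) \<Rightarrow> real^'p \<Rightarrow> real" where
  "Dinf P V A b u = b u - (1 / pA P V A) *
     (\<Sum>k\<in>UNIV. pdD P V A k u * (b (vupd (vec 1) k (u $ k)) - u $ k * b (vec 1)))"

definition phat :: "(nat \<Rightarrow> 'w \<Rightarrow> (real^'p) \<times> (real^'q)) \<Rightarrow> (real^'q) set \<Rightarrow> nat \<Rightarrow> 'w \<Rightarrow> real" where
  "phat V A n \<omega> = (\<Sum>i<n. if snd (V i \<omega>) \<in> A then 1 else 0) / real n"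

definition Fn :: "(nat \<Rightarrow> 'w \<Rightarrow> (real^'p) \<times> (real^'q)) \<Rightarrow> (real^'q) set \<Rightarrow> nat \<Rightarrow> 'p \<Rightarrow> 'w \<Rightarrow> real \<Rightarrow> real" where
  "Fn V A n k \<omega> t = (\<Sum>i<n. if fst (V i \<omega>) $ k \<le> t \<and> snd (V i \<omega>) \<in> A then 1 else 0)
      / (real n * phat V A n \<omega>)"

text \<open>generalized inverse, in the extended reals (inf of empty set = +infinity)\<close>
definition geninv :: "(real \<Rightarrow> real) \<Rightarrow> real \<Rightarrow> ereal" where
  "geninv F u = Inf {ereal t | t. u \<le> F t}"

definition indic_obs :: "(nat \<Rightarrow> 'w \<Rightarrow> (real^'p) \<times> (real^'q)) \<Rightarrow> (real^'q) set \<Rightarrow> nat \<Rightarrow> 'w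
    \<Rightarrow> real^'p \<Rightarrow> nat \<Rightarrow> real" where
  "indic_obs V A n \<omega> u i = (if (\<forall>k. ereal (fst (V i \<omega>) $ k) \<le> geninv (Fn V A n k \<omega>) (u $ k))
      \<and> snd (V i \<omega>) \<in> A then 1 else 0)"

definition Dbar :: "(nat \<Rightarrow> 'w \<Rightarrow> (real^'p) \<times> (real^'q)) \<Rightarrow> (real^'q) set \<Rightarrow> nat \<Rightarrow> 'w \<Rightarrow> real^'p \<Rightarrow> real" where
  "Dbar V A n \<omega> u = (\<Sum>i<n. indic_obs V A n \<omega> u i) / real n"

definition DbarProc :: "'w measure \<Rightarrow> (nat \<Rightarrow> 'w \<Rightarrow> (real^'p) \<times> (real^'q)) \<Rightarrow> (real^'q) set
    \<Rightarrow> nat \<Rightarrow> 'w \<Rightarrow> real^'p \<Rightarrow> real" where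
  "DbarProc P V A n \<omega> u = sqrt (real n) * (Dbar V A n \<omega> u - DD P V A u)"

text \<open>one realization of the weights: W n i = W_{n,i+1}\<close>
definition Wbar :: "(nat \<Rightarrow> nat \<Rightarrow> 'w \<Rightarrow> real) \<Rightarrow> nat \<Rightarrow> 'w \<Rightarrow> real" where
  "Wbar W n \<omega> = (\<Sum>i<n. W n i \<omega>) / real n"

definition Dstar :: "(nat \<Rightarrow> 'w \<Rightarrow> (real^'p) \<times> (real^'q)) \<Rightarrow> (real^'q) set \<Rightarrow> (nat \<Rightarrow> nat \<Rightarrow> 'w \<Rightarrow> real)
    \<Rightarrow> nat \<Rightarrow> 'w \<Rightarrow> real^'p \<Rightarrow> real" where
  "Dstar V A W n \<omega> u = (\<Sum>i<n. W n i \<omega> * indic_obs V A n \<omega> u i) / sqrt (real n)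
      - sqrt (real n) * Wbar W n \<omega> * Dbar V A n \<omega> u"

definition pd_hat :: "(nat \<Rightarrow> 'w \<Rightarrow> (real^'p) \<times> (real^'q)) \<Rightarrow> (real^'q) set \<Rightarrow> nat \<Rightarrow> 'w
    \<Rightarrow> 'p \<Rightarrow> real^'p \<Rightarrow> real" where
  "pd_hat V A n \<omega> k u =
    (let up = min (u $ k + 1 / sqrt (real n)) 1; um = max (u $ k - 1 / sqrt (real n)) 0
     in (Dbar V A n \<omega> (vupd u k up) - Dbar V A n \<omega> (vupd u k um)) / (up - um))"

definition Dtilde :: "(nat \<Rightarrow> 'w \<Rightarrow> (real^'p) \<times> (real^'q)) \<Rightarrow> (real^'q) set \<Rightarrow> (nat \<Rightarrow> nat \<Rightarrow> 'w \<Rightarrow> real)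
    \<Rightarrow> nat \<Rightarrow> 'w \<Rightarrow> real^'p \<Rightarrow> real" where
  "Dtilde V A W n \<omega> u = Dstar V A W n \<omega> u - (1 / phat V A n \<omega>) *
     (\<Sum>k\<in>UNIV. pd_hat V A n \<omega> k u *
        (Dstar V A W n \<omega> (vupd (vec 1) k (u $ k)) - u $ k * Dstar V A W n \<omega> (vec 1)))"

definition conv_in_prob :: "'w measure \<Rightarrow> (nat \<Rightarrow> 'w \<Rightarrow> real) \<Rightarrow> real \<Rightarrow> bool" where
  "conv_in_prob P Y c \<longleftrightarrow>
     (\<forall>\<epsilon>>0. (\<lambda>n. measure P {\<omega> \<in> space P. \<bar>Y n \<omega> - c\<bar> > \<epsilon>}) \<longlonglongrightarrow> 0)"

definition exch_weights :: "'w measure \<Rightarrow> (nat \<Rightarrow> nat \<Rightarrow> 'w \<Rightarrow> real) \<Rightarrow> bool" where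
  "exch_weights P W \<longleftrightarrow>
     (\<forall>n. \<forall>i<n. W n i \<in> borel_measurable P) \<and>
     (\<forall>n. \<forall>i<n. \<forall>\<omega>\<in>space P. 0 \<le> W n i \<omega>) \<and>
     (\<forall>n \<pi>. \<pi> permutes {..<n} \<longrightarrow>
        distr P (Pi\<^sub>M {..<n} (\<lambda>_. borel)) (\<lambda>\<omega>. \<lambda>i\<in>{..<n}. W n (\<pi> i) \<omega>)
      = distr P (Pi\<^sub>M {..<n} (\<lambda>_. borel)) (\<lambda>\<omega>. \<lambda>i\<in>{..<n}. W n i \<omega>))"

definition condW :: "'w measure \<Rightarrow> (nat \<Rightarrow> nat \<Rightarrow> 'w \<Rightarrow> real) \<Rightarrow> bool" where
  "condW P W \<longleftrightarrow>
     (\<exists>K::real. \<forall>n\<ge>1.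
        (\<integral>\<^sup>+ t\<in>{0..}. ennreal (sqrt (measure P {\<omega> \<in> space P. \<bar>W n 0 \<omega> - Wbar W n \<omega>\<bar> > t})) \<partial>lborel)
          \<le> ennreal K) \<and>
     (\<lambda>n. (\<integral>\<omega>. Max ((\<lambda>i. \<bar>W n i \<omega> - Wbar W n \<omega>\<bar>) ` {..<n}) \<partial>P) / sqrt (real n)) \<longlonglongrightarrow> 0 \<and>
     conv_in_prob P (\<lambda>n \<omega>. (\<Sum>i<n. (W n i \<omega> - Wbar W n \<omega>)\<^sup>2) / real n) 1"

definition gen_sigma :: "'w measure \<Rightarrow> ('i \<Rightarrow> 'w \<Rightarrow> 'b::topological_space) \<Rightarrow> 'i set \<Rightarrow> 'w set set" where
  "gen_sigma P Y I = sigma_sets (space P) (\<Union>i\<in>I. {Y i -` S \<inter> space P | S. S \<in> sets borel})"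

definition normal_law :: "'v measure \<Rightarrow> ('v \<Rightarrow> real) \<Rightarrow> real \<Rightarrow> bool" where
  "normal_law Q Y s2 \<longleftrightarrow> (if s2 = 0 then distr Q borel Y = return borel 0
      else distr Q borel Y = density lborel (normal_density 0 (sqrt s2)))"

definition gaussian_proc :: "'v measure \<Rightarrow> ('v \<Rightarrow> real^'p \<Rightarrow> real) \<Rightarrow> (real^'p \<Rightarrow> real^'p \<Rightarrow> real) \<Rightarrow> bool" where
  "gaussian_proc Q B K \<longleftrightarrow>
     (\<forall>u\<in>cube. (\<lambda>\<omega>. B \<omega> u) \<in> borel_measurable Q) \<and>
     (\<forall>S c. finite S \<and> S \<subseteq> cube \<longrightarrow>
        normal_law Q (\<lambda>\<omega>. \<Sum>u\<in>S. c u * B \<omega> u) (\<Sum>u\<in>S. \<Sum>v\<in>S. c u * c v * K u v))"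

text \<open>an element is g with g j u the j-th output coordinate at u_j, j = 0..M, u in cube\<close>
definition lspace :: "nat \<Rightarrow> (nat \<Rightarrow> real^'p \<Rightarrow> real) set" where
  "lspace M = {g. (\<forall>j u. \<not> (j \<le> M \<and> u \<in> cube) \<longrightarrow> g j u = 0) \<and> (\<exists>K. \<forall>j u. \<bar>g j u\<bar> \<le> K)}"

definition supdist :: "nat \<Rightarrow> (nat \<Rightarrow> real^'p \<Rightarrow> real) \<Rightarrow> (nat \<Rightarrow> real^'p \<Rightarrow> real) \<Rightarrow> real" where
  "supdist M g g' = (SUP x\<in>{..M} \<times> cube. \<bar>g (fst x) (snd x) - g' (fst x) (snd x)\<bar>)"

definition lopen :: "nat \<Rightarrow> (nat \<Rightarrow> real^'p \<Rightarrow> real) set \<Rightarrow> bool" where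
  "lopen M U \<longleftrightarrow> U \<subseteq> lspace M \<and>
     (\<forall>g\<in>U. \<exists>e>0. \<forall>g'\<in>lspace M. supdist M g g' < e \<longrightarrow> g' \<in> U)"

definition lsp_borel :: "nat \<Rightarrow> (nat \<Rightarrow> real^'p \<Rightarrow> real) measure" where
  "lsp_borel M = sigma (lspace M) {U. lopen M U}"

definition bcont :: "nat \<Rightarrow> ((nat \<Rightarrow> real^'p \<Rightarrow> real) \<Rightarrow> real) \<Rightarrow> bool" where
  "bcont M h \<longleftrightarrow> (\<exists>K. \<forall>g\<in>lspace M. \<bar>h g\<bar> \<le> K) \<and>
     (\<forall>g\<in>lspace M. \<forall>\<epsilon>>0. \<exists>\<delta>>0. \<forall>g'\<in>lspace M. supdist M g g' < \<delta> \<longrightarrow> \<bar>h g - h g'\<bar> < \<epsilon>)"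

definition outer_exp :: "'w measure \<Rightarrow> ('w \<Rightarrow> real) \<Rightarrow> real" where
  "outer_exp P f = Inf {integral\<^sup>L P g | g. g \<in> borel_measurable P \<and> integrable P g
      \<and> (\<forall>\<omega>\<in>space P. f \<omega> \<le> g \<omega>)}"

definition hj_weak_conv :: "nat \<Rightarrow> 'w measure \<Rightarrow> (nat \<Rightarrow> 'w \<Rightarrow> (nat \<Rightarrow> real^'p \<Rightarrow> real))
    \<Rightarrow> 'v measure \<Rightarrow> ('v \<Rightarrow> (nat \<Rightarrow> real^'p \<Rightarrow> real)) \<Rightarrow> bool" where
  "hj_weak_conv M P X Q G \<longleftrightarrow> (\<forall>h. bcont M h \<longrightarrow>
     (\<lambda>n. outer_exp P (\<lambda>\<omega>. h (X n \<omega>))) \<longlonglongrightarrow> (\<integral>x. h (G x) \<partial>Q))"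

definition bootproc :: "'w measure \<Rightarrow> (nat \<Rightarrow> 'w \<Rightarrow> (real^'p) \<times> (real^'q)) \<Rightarrow> (real^'q) set
   \<Rightarrow> (nat \<Rightarrow> nat \<Rightarrow> nat \<Rightarrow> 'w \<Rightarrow> real) \<Rightarrow> nat \<Rightarrow> nat \<Rightarrow> 'w \<Rightarrow> (nat \<Rightarrow> real^'p \<Rightarrow> real)" where
  "bootproc P V A W M n \<omega> = (\<lambda>j u. if j \<le> M \<and> u \<in> cube then
      (if j = 0 then DbarProc P V A n \<omega> u else Dtilde V A (W j) n \<omega> u) else 0)"

definition limproc :: "'w measure \<Rightarrow> (nat \<Rightarrow> 'w \<Rightarrow> (real^'p) \<times> (real^'q)) \<Rightarrow> (real^'q) set
   \<Rightarrow> nat \<Rightarrow> (nat \<Rightarrow> 'v \<Rightarrow> real^'p \<Rightarrow> real) \<Rightarrow> 'v \<Rightarrow> (nat \<Rightarrow> real^'p \<Rightarrow> real)" where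
  "limproc P V A M B x = (\<lambda>j u. if j \<le> M \<and> u \<in> cube then Dinf P V A (B j x) u else 0)"

end

theory Submission
  imports Defs
begin

text \<open>
  Write \<open>f\<^sub>u\<close> for the indicator of the box \<open>U\<^sup>A \<le> u, Z \<in> A\<close>.  Off a null set of ties,
  the rank-based processes are smooth functionals of the weighted empirical processes
  \<open>n\<^sup>-\<^sup>1\<^sup>/\<^sup>2 \<Sum>\<^sub>i \<xi>\<^sub>i (f\<^sub>u(V\<^sub>i) - D u)\<close>, with \<open>\<xi>\<^sub>i = 1\<close> for the original sample and
  \<open>\<xi>\<^sub>i = W\<^sub>i - mean W\<close> for a bootstrap replicate.  Conditionally on the weights these are sums of
  independent terms, so exchangeability is needed only to show that \<open>n\<^sup>-\<^sup>1 \<Sum>\<^sub>i \<xi>\<^sub>i \<xi>'\<^sub>i\<close> tends to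
  \<open>0\<close> for two independent replicates.  Conditional characteristic functions then give the
  finite-dimensional limits, and symmetrization with chaining over boxes, whose entropy is controlled by
  the squared-weight mass of each slab, gives asymptotic equicontinuity.  A deterministic delta method
  (mean value theorem in the interior; near a face of the cube the bridge terms are small while the
  derivatives stay bounded by \<open>1\<close>) transfers both to the rank-based processes.  The limit is a chained Gaussian
  process with continuous paths, and bounded continuous test functions reduce to Lipschitz ones by
  inf-convolution.
\<close>

text \<open>The processes need not be measurable as maps into the bounded functions, so every
  probabilistic estimate concerns finitely many points, and the cube is reached afterwards by
  right-continuity of box indicators. What is asked of the weights is collected in one event
  \<open>gw\<close>: the rows \<open>1 / sqrt n\<close> and \<open>xi_i / sqrt n\<close> are
  uniformly small and nearly orthonormal. On it the Gaussian limit and the equicontinuity hold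
  uniformly in the weight vector. The entropy bound needs no combinatorics of boxes: the
  squared-weight mass of \<open>U_k <= t\<close> is monotone in \<open>t\<close>, so equal cuts of
  its range give a number of cells that has a bound independent of the sample. The delta method
  chooses its accuracy \<open>e\<close> after a bound \<open>C\<close> for the paths, and the scale
  \<open>dl\<close>, over which the paths vary by at most \<open>e\<close>, comes last;
  \<open>C\<close> is therefore taken from the modulus at accuracy 1, before any \<open>e\<close> is
  known. The limit has to live on a measure over the reals, so the Gaussian copies are transported
  there by an injection.\<close>

abbreviation cor where "cor \<equiv> complex_of_real"
abbreviation bm where "bm M \<equiv> borel_measurable M"
abbreviation rt :: "nat => real" where "rt n \<equiv> sqrt (real n)"

section \<open>Trigonometric approximation and the multivariate continuity theorem\<close>

text \<open>Fejer kernel centred at the node \<open>2 pi r / m\<close>. Dividing by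
  \<open>m^2\<close> instead of \<open>m\<close> makes the weights at the \<open>m\<close>
  equidistant nodes add up to one.\<close>

definition fejw :: "nat => nat => real => real" where
	"fejw m r x = (cmod (SUM k<m. cis (real k * (x - 2 * pi * real r / real m))))^2 / (real m)^2"

lemma fejw_nonneg: "0 <= fejw m r x"
	by (simp add: fejw_def)

lemma fejw_expand:
	"cor (fejw m r x) =
		(SUM k<m. SUM l<m. cis ((real k - real l) * (x - 2 * pi * real r / real m))) / (real m)^2"
proof -
	let ?z = "x - 2 * pi * real r / real m"
	let ?w = "SUM k<m. cis (real k * ?z)"
	have "cor ((cmod ?w)^2) = ?w * cnj ?w"
		using complex_norm_square by metis
	also have "... = (SUM k<m. SUM l<m. cis (real k * ?z) * cis (- (real l * ?z)))"
		by (simp add: sum_product cis_cnj)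
	also have "... = (SUM k<m. SUM l<m. cis ((real k - real l) * ?z))"
		by (simp add: cis_mult left_diff_distrib)
	finally show ?thesis
		by (simp add: fejw_def)
qed

text \<open>Expanding the square leaves sums of powers of an m-th root of unity \<open>q\<close>
  over \<open>r\<close>; they vanish unless \<open>k = l\<close>, because \<open>|k - l| < m\<close>
  keeps \<open>q\<close> away from 1.\<close>

lemma fejw_sum:
	assumes "m > 0"
	shows "(SUM r<m. fejw m r x) = 1"
proof -
	have key: "(SUM r<m. cis ((real k - real l) * (x - 2 * pi * real r / real m))) = (if k = l then of_nat m else 0)"
		if "k < m" "l < m" for k l
	proof (cases "k = l")
		case True
		thus ?thesis by simp
	next
		case False
		define q where "q = cis (- (real k - real l) * 2 * pi / real m)"
		have t: "cis ((real k - real l) * (x - 2 * pi * real r / real m)) = cis ((real k - real l) * x) * q ^ r" for r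
			unfolding q_def Complex.DeMoivre cis_mult
			by (rule arg_cong[where f=cis]) (simp add: algebra_simps diff_divide_distrib)
		have "q ^ m = cis (2 * pi * real_of_int (int l - int k))"
			unfolding q_def Complex.DeMoivre using assms
			by (intro arg_cong[where f=cis]) (simp add: field_simps)
		hence qm: "q ^ m = 1"
			by (metis cis_multiple_2pi Ints_of_int)
		have "q ~= 1"
		proof
			assume "q = 1"
			hence "cos (- (real k - real l) * 2 * pi / real m) = 1"
				unfolding q_def by (metis cis.sel(1) one_complex.sel(1))
			then obtain n::int where "- (real k - real l) * 2 * pi / real m = real_of_int n * 2 * pi"
				using cos_one_2pi_int by auto
			hence "(2 * pi) * (real l - real k) = (2 * pi) * (real_of_int n * real m)"
				using assms by (simp add: field_simps)
			hence "real l - real k = real_of_int n * real m"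
				by (simp only: mult_cancel_left) simp
			hence "real_of_int (int l - int k) = real_of_int (n * int m)" by simp
			hence e: "int l - int k = n * int m" by (simp only: of_int_eq_iff)
			have "abs (int l - int k) < int m" using that by linarith
			hence "abs n * int m < 1 * int m" using e by (simp add: abs_mult)
			hence "abs n < 1" using assms by (subst (asm) mult_less_cancel_right) auto
			hence "n = 0" by simp
			thus False using e False by simp
		qed
		hence "(SUM r<m. q ^ r) = 0"
			using qm by (simp add: geometric_sum)
		thus ?thesis using False by (simp add: t flip: sum_distrib_left)
	qed
	have "cor (SUM r<m. fejw m r x) =
			(SUM r<m. (SUM k<m. SUM l<m. cis ((real k - real l) * (x - 2 * pi * real r / real m)))) / (real m)^2"
		by (simp add: fejw_expand sum_divide_distrib)
	also have "(SUM r<m. (SUM k<m. SUM l<m. cis ((real k - real l) * (x - 2 * pi * real r / real m))))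
		 = (SUM k<m. SUM r<m. SUM l<m. cis ((real k - real l) * (x - 2 * pi * real r / real m)))"
		by (rule sum.swap)
	also have "... = (SUM k<m. SUM l<m. SUM r<m. cis ((real k - real l) * (x - 2 * pi * real r / real m)))"
		by (intro sum.cong refl sum.swap)
	also have "... = (SUM k<m. SUM l<m. (if k = l then of_nat m else 0))"
		by (intro sum.cong refl) (simp add: key)
	also have "... = of_nat m * of_nat m"
		by (simp add: sum.delta)
	finally have "cor (SUM r<m. fejw m r x) = 1"
		using assms by (simp add: power2_eq_square)
	thus ?thesis
		by (metis of_real_eq_1_iff)
qed

text \<open>The exponential sum is geometric, with numerator at most 2 and denominator at least
  \<open>ta\<close>. The order \<open>m^-2\<close> still tends to 0 after summation over the
  \<open>m\<close> nodes.\<close>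

lemma fejw_far:
	assumes "m > 0" "0 < ta" "ta <= cmod (cis (x - 2 * pi * real r / real m) - 1)"
	shows "fejw m r x <= 4 / (ta^2 * (real m)^2)"
proof -
	let ?q = "cis (x - 2 * pi * real r / real m)"
	have ne: "?q ~= 1" using assms by auto
	have "(SUM k<m. cis (real k * (x - 2 * pi * real r / real m))) = (SUM k<m. ?q ^ k)"
		by (simp add: Complex.DeMoivre)
	also have "... = (?q ^ m - 1) / (?q - 1)" using ne by (simp add: geometric_sum)
	finally have "cmod (SUM k<m. cis (real k * (x - 2 * pi * real r / real m))) = cmod (?q ^ m - 1) / cmod (?q - 1)"
		by (simp add: norm_divide)
	also have "... <= 2 / ta"
	proof (rule frac_le)
		have "cmod (?q ^ m - 1) <= cmod (?q ^ m) + 1"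
			using norm_triangle_ineq4[of "?q ^ m" 1] by simp
		thus "cmod (?q ^ m - 1) <= 2" by (simp add: norm_power)
	qed (use assms in auto)
	finally have "(cmod (SUM k<m. cis (real k * (x - 2 * pi * real r / real m))))^2 <= (2 / ta)^2"
		by (rule power_mono) simp
	hence "fejw m r x <= (2 / ta)^2 / (real m)^2"
		unfolding fejw_def by (rule divide_right_mono) simp
	thus ?thesis by (simp add: power_divide)
qed

text \<open>Dividing by \<open>R\<close> puts both angles into [-1, 1], where chord and arc are
  comparable: half the difference is at most 1 in modulus, and there
  \<open>|s| <= 2 |sin s|\<close>.\<close>

lemma cis_diff_lower:
	fixes x y R :: real
	assumes "R > 0" "abs x <= R" "abs y <= R" "cmod (cis (x / R) - cis (y / R)) <= t"
	shows "abs (x - y) <= 2 * R * t"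
proof -
	define s where "s = (x / R - y / R) / 2"
	have s1: "abs s <= 1"
	proof -
		have *: "abs ((a - b) / 2) <= 1" if "abs a <= 1" "abs b <= 1" for a b :: real
			using that by (auto simp: abs_le_iff)
		have "abs (x / R) <= 1" "abs (y / R) <= 1" using assms by auto
		thus ?thesis unfolding s_def by (rule *)
	qed
	have a: "abs s <= 2 * abs (sin s)"
	proof -
		have *: "z <= 2 * sin z" if "0 <= z" "z <= 1" for z :: real
		proof -
			have "abs (sin z - (SUM m<3. sin_coeff m * z ^ m)) <= inverse (fact 3) * abs z ^ 3"
				by (rule Maclaurin_sin_bound)
			hence "abs (sin z - z) <= z ^ 3 / 6"
				using that by (simp add: eval_nat_numeral sin_coeff_def)
			moreover have "z ^ 3 <= z * 1"
				using that power_decreasing[of 1 3 z] by simp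
			ultimately show ?thesis using that by linarith
		qed
		show ?thesis
		proof (cases "s >= 0")
			case True
			hence "s <= 2 * sin s" using s1 * by simp
			thus ?thesis using True by linarith
		next
			case False
			hence "- s <= 2 * sin (- s)" using s1 by (intro *) auto
			thus ?thesis using False by simp
		qed
	qed
	have "cmod (cis (x / R) - cis (y / R)) = 2 * abs (sin s)"
	proof -
		have e: "cis (x / R) - cis (y / R) = cis ((x / R + y / R) / 2) * (2 * \<i> * sin s)"
		proof -
			have 1: "cis (x / R) = cis ((x / R + y / R) / 2) * cis s"
				unfolding cis_mult s_def by (simp add: field_simps)
			have 2: "cis (y / R) = cis ((x / R + y / R) / 2) * cis (- s)"
				unfolding cis_mult s_def by (simp add: field_simps)
			have 3: "cis s - cis (- s) = 2 * \<i> * sin s"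
				by (simp add: complex_eq_iff)
			show ?thesis unfolding 1 2 by (simp add: 3 flip: right_diff_distrib)
		qed
		show ?thesis unfolding e by (simp add: norm_mult)
	qed
	hence "abs s <= t" using a assms by linarith
	moreover have "x - y = 2 * R * s" using assms unfolding s_def by (simp add: field_simps)
	ultimately show ?thesis using assms by (simp add: abs_mult)
qed

lemma fejer_partition:
	fixes R de et :: real
	assumes "R > 0" "de > 0" "et > 0"
	obtains m :: nat and y :: "nat => real" where "m > 0"
		"!!x. abs x <= R ==> (SUM r<m. fejw m r (x / R) * (if (abs (x - y r)) > de then 1 else 0)) <= et"
proof -
	define ta where "ta = de / (4 * R)"
	have ta: "ta > 0" unfolding ta_def using assms by simp
	obtain m :: nat where m: "real m > 4 / (ta^2 * et)" using reals_Archimedean2 by blast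
	have "0 < 4 / (ta^2 * et)" using ta assms by simp
	hence m0: "m > 0" using m by (cases m) auto
	define good where "good r x \<longleftrightarrow> abs x <= R & cmod (cis (x / R) - cis (2 * pi * real r / real m)) < ta" for r x
	\<comment> \<open>A point of \<open>[-R, R]\<close> whose angle is close to node \<open>r\<close>.
	  If there is none, \<open>y r\<close> is arbitrary and harmless: then every admissible
	  \<open>x\<close> is far from the node and \<open>fejw_far\<close> applies.\<close>
	define y where "y r = (SOME x. good r x)" for r
	have near: "abs (x - y r) <= de" if "good r x" for r x
	proof -
		have g: "good r (y r)" unfolding y_def using that by (rule someI)
		have "cmod (cis (x / R) - cis (y r / R)) <= 2 * ta"
			using that g norm_triangle_ineq4[of "cis (x / R) - cis (2 * pi * real r / real m)" "cis (y r / R) - cis (2 * pi * real r / real m)"]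
			unfolding good_def by simp
		hence "abs (x - y r) <= 2 * R * (2 * ta)"
			using that g unfolding good_def by (intro cis_diff_lower assms) auto
		thus ?thesis unfolding ta_def using assms by simp
	qed
	have "(SUM r<m. fejw m r (x / R) * (if (abs (x - y r)) > de then 1 else 0)) <= et" if "abs x <= R" for x
	proof -
		have le: "fejw m r (x / R) * (if (abs (x - y r)) > de then 1 else 0) <= 4 / (ta^2 * (real m)^2)" for r
		proof (cases "abs (x - y r) > de")
			case True
			hence "~ good r x" using near by force
			hence "ta <= cmod (cis (x / R) - cis (2 * pi * real r / real m))"
				using that unfolding good_def by simp
			also have "... = cmod (cis (2 * pi * real r / real m) * (cis (x / R - 2 * pi * real r / real m) - 1))"
				by (simp add: right_diff_distrib cis_mult)
			also have "... = cmod (cis (x / R - 2 * pi * real r / real m) - 1)"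
				by (simp add: norm_mult)
			finally show ?thesis using fejw_far[OF m0 ta] True by simp
		next
			case False
			thus ?thesis using ta by simp
		qed
		have "(SUM r<m. fejw m r (x / R) * (if (abs (x - y r)) > de then 1 else 0)) <= (SUM r<m. 4 / (ta^2 * (real m)^2))"
			by (rule sum_mono) (rule le)
		also have "... = 4 / (ta^2 * real m)" using m0 by (simp add: power2_eq_square)
		also have "... <= et" using m m0 ta assms by (simp add: field_simps)
		finally show ?thesis .
	qed
	with m0 show ?thesis by (rule that)
qed

text \<open>A bounded Lipschitz function is, up to a small error on a large box, the convex combination of its
  values at the points \<open>y \<circ> \<rho>\<close> with tensor Fejer weights; these weights are trigonometric polynomials.\<close>

lemma lipschitz_trig_approx:
	fixes g :: "('i => real) => real" and L K R ep :: real
	assumes fin: "finite I" and bdd: "!!x. abs (g x) <= K" and L: "L >= 0"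
		and lip: "ALL x x' d. (ALL i:I. abs (x i - x' i) <= d) --> 0 <= d --> abs (g x - g x') <= L * d"
		and R: "R > 0" and ep: "ep > 0"
	obtains m :: nat and y :: "nat => real" where "m > 0"
		"!!x. abs (SUM rh:(\<Pi>\<^sub>E i\<in>I. {..<m}). g (%i. y (rh i)) * (PROD i:I. fejw m (rh i) (x i / R))) <= K"
		"!!x. (!!i. i : I ==> abs (x i) <= R) ==>
			 abs (g x - (SUM rh:(\<Pi>\<^sub>E i\<in>I. {..<m}). g (%i. y (rh i)) * (PROD i:I. fejw m (rh i) (x i / R)))) <= ep"
proof -
	have K0: "K >= 0" using bdd[of undefined] by linarith
	define de where "de = ep / (2 * (L + 1))"
	define a where "a = (K + 1) * (real (card I) + 1)"
	have a: "a > 0" using K0 unfolding a_def by simp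
	define et where "et = ep / (4 * a)"
	have de: "de > 0" using ep L by (simp add: de_def)
	have et: "et > 0" using ep a by (simp add: et_def)
	obtain m y where m: "m > 0" and far: "!!x. abs x <= R ==>
			(SUM r<m. fejw m r (x / R) * (if (abs (x - y r)) > de then 1 else 0)) <= et"
		using fejer_partition[OF R de et] by blast
	let ?E = "\<Pi>\<^sub>E i\<in>I. {..<m}"
	define p where "p x rh = (PROD i:I. fejw m (rh i) (x i / R))" for x rh
	have p0: "p x rh >= 0" for x rh
		unfolding p_def by (intro prod_nonneg) (simp add: fejw_nonneg)
	have p1: "(SUM rh:?E. p x rh) = 1" for x
		unfolding p_def using fin m by (subst prod_sum_PiE[symmetric]) (auto simp: fejw_sum)
	show ?thesis
	proof (rule that[OF m, of y])
		fix x
		have "abs (SUM rh:?E. g (%i. y (rh i)) * p x rh) <= (SUM rh:?E. K * p x rh)"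
			by (rule order_trans[OF sum_abs]) (auto intro!: sum_mono mult_right_mono bdd simp: abs_mult p0)
		thus "abs (SUM rh:?E. g (%i. y (rh i)) * (PROD i:I. fejw m (rh i) (x i / R))) <= K"
			by (simp add: p1 p_def[symmetric] flip: sum_distrib_left)
	next
		fix x assume x: "!!i. i : I ==> abs (x i) <= R"
		let ?b = "%i rh. if (abs (x i - y (rh i))) > de then 1 else 0 :: real"
		have pt: "abs (g x - g (%i. y (rh i))) <= L * de + 2 * K * (SUM i:I. ?b i rh)" for rh
		proof (cases "ALL i:I. abs (x i - y (rh i)) <= de")
			case True
			hence "abs (g x - g (%i. y (rh i))) <= L * de" using de lip by (auto simp: less_imp_le)
			moreover have "0 <= 2 * K * (SUM i:I. ?b i rh)" using K0 by (intro mult_nonneg_nonneg sum_nonneg) auto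
			ultimately show ?thesis by linarith
		next
			case False
			then obtain i where i: "i : I" "abs (x i - y (rh i)) > de" by force
			have "?b i rh <= (SUM i:I. ?b i rh)"
				using fin i(1) by (intro member_le_sum) auto
			hence "1 <= (SUM i:I. ?b i rh)" using i by simp
			hence "2 * K * 1 <= 2 * K * (SUM i:I. ?b i rh)" using K0 by (intro mult_left_mono) auto
			moreover have "abs (g x - g (%i. y (rh i))) <= 2 * K"
				using bdd[of x] bdd[of "%i. y (rh i)"] by linarith
			moreover have "0 <= L * de" using L de by simp
			ultimately show ?thesis by linarith
		qed
		\<comment> \<open>Only the factor of coordinate \<open>i\<close> is modified; the other
		  one-dimensional sums equal 1, so the product weight has the one-dimensional Fejer weight as its
		  marginal.\<close>
		have marg: "(SUM rh:?E. p x rh * ?b i rh) <= et" if "i : I" for i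
		proof -
			have "p x rh * ?b i rh = (PROD j:I. fejw m (rh j) (x j / R) * (if j = i then (if (abs (x j - y (rh j))) > de then 1 else 0) else 1))" for rh
				unfolding p_def prod.distrib using fin that by (simp add: prod.delta)
			hence "(SUM rh:?E. p x rh * ?b i rh) = (PROD j:I. SUM r<m. fejw m r (x j / R) * (if j = i then (if (abs (x j - y r)) > de then 1 else 0) else 1))"
				using fin by (subst prod_sum_PiE) auto
			also have "... = (PROD j:I. if j = i then (SUM r<m. fejw m r (x j / R) * (if (abs (x j - y r)) > de then 1 else 0)) else 1)"
				by (intro prod.cong refl) (use m in \<open>auto simp: fejw_sum\<close>)
			also have "... = (SUM r<m. fejw m r (x i / R) * (if (abs (x i - y r)) > de then 1 else 0))"
				using fin that by (simp add: prod.delta)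
			also have "... <= et" using far x that by blast
			finally show ?thesis .
		qed
		have "g x - (SUM rh:?E. g (%i. y (rh i)) * p x rh) = (SUM rh:?E. (g x - g (%i. y (rh i))) * p x rh)"
			using p1[of x] by (simp add: left_diff_distrib sum_subtractf flip: sum_distrib_left)
		hence "abs (g x - (SUM rh:?E. g (%i. y (rh i)) * p x rh)) <= (SUM rh:?E. abs (g x - g (%i. y (rh i))) * p x rh)"
			using sum_abs[of "%rh. (g x - g (%i. y (rh i))) * p x rh" ?E] by (simp add: abs_mult p0)
		also have "... <= (SUM rh:?E. (L * de + 2 * K * (SUM i:I. ?b i rh)) * p x rh)"
			by (intro sum_mono mult_right_mono pt p0)
		also have "... = L * de * (SUM rh:?E. p x rh) + 2 * K * (SUM rh:?E. SUM i:I. p x rh * ?b i rh)"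
			by (simp add: distrib_left sum.distrib sum_distrib_left mult_ac)
		also have "(SUM rh:?E. SUM i:I. p x rh * ?b i rh) = (SUM i:I. SUM rh:?E. p x rh * ?b i rh)"
			by (rule sum.swap)
		also have "L * de * (SUM rh:?E. p x rh) + 2 * K * ... <= L * de + 2 * K * (SUM i:I. et)"
			using K0 by (intro add_mono mult_left_mono sum_mono marg) (auto simp: p1)
		also have "... <= ep"
		proof -
			have "L * de <= (L + 1) * de" using de by (intro mult_right_mono) auto
			also have "... = ep / 2" unfolding de_def using L by (simp add: field_simps)
			finally have l: "L * de <= ep / 2" .
			have "2 * K * (SUM i:I. et) = 2 * (K * real (card I)) * et" by simp
			also have "... <= 2 * a * et"
				unfolding a_def using et K0 by (intro mult_right_mono mult_left_mono mult_mono) auto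
			also have "... = ep / 2" unfolding et_def using a by simp
			finally show ?thesis using l by linarith
		qed
		finally show "abs (g x - (SUM rh:?E. g (%i. y (rh i)) * (PROD i:I. fejw m (rh i) (x i / R)))) <= ep"
			by (simp add: p_def)
	qed
qed

section \<open>From trigonometric approximation to weak convergence of finite vectors\<close>

lemma measurable_cis [measurable]: "cis : bm borel"
	by (intro borel_measurable_continuous_onI continuous_intros)

lemma fejw_measurable: "fejw m r : bm borel"
	unfolding fejw_def by measurable

text \<open>The Lipschitz condition makes \<open>g\<close> depend on the coordinates in
  \<open>I\<close> only. It is the pointwise limit of its Fejer sums at accuracy
  \<open>1 / Suc r\<close> on the box of radius \<open>Suc r\<close>, and these are visibly
  measurable.\<close>

lemma borel_measurable_lipschitz_finite:
	fixes g :: "('i => real) => real" and L K :: real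
	assumes fin: "finite I" and bdd: "!!x. abs (g x) <= K" and L: "L >= 0"
		and lip: "ALL x x' d. (ALL i:I. abs (x i - x' i) <= d) --> 0 <= d --> abs (g x - g x') <= L * d"
		and X: "!!i. i : I ==> X i : bm N"
	shows "(%om. g (%i. X i om)) : bm N"
proof -
	have "EX G. G : bm N & (ALL om. (ALL i:I. abs (X i om) <= real (Suc r)) --> abs (g (%i. X i om) - G om) <= 1 / real (Suc r))" for r
	proof -
		obtain m y where "m > 0" and
		 *: "!!x. (!!i. i : I ==> abs (x i) <= real (Suc r)) ==>
			 abs (g x - (SUM rh:(\<Pi>\<^sub>E i\<in>I. {..<m}). g (%i. y (rh i)) * (PROD i:I. fejw m (rh i) (x i / real (Suc r))))) <= 1 / real (Suc r)"
			by (rule lipschitz_trig_approx[where R="real (Suc r)" and ep="1 / real (Suc r)", OF fin bdd L lip]) (simp, simp, blast)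
		have "(%om. SUM rh:(\<Pi>\<^sub>E i\<in>I. {..<m}). g (%i. y (rh i)) * (PROD i:I. fejw m (rh i) (X i om / real (Suc r)))) : bm N"
		proof (intro borel_measurable_sum borel_measurable_times borel_measurable_prod borel_measurable_const)
			fix rh i assume "i : I"
			from measurable_compose[OF _ fejw_measurable, where f="%om. X i om / real (Suc r)"] X[OF \<open>i : I\<close>]
			show "(%om. fejw m (rh i) (X i om / real (Suc r))) : bm N" by simp
		qed
		with * show ?thesis by (intro exI[of _ "%om. SUM rh:(\<Pi>\<^sub>E i\<in>I. {..<m}). g (%i. y (rh i)) * (PROD i:I. fejw m (rh i) (X i om / real (Suc r)))"]) auto
	qed
	then obtain G where "ALL r. G r : bm N & (ALL om. (ALL i:I. abs (X i om) <= real (Suc r)) --> abs (g (%i. X i om) - G r om) <= 1 / real (Suc r))"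
		using choice[of "%r G. G : bm N & (ALL om. (ALL i:I. abs (X i om) <= real (Suc r)) --> abs (g (%i. X i om) - G om) <= 1 / real (Suc r))"] by blast
	hence G: "!!r. G r : bm N"
		"!!r om. (ALL i:I. abs (X i om) <= real (Suc r)) ==> abs (g (%i. X i om) - G r om) <= 1 / real (Suc r)"
		by blast+
	show ?thesis
	proof (rule borel_measurable_LIMSEQ_real[where u=G])
		fix om
		obtain r0 :: nat where r0: "real r0 >= (SUM i:I. abs (X i om))" using real_arch_simple by blast
		have b: "abs (X i om) <= real (Suc r)" if "i : I" "r >= r0" for i r
		proof -
			have "abs (X i om) <= (SUM i:I. abs (X i om))" using fin that by (intro member_le_sum) auto
			thus ?thesis using r0 that by simp
		qed
		have "eventually (%r. norm (G r om - g (%i. X i om)) <= 1 / real (Suc r)) sequentially"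
			unfolding eventually_sequentially using G(2) b by (intro exI[of _ r0]) (auto simp: abs_minus_commute)
		hence "(%r. G r om - g (%i. X i om)) \<longlonglongrightarrow> 0"
			by (rule Lim_null_comparison) (rule LIMSEQ_Suc[OF lim_1_over_n])
		thus "(%r. G r om) \<longlonglongrightarrow> g (%i. X i om)" by (rule LIM_zero_cancel)
	qed (rule G)
qed

lemma (in finite_measure) measure_tail_small:
	fixes Y :: "'a => real"
	assumes [measurable]: "Y : bm M" and "e > 0"
	shows "EX R. measure M {om : space M. abs (Y om) > R} < e"
proof -
	have "(%n. measure M {om : space M. abs (Y om) > real n}) \<longlonglongrightarrow> measure M (\<Inter>n. {om : space M. abs (Y om) > real n})"
		by (rule finite_Lim_measure_decseq) (auto simp: decseq_def)
	moreover have "(\<Inter>n. {om : space M. abs (Y om) > real n}) = {}"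
	proof -
		have "EX n. abs (Y om) <= real n" for om by (rule real_arch_simple)
		thus ?thesis by (auto simp: set_eq_iff) (meson not_less)
	qed
	ultimately have "(%n. measure M {om : space M. abs (Y om) > real n}) \<longlonglongrightarrow> 0" by simp
	hence "eventually (%n. measure M {om : space M. abs (Y om) > real n} < e) sequentially"
		using assms(2) by (rule order_tendstoD)
	thus ?thesis by (auto simp: eventually_sequentially)
qed

text \<open>Turns a tensor weight into a linear combination of characters, so that convergence of
  characteristic functions passes to the approximating sums.\<close>

lemma prod_fejw_expand:
	fixes x :: "'i => real"
	assumes "finite I"
	shows "cor (PROD i:I. fejw m (rh i) (x i / R)) =
		(SUM sg:(\<Pi>\<^sub>E i\<in>I. {..<m} \<times> {..<m}).
			 cis (- (SUM i:I. (real (fst (sg i)) - real (snd (sg i))) * (2 * pi * real (rh i) / real m))) / ((real m)^2) ^ card I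
			 * cis (SUM i:I. ((real (fst (sg i)) - real (snd (sg i))) / R) * x i))"
proof -
	have cis_sum: "(PROD i:J. cis (f i)) = cis (SUM i:J. f i)" if "finite J" for J :: "'i set" and f
		using that by (induction J rule: finite_induct) (auto simp: cis_mult)
	have "cor (PROD i:I. fejw m (rh i) (x i / R)) =
		 (PROD i:I. SUM kl:{..<m} \<times> {..<m}. cis ((real (fst kl) - real (snd kl)) * (x i / R - 2 * pi * real (rh i) / real m)) / (real m)^2)"
		unfolding of_real_prod fejw_expand sum.cartesian_product by (simp add: sum_divide_distrib case_prod_beta)
	also have "... = (SUM sg:(\<Pi>\<^sub>E i\<in>I. {..<m} \<times> {..<m}). PROD i:I. cis ((real (fst (sg i)) - real (snd (sg i))) * (x i / R - 2 * pi * real (rh i) / real m)) / (real m)^2)"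
		using assms by (subst prod_sum_PiE) auto
	also have "... = (SUM sg:(\<Pi>\<^sub>E i\<in>I. {..<m} \<times> {..<m}).
			 cis (- (SUM i:I. (real (fst (sg i)) - real (snd (sg i))) * (2 * pi * real (rh i) / real m))) / ((real m)^2) ^ card I
			 * cis (SUM i:I. ((real (fst (sg i)) - real (snd (sg i))) / R) * x i))"
	proof (rule sum.cong[OF refl])
		fix sg :: "'i => nat \<times> nat"
		have "(PROD i:I. cis ((real (fst (sg i)) - real (snd (sg i))) * (x i / R - 2 * pi * real (rh i) / real m)) / (real m)^2)
			= cis (SUM i:I. (real (fst (sg i)) - real (snd (sg i))) * (x i / R - 2 * pi * real (rh i) / real m)) / ((real m)^2) ^ card I"
			using assms by (simp add: prod_dividef cis_sum)
		also have "(SUM i:I. (real (fst (sg i)) - real (snd (sg i))) * (x i / R - 2 * pi * real (rh i) / real m))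
			= - (SUM i:I. (real (fst (sg i)) - real (snd (sg i))) * (2 * pi * real (rh i) / real m)) + (SUM i:I. ((real (fst (sg i)) - real (snd (sg i))) / R) * x i)"
			by (simp add: right_diff_distrib sum_subtractf)
		finally show "(PROD i:I. cis ((real (fst (sg i)) - real (snd (sg i))) * (x i / R - 2 * pi * real (rh i) / real m)) / (real m)^2)
			= cis (- (SUM i:I. (real (fst (sg i)) - real (snd (sg i))) * (2 * pi * real (rh i) / real m))) / ((real m)^2) ^ card I
			 * cis (SUM i:I. ((real (fst (sg i)) - real (snd (sg i))) / R) * x i)"
			by (simp add: cis_mult)
	qed
	finally show ?thesis .
qed

lemma (in prob_space) integrable_cis:
	assumes [measurable]: "f : bm M"
	shows "integrable M (%om. cis (f om))"
proof -
	show ?thesis by (rule integrable_const_bound[where B=1]) auto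
qed

lemma (in prob_space) integrable_bounded:
	fixes f :: "'a => real"
	assumes "f : bm M" "!!om. om : space M ==> abs (f om) <= K"
	shows "integrable M f"
	using assms by (intro integrable_const_bound[where B=K]) auto

text \<open>By tightness the coordinates stay in a box with probability close to one. On the box
  \<open>g\<close> is within \<open>ep / 8\<close> of a trigonometric polynomial \<open>T\<close>;
  off it both are bounded by \<open>K\<close>. The integrals of \<open>T\<close> are finite
  combinations of characteristic functions and therefore converge.\<close>

theorem multivariate_levy_continuity:
	fixes X :: "nat => 'i => 'w => real" and Y :: "'i => 'v => real"
		and g :: "('i => real) => real" and L K :: real
	assumes P: "prob_space P" and Q: "prob_space Q" and fin: "finite I"
		and X: "!!n i. i : I ==> X n i : bm P"
		and Y: "!!i. i : I ==> Y i : bm Q"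
		and char: "!!t :: 'i => real. (%n. \<integral>om. cis (SUM i:I. t i * X n i om) \<partial>P) \<longlonglongrightarrow> (\<integral>om. cis (SUM i:I. t i * Y i om) \<partial>Q)"
		and tight: "!!i e. i : I ==> e > 0 ==> EX R. \<forall>\<^sub>F n in sequentially. measure P {om : space P. abs (X n i om) > R} < e"
		and bdd: "!!x. abs (g x) <= K" and L: "L >= 0"
		and lip: "ALL x x' d. (ALL i:I. abs (x i - x' i) <= d) --> 0 <= d --> abs (g x - g x') <= L * d"
	shows "(%n. \<integral>om. g (%i. X n i om) \<partial>P) \<longlonglongrightarrow> (\<integral>om. g (%i. Y i om) \<partial>Q)"
proof -
	interpret P: prob_space P by fact
	interpret Q: prob_space Q by fact
	have K0: "K >= 0" using bdd[of undefined] by linarith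
	have gX: "(%om. g (%i. X n i om)) : bm P" for n
		by (rule borel_measurable_lipschitz_finite[OF fin bdd L lip]) (auto intro: X)
	have gY: "(%om. g (%i. Y i om)) : bm Q"
		by (rule borel_measurable_lipschitz_finite[OF fin bdd L lip]) (auto intro: Y)
	have key: "\<forall>\<^sub>F n in sequentially. abs ((\<integral>om. g (%i. X n i om) \<partial>P) - (\<integral>om. g (%i. Y i om) \<partial>Q)) < ep" if ep: "ep > 0" for ep
	proof -
		\<comment> \<open>Chosen so that the part outside the box, \<open>2 * K\<close> times the
		  \<open>card I\<close> tail probabilities, costs at most \<open>ep / 8\<close>.\<close>
		define e where "e = ep / (16 * ((K + 1) * (real (card I) + 1)))"
		have e: "e > 0" unfolding e_def using ep K0 by simp
		have "EX R. (\<forall>\<^sub>F n in sequentially. measure P {om : space P. abs (X n i om) > R} < e) & measure Q {om : space Q. abs (Y i om) > R} < e" if i: "i : I" for i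
		proof -
			obtain R1 where R1: "\<forall>\<^sub>F n in sequentially. measure P {om : space P. abs (X n i om) > R1} < e"
				using tight[OF i e] by blast
			obtain R2 where R2: "measure Q {om : space Q. abs (Y i om) > R2} < e"
				using Q.measure_tail_small[OF Y[OF i] e] by blast
			let ?R = "max R1 R2"
			have "measure P {om : space P. abs (X n i om) > ?R} <= measure P {om : space P. abs (X n i om) > R1}" for n
				using X[OF i] by (intro P.finite_measure_mono) auto
			hence "\<forall>\<^sub>F n in sequentially. measure P {om : space P. abs (X n i om) > ?R} < e"
				using R1 by (elim eventually_mono) (rule le_less_trans)
			moreover have "measure Q {om : space Q. abs (Y i om) > ?R} <= measure Q {om : space Q. abs (Y i om) > R2}"
				using Y[OF i] by (intro Q.finite_measure_mono) auto
			ultimately show ?thesis using R2 by (meson le_less_trans)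
		qed
		then obtain Rf where "ALL i:I. (\<forall>\<^sub>F n in sequentially. measure P {om : space P. abs (X n i om) > Rf i} < e) & measure Q {om : space Q. abs (Y i om) > Rf i} < e"
			using bchoice[of I "%i R. (\<forall>\<^sub>F n in sequentially. measure P {om : space P. abs (X n i om) > R} < e) & measure Q {om : space Q. abs (Y i om) > R} < e"] by blast
		hence Rf: "!!i. i : I ==> \<forall>\<^sub>F n in sequentially. measure P {om : space P. abs (X n i om) > Rf i} < e"
			 "!!i. i : I ==> measure Q {om : space Q. abs (Y i om) > Rf i} < e" by blast+
		define R where "R = 1 + (SUM i:I. abs (Rf i))"
		have R0: "R > 0" unfolding R_def by (intro add_pos_nonneg sum_nonneg) auto
		have RR: "Rf i <= R" if "i : I" for i
		proof -
			have "abs (Rf i) <= (SUM i:I. abs (Rf i))" using fin that by (intro member_le_sum) auto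
			thus ?thesis unfolding R_def by linarith
		qed
		obtain m y where T: "!!x. abs (SUM rh:(\<Pi>\<^sub>E i\<in>I. {..<m}). g (%i. y (rh i)) * (PROD i:I. fejw m (rh i) (x i / R))) <= K"
		"!!x. (!!i. i : I ==> abs (x i) <= R) ==>
			 abs (g x - (SUM rh:(\<Pi>\<^sub>E i\<in>I. {..<m}). g (%i. y (rh i)) * (PROD i:I. fejw m (rh i) (x i / R)))) <= ep / 8"
			by (rule lipschitz_trig_approx[where ep="ep / 8", OF fin bdd L lip R0]) (use ep in simp, blast)
		define T where "T x = (SUM rh:(\<Pi>\<^sub>E i\<in>I. {..<m}). g (%i. y (rh i)) * (PROD i:I. fejw m (rh i) (x i / R)))" for x :: "'i => real"
		have TK: "abs (T x) <= K" for x using T(1) by (simp add: T_def)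
		have Tg: "abs (g x - T x) <= ep / 8 + 2 * K * (SUM i:I. if (abs (x i)) > R then 1 else 0)" for x
		proof (cases "ALL i:I. abs (x i) <= R")
			case True
			hence "abs (g x - T x) <= ep / 8" using T(2) by (simp add: T_def)
			moreover have "0 <= 2 * K * (SUM i:I. if (abs (x i)) > R then 1 else 0)" using K0 by (intro mult_nonneg_nonneg sum_nonneg) auto
			ultimately show ?thesis by linarith
		next
			case False
			then obtain i where i: "i : I" "abs (x i) > R" by force
			have "(if (abs (x i)) > R then 1 else 0) <= (SUM i:I. if (abs (x i)) > R then 1 else 0 :: real)"
				using fin i(1) by (intro member_le_sum) auto
			hence "2 * K * 1 <= 2 * K * (SUM i:I. if (abs (x i)) > R then 1 else 0 :: real)" using K0 i by (intro mult_left_mono) auto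
			moreover have "abs (g x - T x) <= 2 * K" using bdd[of x] TK[of x] by linarith
			ultimately show ?thesis using ep by linarith
		qed
		have approx: "abs ((\<integral>om. g (%i. Z i om) \<partial>N) - (\<integral>om. T (%i. Z i om) \<partial>N)) <= ep / 4"
			if N: "prob_space N" and Z: "!!i. i : I ==> Z i : bm N" and gZ: "(%om. g (%i. Z i om)) : bm N"
				and tl: "!!i. i : I ==> measure N {om : space N. abs (Z i om) > Rf i} < e" for N :: "'z measure" and Z
		proof -
			interpret N: prob_space N by fact
			have TZ: "(%om. T (%i. Z i om)) : bm N"
				unfolding T_def
			proof (intro borel_measurable_sum borel_measurable_times borel_measurable_prod borel_measurable_const)
				fix rh i assume "i : I"
				from measurable_compose[OF _ fejw_measurable, where f="%om. Z i om / R"] Z[OF \<open>i : I\<close>]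
				show "(%om. fejw m (rh i) (Z i om / R)) : bm N" by simp
			qed
			have ig: "integrable N (%om. g (%i. Z i om))" using gZ bdd by (rule N.integrable_bounded)
			have iT: "integrable N (%om. T (%i. Z i om))" using TZ TK by (rule N.integrable_bounded)
			have iI: "integrable N (%om. if (abs (Z i om)) > R then 1 else 0 :: real)" if "i : I" for i
				using Z[OF that] by (intro N.integrable_bounded[where K=1]) auto
			have pI: "(\<integral>om. (if (abs (Z i om)) > R then 1 else 0) \<partial>N) <= e" if i: "i : I" for i
			proof -
				have [measurable]: "Z i : bm N" using Z[OF i] .
				have "(\<integral>om. (if (abs (Z i om)) > R then 1 else 0) \<partial>N) = (\<integral>om. indicator {om : space N. abs (Z i om) > R} om \<partial>N)"
					by (rule Bochner_Integration.integral_cong) (auto simp: indicator_def)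
				also have "... = measure N {om : space N. abs (Z i om) > R}" by simp
				also have "... <= measure N {om : space N. abs (Z i om) > Rf i}"
					using RR[OF i] by (intro N.finite_measure_mono) auto
				finally show ?thesis using tl[OF i] by linarith
			qed
			have "abs ((\<integral>om. g (%i. Z i om) \<partial>N) - (\<integral>om. T (%i. Z i om) \<partial>N)) = abs (\<integral>om. g (%i. Z i om) - T (%i. Z i om) \<partial>N)"
				using ig iT by simp
			also have "... <= (\<integral>om. abs (g (%i. Z i om) - T (%i. Z i om)) \<partial>N)" by (rule integral_abs_bound)
			also have "... <= (\<integral>om. ep / 8 + 2 * K * (SUM i:I. if (abs (Z i om)) > R then 1 else 0) \<partial>N)"
				using ig iT iI by (intro integral_mono Tg) auto
			also have "... = ep / 8 + 2 * K * (SUM i:I. \<integral>om. (if (abs (Z i om)) > R then 1 else 0) \<partial>N)"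
				using iI by (simp add: N.prob_space)
			also have "... <= ep / 8 + 2 * K * (SUM i:I. e)"
				using K0 by (intro add_mono mult_left_mono sum_mono pI) auto
			also have "2 * K * (SUM i:I. e) <= 2 * ((K + 1) * (real (card I) + 1)) * e"
			proof -
				have "2 * K * (SUM i:I. e) = 2 * (K * real (card I)) * e" by simp
				also have "... <= 2 * ((K + 1) * (real (card I) + 1)) * e"
					using e K0 by (intro mult_right_mono mult_left_mono mult_mono) auto
				finally show ?thesis .
			qed
			also have "2 * ((K + 1) * (real (card I) + 1)) * e = ep / 8"
			proof -
				have *: "2 * a * (ep / (16 * a)) = ep / 8" if "a ~= 0" for a :: real using that by simp
				have "(K + 1) * (real (card I) + 1) ~= 0" using K0 by simp
				from *[OF this] show ?thesis unfolding e_def .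
			qed
			finally show ?thesis by simp
		qed
		have conv: "(%n. \<integral>om. T (%i. X n i om) \<partial>P) \<longlonglongrightarrow> (\<integral>om. T (%i. Y i om) \<partial>Q)"
		proof -
			define co where "co rh sg = cor (g (%i. y (rh i))) * (cis (- (SUM i:I. (real (fst (sg i)) - real (snd (sg i))) * (2 * pi * real (rh i) / real m))) / ((real m)^2) ^ card I)" for rh and sg :: "'i => nat \<times> nat"
			define t where "t sg i = (real (fst (sg i)) - real (snd (sg i))) / R" for sg :: "'i => nat \<times> nat" and i
			have Te: "cor (T x) = (SUM rh:(\<Pi>\<^sub>E i\<in>I. {..<m}). SUM sg:(\<Pi>\<^sub>E i\<in>I. {..<m} \<times> {..<m}). co rh sg * cis (SUM i:I. t sg i * x i))" for x
				unfolding T_def of_real_sum of_real_mult prod_fejw_expand[OF fin] co_def t_def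
				by (simp add: sum_distrib_left mult.assoc)
			have iT: "cor (\<integral>om. T (%i. Z i om) \<partial>N) = (SUM rh:(\<Pi>\<^sub>E i\<in>I. {..<m}). SUM sg:(\<Pi>\<^sub>E i\<in>I. {..<m} \<times> {..<m}). co rh sg * (\<integral>om. cis (SUM i:I. t sg i * Z i om) \<partial>N))"
				if N: "prob_space N" and Z: "!!i. i : I ==> Z i : bm N" for N :: "'z measure" and Z
			proof -
				interpret N: prob_space N by fact
				have "integrable N (%om. cis (SUM i:I. t sg i * Z i om))" for sg
					using Z by (intro N.integrable_cis borel_measurable_sum borel_measurable_times) auto
				thus ?thesis unfolding integral_complex_of_real[symmetric] Te by simp
			qed
			let ?S = "%h. SUM rh:(\<Pi>\<^sub>E i\<in>I. {..<m}). SUM sg:(\<Pi>\<^sub>E i\<in>I. {..<m} \<times> {..<m}). co rh sg * h sg"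
			have 1: "cor (\<integral>om. T (%i. X n i om) \<partial>P) = ?S (%sg. \<integral>om. cis (SUM i:I. t sg i * X n i om) \<partial>P)" for n
				by (rule iT[OF P]) (rule X)
			have 2: "cor (\<integral>om. T (%i. Y i om) \<partial>Q) = ?S (%sg. \<integral>om. cis (SUM i:I. t sg i * Y i om) \<partial>Q)"
				by (rule iT[OF Q]) (rule Y)
			have "(%n. cor (\<integral>om. T (%i. X n i om) \<partial>P)) \<longlonglongrightarrow> cor (\<integral>om. T (%i. Y i om) \<partial>Q)"
				unfolding 1 2 by (intro tendsto_intros char)
			thus ?thesis by (simp only: tendsto_of_real_iff)
		qed
		have "\<forall>\<^sub>F n in sequentially. abs ((\<integral>om. T (%i. X n i om) \<partial>P) - (\<integral>om. T (%i. Y i om) \<partial>Q)) < ep / 4"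
			using tendstoD[OF conv, of "ep / 4"] ep by (simp add: dist_real_def)
		moreover have "\<forall>\<^sub>F n in sequentially. ALL i:I. measure P {om : space P. abs (X n i om) > Rf i} < e"
			using fin Rf(1) by (simp add: eventually_ball_finite_distrib)
		ultimately show ?thesis
		proof eventually_elim
			case (elim n)
			have "abs ((\<integral>om. g (%i. X n i om) \<partial>P) - (\<integral>om. T (%i. X n i om) \<partial>P)) <= ep / 4"
				using elim X by (intro approx P gX) auto
			moreover have "abs ((\<integral>om. g (%i. Y i om) \<partial>Q) - (\<integral>om. T (%i. Y i om) \<partial>Q)) <= ep / 4"
				using Y Rf(2) by (intro approx Q gY) auto
			ultimately show ?case using elim ep by linarith
		qed
	qed
	show ?thesis
		by (rule tendstoI) (use key in \<open>simp add: dist_real_def\<close>)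
qed

section \<open>Symmetrization and chaining\<close>

text \<open>Hoeffding's lemma for a fair sign: the bound with \<open>p = 1 / 2\<close> on an
  interval of length \<open>2 * x\<close>, read after factoring out \<open>exp x\<close>.\<close>

lemma cosh_le_exp_half_square: "cosh (x::real) <= exp (x^2 / 2)"
proof -
	have *: "cosh x <= exp (x^2 / 2)" if "x >= 0" for x :: real
	proof -
		have e: "1 + 1 / 2 * (exp (2 * x) - 1) = exp x * cosh x"
		proof -
			have "exp (2 * x) = exp x * exp x" by (simp flip: exp_add)
			moreover have "exp x * exp (- x) = 1" by (simp flip: exp_add)
			ultimately show ?thesis by (simp add: cosh_field_def field_simps)
		qed
		have "- (2 * x) * (1 / 2) + ln (1 + 1 / 2 * (exp (2 * x) - 1)) <= (2 * x)^2 / 8"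
			using that by (intro Hoeffdings_lemma_aux) auto
		hence "ln (cosh x) <= x^2 / 2" unfolding e by (simp add: ln_mult power_mult_distrib)
		hence "exp (ln (cosh x)) <= exp (x^2 / 2)" by (simp only: exp_le_cancel_iff)
		thus ?thesis by (simp only: exp_ln cosh_real_pos)
	qed
	show ?thesis
	proof (cases "x >= 0")
		case False
		thus ?thesis using *[of "- x"] by simp
	qed (rule *)
qed

text \<open>The inequality \<open>1 + z <= exp z\<close> at \<open>z = tt * |y| - c\<close>. The
  free constant \<open>c\<close> does the work of Jensen's inequality for the logarithm, so the
  later averages stay linear.\<close>

lemma max_exp_bound:
	fixes y :: "'t => real"
	assumes "finite T" "T ~= {}" "tt > 0"
	shows "tt * Max ((%t. abs (y t)) ` T) <= c - 1 + exp (- c) * (SUM t:T. exp (tt * y t) + exp (- (tt * y t)))"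
proof -
	have "Max ((%t. abs (y t)) ` T) : (%t. abs (y t)) ` T" using assms by (intro Max_in) auto
	then obtain t where t: "t : T" "Max ((%t. abs (y t)) ` T) = abs (y t)" by auto
	let ?z = "tt * abs (y t)"
	have "1 + (?z - c) <= exp (?z - c)" by (rule exp_ge_add_one_self)
	also have "exp (?z - c) = exp (- c) * exp ?z" by (simp flip: exp_add)
	also have "exp ?z <= exp (tt * y t) + exp (- (tt * y t))" by (cases "y t >= 0") auto
	also have "... <= (SUM t:T. exp (tt * y t) + exp (- (tt * y t)))"
		using assms t by (intro member_le_sum) (auto intro: add_nonneg_nonneg)
	finally show ?thesis unfolding t(2) by simp
qed

text \<open>Sign vectors are coded by subsets, so a Rademacher average over \<open>I\<close> is a
  finite sum over \<open>Pow I\<close> divided by \<open>2 ^ card I\<close>, without an auxiliary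
  probability space.\<close>

definition rsign :: "nat set => nat => real" where
	"rsign S i = (if i : S then 1 else - 1)"

lemma abs_rsign [simp]: "abs (rsign S i) = 1" by (simp add: rsign_def)
lemma rsign_square [simp]: "(rsign S i)^2 = 1" by (simp add: rsign_def)

lemma sum_Pow_insert:
	assumes "finite I" "j \<notin> I"
	shows "(SUM S:Pow (insert j I). F S) = (SUM S:Pow I. F (insert j S) + (F S :: 'a::comm_monoid_add))"
proof -
	have "(SUM S:Pow (insert j I). F S) = (SUM S:Pow I. F S) + (SUM S:insert j ` Pow I. F S)"
		unfolding Pow_insert using assms by (intro sum.union_disjoint) auto
	also have "(SUM S:insert j ` Pow I. F S) = (SUM S:Pow I. F (insert j S))"
		using assms by (subst sum.reindex) (auto simp: inj_on_def dest: insert_ident)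
	finally show ?thesis by (simp add: sum.distrib add.commute)
qed

lemma sum_signs_exp:
	assumes "finite I"
	shows "(SUM S:Pow I. exp (SUM i:I. rsign S i * b i)) = 2 ^ card I * (PROD i:I. cosh (b i))"
	using assms
proof (induction I rule: finite_induct)
	case (insert j I)
	have 1: "(SUM i:I. rsign (insert j S) i * b i) = (SUM i:I. rsign S i * b i)" for S
		using insert by (intro sum.cong) (auto simp: rsign_def)
	have 2: "S : Pow I ==> rsign S j = - 1" for S using insert by (auto simp: rsign_def)
	have "(SUM S:Pow (insert j I). exp (SUM i:insert j I. rsign S i * b i)) =
		 (SUM S:Pow I. exp (SUM i:I. rsign S i * b i) * (2 * cosh (b j)))"
		unfolding sum_Pow_insert[OF insert(1,2)]
	proof (rule sum.cong[OF refl])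
		fix S assume S: "S : Pow I"
		have 3: "rsign (insert j S) j = 1" by (simp add: rsign_def)
		show "exp (SUM i:insert j I. rsign (insert j S) i * b i) + exp (SUM i:insert j I. rsign S i * b i) = exp (SUM i:I. rsign S i * b i) * (2 * cosh (b j))"
			using insert(1,2) by (simp add: 1 2[OF S] 3 exp_add exp_diff) (simp add: cosh_field_def exp_minus field_simps)
	qed
	also have "... = 2 ^ card (insert j I) * (PROD i:insert j I. cosh (b i))"
		using insert by (simp add: flip: sum_distrib_right)
	finally show ?case .
qed simp

text \<open>Subgaussian maximal inequality. The parameter \<open>tt\<close> is left free because the
  chaining takes a different value at every level.\<close>

lemma sum_signs_max:
	fixes b :: "'t => nat => real"
	assumes I: "finite I" and T: "finite T" "T ~= {}" and lam: "tt > 0" and N: "real (card T) <= N"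
		and sg: "!!t. t : T ==> (SUM i:I. (b t i)^2) <= sg2"
	shows "(SUM S:Pow I. Max ((%t. abs (SUM i:I. rsign S i * b t i)) ` T)) <= 2 ^ card I * (ln (2 * N) / tt + tt * sg2 / 2)"
proof -
	have N0: "N > 0" using N T by (metis card_gt_0_iff less_le_trans of_nat_0_less_iff)
	\<comment> \<open>This value makes \<open>exp (- c) * (2 * N * exp (tt^2 * sg2 / 2))\<close> equal
	  to 1, which cancels the \<open>- 1\<close> of \<open>max_exp_bound\<close>.\<close>
	define c where "c = ln (2 * N) + tt^2 * sg2 / 2"
	have mgf: "(SUM S:Pow I. exp (s * (SUM i:I. rsign S i * b t i))) <= 2 ^ card I * exp (tt^2 * sg2 / 2)"
		if "t : T" "s^2 = tt^2" for s t
	proof -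
		have "(SUM S:Pow I. exp (s * (SUM i:I. rsign S i * b t i))) = (SUM S:Pow I. exp (SUM i:I. rsign S i * (s * b t i)))"
			by (simp add: sum_distrib_left mult_ac)
		also have "... = 2 ^ card I * (PROD i:I. cosh (s * b t i))" using I by (rule sum_signs_exp)
		also have "(PROD i:I. cosh (s * b t i)) <= (PROD i:I. exp ((s * b t i)^2 / 2))"
			by (intro prod_mono) (auto intro: cosh_le_exp_half_square)
		also have "... = exp (SUM i:I. (s * b t i)^2 / 2)" using I by (simp add: exp_sum)
		also have "(SUM i:I. (s * b t i)^2 / 2) = tt^2 * (SUM i:I. (b t i)^2) / 2"
			using that by (simp add: power_mult_distrib sum_distrib_left sum_divide_distrib)
		also have "exp ... <= exp (tt^2 * sg2 / 2)"
			using sg[OF that(1)] by (simp add: mult_left_mono)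
		finally show ?thesis by simp
	qed
	have "tt * (SUM S:Pow I. Max ((%t. abs (SUM i:I. rsign S i * b t i)) ` T))
		 <= (SUM S:Pow I. c - 1 + exp (- c) * (SUM t:T. exp (tt * (SUM i:I. rsign S i * b t i)) + exp (- (tt * (SUM i:I. rsign S i * b t i)))))"
		by (subst sum_distrib_left) (intro sum_mono max_exp_bound T lam)
	also have "... = 2 ^ card I * (c - 1) + exp (- c) * (SUM t:T. (SUM S:Pow I. exp (tt * (SUM i:I. rsign S i * b t i))) + (SUM S:Pow I. exp ((- tt) * (SUM i:I. rsign S i * b t i))))"
	proof -
		have "(SUM S:Pow I. SUM t:T. exp (tt * (SUM i:I. rsign S i * b t i)) + exp (- (tt * (SUM i:I. rsign S i * b t i))))
			= (SUM t:T. SUM S:Pow I. exp (tt * (SUM i:I. rsign S i * b t i)) + exp (- (tt * (SUM i:I. rsign S i * b t i))))"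
			by (rule sum.swap)
		thus ?thesis using I
			unfolding sum.distrib by (simp add: card_Pow flip: sum_distrib_left sum.distrib)
	qed
	also have "... <= 2 ^ card I * (c - 1) + exp (- c) * (SUM t:T. 2 ^ card I * exp (tt^2 * sg2 / 2) + 2 ^ card I * exp (tt^2 * sg2 / 2))"
		by (intro add_left_mono mult_left_mono sum_mono add_mono mgf) auto
	also have "... = 2 ^ card I * (c - 1 + exp (- c) * (2 * real (card T) * exp (tt^2 * sg2 / 2)))"
		by (simp add: field_simps)
	also have "... <= 2 ^ card I * (c - 1 + exp (- c) * (2 * N * exp (tt^2 * sg2 / 2)))"
		using N by (intro mult_left_mono add_left_mono mult_right_mono) auto
	also have "exp (- c) * (2 * N * exp (tt^2 * sg2 / 2)) = 1"
	proof -
		have "2 * N * exp (tt^2 * sg2 / 2) = exp c" unfolding c_def using N0 by (simp add: exp_add)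
		thus ?thesis by (simp flip: exp_add)
	qed
	finally have "tt * (SUM S:Pow I. Max ((%t. abs (SUM i:I. rsign S i * b t i)) ` T)) <= 2 ^ card I * c" by simp
	also have "2 ^ card I * c = tt * (2 ^ card I * (ln (2 * N) / tt + tt * sg2 / 2))"
		unfolding c_def using lam by (simp add: field_simps power2_eq_square)
	finally show ?thesis using lam by (simp only: mult_le_cancel_left_pos)
qed

lemma Max_abs_le:
	assumes "finite T" "T ~= {}" "!!t. t : T ==> abs (f t) <= (M::real)"
	shows "Max ((%t. abs (f t)) ` T) <= M"
	using assms by (auto simp: Max_le_iff)

lemma Max_abs_ge:
	assumes "finite T" "t : T"
	shows "abs (f t :: real) <= Max ((%t. abs (f t)) ` T)"
	using assms by (intro Max_ge) auto

text \<open>\<open>c l t\<close> names the cell of \<open>t\<close> at level \<open>l\<close> of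
  nested partitions. Each index is joined to its representative at level \<open>l0\<close> by a
  chain of \<open>L\<close> links; each level of links is paid for by \<open>sum_signs_max\<close>,
  and the last term bounds what remains below level \<open>l0 + L\<close> by Cauchy-Schwarz.\<close>

lemma chaining_signs:
	fixes b :: "'t => nat => real" and c :: "nat => 't => 'c"
	assumes I: "finite I" and T: "finite T" "T ~= {}"
		and refine: "!!l t t'. t : T ==> t' : T ==> c (Suc l) t = c (Suc l) t' ==> c l t = c l t'"
		and N: "!!l. real (card (c l ` T)) <= N l"
		and close: "!!l t t'. t : T ==> t' : T ==> c l t = c l t' ==> (SUM i:I. (b t i - b t' i)^2) <= ta l"
		and start: "!!t. t : T ==> (SUM i:I. (b t i)^2) <= De"
		and lam: "tt0 > 0" "!!l. tt l > 0"
	shows "(SUM S:Pow I. Max ((%t. abs (SUM i:I. rsign S i * b t i)) ` T)) <=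
		2 ^ card I * ((ln (2 * N l0) / tt0 + tt0 * De / 2)
			+ (SUM l:{l0..<l0 + L}. ln (2 * N (Suc l)) / tt l + tt l * ta l / 2) + sqrt (real (card I) * ta (l0 + L)))"
proof -
	define rep where "rep l t = (SOME t'. t' : T & c l t' = c l t)" for l t
	have rep: "rep l t : T & c l (rep l t) = c l t" if "t : T" for l t
		unfolding rep_def by (rule someI[of _ t]) (use that in auto)
	have repc: "rep l t = rep l t'" if "c l t = c l t'" for l t t'
		unfolding rep_def that ..
	have cardrep: "real (card (rep l ` T)) <= N l" for l
	proof -
		have "rep l ` T = (%k. SOME t'. t' : T & c l t' = k) ` (c l ` T)"
			unfolding rep_def by (simp add: image_image)
		hence "card (rep l ` T) <= card (c l ` T)" using T by (simp add: card_image_le)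
		thus ?thesis using N[of l] by linarith
	qed
	\<comment> \<open>By nestedness a link is determined by the finer representative, hence there are
	  at most \<open>N (Suc l)\<close> different links between the levels \<open>l\<close> and
	  \<open>Suc l\<close>.\<close>
	have reprep: "rep l (rep (Suc l) t) = rep l t" if "t : T" for l t
		using refine[of "rep (Suc l) t" t l] rep[OF that, of "Suc l"] that by (intro repc) auto
	define Z where "Z S t = (SUM i:I. rsign S i * b t i)" for S t
	let ?b = "%l t i. b t i - b (rep l t) i"
	have Zd: "Z S t - Z S t' = (SUM i:I. rsign S i * (b t i - b t' i))" for S t t'
		unfolding Z_def by (simp add: right_diff_distrib sum_subtractf)
	have tele: "Z S t = Z S (rep l0 t) + (SUM l:{l0..<l0 + L}. Z S (rep (Suc l) t) - Z S (rep l t)) + (Z S t - Z S (rep (l0 + L) t))" for S t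
		by (induction L) auto
	have resid: "abs (Z S t - Z S (rep l t)) <= sqrt (real (card I) * ta l)" if "t : T" for S t l
	proof -
		have "abs (Z S t - Z S (rep l t)) <= (SUM i:I. abs (b t i - b (rep l t) i))"
			unfolding Zd by (rule order_trans[OF sum_abs]) (simp add: abs_mult)
		also have "... = (SUM i:I. abs 1 * abs (b t i - b (rep l t) i))" by simp
		also have "... <= L2_set (%_. 1) I * L2_set (%i. b t i - b (rep l t) i) I"
			by (rule L2_set_mult_ineq)
		also have "... = sqrt (real (card I) * (SUM i:I. (b t i - b (rep l t) i)^2))"
			by (simp add: L2_set_def real_sqrt_mult)
		also have "... <= sqrt (real (card I) * ta l)"
			using close[of t "rep l t" l] rep[OF that] that by (intro real_sqrt_le_mono mult_left_mono) auto
		finally show ?thesis .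
	qed
	have T': "finite (rep l ` T)" "rep l ` T ~= {}" for l using T by auto
	have pt: "Max ((%t. abs (Z S t)) ` T) <= Max ((%t. abs (Z S t)) ` rep l0 ` T)
			+ (SUM l:{l0..<l0 + L}. Max ((%t. abs (SUM i:I. rsign S i * ?b l t i)) ` rep (Suc l) ` T)) + sqrt (real (card I) * ta (l0 + L))" for S
	proof (rule Max_abs_le[OF T])
		fix t assume t: "t : T"
		have "abs (Z S t) <= abs (Z S (rep l0 t)) + (SUM l:{l0..<l0 + L}. abs (Z S (rep (Suc l) t) - Z S (rep l t))) + abs (Z S t - Z S (rep (l0 + L) t))"
			using tele[of S t] sum_abs[of "%l. Z S (rep (Suc l) t) - Z S (rep l t)" "{l0..<l0 + L}"] by linarith
		also have "... <= Max ((%t. abs (Z S t)) ` rep l0 ` T)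
			+ (SUM l:{l0..<l0 + L}. Max ((%t. abs (SUM i:I. rsign S i * ?b l t i)) ` rep (Suc l) ` T)) + sqrt (real (card I) * ta (l0 + L))"
		proof (intro add_mono sum_mono resid t)
			show "abs (Z S (rep l0 t)) <= Max ((%t. abs (Z S t)) ` rep l0 ` T)"
				using T' t by (intro Max_abs_ge) auto
			fix l
			have "abs (Z S (rep (Suc l) t) - Z S (rep l t)) = abs (SUM i:I. rsign S i * ?b l (rep (Suc l) t) i)"
				unfolding Zd reprep[OF t] ..
			also have "... <= Max ((%t. abs (SUM i:I. rsign S i * ?b l t i)) ` rep (Suc l) ` T)"
				using T' t by (intro Max_abs_ge[of _ _ "%t. SUM i:I. rsign S i * ?b l t i"]) auto
			finally show "abs (Z S (rep (Suc l) t) - Z S (rep l t)) <= Max ((%t. abs (SUM i:I. rsign S i * ?b l t i)) ` rep (Suc l) ` T)" .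
		qed
		finally show "abs (Z S t) <= Max ((%t. abs (Z S t)) ` rep l0 ` T)
			+ (SUM l:{l0..<l0 + L}. Max ((%t. abs (SUM i:I. rsign S i * ?b l t i)) ` rep (Suc l) ` T)) + sqrt (real (card I) * ta (l0 + L))" .
	qed
	have "(SUM S:Pow I. Max ((%t. abs (Z S t)) ` T)) <= (SUM S:Pow I. Max ((%t. abs (Z S t)) ` rep l0 ` T)
			+ (SUM l:{l0..<l0 + L}. Max ((%t. abs (SUM i:I. rsign S i * ?b l t i)) ` rep (Suc l) ` T)) + sqrt (real (card I) * ta (l0 + L)))"
		by (rule sum_mono) (rule pt)
	also have "... = (SUM S:Pow I. Max ((%t. abs (Z S t)) ` rep l0 ` T))
			+ (SUM l:{l0..<l0 + L}. SUM S:Pow I. Max ((%t. abs (SUM i:I. rsign S i * ?b l t i)) ` rep (Suc l) ` T)) + 2 ^ card I * sqrt (real (card I) * ta (l0 + L))"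
	proof -
		have "(SUM S:Pow I. SUM l:{l0..<l0 + L}. Max ((%t. abs (SUM i:I. rsign S i * ?b l t i)) ` rep (Suc l) ` T))
			 = (SUM l:{l0..<l0 + L}. SUM S:Pow I. Max ((%t. abs (SUM i:I. rsign S i * ?b l t i)) ` rep (Suc l) ` T))"
			by (rule sum.swap)
		thus ?thesis using I by (simp add: sum.distrib card_Pow)
	qed
	also have "... <= 2 ^ card I * (ln (2 * N l0) / tt0 + tt0 * De / 2)
			+ (SUM l:{l0..<l0 + L}. 2 ^ card I * (ln (2 * N (Suc l)) / tt l + tt l * ta l / 2)) + 2 ^ card I * sqrt (real (card I) * ta (l0 + L))"
	proof (intro add_mono order_refl sum_mono)
		show "(SUM S:Pow I. Max ((%t. abs (Z S t)) ` rep l0 ` T)) <= 2 ^ card I * (ln (2 * N l0) / tt0 + tt0 * De / 2)"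
			unfolding Z_def using rep by (intro sum_signs_max I T' lam cardrep start) auto
		fix l
		show "(SUM S:Pow I. Max ((%t. abs (SUM i:I. rsign S i * ?b l t i)) ` rep (Suc l) ` T)) <= 2 ^ card I * (ln (2 * N (Suc l)) / tt l + tt l * ta l / 2)"
		proof (intro sum_signs_max I T' lam cardrep)
			fix t assume "t : rep (Suc l) ` T"
			hence "t : T" using rep by auto
			thus "(SUM i:I. (?b l t i)^2) <= ta l" using rep[of t l] by (intro close) auto
		qed
	qed
	also have "... = 2 ^ card I * ((ln (2 * N l0) / tt0 + tt0 * De / 2)
			+ (SUM l:{l0..<l0 + L}. ln (2 * N (Suc l)) / tt l + tt l * ta l / 2) + sqrt (real (card I) * ta (l0 + L)))"
		by (simp only: distrib_left sum_distrib_left)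
	finally show ?thesis by (simp only: Z_def)
qed

text \<open>No independent copy is introduced. Pointwise
  \<open>|c + x| <= (|c + 2 x| + |c|) / 2\<close>, and centring gives
  \<open>|c| <= E |c - 2 x|\<close> by Jensen; together they replace \<open>x\<close> by a random
  sign times \<open>2 x\<close>.\<close>

lemma (in prob_space) symmetrization_step:
	fixes xx :: "'t => 'a => real" and c :: "'t => real"
	assumes T: "finite T" "T ~= {}"
		and [measurable]: "!!t. t : T ==> xx t : bm M"
		and bdd: "!!t y. t : T ==> abs (xx t y) <= K"
		and mean: "!!t. t : T ==> (\<integral>y. xx t y \<partial>M) = 0"
	shows "2 * (\<integral>\<^sup>+y. ennreal (Max ((%t. abs (c t + xx t y)) ` T)) \<partial>M) <=
		(\<integral>\<^sup>+y. ennreal (Max ((%t. abs (c t + 2 * xx t y)) ` T)) \<partial>M) + (\<integral>\<^sup>+y. ennreal (Max ((%t. abs (c t - 2 * xx t y)) ` T)) \<partial>M)"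
proof -
	define H where "H s y = Max ((%t. abs (c t + s * xx t y)) ` T)" for s y
	have Hm: "H s : bm M" for s
		unfolding H_def using T by (intro borel_measurable_Max) auto
	have H0: "0 <= H s y" for s y
	proof -
		obtain t where "t : T" using T by auto
		thus ?thesis unfolding H_def using Max_abs_ge[OF T(1), of t "%t. c t + s * xx t y"] by linarith
	qed
	have Hb: "abs (H s y) <= (SUM t:T. abs (c t)) + abs s * K" for s y
	proof -
		have "H s y <= (SUM t:T. abs (c t)) + abs s * K" unfolding H_def
		proof (rule Max_abs_le[OF T])
			fix t assume t: "t : T"
			have "abs (c t + s * xx t y) <= abs (c t) + abs s * abs (xx t y)" by (metis abs_mult abs_triangle_ineq)
			also have "... <= (SUM t:T. abs (c t)) + abs s * K"
				using t T bdd[OF t] by (intro add_mono mult_left_mono member_le_sum[of t T "%t. abs (c t)"]) auto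
			finally show "abs (c t + s * xx t y) <= (SUM t:T. abs (c t)) + abs s * K" .
		qed
		thus ?thesis using H0[of s y] by simp
	qed
	have Hi: "integrable M (H s)" for s using Hm Hb by (rule integrable_bounded)
	have xi: "integrable M (xx t)" if "t : T" for t using that bdd by (intro integrable_bounded) auto
	have c: "Max ((%t. abs (c t)) ` T) <= (\<integral>y. H (-2) y \<partial>M)"
	proof (rule Max_abs_le[OF T])
		fix t assume t: "t : T"
		have "c t = (\<integral>y. c t + (-2) * xx t y \<partial>M)" using xi[OF t] mean[OF t] by (simp add: prob_space)
		also have "abs (...) <= (\<integral>y. abs (c t + (-2) * xx t y) \<partial>M)" by (rule integral_abs_bound)
		also have "... <= (\<integral>y. H (-2) y \<partial>M)"
		proof (rule integral_mono)
			show "abs (c t + (-2) * xx t y) <= H (-2) y" for y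
				unfolding H_def by (rule Max_abs_ge[OF T(1) t])
		qed (use xi[OF t] Hi in auto)
		finally show "abs (c t) <= (\<integral>y. H (-2) y \<partial>M)" .
	qed
	have pt: "2 * H 1 y <= H 2 y + Max ((%t. abs (c t)) ` T)" for y
	proof -
		have "H 1 y <= (H 2 y + Max ((%t. abs (c t)) ` T)) / 2" unfolding H_def
		proof (rule Max_abs_le[OF T])
			fix t assume t: "t : T"
			have "abs (c t + 1 * xx t y) <= (abs (c t + 2 * xx t y) + abs (c t)) / 2" by (simp add: abs_if)
			also have "... <= (Max ((%t. abs (c t + 2 * xx t y)) ` T) + Max ((%t. abs (c t)) ` T)) / 2"
				using Max_abs_ge[OF T(1) t, of "%t. c t + 2 * xx t y"] Max_abs_ge[OF T(1) t, of c] by simp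
			finally show "abs (c t + 1 * xx t y) <= (Max ((%t. abs (c t + 2 * xx t y)) ` T) + Max ((%t. abs (c t)) ` T)) / 2" .
		qed
		thus ?thesis by simp
	qed
	have "2 * (\<integral>y. H 1 y \<partial>M) = (\<integral>y. 2 * H 1 y \<partial>M)" by simp
	also have "... <= (\<integral>y. H 2 y + Max ((%t. abs (c t)) ` T) \<partial>M)"
		using Hi by (intro integral_mono pt) auto
	also have "... = (\<integral>y. H 2 y \<partial>M) + Max ((%t. abs (c t)) ` T)" using Hi by (simp add: prob_space)
	finally have "2 * (\<integral>y. H 1 y \<partial>M) <= (\<integral>y. H 2 y \<partial>M) + (\<integral>y. H (-2) y \<partial>M)" using c by linarith
	hence "ennreal (2 * (\<integral>y. H 1 y \<partial>M)) <= ennreal ((\<integral>y. H 2 y \<partial>M) + (\<integral>y. H (-2) y \<partial>M))" by (rule ennreal_leI)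
	hence "2 * (\<integral>\<^sup>+y. ennreal (H 1 y) \<partial>M) <= (\<integral>\<^sup>+y. ennreal (H 2 y) \<partial>M) + (\<integral>\<^sup>+y. ennreal (H (-2) y) \<partial>M)"
		using Hi H0 by (simp add: nn_integral_eq_integral ennreal_mult ennreal_plus)
	thus ?thesis unfolding H_def by simp
qed

text \<open>Induction over the coordinates, exchanging one centred variable at a time for its signed
  double. The offset \<open>c\<close> exists for the induction: whatever is not being treated is
  absorbed into it.\<close>

lemma symmetrization:
	fixes xx :: "'t => 'x => real" and c :: "'t => real" and a :: "nat => real"
	assumes mm: "prob_space mm" and I: "finite I" and T: "finite T" "T ~= {}"
		and m: "!!t. t : T ==> xx t : bm mm"
		and bdd: "!!t y. t : T ==> abs (xx t y) <= K"
		and mean: "!!t. t : T ==> (\<integral>y. xx t y \<partial>mm) = 0"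
	shows "2 ^ card I * (\<integral>\<^sup>+x. ennreal (Max ((%t. abs (c t + (SUM i:I. a i * xx t (x i)))) ` T)) \<partial>(PiM I (%i. mm))) <=
		(SUM S:Pow I. \<integral>\<^sup>+x. ennreal (Max ((%t. abs (c t + (SUM i:I. 2 * rsign S i * a i * xx t (x i)))) ` T)) \<partial>(PiM I (%i. mm)))"
	using I
proof (induction I arbitrary: c rule: finite_induct)
	case empty
	thus ?case by simp
next
	case (insert j I)
	interpret mm: prob_space mm by fact
	interpret product_sigma_finite "%_::nat. mm" by unfold_locales
	define F where "F b x = ennreal (Max ((%t. abs (c t + (SUM i:insert j I. b i * xx t (x i)))) ` T))" for b :: "nat => real" and x
	have comp: "(%x. xx t (x i)) : bm (\<Pi>\<^sub>M i\<in>J. mm)" if "i : J" "t : T" for i t J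
		using measurable_compose[OF measurable_component_singleton[OF that(1), of "%_. mm"] m[OF that(2)]] .
	have Fm: "F b : bm (\<Pi>\<^sub>M i\<in>insert j I. mm)" for b
		unfolding F_def
		by (intro measurable_compose[OF _ measurable_ennreal] borel_measurable_Max borel_measurable_abs T
			borel_measurable_add borel_measurable_const borel_measurable_sum borel_measurable_times comp)
	have upd: "(SUM i:insert j I. b i * xx t ((x(j := y)) i)) = b j * xx t y + (SUM i:I. b i * xx t (x i))" for b t x y
		using insert(1,2) by (auto intro!: sum.cong)
	let ?R = "%S i. 2 * rsign S i * a i"
	have rI: "(SUM i:I. ?R (insert j S) i * xx t (x i)) = (SUM i:I. ?R S i * xx t (x i))" for S t x
		using insert(2) by (intro sum.cong) (auto simp: rsign_def)
	have "2 ^ card (insert j I) * (\<integral>\<^sup>+x. F a x \<partial>(\<Pi>\<^sub>M i\<in>insert j I. mm))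
		= 2 * (2 ^ card I * (\<integral>\<^sup>+y. (\<integral>\<^sup>+x. F a (x(j := y)) \<partial>(PiM I (%i. mm))) \<partial>mm))"
		using insert(1,2) by (subst product_nn_integral_insert_rev[OF insert(1,2) Fm]) (simp add: mult.assoc)
	also have "... = 2 * (\<integral>\<^sup>+y. 2 ^ card I * (\<integral>\<^sup>+x. F a (x(j := y)) \<partial>(PiM I (%i. mm))) \<partial>mm)"
	proof (subst nn_integral_cmult)
		interpret I: sigma_finite_measure "\<Pi>\<^sub>M i\<in>I. mm" using insert(1) by (rule sigma_finite)
		have "(%(x, y). F a (x(j := y))) : bm ((PiM I (%i. mm)) \<Otimes>\<^sub>M mm)"
			using measurable_compose[OF measurable_add_dim[of j I "%_. mm"] Fm[of a]] by (simp add: case_prod_beta')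
		hence "(%(y, x). F a (x(j := y))) : bm (mm \<Otimes>\<^sub>M (PiM I (%i. mm)))"
			by (subst measurable_pair_swap_iff) (simp add: case_prod_beta')
		thus "(%y. \<integral>\<^sup>+x. F a (x(j := y)) \<partial>(PiM I (%i. mm))) : bm mm"
			by (rule I.borel_measurable_nn_integral)
	qed simp
	also have "... <= 2 * (\<integral>\<^sup>+y. (SUM S:Pow I. \<integral>\<^sup>+x. ennreal (Max ((%t. abs ((c t + a j * xx t y) + (SUM i:I. ?R S i * xx t (x i)))) ` T)) \<partial>(PiM I (%i. mm))) \<partial>mm)"
	proof (intro mult_left_mono nn_integral_mono)
		fix y
		show "2 ^ card I * (\<integral>\<^sup>+x. F a (x(j := y)) \<partial>(PiM I (%i. mm))) <=
			 (SUM S:Pow I. \<integral>\<^sup>+x. ennreal (Max ((%t. abs ((c t + a j * xx t y) + (SUM i:I. ?R S i * xx t (x i)))) ` T)) \<partial>(PiM I (%i. mm)))"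
			using insert.IH[of "%t. c t + a j * xx t y"] unfolding F_def upd add.assoc .
	qed simp
	also have "... = 2 * (\<integral>\<^sup>+y. (SUM S:Pow I. \<integral>\<^sup>+x. F (%i. if i = j then a j else ?R S i) (x(j := y)) \<partial>(PiM I (%i. mm))) \<partial>mm)"
	proof -
		have "(SUM i:I. (if i = j then a j else ?R S i) * xx t (x i)) = (SUM i:I. ?R S i * xx t (x i))" for S t x
			using insert(2) by (intro sum.cong) auto
		thus ?thesis unfolding F_def upd by (simp add: add.assoc)
	qed
	also have "... = 2 * (SUM S:Pow I. \<integral>\<^sup>+y. (\<integral>\<^sup>+x. F (%i. if i = j then a j else ?R S i) (x(j := y)) \<partial>(PiM I (%i. mm))) \<partial>mm)"
	proof (subst nn_integral_sum)
		fix S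
		interpret I: sigma_finite_measure "\<Pi>\<^sub>M i\<in>I. mm" using insert(1) by (rule sigma_finite)
		let ?b = "%i. if i = j then a j else ?R S i"
		have "(%(x, y). F ?b (x(j := y))) : bm ((PiM I (%i. mm)) \<Otimes>\<^sub>M mm)"
			using measurable_compose[OF measurable_add_dim[of j I "%_. mm"] Fm[of ?b]] by (simp add: case_prod_beta')
		hence "(%(y, x). F ?b (x(j := y))) : bm (mm \<Otimes>\<^sub>M (PiM I (%i. mm)))"
			by (subst measurable_pair_swap_iff) (simp add: case_prod_beta')
		thus "(%y. \<integral>\<^sup>+x. F ?b (x(j := y)) \<partial>(PiM I (%i. mm))) : bm mm"
			by (rule I.borel_measurable_nn_integral)
	qed simp
	also have "... = (SUM S:Pow I. 2 * (\<integral>\<^sup>+x. F (%i. if i = j then a j else ?R S i) x \<partial>(\<Pi>\<^sub>M i\<in>insert j I. mm)))"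
		by (simp add: product_nn_integral_insert_rev[OF insert(1,2) Fm] sum_distrib_left)
	also have "... <= (SUM S:Pow I. (\<integral>\<^sup>+x. F (?R (insert j S)) x \<partial>(\<Pi>\<^sub>M i\<in>insert j I. mm)) + (\<integral>\<^sup>+x. F (?R S) x \<partial>(\<Pi>\<^sub>M i\<in>insert j I. mm)))"
	proof (rule sum_mono)
		fix S assume "S : Pow I"
		hence jS: "j \<notin> S" using insert(2) by auto
		have sI: "(SUM i:I. (if i = j then a j else ?R S i) * xx t (x i)) = (SUM i:I. ?R S i * xx t (x i))" for t x
			using insert(2) by (intro sum.cong) auto
		interpret I: sigma_finite_measure "\<Pi>\<^sub>M i\<in>I. mm" using insert(1) by (rule sigma_finite)
		have meas: "(%x. \<integral>\<^sup>+y. F b (x(j := y)) \<partial>mm) : bm (PiM I (%i. mm))" for b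
		proof -
			have "(%(x, y). F b (x(j := y))) : bm ((PiM I (%i. mm)) \<Otimes>\<^sub>M mm)"
				using measurable_compose[OF measurable_add_dim[of j I "%_. mm"] Fm[of b]] by (simp add: case_prod_beta')
			thus ?thesis by (rule mm.borel_measurable_nn_integral)
		qed
		have "2 * (\<integral>\<^sup>+x. F (%i. if i = j then a j else ?R S i) x \<partial>(\<Pi>\<^sub>M i\<in>insert j I. mm))
			= (\<integral>\<^sup>+x. 2 * (\<integral>\<^sup>+y. F (%i. if i = j then a j else ?R S i) (x(j := y)) \<partial>mm) \<partial>(PiM I (%i. mm)))"
			by (simp add: product_nn_integral_insert[OF insert(1,2) Fm] nn_integral_cmult[OF meas])
		also have "... <= (\<integral>\<^sup>+x. (\<integral>\<^sup>+y. F (?R (insert j S)) (x(j := y)) \<partial>mm) + (\<integral>\<^sup>+y. F (?R S) (x(j := y)) \<partial>mm) \<partial>(PiM I (%i. mm)))"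
		proof (rule nn_integral_mono)
			fix x
			have "2 * (\<integral>\<^sup>+y. ennreal (Max ((%t. abs ((c t + (SUM i:I. ?R S i * xx t (x i))) + a j * xx t y)) ` T)) \<partial>mm) <=
				(\<integral>\<^sup>+y. ennreal (Max ((%t. abs ((c t + (SUM i:I. ?R S i * xx t (x i))) + 2 * (a j * xx t y))) ` T)) \<partial>mm)
			 + (\<integral>\<^sup>+y. ennreal (Max ((%t. abs ((c t + (SUM i:I. ?R S i * xx t (x i))) - 2 * (a j * xx t y))) ` T)) \<partial>mm)"
			proof (rule mm.symmetrization_step[OF T, where K="abs (a j) * K"])
				fix t assume t: "t : T"
				show "(%y. a j * xx t y) : bm mm" using m[OF t] by simp
				show "abs (a j * xx t y) <= abs (a j) * K" for y using bdd[OF t, of y] by (simp add: abs_mult mult_left_mono)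
				show "(\<integral>y. a j * xx t y \<partial>mm) = 0" using mean[OF t] by simp
			qed
			moreover have "F (%i. if i = j then a j else ?R S i) (x(j := y)) = ennreal (Max ((%t. abs ((c t + (SUM i:I. ?R S i * xx t (x i))) + a j * xx t y)) ` T))" for y
				unfolding F_def upd sI by (simp add: algebra_simps)
			moreover have "F (?R (insert j S)) (x(j := y)) = ennreal (Max ((%t. abs ((c t + (SUM i:I. ?R S i * xx t (x i))) + 2 * (a j * xx t y))) ` T))" for y
				unfolding F_def upd rI by (simp add: rsign_def algebra_simps)
			moreover have "F (?R S) (x(j := y)) = ennreal (Max ((%t. abs ((c t + (SUM i:I. ?R S i * xx t (x i))) - 2 * (a j * xx t y))) ` T))" for y
			proof -
				have "rsign S j = - 1" using jS by (simp add: rsign_def)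
				thus ?thesis unfolding F_def upd by (simp add: algebra_simps)
			qed
			ultimately show "2 * (\<integral>\<^sup>+y. F (%i. if i = j then a j else ?R S i) (x(j := y)) \<partial>mm) <= (\<integral>\<^sup>+y. F (?R (insert j S)) (x(j := y)) \<partial>mm) + (\<integral>\<^sup>+y. F (?R S) (x(j := y)) \<partial>mm)"
				by simp
		qed
		also have "... = (\<integral>\<^sup>+x. F (?R (insert j S)) x \<partial>(\<Pi>\<^sub>M i\<in>insert j I. mm)) + (\<integral>\<^sup>+x. F (?R S) x \<partial>(\<Pi>\<^sub>M i\<in>insert j I. mm))"
			by (simp add: product_nn_integral_insert[OF insert(1,2) Fm] nn_integral_add[OF meas meas])
		finally show "2 * (\<integral>\<^sup>+x. F (%i. if i = j then a j else ?R S i) x \<partial>(\<Pi>\<^sub>M i\<in>insert j I. mm)) <=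
			(\<integral>\<^sup>+x. F (?R (insert j S)) x \<partial>(\<Pi>\<^sub>M i\<in>insert j I. mm)) + (\<integral>\<^sup>+x. F (?R S) x \<partial>(\<Pi>\<^sub>M i\<in>insert j I. mm))" .
	qed
	also have "... = (SUM S:Pow (insert j I). \<integral>\<^sup>+x. F (?R S) x \<partial>(\<Pi>\<^sub>M i\<in>insert j I. mm))"
		by (rule sum_Pow_insert[OF insert(1,2), symmetric])
	finally show ?case unfolding F_def .
qed

text \<open>Separates the two sources of randomness: \<open>B x\<close> comes from a purely
  combinatorial estimate over signs at a frozen sample, and only \<open>B\<close> has to be
  integrated afterwards.\<close>

lemma symmetrization_bound:
	fixes xx :: "'t => 'x => real" and a :: "nat => real"
	assumes mm: "prob_space mm" and I: "finite I" and T: "finite T" "T ~= {}"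
		and m: "!!t. t : T ==> xx t : bm mm"
		and bdd: "!!t y. t : T ==> abs (xx t y) <= K"
		and mean: "!!t. t : T ==> (\<integral>y. xx t y \<partial>mm) = 0"
		and Bm: "B : bm (PiM I (%i. mm))"
		and B: "!!x. x : space (PiM I (%i. mm)) ==> (SUM S:Pow I. Max ((%t. abs (SUM i:I. rsign S i * (a i * xx t (x i)))) ` T)) <= 2 ^ card I * B x"
	shows "(\<integral>\<^sup>+x. ennreal (Max ((%t. abs (SUM i:I. a i * xx t (x i))) ` T)) \<partial>(PiM I (%i. mm))) <= (\<integral>\<^sup>+x. ennreal (2 * B x) \<partial>(PiM I (%i. mm)))"
proof -
	have comp: "(%x. xx t (x i)) : bm (PiM I (%i. mm))" if "i : I" "t : T" for i t
		using measurable_compose[OF measurable_component_singleton[OF that(1), of "%_. mm"] m[OF that(2)]] .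
	define F where "F S x = Max ((%t. abs (SUM i:I. 2 * rsign S i * a i * xx t (x i))) ` T)" for S x
	have Fm: "F S : bm (PiM I (%i. mm))" for S
		unfolding F_def
		by (intro borel_measurable_Max borel_measurable_abs T borel_measurable_const borel_measurable_sum borel_measurable_times comp)
	have F0: "F S x >= 0" for S x
	proof -
		obtain t where "t : T" using T by auto
		thus ?thesis unfolding F_def using Max_abs_ge[OF T(1), of t "%t. SUM i:I. 2 * rsign S i * a i * xx t (x i)"] by linarith
	qed
	have F2: "F S x = 2 * Max ((%t. abs (SUM i:I. rsign S i * (a i * xx t (x i)))) ` T)" for S x
	proof -
		have e: "abs (SUM i:I. 2 * rsign S i * a i * xx t (x i)) = 2 * abs (SUM i:I. rsign S i * (a i * xx t (x i)))" for t
			by (simp add: mult.assoc abs_mult flip: sum_distrib_left)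
		have "mono (%y::real. 2 * y)" by (auto simp: mono_def)
		from mono_Max_commute[OF this, of "(%t. abs (SUM i:I. rsign S i * (a i * xx t (x i)))) ` T"]
		show ?thesis unfolding F_def e using T by (simp add: image_image)
	qed
	have "2 ^ card I * (\<integral>\<^sup>+x. ennreal (Max ((%t. abs (SUM i:I. a i * xx t (x i))) ` T)) \<partial>(PiM I (%i. mm))) <= (SUM S:Pow I. \<integral>\<^sup>+x. ennreal (F S x) \<partial>(PiM I (%i. mm)))"
		using symmetrization[where c="%_. 0" and a=a, OF mm I T m bdd mean] by (simp add: F_def)
	also have "... = (\<integral>\<^sup>+x. (SUM S:Pow I. ennreal (F S x)) \<partial>(PiM I (%i. mm)))"
		by (rule nn_integral_sum[symmetric]) (rule measurable_compose[OF Fm measurable_ennreal])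
	also have "... <= (\<integral>\<^sup>+x. 2 ^ card I * ennreal (2 * B x) \<partial>(PiM I (%i. mm)))"
	proof (rule nn_integral_mono)
		fix x assume x: "x : space (PiM I (%i. mm))"
		have "(SUM S:Pow I. ennreal (F S x)) = ennreal (SUM S:Pow I. F S x)" using F0 by (intro sum_ennreal)
		also have "(SUM S:Pow I. F S x) <= 2 ^ card I * (2 * B x)"
			using B[OF x] unfolding F2 by (simp flip: sum_distrib_left)
		also have "ennreal (2 ^ card I * (2 * B x)) = 2 ^ card I * ennreal (2 * B x)"
			by (simp add: ennreal_mult' flip: ennreal_power ennreal_numeral)
		finally show "(SUM S:Pow I. ennreal (F S x)) <= 2 ^ card I * ennreal (2 * B x)" by (simp add: ennreal_leI)
	qed
	also have "... = 2 ^ card I * (\<integral>\<^sup>+x. ennreal (2 * B x) \<partial>(PiM I (%i. mm)))"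
		using Bm by (intro nn_integral_cmult) simp
	finally show ?thesis
		by (subst (asm) ennreal_mult_le_mult_iff) (auto simp: power_eq_top_ennreal less_top[symmetric])
qed

text \<open>The maximal bound for a single index; its entropy term is \<open>ln 2 / tt\<close>,
  which is below \<open>1 / tt\<close>.\<close>

lemma weighted_sum_L1_bound:
	fixes zt :: "'x => real" and a :: "nat => real"
	assumes mm: "prob_space mm" and I: "finite I" and m: "zt : bm mm"
		and bdd: "!!y. abs (zt y) <= 1" and mean: "(\<integral>y. zt y \<partial>mm) = 0"
		and s2: "(SUM i:I. (a i)^2) <= s2" and th: "tt > 0"
	shows "(\<integral>\<^sup>+x. ennreal (abs (SUM i:I. a i * zt (x i))) \<partial>(PiM I (%i. mm))) <= ennreal (2 * (1 / tt + tt * s2 / 2))"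
proof -
	interpret mm: prob_space mm by fact
	interpret product_prob_space "%_::nat. mm" by unfold_locales
	have "(\<integral>\<^sup>+x. ennreal (Max ((%t. abs (SUM i:I. a i * zt (x i))) ` {()})) \<partial>(PiM I (%i. mm))) <= (\<integral>\<^sup>+x. ennreal (2 * (1 / tt + tt * s2 / 2)) \<partial>(PiM I (%i. mm)))"
	proof (rule symmetrization_bound[OF mm I _ _ m bdd mean])
		fix x
		have "(SUM S:Pow I. Max ((%t. abs (SUM i:I. rsign S i * (a i * zt (x i)))) ` {()})) <= 2 ^ card I * (ln (2 * 1) / tt + tt * s2 / 2)"
		proof (rule sum_signs_max[OF I _ _ th])
			have "(SUM i:I. (a i * zt (x i))^2) <= (SUM i:I. (a i)^2)"
				unfolding power_mult_distrib using bdd by (intro sum_mono mult_left_le) (auto simp: abs_square_le_1)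
			thus "(SUM i:I. (a i * zt (x i))^2) <= s2" using s2 by linarith
		qed auto
		also have "... <= 2 ^ card I * (1 / tt + tt * s2 / 2)"
			using th ln_2_less_1 by (intro mult_left_mono add_right_mono divide_right_mono) auto
		finally show "(SUM S:Pow I. Max ((%t. abs (SUM i:I. rsign S i * (a i * zt (x i)))) ` {()})) <= 2 ^ card I * (1 / tt + tt * s2 / 2)" .
	qed auto
	moreover have "prob_space (PiM I (%i. mm))" by (intro prob_space_PiM mm)
	ultimately show ?thesis by (simp add: prob_space.emeasure_space_1)
qed

section \<open>Box indicators under a law with slab masses bounded by slab widths, and their
  entropy\<close>

locale box_class =
	fixes mm :: "'x measure" and A :: "'x set" and U :: "'x => 'p::finite => real"
	assumes prob_mu: "prob_space mm" and space_mu [simp]: "space mm = UNIV"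
		and A_meas: "A : sets mm" and U_meas: "!!k. (%x. U x k) : bm mm"
		and slab: "!!k s t. 0 <= s ==> s <= t ==> measure mm {x : A. s < U x k & U x k <= t} <= t - s"
begin

sublocale mu: prob_space mm by (rule prob_mu)

definition bi :: "real^'p => 'x => real" where
	"bi u x = (if x : A & (ALL k. U x k <= u $ k) then 1 else 0)"

definition ci :: "'p => real => 'x => real" where
	"ci k t x = (if x : A & U x k <= t then 1 else 0)"

definition Dm :: "real^'p => real" where
	"Dm u = (\<integral>x. bi u x \<partial>mm)"

lemma bi_measurable [measurable]: "bi u : bm mm"
proof -
	have [measurable]: "A : sets mm" "!!k. (%x. U x k) : bm mm" by (rule A_meas U_meas)+
	show ?thesis unfolding bi_def by measurable
qed

lemma bi_range: "0 <= bi u x" "bi u x <= 1" by (auto simp: bi_def)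

lemma bi_integrable: "integrable mm (bi u)"
	by (rule mu.integrable_bounded[where K=1]) (auto simp: bi_def)

lemma Dm_range: "0 <= Dm u" "Dm u <= 1"
	unfolding Dm_def using bi_range bi_integrable
	by (auto intro!: integral_nonneg_AE mu.integral_le_const)

lemma ci_mono: "s <= t ==> ci k s x <= ci k t x" by (auto simp: ci_def)

lemma ci_diff: "abs (ci k s x - ci k t x) = (if x : A & min s t < U x k & U x k <= max s t then 1 else 0)"
	by (auto simp: ci_def)

text \<open>If the boxes disagree at \<open>x\<close>, the left side is 1 and at least one
  coordinate indicator disagrees as well. This reduces boxes to half-lines, coordinate by
  coordinate.\<close>

lemma bi_diff: "abs (bi u x - bi v x) <= (SUM k:UNIV. abs (ci k (u $ k) x - ci k (v $ k) x))"
proof (cases "ALL k. ci k (u $ k) x = ci k (v $ k) x")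
	case True
	have "(U x k <= u $ k) = (U x k <= v $ k)" if "x : A" for k
		using True[rule_format, of k] that by (auto simp: ci_def split: if_splits)
	hence "bi u x = bi v x" by (auto simp: bi_def)
	thus ?thesis by (simp add: sum_nonneg)
next
	case False
	then obtain k where k: "ci k (u $ k) x ~= ci k (v $ k) x" by auto
	have "abs (bi u x - bi v x) <= 1" by (auto simp: bi_def)
	also have "1 <= abs (ci k (u $ k) x - ci k (v $ k) x)" using k by (auto simp: ci_def split: if_splits)
	also have "... <= (SUM k:UNIV. abs (ci k (u $ k) x - ci k (v $ k) x))"
		by (rule member_le_sum[where f="%k. abs (ci k (u $ k) x - ci k (v $ k) x)"]) auto
	finally show ?thesis .
qed

lemma bi_diff_sq: "(bi u x - bi v x)^2 = abs (bi u x - bi v x)" by (auto simp: bi_def)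

text \<open>A difference of boxes is controlled by the functions \<open>G k\<close>, the
  squared-weight masses of \<open>U_k <= t\<close> inside \<open>A\<close>. Each is monotone in
  \<open>t\<close> with total mass at most 2, so cutting its range into pieces of length
  \<open>2^-l\<close> leaves at most \<open>2 * 2^l + 1\<close> cells per coordinate, whatever the
  sample. The indices are pairs because increments are to be bounded.\<close>

lemma box_chaining:
	fixes a :: "nat => real" and x :: "nat => 'x" and T :: "((real^'p) \<times> (real^'p)) set"
	assumes I: "finite I" and T: "finite T" "T ~= {}" and a2: "(SUM i:I. (a i)^2) <= 2"
		and De: "!!u v. (u, v) : T ==> (SUM i:I. (a i)^2 * abs (bi u (x i) - bi v (x i))) <= De" and th: "tt > 0"
	shows "(SUM S:Pow I. Max ((%t. abs (SUM i:I. rsign S i * (a i * (bi (fst t) (x i) - bi (snd t) (x i))))) ` T)) <=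
		2 ^ card I * ((1 + 2 * real CARD('p) * (real l0 + 2)) / tt + tt * De / 2
			+ (1 + 8 * real CARD('p)) * (5 / (4 * sqrt 2)) ^ l0 / (1 - 5 / (4 * sqrt 2)))"
proof -
	define d where "d = real CARD('p)"
	have d0: "d >= 0" by (simp add: d_def)
	define q where "q i = (a i)^2" for i
	have q0: "q i >= 0" for i by (simp add: q_def)
	define G where "G k t = (SUM i:I. q i * ci k t (x i))" for k t
	have G0: "0 <= G k t" for k t unfolding G_def by (intro sum_nonneg mult_nonneg_nonneg q0) (simp add: ci_def)
	have G2: "G k t <= 2" for k t
	proof -
		have "G k t <= (SUM i:I. q i)" unfolding G_def by (intro sum_mono mult_left_le q0) (simp add: ci_def)
		thus ?thesis using a2 by (simp add: q_def)
	qed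
	have Gdiff: "(SUM i:I. q i * abs (ci k s (x i) - ci k t (x i))) = abs (G k s - G k t)" for k s t
	proof -
		have *: "(SUM i:I. q i * abs (ci k s (x i) - ci k t (x i))) = G k t - G k s" if "s <= t" for s t
		proof -
			have "(SUM i:I. q i * abs (ci k s (x i) - ci k t (x i))) = (SUM i:I. q i * (ci k t (x i) - ci k s (x i)))"
				by (intro sum.cong refl) (simp add: abs_of_nonpos ci_mono[OF that])
			thus ?thesis by (simp add: G_def right_diff_distrib sum_subtractf)
		qed
		have mono: "G k s <= G k t" if "s <= t" for s t unfolding G_def using ci_mono[OF that] q0 by (intro sum_mono mult_left_mono) auto
		show ?thesis
		proof (cases "s <= t")
			case True
			thus ?thesis using *[OF True] mono[OF True] by simp
		next
			case False
			hence "t <= s" by simp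
			thus ?thesis using *[of t s] mono[of t s] by (simp add: abs_minus_commute)
		qed
	qed
	define cl where "cl l (u :: real^'p) = (%k. \<lfloor>2 ^ l * G k (u $ k)\<rfloor>)" for l u
	define c where "c l t = (cl l (fst t), cl l (snd t))" for l t
	define b where "b t i = a i * (bi (fst t) (x i) - bi (snd t) (x i))" for t i
	define N where "N l = (2 * 2 ^ l + 1 :: real) ^ (2 * CARD('p))" for l :: nat
	\<comment> \<open>Integer halving: the cells of level \<open>l\<close> are unions of cells of level
	  \<open>Suc l\<close>.\<close>
	have cl_refine: "cl l u = cl l u'" if "cl (Suc l) u = cl (Suc l) u'" for l u u'
	proof -
		have "\<lfloor>2 ^ l * y\<rfloor> = \<lfloor>2 ^ Suc l * y\<rfloor> div 2" for y :: real
			using floor_divide_real_eq_div[of 2 "2 ^ Suc l * y"] by simp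
		thus ?thesis using that unfolding cl_def by (simp add: fun_eq_iff)
	qed
	have cl_close: "(SUM i:I. q i * abs (bi u (x i) - bi u' (x i))) <= d / 2 ^ l" if "cl l u = cl l u'" for l u u'
	proof -
		have "(SUM i:I. q i * abs (bi u (x i) - bi u' (x i))) <= (SUM i:I. q i * (SUM k:UNIV. abs (ci k (u $ k) (x i) - ci k (u' $ k) (x i))))"
			by (intro sum_mono mult_left_mono bi_diff q0)
		also have "... = (SUM k:UNIV. SUM i:I. q i * abs (ci k (u $ k) (x i) - ci k (u' $ k) (x i)))"
			by (subst sum.swap) (simp add: sum_distrib_left)
		also have "... <= (SUM k:(UNIV::'p set). 1 / 2 ^ l)"
		proof (rule sum_mono)
			fix k
			have "\<lfloor>2 ^ l * G k (u $ k)\<rfloor> = \<lfloor>2 ^ l * G k (u' $ k)\<rfloor>" using that unfolding cl_def by metis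
			hence "abs (2 ^ l * G k (u $ k) - 2 ^ l * G k (u' $ k)) <= 1" by linarith
			hence "2 ^ l * abs (G k (u $ k) - G k (u' $ k)) <= 1" by (simp add: abs_mult flip: right_diff_distrib)
			thus "(SUM i:I. q i * abs (ci k (u $ k) (x i) - ci k (u' $ k) (x i))) <= 1 / 2 ^ l"
				unfolding Gdiff by (simp add: field_simps)
		qed
		finally show ?thesis by (simp add: d_def)
	qed
	have card_c: "real (card (c l ` T)) <= N l" for l
	proof -
		let ?B = "\<Pi>\<^sub>E k\<in>(UNIV::'p set). {0..2 * 2 ^ l :: int}"
		have "cl l u : ?B" for u
		proof -
			have "0 <= \<lfloor>2 ^ l * G k (u $ k)\<rfloor>" for k using G0 by simp
			moreover have "\<lfloor>2 ^ l * G k (u $ k)\<rfloor> <= 2 * 2 ^ l" for k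
			proof -
				have "2 ^ l * G k (u $ k) <= of_int (2 * 2 ^ l)" using G2[of k "u $ k"] by simp
				thus ?thesis by (metis floor_mono floor_of_int)
			qed
			ultimately show ?thesis by (auto simp: cl_def PiE_def Pi_def)
		qed
		hence "c l ` T \<subseteq> ?B \<times> ?B" by (auto simp: c_def)
		hence "card (c l ` T) <= card (?B \<times> ?B)" by (intro card_mono finite_cartesian_product finite_PiE) auto
		also have "... = nat (2 * 2 ^ l + 1) ^ (2 * CARD('p))"
		proof -
			have "card ?B = nat (2 * 2 ^ l + 1) ^ CARD('p)" by (simp add: card_PiE)
			thus ?thesis unfolding card_cartesian_product by (simp only: mult_2[of "CARD('p)"] power_add)
		qed
		finally have "real (card (c l ` T)) <= real (nat (2 * 2 ^ l + 1) ^ (2 * CARD('p)))" by (simp only: of_nat_le_iff)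
		also have "... = N l" unfolding N_def by (simp add: nat_add_distrib nat_mult_distrib nat_power_eq add.commute)
		finally show ?thesis .
	qed
	have lnN: "ln (2 * N l) <= 1 + 2 * d * (real l + 2)" for l
	proof -
		have "1 <= (2::real) ^ l" by simp
		moreover have "(2::real) ^ (l + 2) = 4 * 2 ^ l" unfolding power_add by simp
		ultimately have "2 * 2 ^ l + 1 <= (2 ^ (l + 2) :: real)" by linarith
		hence "N l <= (2 ^ (l + 2)) ^ (2 * CARD('p))" unfolding N_def by (intro power_mono) auto
		moreover have "(2::real) ^ (1 + (l + 2) * (2 * CARD('p))) = 2 * (2 ^ (l + 2)) ^ (2 * CARD('p))"
			by (simp only: power_add[of _ 1] power_mult power_one_right)
		ultimately have "2 * N l <= 2 ^ (1 + (l + 2) * (2 * CARD('p)))" by simp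
		moreover have N0: "0 < 2 * N l" by (simp add: N_def add_pos_nonneg)
		ultimately have "ln (2 * N l) <= ln (2 ^ (1 + (l + 2) * (2 * CARD('p))))" by simp
		also have "... = real (1 + (l + 2) * (2 * CARD('p))) * ln 2" by (simp only: ln_realpow)
		also have "... <= real (1 + (l + 2) * (2 * CARD('p)))" using ln_2_less_1 by (intro mult_left_le) auto
		also have "... = 1 + 2 * d * (real l + 2)" by (simp add: d_def algebra_simps)
		finally show ?thesis .
	qed
	\<comment> \<open>With \<open>tt l = sqrt 2 ^ l\<close> the term of level \<open>l\<close> is of
	  order \<open>l / sqrt 2 ^ l\<close>. Bernoulli's inequality bounds the linear factor by a
	  multiple of \<open>(5 / 4) ^ l\<close>, and \<open>5 / 4 < sqrt 2\<close> makes the ratio less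
	  than 1.\<close>
	define rh :: real where "rh = 5 / (4 * sqrt 2)"
	have rh: "0 < rh" "rh < 1"
	proof -
		have "(5 / 4 :: real) < sqrt 2" by (rule real_less_rsqrt) (simp add: power2_eq_square)
		thus "rh < 1" by (simp add: rh_def)
	qed (simp add: rh_def)
	have trm: "ln (2 * N (Suc l)) / sqrt 2 ^ l + sqrt 2 ^ l * (4 * d / 2 ^ l) / 2 <= (1 + 8 * d) * rh ^ l" for l
	proof -
		have s: "sqrt 2 ^ l * sqrt 2 ^ l = (2::real) ^ l" by (simp flip: power_mult_distrib)
		have "sqrt 2 ^ l * (4 * d / 2 ^ l) / 2 = 2 * d / sqrt 2 ^ l"
			unfolding s[symmetric] by (simp add: field_simps)
		hence "ln (2 * N (Suc l)) / sqrt 2 ^ l + sqrt 2 ^ l * (4 * d / 2 ^ l) / 2 = (ln (2 * N (Suc l)) + 2 * d) / sqrt 2 ^ l"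
			by (simp add: add_divide_distrib)
		also have "... <= ((1 + 8 * d) * (5 / 4) ^ l) / sqrt 2 ^ l"
		proof (rule divide_right_mono)
			have "1 + real l * (1 / 4) <= (1 + 1 / 4) ^ l" by (rule Bernoulli_inequality) simp
			hence l: "real l + 4 <= 4 * (5 / 4) ^ l" by simp
			have "ln (2 * N (Suc l)) + 2 * d <= 1 + 2 * d * (real l + 4)" using lnN[of "Suc l"] by (simp add: algebra_simps)
			also have "... <= (5 / 4) ^ l + 2 * d * (4 * (5 / 4) ^ l)"
				using l d0 by (intro add_mono mult_left_mono) auto
			finally show "ln (2 * N (Suc l)) + 2 * d <= (1 + 8 * d) * (5 / 4) ^ l" by (simp add: algebra_simps)
		qed simp
		also have "... = (1 + 8 * d) * rh ^ l" by (simp add: rh_def power_divide power_mult_distrib)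
		finally show ?thesis .
	qed
	have bound: "(SUM S:Pow I. Max ((%t. abs (SUM i:I. rsign S i * b t i)) ` T)) <=
		2 ^ card I * ((1 + 2 * d * (real l0 + 2)) / tt + tt * De / 2 + (1 + 8 * d) * rh ^ l0 / (1 - rh) + sqrt (real (card I) * (4 * d / 2 ^ (l0 + L))))" for L
	proof -
		have "(SUM S:Pow I. Max ((%t. abs (SUM i:I. rsign S i * b t i)) ` T)) <=
			2 ^ card I * ((ln (2 * N l0) / tt + tt * De / 2)
			+ (SUM l:{l0..<l0 + L}. ln (2 * N (Suc l)) / sqrt 2 ^ l + sqrt 2 ^ l * (4 * d / 2 ^ l) / 2) + sqrt (real (card I) * (4 * d / 2 ^ (l0 + L))))"
		proof (rule chaining_signs[where c=c and ta="%l. 4 * d / 2 ^ l"])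
			fix l t t' assume t: "c (Suc l) t = c (Suc l) t'"
			thus "c l t = c l t'" using cl_refine[of l "fst t" "fst t'"] cl_refine[of l "snd t" "snd t'"] by (simp add: c_def)
		next
			fix l t t' assume "c l t = c l t'"
			hence cc: "cl l (fst t) = cl l (fst t')" "cl l (snd t) = cl l (snd t')" by (auto simp: c_def)
			have sq: "(f - g)^2 <= 2 * f^2 + 2 * g^2" for f g :: real
				using zero_le_power2[of "f + g"] unfolding power2_diff power2_sum by linarith
			have "(SUM i:I. (b t i - b t' i)^2) <= (SUM i:I. 2 * (q i * abs (bi (fst t) (x i) - bi (fst t') (x i))) + 2 * (q i * abs (bi (snd t) (x i) - bi (snd t') (x i))))"
			proof (rule sum_mono)
				fix i
				let ?f = "bi (fst t) (x i) - bi (fst t') (x i)" and ?g = "bi (snd t) (x i) - bi (snd t') (x i)"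
				have "b t i - b t' i = a i * (?f - ?g)" by (simp add: b_def algebra_simps)
				hence "(b t i - b t' i)^2 = q i * (?f - ?g)^2" by (simp add: q_def power_mult_distrib)
				also have "... <= q i * (2 * ?f^2 + 2 * ?g^2)"
				proof (rule mult_left_mono[OF _ q0])
					show "(?f - ?g)^2 <= 2 * ?f^2 + 2 * ?g^2"
						by (rule sq)
				qed
				also have "... = 2 * (q i * abs (?f)) + 2 * (q i * abs (?g))"
					unfolding bi_diff_sq by (simp add: distrib_left)
				finally show "(b t i - b t' i)^2 <= 2 * (q i * abs (?f)) + 2 * (q i * abs (?g))" .
			qed
			also have "... = 2 * (SUM i:I. q i * abs (bi (fst t) (x i) - bi (fst t') (x i))) + 2 * (SUM i:I. q i * abs (bi (snd t) (x i) - bi (snd t') (x i)))"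
				by (simp add: sum.distrib sum_distrib_left)
			also have "... <= 2 * (d / 2 ^ l) + 2 * (d / 2 ^ l)"
				using cl_close[OF cc(1)] cl_close[OF cc(2)] by linarith
			finally show "(SUM i:I. (b t i - b t' i)^2) <= 4 * d / 2 ^ l" by simp
		next
			fix t assume t: "t : T"
			have "(SUM i:I. (b t i)^2) = (SUM i:I. (a i)^2 * abs (bi (fst t) (x i) - bi (snd t) (x i)))"
				by (simp add: b_def power_mult_distrib bi_diff_sq)
			thus "(SUM i:I. (b t i)^2) <= De" using De[of "fst t" "snd t"] t by simp
		qed (use I T th card_c in auto)
		also have "... <= 2 ^ card I * (((1 + 2 * d * (real l0 + 2)) / tt + tt * De / 2)
			+ (1 + 8 * d) * rh ^ l0 / (1 - rh) + sqrt (real (card I) * (4 * d / 2 ^ (l0 + L))))"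
		proof (intro mult_left_mono add_mono order_refl divide_right_mono lnN)
			have "(SUM l:{l0..<l0 + L}. ln (2 * N (Suc l)) / sqrt 2 ^ l + sqrt 2 ^ l * (4 * d / 2 ^ l) / 2) <= (SUM l:{l0..<l0 + L}. (1 + 8 * d) * rh ^ l)"
				by (intro sum_mono trm)
			also have "... = (SUM l<L. (1 + 8 * d) * rh ^ (l + l0))"
				using sum.shift_bounds_nat_ivl[of "%l. (1 + 8 * d) * rh ^ l" 0 l0 L] by (simp add: atLeast0LessThan add.commute)
			also have "... = (1 + 8 * d) * rh ^ l0 * (SUM l<L. rh ^ l)"
				by (simp add: power_add sum_distrib_left sum_distrib_right mult_ac)
			also have "(SUM l<L. rh ^ l) = (1 - rh ^ L) / (1 - rh)"
				using rh by (simp add: sum_gp_strict)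
			also have "(1 + 8 * d) * rh ^ l0 * ((1 - rh ^ L) / (1 - rh)) <= (1 + 8 * d) * rh ^ l0 * (1 / (1 - rh))"
				using rh d0 by (intro mult_left_mono divide_right_mono) auto
			finally show "(SUM l:{l0..<l0 + L}. ln (2 * N (Suc l)) / sqrt 2 ^ l + sqrt 2 ^ l * (4 * d / 2 ^ l) / 2) <= (1 + 8 * d) * rh ^ l0 / (1 - rh)" by simp
		qed (use th in auto)
		finally show ?thesis .
	qed
	\<comment> \<open>\<open>L\<close> is arbitrary while \<open>I\<close> is fixed and finite, so the
	  residual, which contains \<open>card I\<close>, disappears in the limit.\<close>
	have lim: "(%L. 2 ^ card I * ((1 + 2 * d * (real l0 + 2)) / tt + tt * De / 2 + (1 + 8 * d) * rh ^ l0 / (1 - rh) + sqrt (real (card I) * (4 * d / 2 ^ (l0 + L)))))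
		 \<longlonglongrightarrow> 2 ^ card I * ((1 + 2 * d * (real l0 + 2)) / tt + tt * De / 2 + (1 + 8 * d) * rh ^ l0 / (1 - rh) + sqrt 0)"
	proof (intro tendsto_intros)
		have "(%L. (1 / 2 :: real) ^ L) \<longlonglongrightarrow> 0" by (rule LIMSEQ_realpow_zero) auto
		hence "(%L. real (card I) * 4 * d / 2 ^ l0 * (1 / 2 :: real) ^ L) \<longlonglongrightarrow> real (card I) * 4 * d / 2 ^ l0 * 0" by (rule tendsto_mult_left)
		thus "(%L. real (card I) * (4 * d / 2 ^ (l0 + L))) \<longlonglongrightarrow> 0" by (simp add: power_add power_divide mult.assoc)
	qed
	have "(SUM S:Pow I. Max ((%t. abs (SUM i:I. rsign S i * b t i)) ` T)) <= 2 ^ card I * ((1 + 2 * d * (real l0 + 2)) / tt + tt * De / 2 + (1 + 8 * d) * rh ^ l0 / (1 - rh) + sqrt 0)"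
		by (rule LIMSEQ_le_const[OF lim]) (use bound in blast)
	thus ?thesis by (simp add: b_def d_def rh_def)
qed

end

section \<open>Equicontinuity of weighted box sums, uniformly in small weights\<close>

context box_class
begin

lemma mu_UNIV [simp]: "measure mm UNIV = 1" using mu.prob_space by simp

definition slab_ind :: "'p => real => real => 'x => real" where
	"slab_ind k s t x = (if x : A & s < U x k & U x k <= t then 1 else 0)"

lemma slab_ind_measurable [measurable]: "slab_ind k s t : bm mm"
proof -
	have [measurable]: "A : sets mm" "!!k. (%x. U x k) : bm mm" by (rule A_meas U_meas)+
	show ?thesis unfolding slab_ind_def by measurable
qed

lemma slab_ind_range: "0 <= slab_ind k s t x" "slab_ind k s t x <= 1" by (auto simp: slab_ind_def)

lemma slab_ind_integrable: "integrable mm (slab_ind k s t)"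
	by (rule mu.integrable_bounded[where K=1]) (auto simp: slab_ind_def)

lemma slab_ind_integral:
	assumes "0 <= s" "s <= t"
	shows "0 <= (\<integral>x. slab_ind k s t x \<partial>mm)" "(\<integral>x. slab_ind k s t x \<partial>mm) <= t - s"
proof -
	have [measurable]: "A : sets mm" "!!k. (%x. U x k) : bm mm" by (rule A_meas U_meas)+
	have "{x : space mm. x : A & s < U x k & U x k <= t} : sets mm" by measurable
	hence S: "{x : A. s < U x k & U x k <= t} : sets mm" by simp
	have "(\<integral>x. slab_ind k s t x \<partial>mm) = (\<integral>x. indicator {x : A. s < U x k & U x k <= t} x \<partial>mm)"
		by (rule Bochner_Integration.integral_cong) (auto simp: slab_ind_def)
	also have "... = measure mm {x : A. s < U x k & U x k <= t}" using S by simp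
	finally have e: "(\<integral>x. slab_ind k s t x \<partial>mm) = measure mm {x : A. s < U x k & U x k <= t}" .
	show "0 <= (\<integral>x. slab_ind k s t x \<partial>mm)" "(\<integral>x. slab_ind k s t x \<partial>mm) <= t - s"
		unfolding e using slab[OF assms] by auto
qed

lemma Dm_diff:
	assumes "u : cube" "v : cube"
	shows "abs (Dm u - Dm v) <= (SUM k:UNIV. abs (u $ k - v $ k))"
proof -
	have ci: "abs (ci k s x - ci k t x) = slab_ind k (min s t) (max s t) x" for k s t x
		unfolding ci_diff slab_ind_def by simp
	have "abs (Dm u - Dm v) = abs (\<integral>x. bi u x - bi v x \<partial>mm)" unfolding Dm_def using bi_integrable by simp
	also have "... <= (\<integral>x. abs (bi u x - bi v x) \<partial>mm)" by (rule integral_abs_bound)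
	also have "... <= (\<integral>x. (SUM k:UNIV. slab_ind k (min (u $ k) (v $ k)) (max (u $ k) (v $ k)) x) \<partial>mm)"
		using bi_integrable slab_ind_integrable bi_diff by (intro integral_mono) (auto simp: ci)
	also have "... = (SUM k:UNIV. \<integral>x. slab_ind k (min (u $ k) (v $ k)) (max (u $ k) (v $ k)) x \<partial>mm)"
		using slab_ind_integrable by simp
	also have "... <= (SUM k:UNIV. abs (u $ k - v $ k))"
	proof (rule sum_mono)
		fix k
		have "(\<integral>x. slab_ind k (min (u $ k) (v $ k)) (max (u $ k) (v $ k)) x \<partial>mm) <= max (u $ k) (v $ k) - min (u $ k) (v $ k)"
			using assms by (intro slab_ind_integral) (auto simp: cube_def)
		thus "(\<integral>x. slab_ind k (min (u $ k) (v $ k)) (max (u $ k) (v $ k)) x \<partial>mm) <= abs (u $ k - v $ k)" by linarith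
	qed
	finally show ?thesis .
qed

text \<open>The weights are squares bounded by \<open>kp^2\<close>, so their own squares sum to at
  most \<open>2 * kp^2\<close>; the choice \<open>tt = 1 / kp\<close> balances the two terms of
  \<open>weighted_sum_L1_bound\<close>.\<close>

lemma slab_deviation:
	fixes I :: "nat set" and q :: "nat => real"
	assumes I: "finite I" and q: "!!i. i : I ==> 0 <= q i & q i <= kp^2" "(SUM i:I. q i) <= 2" and kp: "kp > 0"
	shows "(\<integral>\<^sup>+x. ennreal (abs (SUM i:I. q i * (slab_ind k s t (x i) - (\<integral>y. slab_ind k s t y \<partial>mm)))) \<partial>(PiM I (%i. mm))) <= ennreal (4 * kp)"
proof -
	let ?p = "\<integral>y. slab_ind k s t y \<partial>mm"
	have p: "0 <= ?p" "?p <= 1"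
		by (auto intro!: integral_nonneg_AE mu.integral_le_const slab_ind_integrable simp: slab_ind_range)
	have "(\<integral>\<^sup>+x. ennreal (abs (SUM i:I. q i * (slab_ind k s t (x i) - ?p))) \<partial>(PiM I (%i. mm))) <= ennreal (2 * (1 / (1 / kp) + (1 / kp) * (2 * kp^2) / 2))"
	proof (rule weighted_sum_L1_bound[OF prob_mu I])
		show "abs (slab_ind k s t y - ?p) <= 1" for y using p slab_ind_range[of k s t y] by (simp add: abs_le_iff)
		show "(\<integral>y. slab_ind k s t y - ?p \<partial>mm) = 0" using slab_ind_integrable by (simp add: mu.prob_space)
		have "(SUM i:I. (q i)^2) <= (SUM i:I. kp^2 * q i)"
			unfolding power2_eq_square[of "q _"] using q by (intro sum_mono mult_right_mono) auto
		also have "... <= kp^2 * 2" using q(2) by (simp add: mult_left_mono flip: sum_distrib_left)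
		finally show "(SUM i:I. (q i)^2) <= 2 * kp^2" by simp
	qed (use kp in auto)
	also have "2 * (1 / (1 / kp) + (1 / kp) * (2 * kp^2) / 2) = 4 * kp" using kp by (simp add: power2_eq_square)
	finally show ?thesis .
qed

text \<open>The chaining bound depends on the sample only through the starting diameter
  \<open>De\<close>, a sum of slab masses whose means are of order \<open>1 / h\<close> and whose
  fluctuations are of order \<open>kp\<close>. The choices are made in the order \<open>l0\<close>
  (tail of the chain), \<open>tt\<close> (entropy at its start), \<open>h\<close> (means),
  \<open>kp\<close> (fluctuations), each depending on earlier ones.\<close>

theorem box_equicontinuity:
	assumes ep: "ep > 0"
	obtains h :: nat and kp :: real where "h > 0" "kp > 0"
		"!!(I::nat set) a T. finite I ==> (SUM i:I. (a i)^2) <= 2 ==> (!!i. i : I ==> abs (a i) <= kp) ==> finite T ==> T ~= {} ==>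
			 (!!u v. (u, v) : T ==> u : cube & v : cube & (ALL k. abs (u $ k - v $ k) <= 1 / real h)) ==>
			 (\<integral>\<^sup>+x. ennreal (Max ((%t. abs (SUM i:I. a i * ((bi (fst t) (x i) - Dm (fst t)) - (bi (snd t) (x i) - Dm (snd t))))) ` T)) \<partial>(PiM I (%i. mm))) <= ennreal ep"
proof -
	define d where "d = real CARD('p)"
	have d0: "d > 0" by (simp add: d_def)
	define rh :: real where "rh = 5 / (4 * sqrt 2)"
	have rh: "0 < rh" "rh < 1"
	proof -
		have "(5 / 4 :: real) < sqrt 2" by (rule real_less_rsqrt) (simp add: power2_eq_square)
		thus "rh < 1" by (simp add: rh_def)
	qed (simp add: rh_def)
	have "(%l. (1 + 8 * d) * rh ^ l / (1 - rh)) \<longlonglongrightarrow> (1 + 8 * d) * 0 / (1 - rh)"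
		using rh by (intro tendsto_intros LIMSEQ_realpow_zero) auto
	hence "eventually (%l. (1 + 8 * d) * rh ^ l / (1 - rh) < ep / 8) sequentially"
		using ep by (intro order_tendstoD) auto
	then obtain l0 where l0: "(1 + 8 * d) * rh ^ l0 / (1 - rh) < ep / 8" by (auto simp: eventually_sequentially)
	define cl where "cl = 1 + 2 * d * (real l0 + 2)"
	have cl: "cl > 0" using d0 by (simp add: cl_def add_pos_nonneg)
	define tt where "tt = 8 * cl / ep"
	have th: "tt > 0" using cl ep by (simp add: tt_def)
	obtain h :: nat where h: "real h > max (32 * tt * d / ep) (32 * d / ep)" using reals_Archimedean2 by blast
	have h0: "h > 0"
	proof (rule ccontr)
		assume "~ h > 0"
		hence "32 * d / ep < 0" using h by simp
		thus False using d0 ep by (simp add: divide_less_0_iff)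
	qed
	have h1: "4 * tt * d / real h <= ep / 8" and h2: "4 * d / real h <= ep / 8"
		using h h0 ep by (simp_all add: field_simps)
	define kp where "kp = ep / (32 * tt * d * (real h + 1))"
	have kp: "kp > 0" using ep th d0 by (simp add: kp_def)
	have kp1: "tt * d * (real h + 1) * (4 * kp) = ep / 8"
	proof -
		have *: "z * (4 * (ep / (32 * z))) = ep / 8" if "z ~= 0" for z :: real using that by simp
		have "tt * d * (real h + 1) ~= 0" using th d0 by simp
		from *[OF this] show ?thesis unfolding kp_def by (simp add: mult.assoc)
	qed
	\<comment> \<open>The slabs \<open>(j / h, (j + 2) / h]\<close> overlap on purpose: the interval
	  between two numbers at distance at most \<open>1 / h\<close>, the smaller one in
	  \<open>[j / h, (j + 1) / h)\<close>, fits into one slab.\<close>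
	define sj where "sj j = real j / real h" for j :: nat
	define tj where "tj j = (real j + 2) / real h" for j :: nat
	define p where "p k j = (\<integral>y. slab_ind k (sj j) (tj j) y \<partial>mm)" for k j
	have p: "0 <= p k j" "p k j <= 2 / real h" for k j
	proof -
		have "tj j - sj j = 2 / real h" unfolding tj_def sj_def by (simp add: diff_divide_distrib[symmetric])
		moreover have "0 <= sj j" "sj j <= tj j" unfolding sj_def tj_def by (auto simp: divide_right_mono)
		ultimately show "0 <= p k j" "p k j <= 2 / real h" unfolding p_def using slab_ind_integral by metis+
	qed
	show ?thesis
	proof (rule that[OF h0 kp])
		fix I :: "nat set" and a :: "nat => real" and T :: "((real^'p) \<times> (real^'p)) set"
		assume I: "finite I" and a2: "(SUM i:I. (a i)^2) <= 2" and akp: "!!i. i : I ==> abs (a i) <= kp"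
			and T: "finite T" "T ~= {}" and Tc: "!!u v. (u, v) : T ==> u : cube & v : cube & (ALL k. abs (u $ k - v $ k) <= 1 / real h)"
		define q where "q i = (a i)^2" for i
		have q: "0 <= q i & q i <= kp^2" if "i : I" for i
			unfolding q_def using akp[OF that] kp abs_le_square_iff[of "a i" kp] by simp
		define Y where "Y k j x = abs (SUM i:I. q i * (slab_ind k (sj j) (tj j) (x i) - p k j))" for k j and x :: "nat => 'x"
		define De where "De x = (SUM k:UNIV. 4 / real h + (SUM j<=h. Y k j x))" for x
		have Ym: "Y k j : bm (PiM I (%i. mm))" for k j
		proof -
			have comp: "(%x. slab_ind k s t (x i)) : bm (PiM I (%i. mm))" if "i : I" for i s t
				using measurable_compose[OF measurable_component_singleton[OF that, of "%_. mm"] slab_ind_measurable] .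
			show ?thesis unfolding Y_def
				by (intro borel_measurable_abs borel_measurable_sum borel_measurable_times borel_measurable_diff borel_measurable_const comp)
		qed
		have Y0: "0 <= Y k j x" for k j x by (simp add: Y_def)
		have De: "(SUM i:I. q i * abs (bi u (x i) - bi v (x i))) <= De x" if uv: "(u, v) : T" for u v x
		proof -
			have "(SUM i:I. q i * abs (bi u (x i) - bi v (x i))) <= (SUM i:I. q i * (SUM k:UNIV. abs (ci k (u $ k) (x i) - ci k (v $ k) (x i))))"
				using q by (intro sum_mono mult_left_mono bi_diff) auto
			also have "... = (SUM k:UNIV. SUM i:I. q i * abs (ci k (u $ k) (x i) - ci k (v $ k) (x i)))"
				by (subst sum.swap) (simp add: sum_distrib_left)
			also have "... <= De x" unfolding De_def
			proof (rule sum_mono)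
				fix k
				have uk: "0 <= u $ k" "u $ k <= 1" "0 <= v $ k" "v $ k <= 1" "abs (u $ k - v $ k) <= 1 / real h"
					using Tc[OF uv] by (auto simp: cube_def)
				define m where "m = min (u $ k) (v $ k)"
				define j where "j = nat \<lfloor>real h * m\<rfloor>"
				have m: "0 <= m" "m <= 1" using uk by (auto simp: m_def)
				have hm: "0 <= real h * m" "real h * m <= real h" using m h0 by auto
				have "\<lfloor>real h * m\<rfloor> <= int h" using hm(2) by (metis floor_mono floor_of_nat)
				hence jh: "j <= h" unfolding j_def by simp
				have jr: "real j = of_int \<lfloor>real h * m\<rfloor>" unfolding j_def using hm(1) by simp
				have r: "real j <= real h * m" "real h * m < real j + 1" unfolding jr by linarith+
				have sm1: "sj j <= m" unfolding sj_def using h0 r(1) by (simp add: pos_divide_le_eq mult.commute)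
				have "m <= (real j + 1) / real h" using h0 r(2) by (simp add: pos_le_divide_eq mult.commute)
				hence sm2: "m + 1 / real h <= tj j" unfolding tj_def by (simp add: add_divide_distrib)
				have cs: "abs (ci k (u $ k) y - ci k (v $ k) y) <= slab_ind k (sj j) (tj j) y" for y
					unfolding ci_diff slab_ind_def using sm1 sm2 uk unfolding m_def by (auto simp: min_def max_def abs_if split: if_splits)
				have "(SUM i:I. q i * abs (ci k (u $ k) (x i) - ci k (v $ k) (x i))) <= (SUM i:I. q i * slab_ind k (sj j) (tj j) (x i))"
					using q by (intro sum_mono mult_left_mono cs) auto
				also have "... = (SUM i:I. q i) * p k j + (SUM i:I. q i * (slab_ind k (sj j) (tj j) (x i) - p k j))"
					by (simp add: right_diff_distrib sum_subtractf sum_distrib_right)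
				also have "... <= 2 * (2 / real h) + Y k j x"
				proof (intro add_mono mult_mono p)
					show "(SUM i:I. q i) <= 2" using a2 by (simp add: q_def)
				qed (auto simp: Y_def)
				also have "Y k j x <= (SUM j<=h. Y k j x)" using jh Y0 by (intro member_le_sum) auto
				finally show "(SUM i:I. q i * abs (ci k (u $ k) (x i) - ci k (v $ k) (x i))) <= 4 / real h + (SUM j<=h. Y k j x)" by simp
			qed
			finally show ?thesis .
		qed
		define B where "B x = (cl / tt + tt * De x / 2 + (1 + 8 * d) * rh ^ l0 / (1 - rh)) + d / real h * 2" for x
		have Dem: "De : bm (PiM I (%i. mm))"
			unfolding De_def by (intro borel_measurable_sum borel_measurable_add borel_measurable_const Ym)
		let ?xx = "%t y. (bi (fst t) y - Dm (fst t)) - (bi (snd t) y - Dm (snd t))"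
		have "(\<integral>\<^sup>+x. ennreal (Max ((%t. abs (SUM i:I. a i * ?xx t (x i))) ` T)) \<partial>(PiM I (%i. mm))) <= (\<integral>\<^sup>+x. ennreal (2 * B x) \<partial>(PiM I (%i. mm)))"
		proof (rule symmetrization_bound[OF prob_mu I T])
			show "abs (?xx t y) <= 4" for t y
				using bi_range[of "fst t" y] bi_range[of "snd t" y] Dm_range[of "fst t"] Dm_range[of "snd t"] by (simp add: abs_le_iff)
			show "(\<integral>y. ?xx t y \<partial>mm) = 0" for t
				using bi_integrable by (simp add: mu.prob_space Dm_def)
			show "B : bm (PiM I (%i. mm))" unfolding B_def using Dem by simp
			fix x
			\<comment> \<open>The centring terms split off as \<open>D u - D v\<close> times the plain sign
			  sum of the weights; the Lipschitz property \<open>Dm_diff\<close> makes this contribution of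
			  order \<open>1 / h\<close>.\<close>
			have "(SUM S:Pow I. Max ((%t. abs (SUM i:I. rsign S i * (a i * ?xx t (x i)))) ` T)) <=
				 (SUM S:Pow I. Max ((%t. abs (SUM i:I. rsign S i * (a i * (bi (fst t) (x i) - bi (snd t) (x i))))) ` T) + d / real h * Max ((%_. abs (SUM i:I. rsign S i * a i)) ` {()}))"
			proof (rule sum_mono, rule Max_abs_le[OF T])
				fix S t assume t: "t : T"
				have e: "(SUM i:I. rsign S i * (a i * ?xx t (x i))) = (SUM i:I. rsign S i * (a i * (bi (fst t) (x i) - bi (snd t) (x i)))) - (Dm (fst t) - Dm (snd t)) * (SUM i:I. rsign S i * a i)"
					by (simp add: sum_distrib_left sum_subtractf[symmetric] algebra_simps)
				have "abs (Dm (fst t) - Dm (snd t)) <= (SUM k:UNIV. abs (fst t $ k - snd t $ k))"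
					using Tc[of "fst t" "snd t"] t by (intro Dm_diff) auto
				also have "... <= (SUM k:(UNIV::'p set). 1 / real h)"
					using Tc[of "fst t" "snd t"] t by (intro sum_mono) auto
				finally have D: "abs (Dm (fst t) - Dm (snd t)) <= d / real h" by (simp add: d_def)
				have "abs (SUM i:I. rsign S i * (a i * ?xx t (x i))) <= abs (SUM i:I. rsign S i * (a i * (bi (fst t) (x i) - bi (snd t) (x i)))) + abs (Dm (fst t) - Dm (snd t)) * abs (SUM i:I. rsign S i * a i)"
					unfolding e abs_mult[symmetric] by (rule abs_triangle_ineq4)
				also have "... <= Max ((%t. abs (SUM i:I. rsign S i * (a i * (bi (fst t) (x i) - bi (snd t) (x i))))) ` T) + d / real h * abs (SUM i:I. rsign S i * a i)"
					by (intro add_mono mult_right_mono D Max_abs_ge[OF T(1) t]) auto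
				finally show "abs (SUM i:I. rsign S i * (a i * ?xx t (x i))) <= Max ((%t. abs (SUM i:I. rsign S i * (a i * (bi (fst t) (x i) - bi (snd t) (x i))))) ` T) + d / real h * Max ((%_. abs (SUM i:I. rsign S i * a i)) ` {()})"
					by simp
			qed
			also have "... = (SUM S:Pow I. Max ((%t. abs (SUM i:I. rsign S i * (a i * (bi (fst t) (x i) - bi (snd t) (x i))))) ` T)) + d / real h * (SUM S:Pow I. Max ((%_. abs (SUM i:I. rsign S i * a i)) ` {()}))"
				by (simp add: sum.distrib sum_distrib_left)
			also have "... <= 2 ^ card I * (cl / tt + tt * De x / 2 + (1 + 8 * d) * rh ^ l0 / (1 - rh)) + d / real h * (2 ^ card I * (ln (2 * 1) / 1 + 1 * 2 / 2))"
			proof (intro add_mono mult_left_mono)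
				show "(SUM S:Pow I. Max ((%t. abs (SUM i:I. rsign S i * (a i * (bi (fst t) (x i) - bi (snd t) (x i))))) ` T)) <= 2 ^ card I * (cl / tt + tt * De x / 2 + (1 + 8 * d) * rh ^ l0 / (1 - rh))"
					unfolding cl_def d_def rh_def by (rule box_chaining[OF I T a2 _ th]) (use De in \<open>simp add: q_def\<close>)
				show "(SUM S:Pow I. Max ((%_. abs (SUM i:I. rsign S i * a i)) ` {()})) <= 2 ^ card I * (ln (2 * 1) / 1 + 1 * 2 / 2)"
					by (rule sum_signs_max[OF I]) (use a2 in auto)
			qed (use d0 in simp)
			also have "... <= 2 ^ card I * (cl / tt + tt * De x / 2 + (1 + 8 * d) * rh ^ l0 / (1 - rh)) + d / real h * (2 ^ card I * 2)"
				using d0 ln_2_less_1 by (intro add_left_mono mult_left_mono) auto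
			also have "... = 2 ^ card I * B x" unfolding B_def by (simp add: distrib_left mult_ac)
			finally show "(SUM S:Pow I. Max ((%t. abs (SUM i:I. rsign S i * (a i * ?xx t (x i)))) ` T)) <= 2 ^ card I * B x" .
		qed auto
		also have "... <= ennreal ep"
		proof -
			define c1 where "c1 = 2 * (cl / tt + (1 + 8 * d) * rh ^ l0 / (1 - rh) + d / real h * 2) + tt * d * (4 / real h)"
			have c10: "0 <= c1" unfolding c1_def using cl th d0 rh by (intro add_nonneg_nonneg mult_nonneg_nonneg divide_nonneg_nonneg) auto
			have B2: "2 * B x = c1 + (SUM k:UNIV. SUM j<=h. tt * Y k j x)" for x
				unfolding B_def De_def c1_def by (simp add: sum.distrib d_def distrib_left sum_distrib_left algebra_simps)
			interpret PP: prob_space "\<Pi>\<^sub>M i\<in>I. mm" by (intro prob_space_PiM prob_mu)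
			have "(\<integral>\<^sup>+x. ennreal (2 * B x) \<partial>(PiM I (%i. mm))) = (\<integral>\<^sup>+x. ennreal c1 + (SUM k:UNIV. SUM j<=h. ennreal tt * ennreal (Y k j x)) \<partial>(PiM I (%i. mm)))"
				unfolding B2 using c10 th Y0 by (simp add: ennreal_plus sum_nonneg ennreal_mult' flip: sum_ennreal)
			also have "... = ennreal c1 + (SUM k:UNIV. SUM j<=h. ennreal tt * (\<integral>\<^sup>+x. ennreal (Y k j x) \<partial>(PiM I (%i. mm))))"
				using Ym by (simp add: nn_integral_add nn_integral_sum nn_integral_cmult PP.emeasure_space_1)
			also have "... <= ennreal c1 + (SUM k:(UNIV::'p set). SUM j<=h. ennreal tt * ennreal (4 * kp))"
				unfolding Y_def p_def using a2 by (intro add_left_mono sum_mono mult_left_mono slab_deviation[OF I q _ kp]) (auto simp: q_def)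
			also have "(SUM k:(UNIV::'p set). SUM j<=h. ennreal tt * ennreal (4 * kp)) = ennreal (SUM k:(UNIV::'p set). SUM j<=h. tt * (4 * kp))"
			proof -
				have e1: "ennreal tt * ennreal (4 * kp) = ennreal (tt * (4 * kp))"
					using th kp by (intro ennreal_mult[symmetric]) auto
				have e2: "(SUM j<=h. ennreal (tt * (4 * kp))) = ennreal (SUM j<=h. tt * (4 * kp))"
					using th kp by (intro sum_ennreal) auto
				show ?thesis unfolding e1 e2 using th kp by (intro sum_ennreal sum_nonneg) auto
			qed
			also have "(SUM k:(UNIV::'p set). SUM j<=h. tt * (4 * kp)) = tt * d * (real h + 1) * (4 * kp)"
				by (simp add: d_def algebra_simps)
			also have "ennreal c1 + ennreal (tt * d * (real h + 1) * (4 * kp)) = ennreal (c1 + ep / 8)"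
				unfolding kp1 using c10 ep by (simp add: ennreal_plus)
			also have "... <= ennreal ep"
			proof (rule ennreal_leI)
				have "cl / tt = ep / 8" using cl ep by (simp add: tt_def)
				moreover have "c1 = 2 * (cl / tt) + 2 * ((1 + 8 * d) * rh ^ l0 / (1 - rh)) + 4 * d / real h + 4 * tt * d / real h"
					unfolding c1_def by (simp add: distrib_left)
				ultimately show "c1 + ep / 8 <= ep" using l0 h1 h2 ep by linarith
			qed
			finally show ?thesis .
		qed
		finally show "(\<integral>\<^sup>+x. ennreal (Max ((%t. abs (SUM i:I. a i * ?xx t (x i))) ` T)) \<partial>(PiM I (%i. mm))) <= ennreal ep" .
	qed
qed

end

section \<open>Gaussian processes with continuous paths\<close>

definition quad :: "nat => (nat => nat => real) => (nat => real) => real" where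
	"quad n K c = (SUM i<n. SUM j<n. c i * c j * K i j)"

definition psd :: "(nat => nat => real) => bool" where
	"psd K \<longleftrightarrow> (ALL i j. K i j = K j i) & (ALL n c. 0 <= quad n K c)"

text \<open>Along one coordinate the form is a quadratic polynomial in \<open>t\<close>; the facts
  about \<open>K\<close> below come from evaluating it at suitable \<open>t\<close>.\<close>

lemma quad_shift:
	assumes sym: "!!i j. K i j = K j i" and m: "m < n"
	shows "quad n K (%i. c i + (if i = m then t else 0)) = quad n K c + 2 * t * (SUM i<n. c i * K i m) + t^2 * K m m"
proof -
	let ?d = "%i. if i = m then t else 0 :: real"
	have "quad n K (%i. c i + ?d i) = (SUM i<n. SUM j<n. c i * c j * K i j + c i * K i j * ?d j + ?d i * (c j * K i j) + ?d i * (K i j * ?d j))"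
		unfolding quad_def by (intro sum.cong refl) (simp add: algebra_simps)
	also have "... = quad n K c + (SUM i<n. SUM j<n. c i * K i j * ?d j) + (SUM i<n. SUM j<n. ?d i * (c j * K i j)) + (SUM i<n. SUM j<n. ?d i * (K i j * ?d j))"
		unfolding quad_def by (simp only: sum.distrib)
	also have "(SUM i<n. SUM j<n. c i * K i j * ?d j) = t * (SUM i<n. c i * K i m)"
		using m by (simp add: if_distrib sum.delta' sum_distrib_left mult_ac cong: if_cong)
	also have "(SUM i<n. SUM j<n. ?d i * (c j * K i j)) = t * (SUM i<n. c i * K i m)"
	proof -
		have "(SUM i<n. SUM j<n. ?d i * (c j * K i j)) = (SUM i<n. if i = m then t * (SUM j<n. c j * K m j) else 0)"
			by (intro sum.cong refl) (auto simp: sum_distrib_left)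
		also have "... = t * (SUM j<n. c j * K m j)" using m by simp
		finally show ?thesis using sym by simp
	qed
	also have "(SUM i<n. SUM j<n. ?d i * (K i j * ?d j)) = t^2 * K m m"
	proof -
		have hd: "(SUM j<n. f j * ?d j) = f m * t" for f :: "nat => real"
		proof -
			have "(SUM j<n. f j * ?d j) = (SUM j<n. if j = m then f j * t else 0)" by (intro sum.cong) auto
			thus ?thesis using m by simp
		qed
		have "(SUM i<n. SUM j<n. ?d i * (K i j * ?d j)) = (SUM i<n. (SUM j<n. K i j * ?d j) * ?d i)"
			by (simp only: sum_distrib_left sum_distrib_right mult.commute mult.left_commute)
		thus ?thesis unfolding hd by (simp add: power2_eq_square)
	qed
	finally show ?thesis by simp
qed

lemma psd_diag: assumes "psd K" shows "0 <= K m m"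
proof -
	have "0 <= quad (Suc m) K (%i. 0 + (if i = m then 1 else 0))" using assms unfolding psd_def by blast
	thus ?thesis using assms by (subst (asm) quad_shift) (auto simp: psd_def quad_def)
qed

text \<open>With zero variance at \<open>m\<close> the polynomial of \<open>quad_shift\<close> is
  affine in \<open>t\<close>; being nonnegative for all \<open>t\<close>, it has slope zero.\<close>

lemma psd_zero: assumes K: "psd K" and z: "K m m = 0" shows "K m j = 0"
proof (cases "m = j")
	case False
	have sym: "K i j = K j i" for i j using K by (simp add: psd_def)
	let ?n = "Suc (max m j)" and ?c = "%i. if i = j then 1 else 0 :: real"
	have q: "quad ?n K ?c = K j j"
	proof -
		have "quad ?n K (%i. 0 + (if i = j then 1 else 0)) = K j j"
			by (subst quad_shift[OF sym]) (auto simp: quad_def)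
		thus ?thesis by simp
	qed
	have s: "(SUM i<?n. ?c i * K i m) = K m j"
	proof -
		have "(SUM i<?n. ?c i * K i m) = (SUM i<?n. if i = j then K i m else 0)" by (intro sum.cong) auto
		also have "... = K j m" by (simp add: sum.delta)
		finally show ?thesis using sym by simp
	qed
	have ge: "0 <= K j j + 2 * t * K m j" for t
	proof -
		have "0 <= quad ?n K (%i. ?c i + (if i = m then t else 0))" using K unfolding psd_def by blast
		thus ?thesis by (subst (asm) quad_shift[OF sym]) (auto simp: q s z simp del: sum.lessThan_Suc)
	qed
	show ?thesis
	proof (rule ccontr)
		assume "K m j ~= 0"
		thus False using ge[of "- (K j j + 1) / (2 * K m j)"] by (simp add: field_simps)
	qed
qed (use z in simp)

text \<open>Minimising the form over coordinate \<open>m\<close>, at \<open>t = - b / K m m\<close>,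
  leaves the Schur complement. If \<open>K m m = 0\<close> the quotient is 0 by convention and the
  matrix does not change.\<close>

lemma psd_schur:
	assumes K: "psd K"
	shows "psd (%i j. K i j - K i m * K j m / K m m)"
proof -
	have sym: "K i j = K j i" for i j using K by (simp add: psd_def)
	have "0 <= quad n (%i j. K i j - K i m * K j m / K m m) c" for n c
	proof -
		define b where "b = (SUM i<n. c i * K i m)"
		have q: "quad n (%i j. K i j - K i m * K j m / K m m) c = quad n K c - b^2 / K m m"
		proof -
			have "(SUM i<n. SUM j<n. c i * c j * (K i m * K j m / K m m)) = b * b / K m m"
				unfolding b_def sum_product by (simp add: sum_divide_distrib mult_ac)
			thus ?thesis unfolding quad_def by (simp add: right_diff_distrib sum_subtractf power2_eq_square)
		qed
		show ?thesis
		proof (cases "K m m = 0")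
			case True
			thus ?thesis unfolding q using K by (simp add: psd_def)
		next
			case False
			hence pos: "K m m > 0" using psd_diag[OF K, of m] by simp
			\<comment> \<open>The range is enlarged so that it contains \<open>m\<close>, and the
			  coefficients are continued by zero.\<close>
			define n' where "n' = max n (Suc m)"
			define c0 where "c0 i = (if i < n then c i else 0)" for i
			have sub: "(SUM i<n'. if i < n then f i else 0) = (SUM i<n. f i)" for f :: "nat => real"
			proof -
				have "(SUM i<n'. if i < n then f i else 0) = (SUM i:{..<n'} Int {i. i < n}. f i)"
					by (simp add: sum.inter_restrict)
				also have "{..<n'} Int {i. i < n} = {..<n}" by (auto simp: n'_def)
				finally show ?thesis .
			qed
			have q0: "quad n' K c0 = quad n K c"
			proof -
				have "quad n' K c0 = (SUM i<n'. if i < n then (SUM j<n'. if j < n then c i * c j * K i j else 0) else 0)"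
					unfolding quad_def c0_def by (intro sum.cong refl) (auto intro!: sum.cong)
				thus ?thesis unfolding sub quad_def .
			qed
			have b0: "(SUM i<n'. c0 i * K i m) = b"
			proof -
				have "(SUM i<n'. c0 i * K i m) = (SUM i<n'. if i < n then c i * K i m else 0)" unfolding c0_def by (intro sum.cong) auto
				thus ?thesis unfolding sub b_def .
			qed
			have "0 <= quad n' K (%i. c0 i + (if i = m then - b / K m m else 0))" using K unfolding psd_def by blast
			also have "... = quad n K c + 2 * (- b / K m m) * b + (- b / K m m)^2 * K m m"
				by (subst quad_shift[OF sym]) (auto simp: n'_def q0[unfolded n'_def] b0[unfolded n'_def])
			also have "... = quad n K c - b^2 / K m m" using pos by (simp add: power2_eq_square field_simps)
			finally show ?thesis unfolding q .
		qed
	qed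
	thus ?thesis unfolding psd_def using sym by (simp add: mult.commute)
qed

fun schur_iter :: "(nat => nat => real) => nat => nat => nat => real" where
	"schur_iter K 0 i j = K i j"
| "schur_iter K (Suc m) i j = schur_iter K m i j - schur_iter K m i m * schur_iter K m j m / schur_iter K m m m"

text \<open>Gaussian elimination, one Schur complement per step. Row \<open>i\<close> of
  \<open>L\<close> ends at column \<open>i\<close>, so each member of the Gaussian family becomes a
  finite combination of independent normals and no infinite series has to be summed.\<close>

lemma psd_cholesky:
	assumes K: "psd K"
	obtains L :: "nat => nat => real" where "!!i m. i < m ==> L i m = 0"
		"!!i j n. i < n ==> K i j = (SUM m<n. L i m * L j m)"
proof -
	define S where "S = schur_iter K"
	have S0: "S 0 = K" and SS: "S (Suc m) i j = S m i j - S m i m * S m j m / S m m m" for m i j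
		unfolding S_def by (simp_all add: fun_eq_iff)
	have p: "psd (S m)" for m
	proof (induction m)
		case (Suc m)
		have "S (Suc m) = (%i j. S m i j - S m i m * S m j m / S m m m)" by (simp add: fun_eq_iff SS)
		thus ?case using psd_schur[OF Suc, of m] by simp
	qed (simp add: S0 K)
	have sym: "S m i j = S m j i" for m i j using p by (simp add: psd_def)
	have z: "i < m ==> S m i j = 0" for m i j
	proof (induction m arbitrary: i j)
		case (Suc m)
		show ?case
		proof (cases "i < m")
			case True
			thus ?thesis unfolding SS using Suc.IH by simp
		next
			case False
			hence i: "i = m" using Suc by simp
			show ?thesis
			proof (cases "S m m m = 0")
				case True
				thus ?thesis unfolding i SS using psd_zero[OF p True] by simp
			next
				case False
				thus ?thesis unfolding i SS using sym[of m j m] by simp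
			qed
		qed
	qed simp
	define L where "L i m = S m i m / sqrt (S m m m)" for i m
	show ?thesis
	proof (rule that)
		show "i < m ==> L i m = 0" for i m unfolding L_def using z by simp
		fix i j n :: nat assume "i < n"
		have LL: "L i m * L j m = S m i m * S m j m / S m m m" for m
			unfolding L_def using psd_diag[OF p, of m m] by (simp add: real_sqrt_mult_self)
		have "K i j = S n i j + (SUM m<n. L i m * L j m)"
			by (induction n) (simp_all add: S0 SS LL)
		thus "K i j = (SUM m<n. L i m * L j m)" using z[OF \<open>i < n\<close>] by simp
	qed
qed

section \<open>Normal laws, and linear forms in independent normals\<close>

lemma char_distr_cis:
	assumes "Y : bm Q"
	shows "char (distr Q borel Y) t = (\<integral>x. cis (t * Y x) \<partial>Q)"
	unfolding char_def using assms by (subst integral_distr) (auto simp: cis_conv_exp)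

lemma char_normal:
	assumes "sg > 0"
	shows "char (density lborel (normal_density 0 sg)) t = exp (- (sg^2 * t^2) / 2)"
proof -
	interpret N: prob_space std_normal_distribution
		using real_dist_normal_dist by (simp add: real_distribution_def)
	have "distributed std_normal_distribution lborel (%x. x) std_normal_density"
		unfolding distributed_def by (auto simp: distr_id2)
	hence "distributed std_normal_distribution lborel (%x. 0 + sg * x) (normal_density (0 + sg * 0) (abs sg * 1))"
		using assms by (intro N.normal_density_affine) auto
	hence "distr std_normal_distribution lborel (%x. sg * x) = density lborel (normal_density 0 sg)"
		using assms by (auto simp: distributed_def)
	hence "char (density lborel (normal_density 0 sg)) t = char (distr std_normal_distribution borel (%x. sg * x)) t"
		by (metis distr_cong sets_lborel)
	also have "... = char std_normal_distribution (t * sg)"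
		by (subst char_distr_cis) (auto simp: char_def cis_conv_exp mult.assoc)
	also have "... = exp (- (sg^2 * t^2) / 2)"
		by (simp add: char_std_normal_distribution power_mult_distrib mult.commute)
	finally show ?thesis .
qed

text \<open>Levy's uniqueness theorem. The point mass at 0 fits the same formula with
  \<open>s2 = 0\<close>, so degenerate combinations need no separate treatment afterwards.\<close>

lemma normal_law_iff_char:
	assumes Q: "prob_space Q" and Y: "Y : bm Q" and s: "s2 >= 0"
	shows "normal_law Q Y s2 \<longleftrightarrow> (ALL t. (\<integral>x. cis (t * Y x) \<partial>Q) = exp (- (s2 * t^2) / 2))"
proof -
	interpret Q: prob_space Q by fact
	define N where "N = (if s2 = 0 then return borel 0 else density lborel (normal_density 0 (sqrt s2)))"
	have cN: "char N t = exp (- (s2 * t^2) / 2)" for t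
	proof (cases "s2 = 0")
		case True
		have "char (return borel 0) t = iexp (t * 0)" unfolding char_def by (subst integral_return) auto
		thus ?thesis using True by (simp add: N_def)
	next
		case False
		thus ?thesis using s char_normal[of "sqrt s2" t] by (simp add: N_def)
	qed
	have rN: "real_distribution N"
	proof (cases "s2 = 0")
		case True
		thus ?thesis unfolding N_def by (simp add: real_distribution_def real_distribution_axioms_def prob_space_return)
	next
		case False
		thus ?thesis unfolding N_def using s by (simp add: real_distribution_def real_distribution_axioms_def prob_space_normal_density)
	qed
	have rY: "real_distribution (distr Q borel Y)" using Y by (intro Q.real_distribution_distr) simp
	have "normal_law Q Y s2 \<longleftrightarrow> distr Q borel Y = N" unfolding normal_law_def N_def by simp
	also have "... \<longleftrightarrow> char (distr Q borel Y) = char N" using Levy_uniqueness[OF rY rN] by auto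
	also have "... \<longleftrightarrow> (ALL t. (\<integral>x. cis (t * Y x) \<partial>Q) = exp (- (s2 * t^2) / 2))"
		unfolding fun_eq_iff char_distr_cis[OF Y] cN ..
	finally show ?thesis .
qed

lemma normal_law_mgf:
	assumes "normal_law Q Y s2" "Y : bm Q" "s2 >= 0"
	shows "(\<integral>\<^sup>+x. ennreal (exp (tt * Y x)) \<partial>Q) = ennreal (exp (tt^2 * s2 / 2))"
proof -
	have "(\<integral>\<^sup>+x. ennreal (exp (tt * Y x)) \<partial>Q) = (\<integral>\<^sup>+y. ennreal (exp (tt * y)) \<partial>(distr Q borel Y))"
		using assms by (subst nn_integral_distr) auto
	also have "... = ennreal (exp (tt^2 * s2 / 2))"
	proof (cases "s2 = 0")
		case True
		thus ?thesis using assms by (simp add: normal_law_def nn_integral_return)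
	next
		case False
		define sg where "sg = sqrt s2"
		have sg: "sg > 0" "sg^2 = s2" using False assms by (auto simp: sg_def)
		have pt: "normal_density 0 sg y * exp (tt * y) = exp (tt^2 * s2 / 2) * normal_density (tt * s2) sg y" for y
		proof -
			have "- (y^2) / (2 * s2) + tt * y = tt^2 * s2 / 2 + - ((y - tt * s2)^2) / (2 * s2)"
				using False by (simp add: field_simps power2_eq_square)
			hence "exp (- (y^2) / (2 * s2)) * exp (tt * y) = exp (tt^2 * s2 / 2) * exp (- ((y - tt * s2)^2) / (2 * s2))"
				by (simp only: exp_add[symmetric])
			thus ?thesis unfolding normal_density_def sg(2) by (simp add: mult_ac)
		qed
		have "(\<integral>\<^sup>+y. ennreal (exp (tt * y)) \<partial>(distr Q borel Y)) = (\<integral>\<^sup>+y. ennreal (normal_density 0 sg y) * ennreal (exp (tt * y)) \<partial>lborel)"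
			using False assms by (simp add: normal_law_def nn_integral_density sg_def)
		also have "... = (\<integral>\<^sup>+y. ennreal (exp (tt^2 * s2 / 2)) * ennreal (normal_density (tt * s2) sg y) \<partial>lborel)"
			using sg by (intro nn_integral_cong) (simp add: pt flip: ennreal_mult')
		also have "... = ennreal (exp (tt^2 * s2 / 2)) * (\<integral>\<^sup>+y. ennreal (normal_density (tt * s2) sg y) \<partial>lborel)"
			by (intro nn_integral_cmult) auto
		also have "(\<integral>\<^sup>+y. ennreal (normal_density (tt * s2) sg y) \<partial>lborel) = 1"
			using sg by (subst nn_integral_eq_integral) auto
		finally show ?thesis by simp
	qed
	finally show ?thesis .
qed

lemma indep_vars_PiM_coords:
	assumes M: "!!i. prob_space (M i)"
	shows "prob_space.indep_vars (Pi\<^sub>M UNIV M) M (%i x. x i) UNIV"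
proof -
	interpret product_prob_space M UNIV by (intro product_prob_spaceI M)
	interpret P: prob_space "Pi\<^sub>M UNIV M" by (intro prob_space_PiM M)
	have "distr (Pi\<^sub>M UNIV M) (Pi\<^sub>M UNIV M) (%x. \<lambda>i\<in>UNIV. x i) = Pi\<^sub>M UNIV (%i. distr (Pi\<^sub>M UNIV M) (M i) (%x. x i))"
		by (simp add: PiM_component restrict_UNIV distr_id2)
	thus ?thesis
		by (subst P.indep_vars_iff_distr_eq_PiM) auto
qed

definition gsp :: "(nat => real) measure" where
	"gsp = (\<Pi>\<^sub>M i\<in>UNIV. std_normal_distribution)"

lemma prob_space_gauss: "prob_space gsp"
	unfolding gsp_def using real_dist_normal_dist by (intro prob_space_PiM) (simp add: real_distribution_def)

lemma gauss_coord_measurable [measurable]: "(%x. x i) : bm gsp"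
	unfolding gsp_def using measurable_component_singleton[of i UNIV "%_. std_normal_distribution"] by simp

lemma gauss_linear_normal:
	"normal_law gsp (%x. SUM m<n. a m * x m) (SUM m<n. (a m)^2)"
proof -
	interpret N: prob_space std_normal_distribution
		using real_dist_normal_dist by (simp add: real_distribution_def)
	interpret product_prob_space "%_::nat. std_normal_distribution" UNIV by unfold_locales
	interpret G: prob_space gsp by (rule prob_space_gauss)
	have iv: "G.indep_vars (%_. borel) (%m x. t * (a m * x m)) {..<n}" for t
	proof -
		have "G.indep_vars (%_. std_normal_distribution) (%m x. x m) UNIV"
			unfolding gsp_def by (rule indep_vars_PiM_coords) (rule N.prob_space_axioms)
		hence "G.indep_vars (%_. std_normal_distribution) (%m x. x m) {..<n}"
			by (rule G.indep_vars_subset) auto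
		thus ?thesis by (rule G.indep_vars_compose2) auto
	qed
	have c1: "(\<integral>x. cis (t * x m) \<partial>gsp) = exp (- (t^2) / 2)" for t m
	proof -
		have ms: "(%x. x m) : measurable gsp std_normal_distribution"
			unfolding gsp_def by (rule measurable_component_singleton) simp
		have "(\<integral>x. cis (t * x m) \<partial>gsp) = (\<integral>y. cis (t * y) \<partial>(distr gsp std_normal_distribution (%x. x m)))"
			by (subst integral_distr[OF ms]) auto
		also have "distr gsp std_normal_distribution (%x. x m) = std_normal_distribution"
			unfolding gsp_def by (rule PiM_component) simp
		also have "(\<integral>y. cis (t * y) \<partial>std_normal_distribution) = char std_normal_distribution t"
			by (simp add: char_def cis_conv_exp)
		finally show ?thesis by (simp add: char_std_normal_distribution)
	qed
	have "(\<integral>x. cis (t * (SUM m<n. a m * x m)) \<partial>gsp) = exp (- ((SUM m<n. (a m)^2) * t^2) / 2)" for t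
	proof -
		have cs: "cis (SUM m<k. f m) = (\<Prod>m<k. cis (f m))" for f :: "nat => real" and k by (induction k) (auto simp flip: cis_mult)
		have "(\<integral>x. cis (t * (SUM m<n. a m * x m)) \<partial>gsp) = (\<integral>x. (\<Prod>m<n. cis (t * (a m * x m))) \<partial>gsp)"
			by (simp add: sum_distrib_left cs)
		also have "... = (\<Prod>m<n. \<integral>x. cis (t * (a m * x m)) \<partial>gsp)"
		proof (rule G.indep_vars_lebesgue_integral)
			show "G.indep_vars (%_. borel) (%m x. cis (t * (a m * x m))) {..<n}"
				using G.indep_vars_compose2[OF iv[of t], of "%_. cis" "%_. borel"] by simp
		qed (auto intro!: G.integrable_cis)
		also have "... = (\<Prod>m<n. exp (- ((t * a m)^2) / 2))"
			using c1[of "t * a _"] by (simp add: mult.assoc)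
		also have "... = exp (SUM m<n. - ((t * a m)^2) / 2)"
			by (simp add: exp_sum flip: of_real_prod)
		also have "(SUM m<n. - ((t * a m)^2) / 2) = - ((SUM m<n. (a m)^2) * t^2) / 2"
		proof -
			have "(SUM m<n. - ((t * a m)^2) / 2) = (SUM m<n. (- (t^2) / 2) * (a m)^2)" by (simp add: power_mult_distrib)
			also have "... = (- (t^2) / 2) * (SUM m<n. (a m)^2)" by (simp only: sum_distrib_left)
			finally show ?thesis by simp
		qed
		finally show ?thesis .
	qed
	thus ?thesis
		by (subst normal_law_iff_char[OF prob_space_gauss]) (auto intro: sum_nonneg)
qed

section \<open>Dyadic grids of the cube and continuous Gaussian paths\<close>

definition dyr :: "nat => real => real" where
	"dyr l t = of_int \<lfloor>2 ^ l * t\<rfloor> / 2 ^ l"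

definition dyv :: "nat => real^'p => real^'p" where
	"dyv l u = (\<chi> k. dyr l (u $ k))"

definition dygrid :: "nat => (real^'p) set" where
	"dygrid l = (%f. \<chi> k. real (f k) / 2 ^ l) ` (\<Pi>\<^sub>E k\<in>UNIV. {0..2 ^ l :: nat})"

lemma dyr_bounds: "dyr l t <= t" "t - 1 / 2 ^ l <= dyr l t"
proof -
	have "of_int \<lfloor>2 ^ l * t\<rfloor> <= 2 ^ l * t" "2 ^ l * t - 1 <= of_int \<lfloor>2 ^ l * t\<rfloor>" by linarith+
	hence "of_int \<lfloor>2 ^ l * t\<rfloor> / 2 ^ l <= (2 ^ l * t) / 2 ^ l" "(2 ^ l * t - 1) / 2 ^ l <= of_int \<lfloor>2 ^ l * t\<rfloor> / 2 ^ l"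
		by (intro divide_right_mono; simp)+
	thus "dyr l t <= t" "t - 1 / 2 ^ l <= dyr l t" unfolding dyr_def by (simp_all add: diff_divide_distrib)
qed

lemma dyr_0 [simp]: "dyr l 0 = 0" and dyr_1 [simp]: "dyr l 1 = 1"
proof -
	show "dyr l 0 = 0" by (simp add: dyr_def)
	have "\<lfloor>2 ^ l * 1 :: real\<rfloor> = 2 ^ l" by (metis floor_of_int mult.right_neutral of_int_numeral of_int_power)
	thus "dyr l 1 = 1" by (simp add: dyr_def)
qed

lemma dyr_Suc: "abs (dyr (Suc l) t - dyr l t) <= 1 / 2 ^ l"
proof -
	have "1 / 2 ^ Suc l <= (1 / 2 ^ l :: real)" by (simp add: field_simps)
	thus ?thesis using dyr_bounds(1)[of l t] dyr_bounds(2)[of t l] dyr_bounds(1)[of "Suc l" t] dyr_bounds(2)[of t "Suc l"] by linarith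
qed

lemma dyr_close: "abs (s - t) <= 1 / 2 ^ l ==> abs (dyr l s - dyr l t) <= 2 / 2 ^ l"
	using dyr_bounds(1)[of l t] dyr_bounds(2)[of t l] dyr_bounds(1)[of l s] dyr_bounds(2)[of s l] by (simp add: abs_le_iff)

lemma dyv_nth [simp]: "dyv l u $ k = dyr l (u $ k)" by (simp add: dyv_def)

lemma finite_dygrid: "finite (dygrid l :: (real^'p::finite) set)"
	unfolding dygrid_def by (intro finite_imageI finite_PiE) auto

lemma card_dygrid: "card (dygrid l :: (real^'p::finite) set) <= (2 ^ l + 1) ^ CARD('p)"
proof -
	have "card (dygrid l :: (real^'p) set) <= card (\<Pi>\<^sub>E k\<in>(UNIV::'p set). {0..2 ^ l :: nat})"
		unfolding dygrid_def by (intro card_image_le finite_PiE) auto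
	also have "... = (2 ^ l + 1) ^ CARD('p)" by (simp add: card_PiE)
	finally show ?thesis .
qed

lemma dygrid_cube: "dygrid l \<subseteq> cube"
proof
	fix u :: "real^'p" assume "u : dygrid l"
	then obtain f where f: "f : (\<Pi>\<^sub>E k\<in>UNIV. {0..2 ^ l :: nat})" "u = (\<chi> k. real (f k) / 2 ^ l)" unfolding dygrid_def by auto
	have "real (f k) <= 2 ^ l" for k using f(1) by (auto simp: PiE_def Pi_def)
	thus "u : cube" unfolding f(2) cube_def by simp
qed

lemma dyv_dygrid: assumes "u : cube" shows "dyv l u : dygrid l"
proof -
	have u: "0 <= u $ k" "u $ k <= 1" for k using assms by (auto simp: cube_def)
	define f where "f k = nat \<lfloor>2 ^ l * u $ k\<rfloor>" for k
	have "\<lfloor>2 ^ l * u $ k\<rfloor> <= 2 ^ l" for k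
	proof -
		have "2 ^ l * u $ k <= of_int (2 ^ l)" using u[of k] by simp
		thus ?thesis by (metis floor_mono floor_of_int)
	qed
	hence "f : (\<Pi>\<^sub>E k\<in>UNIV. {0..2 ^ l :: nat})" unfolding f_def by (auto simp: nat_le_iff)
	moreover have "dyv l u = (\<chi> k. real (f k) / 2 ^ l)"
		unfolding f_def dyv_def dyr_def using u(1) by (simp add: vec_eq_iff)
	ultimately show ?thesis unfolding dygrid_def by (intro image_eqI)
qed

lemma dyv_cube: "u : cube ==> dyv l u : cube"
	using dyv_dygrid dygrid_cube by blast

lemma dygrid_Suc: "dygrid l \<subseteq> dygrid (Suc l)"
proof
	fix u :: "real^'p" assume "u : dygrid l"
	then obtain f where f: "f : (\<Pi>\<^sub>E k\<in>UNIV. {0..2 ^ l :: nat})" "u = (\<chi> k. real (f k) / 2 ^ l)" unfolding dygrid_def by auto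
	have "(%k. 2 * f k) : (\<Pi>\<^sub>E k\<in>UNIV. {0..2 ^ Suc l :: nat})" using f(1) by (auto simp: PiE_def Pi_def)
	moreover have "u = (\<chi> k. real (2 * f k) / 2 ^ Suc l)" unfolding f(2) by (simp add: vec_eq_iff)
	ultimately show "u : dygrid (Suc l)" unfolding dygrid_def by (intro image_eqI)
qed

text \<open>The base is the number of points per axis of the grid of level \<open>Suc l\<close>; the
  exponent \<open>2 * n\<close> counts pairs of points in dimension \<open>n\<close>. The logarithm
  is linear in \<open>l\<close>, which geometric decay absorbs.\<close>

lemma ln_card_bound: "ln (2 * (2 * 2 ^ l + 1 :: real) ^ (2 * n)) <= 1 + 2 * real n * (real l + 2)"
proof -
	have "1 <= (2::real) ^ l" by simp
	moreover have "(2::real) ^ (l + 2) = 4 * 2 ^ l" unfolding power_add by simp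
	ultimately have "2 * 2 ^ l + 1 <= (2 ^ (l + 2) :: real)" by linarith
	hence "(2 * 2 ^ l + 1 :: real) ^ (2 * n) <= (2 ^ (l + 2)) ^ (2 * n)" by (intro power_mono) auto
	moreover have "(2::real) ^ (1 + (l + 2) * (2 * n)) = 2 * (2 ^ (l + 2)) ^ (2 * n)"
		by (simp only: power_add[of _ 1] power_mult power_one_right)
	ultimately have "2 * (2 * 2 ^ l + 1 :: real) ^ (2 * n) <= 2 ^ (1 + (l + 2) * (2 * n))" by simp
	moreover have "0 < 2 * (2 * 2 ^ l + 1 :: real) ^ (2 * n)" by (simp add: add_pos_nonneg)
	ultimately have "ln (2 * (2 * 2 ^ l + 1 :: real) ^ (2 * n)) <= ln (2 ^ (1 + (l + 2) * (2 * n)))" by simp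
	also have "... = real (1 + (l + 2) * (2 * n)) * ln 2" by (simp only: ln_realpow)
	also have "... <= real (1 + (l + 2) * (2 * n))" using ln_2_less_1 by (intro mult_left_le) auto
	also have "... = 1 + 2 * real n * (real l + 2)" by (simp add: algebra_simps)
	finally show ?thesis .
qed

lemma gaussian_max:
	fixes Y :: "'t => 'v => real"
	assumes Q: "prob_space Q" and T: "finite T" "T ~= {}" and th: "tt > 0" and N: "real (card T) <= N"
		and Y: "!!t. t : T ==> Y t : bm Q" "!!t. t : T ==> normal_law Q (Y t) (s t)"
		and s: "!!t. t : T ==> 0 <= s t & s t <= sg2"
	shows "(\<integral>\<^sup>+x. ennreal (Max ((%t. abs (Y t x)) ` T)) \<partial>Q) <= ennreal ((1 + ln (2 * N)) / tt + tt * sg2 / 2)"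
proof -
	interpret Q: prob_space Q by fact
	have "card T >= 1" using T by (simp add: Suc_leI card_gt_0_iff)
	hence N1: "N >= 1" using N by linarith
	\<comment> \<open>\<open>max_exp_bound\<close> is applied with \<open>c0 + 1\<close>, so that its
	  additive constant is \<open>c0 >= 0\<close> and the estimate can be carried out in
	  \<open>ennreal\<close>; the price is the extra \<open>1 / tt\<close>.\<close>
	define c0 where "c0 = ln (2 * N) + tt^2 * sg2 / 2"
	obtain t0 where "t0 : T" using T by auto
	hence sg0: "sg2 >= 0" using s by force
	have c0: "c0 >= 0" unfolding c0_def using N1 sg0 by (intro add_nonneg_nonneg ln_ge_zero) auto
	have h: "ennreal (a + b * r) = ennreal a + ennreal b * ennreal r" if "0 <= a" "0 <= b" "0 <= r" for a b r :: real
		using that by (simp add: ennreal_plus ennreal_mult)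
	have pt: "Max ((%t. abs (Y t x)) ` T) <= c0 / tt + exp (- (c0 + 1)) / tt * (SUM t:T. exp (tt * Y t x) + exp ((- tt) * Y t x))" for x
	proof -
		have "tt * Max ((%t. abs (Y t x)) ` T) <= c0 + exp (- (c0 + 1)) * (SUM t:T. exp (tt * Y t x) + exp (- (tt * Y t x)))"
			using max_exp_bound[OF T th, of "%t. Y t x" "c0 + 1"] by simp
		hence "Max ((%t. abs (Y t x)) ` T) <= (c0 + exp (- (c0 + 1)) * (SUM t:T. exp (tt * Y t x) + exp (- (tt * Y t x)))) / tt"
			using th by (simp add: pos_le_divide_eq mult.commute)
		thus ?thesis by (simp add: add_divide_distrib)
	qed
	have "(\<integral>\<^sup>+x. ennreal (Max ((%t. abs (Y t x)) ` T)) \<partial>Q) <= (\<integral>\<^sup>+x. ennreal (c0 / tt) + ennreal (exp (- (c0 + 1)) / tt) * (SUM t:T. ennreal (exp (tt * Y t x)) + ennreal (exp ((- tt) * Y t x))) \<partial>Q)"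
	proof (rule nn_integral_mono)
		fix x
		have "ennreal (Max ((%t. abs (Y t x)) ` T)) <= ennreal (c0 / tt + exp (- (c0 + 1)) / tt * (SUM t:T. exp (tt * Y t x) + exp ((- tt) * Y t x)))"
			by (rule ennreal_leI) (rule pt)
		also have "... = ennreal (c0 / tt) + ennreal (exp (- (c0 + 1)) / tt) * ennreal (SUM t:T. exp (tt * Y t x) + exp ((- tt) * Y t x))"
			using c0 th by (intro h sum_nonneg add_nonneg_nonneg) auto
		also have "ennreal (SUM t:T. exp (tt * Y t x) + exp ((- tt) * Y t x)) = (SUM t:T. ennreal (exp (tt * Y t x)) + ennreal (exp ((- tt) * Y t x)))"
			by (subst sum_ennreal[symmetric]) (auto intro!: sum.cong ennreal_plus add_nonneg_nonneg)
		finally show "ennreal (Max ((%t. abs (Y t x)) ` T)) <= ennreal (c0 / tt) + ennreal (exp (- (c0 + 1)) / tt) * (SUM t:T. ennreal (exp (tt * Y t x)) + ennreal (exp ((- tt) * Y t x)))" .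
	qed
	also have "... = ennreal (c0 / tt) + ennreal (exp (- (c0 + 1)) / tt) * (SUM t:T. (\<integral>\<^sup>+x. ennreal (exp (tt * Y t x)) \<partial>Q) + (\<integral>\<^sup>+x. ennreal (exp ((- tt) * Y t x)) \<partial>Q))"
	proof -
		have m: "(%x. ennreal (exp (r * Y t x))) : bm Q" if "t : T" for r t using Y(1)[OF that] by simp
		have mF: "(%x. ennreal (exp (tt * Y t x)) + ennreal (exp ((- tt) * Y t x))) : bm Q" if "t : T" for t
			using m[OF that] by (intro borel_measurable_add)
		have mS: "(%x. SUM t:T. ennreal (exp (tt * Y t x)) + ennreal (exp ((- tt) * Y t x))) : bm Q"
			using mF by (rule borel_measurable_sum)
		have "(\<integral>\<^sup>+x. (SUM t:T. ennreal (exp (tt * Y t x)) + ennreal (exp ((- tt) * Y t x))) \<partial>Q)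
			 = (SUM t:T. \<integral>\<^sup>+x. ennreal (exp (tt * Y t x)) + ennreal (exp ((- tt) * Y t x)) \<partial>Q)"
			using mF by (rule nn_integral_sum)
		also have "... = (SUM t:T. (\<integral>\<^sup>+x. ennreal (exp (tt * Y t x)) \<partial>Q) + (\<integral>\<^sup>+x. ennreal (exp ((- tt) * Y t x)) \<partial>Q))"
			using m by (intro sum.cong refl nn_integral_add)
		finally have e: "(\<integral>\<^sup>+x. (SUM t:T. ennreal (exp (tt * Y t x)) + ennreal (exp ((- tt) * Y t x))) \<partial>Q) = ..." .
		show ?thesis unfolding e[symmetric] nn_integral_cmult[OF mS, symmetric] using mS
			by (subst nn_integral_add) (auto simp: Q.emeasure_space_1)
	qed
	also have "... <= ennreal (c0 / tt) + ennreal (exp (- (c0 + 1)) / tt) * (SUM t:T. ennreal (exp (tt^2 * sg2 / 2)) + ennreal (exp (tt^2 * sg2 / 2)))"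
	proof (intro add_left_mono mult_left_mono sum_mono add_mono)
		fix t assume t: "t : T"
		have le: "exp (tt^2 * s t / 2) <= exp (tt^2 * sg2 / 2)" using s[OF t] by (simp add: mult_left_mono)
		show "(\<integral>\<^sup>+x. ennreal (exp (tt * Y t x)) \<partial>Q) <= ennreal (exp (tt^2 * sg2 / 2))"
			using s[OF t] le by (subst normal_law_mgf[OF Y(2)[OF t] Y(1)[OF t]]) (auto intro: ennreal_leI)
		show "(\<integral>\<^sup>+x. ennreal (exp ((- tt) * Y t x)) \<partial>Q) <= ennreal (exp (tt^2 * sg2 / 2))"
			using s[OF t] le by (subst normal_law_mgf[OF Y(2)[OF t] Y(1)[OF t]]) (auto intro: ennreal_leI)
	qed auto
	also have "... = ennreal (c0 / tt + exp (- (c0 + 1)) / tt * (SUM t:T. exp (tt^2 * sg2 / 2) + exp (tt^2 * sg2 / 2)))"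
	proof -
		have "(SUM t:T. ennreal (exp (tt^2 * sg2 / 2)) + ennreal (exp (tt^2 * sg2 / 2))) = ennreal (SUM t:T. exp (tt^2 * sg2 / 2) + exp (tt^2 * sg2 / 2))"
		proof -
			have e: "ennreal (exp (tt^2 * sg2 / 2)) + ennreal (exp (tt^2 * sg2 / 2)) = ennreal (exp (tt^2 * sg2 / 2) + exp (tt^2 * sg2 / 2))"
				by (rule ennreal_plus[symmetric]) auto
			show ?thesis unfolding e by (rule sum_ennreal) (auto intro: add_nonneg_nonneg)
		qed
		thus ?thesis using c0 th by (simp only:) (intro h[symmetric] sum_nonneg add_nonneg_nonneg; simp)
	qed
	also have "... <= ennreal ((1 + ln (2 * N)) / tt + tt * sg2 / 2)"
	proof (rule ennreal_leI)
		have "exp (- (c0 + 1)) / tt * (SUM t:T. exp (tt^2 * sg2 / 2) + exp (tt^2 * sg2 / 2)) = exp (- (c0 + 1)) / tt * (2 * real (card T) * exp (tt^2 * sg2 / 2))" by simp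
		also have "... <= exp (- (c0 + 1)) / tt * (2 * N * exp (tt^2 * sg2 / 2))"
			using N th by (intro mult_left_mono mult_right_mono) auto
		also have "2 * N * exp (tt^2 * sg2 / 2) = exp c0" unfolding c0_def using N1 by (simp add: exp_add)
		also have "exp (- (c0 + 1)) / tt * exp c0 = exp (- 1) / tt" by (simp flip: exp_add)
		also have "... <= 1 / tt" using th by (intro divide_right_mono) auto
		finally have "c0 / tt + exp (- (c0 + 1)) / tt * (SUM t:T. exp (tt^2 * sg2 / 2) + exp (tt^2 * sg2 / 2)) <= c0 / tt + 1 / tt" by simp
		also have "... = (1 + ln (2 * N)) / tt + tt * sg2 / 2"
			unfolding c0_def using th by (simp add: field_simps power2_eq_square)
		finally show "c0 / tt + exp (- (c0 + 1)) / tt * (SUM t:T. exp (tt^2 * sg2 / 2) + exp (tt^2 * sg2 / 2)) <= (1 + ln (2 * N)) / tt + tt * sg2 / 2" .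
	qed
	finally show ?thesis .
qed

lemma telescoping_limit:
	fixes a m :: "nat => real"
	assumes step: "!!l. abs (a (Suc l) - a l) <= m l" and sm: "summable m"
	shows "convergent a" "abs (lim a - a l) <= (\<Sum>i. m (i + l))"
proof -
	have m0: "0 <= m l" for l using step[of l] by linarith
	have bd: "abs (a (n + l) - a l) <= (\<Sum>i. m (i + l))" for n l
	proof -
		have "abs (a (n + l) - a l) <= (SUM i<n. m (i + l))"
		proof (induction n)
			case (Suc n)
			have "abs (a (Suc n + l) - a l) <= abs (a (Suc (n + l)) - a (n + l)) + abs (a (n + l) - a l)" by simp
			thus ?case using Suc step[of "n + l"] by simp
		qed simp
		also have "... <= (\<Sum>i. m (i + l))" using sm m0 by (intro sum_le_suminf) (auto simp: summable_iff_shift)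
		finally show ?thesis .
	qed
	have "summable (%l. a (Suc l) - a l)"
		by (rule summable_comparison_test'[OF sm, of 0]) (use step in simp)
	hence "convergent (%n. SUM l<n. a (Suc l) - a l)" by (simp add: summable_iff_convergent)
	hence "convergent (%n. a n - a 0)" by (simp add: sum_lessThan_telescope)
	hence "convergent (%n. (a n - a 0) + a 0)" by (intro convergent_add convergent_const)
	thus c: "convergent a" by simp
	hence "a \<longlonglongrightarrow> lim a" by (simp add: convergent_LIMSEQ_iff)
	hence "(%n. a (n + l)) \<longlonglongrightarrow> lim a" by (rule LIMSEQ_ignore_initial_segment)
	hence "(%n. abs (a (n + l) - a l)) \<longlonglongrightarrow> abs (lim a - a l)" by (intro tendsto_intros)
	thus "abs (lim a - a l) <= (\<Sum>i. m (i + l))" by (rule LIMSEQ_le_const2) (use bd in blast)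
qed

text \<open>Values on dyadic points come from the Cholesky factor. \<open>Mx l\<close> bounds the
  increments between nearby points of the grid of level \<open>Suc l\<close>, and its mean decays
  geometrically; where \<open>Mx\<close> is summable the values along \<open>dyv l u\<close>
  converge to a continuous path. \<open>Zs\<close> collects points of zero variance at which the
  path has to vanish everywhere, not only almost surely.\<close>

theorem continuous_gaussian_process:
	fixes K :: "real^'p::finite => real^'p => real" and C :: real and Zs :: "(real^'p) set"
	assumes sym: "!!u v. K u v = K v u"
		and pos: "!!n c (w :: nat => real^'p). (!!i. w i : cube) ==> 0 <= (SUM i<n. SUM j<n. c i * c j * K (w i) (w j))"
		and inc: "!!u v r. u : cube ==> v : cube ==> (ALL k. abs (u $ k - v $ k) <= r) ==> K u u + K v v - 2 * K u v <= C * r"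
		and cont: "!!u v. u : cube ==> v : cube ==> (%l. K (dyv l u) (dyv l v)) \<longlonglongrightarrow> K u v"
		and zero: "!!u. u : Zs ==> u : cube & K u u = 0 & (ALL l. dyv l u : Zs)"
		and C: "C >= 0"
	obtains B where "gaussian_proc gsp B K" "!!x. continuous_on cube (B x)" "!!x u. u : Zs ==> B x u = 0"
proof -
	interpret G: prob_space gsp by (rule prob_space_gauss)
	define D :: "(real^'p) set" where "D = (\<Union>l. dygrid l)"
	have Dc: "countable D" unfolding D_def by (rule countable_UN) (auto intro: countable_finite finite_dygrid)
	have D0: "D ~= {}"
	proof -
		have "(0 :: real^'p) : cube" by (simp add: cube_def)
		hence "dyv 0 (0 :: real^'p) : D" unfolding D_def using dyv_dygrid by blast
		thus ?thesis by auto
	qed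
	have Dcube: "D \<subseteq> cube" unfolding D_def using dygrid_cube by blast
	define e where "e = to_nat_on D"
	define f where "f = from_nat_into D"
	have fe: "f (e u) = u" if "u : D" for u unfolding f_def e_def using Dc that by (rule from_nat_into_to_nat_on)
	have fD: "f i : cube" for i unfolding f_def using from_nat_into[OF D0, of i] Dcube by blast
	have "psd (%i j. K (f i) (f j))" unfolding psd_def quad_def using sym pos fD by auto
	then obtain L where L0: "!!i m. i < m ==> L i m = 0" and LK: "!!i j n. i < n ==> K (f i) (f j) = (SUM m<n. L i m * L j m)"
		by (rule psd_cholesky) blast
	define Gd where "Gd u x = (SUM m<Suc (e u). L (e u) m * x m)" for u and x :: "nat => real"
	have Gd_ext: "Gd u x = (SUM m<n. L (e u) m * x m)" if "e u < n" for u x n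
		unfolding Gd_def using that L0 by (intro sum.mono_neutral_left) (auto simp: less_Suc_eq_le not_le)
	have Gdm [measurable]: "Gd u : bm gsp" for u unfolding Gd_def by measurable
	have normal: "normal_law gsp (%x. SUM u:S. c u * Gd (w u) x) (SUM u:S. SUM v:S. c u * c v * K (w u) (w v)) & 0 <= (SUM u:S. SUM v:S. c u * c v * K (w u) (w v))"
		if S: "finite S" and w: "!!u. u : S ==> w u : D" for S :: "'s set" and c w
	proof -
		define n where "n = Suc (SUM u:S. e (w u))"
		have en: "e (w u) < n" if "u : S" for u
			using member_le_sum[of u S "%u. e (w u)"] that S by (simp add: n_def less_Suc_eq_le)
		define a where "a m = (SUM u:S. c u * L (e (w u)) m)" for m
		have 1: "(SUM u:S. c u * Gd (w u) x) = (SUM m<n. a m * x m)" for x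
		proof -
			have "(SUM u:S. c u * Gd (w u) x) = (SUM u:S. SUM m<n. c u * L (e (w u)) m * x m)"
				by (intro sum.cong refl) (simp add: Gd_ext[OF en] sum_distrib_left mult.assoc)
			also have "... = (SUM m<n. SUM u:S. c u * L (e (w u)) m * x m)" by (rule sum.swap)
			finally show ?thesis by (simp add: a_def sum_distrib_right)
		qed
		have 2: "(SUM m<n. (a m)^2) = (SUM u:S. SUM v:S. c u * c v * K (w u) (w v))"
		proof -
			have "(SUM m<n. (a m)^2) = (SUM m<n. SUM u:S. SUM v:S. c u * c v * (L (e (w u)) m * L (e (w v)) m))"
				unfolding a_def power2_eq_square sum_product by (simp add: mult_ac)
			also have "... = (SUM u:S. SUM m<n. SUM v:S. c u * c v * (L (e (w u)) m * L (e (w v)) m))" by (rule sum.swap)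
			also have "... = (SUM u:S. SUM v:S. SUM m<n. c u * c v * (L (e (w u)) m * L (e (w v)) m))"
				by (intro sum.cong refl sum.swap)
			also have "... = (SUM u:S. SUM v:S. c u * c v * K (f (e (w u))) (f (e (w v))))"
				by (intro sum.cong refl) (simp add: LK[OF en] sum_distrib_left)
			finally show ?thesis using fe w by simp
		qed
		have "0 <= (SUM m<n. (a m)^2)" by (intro sum_nonneg) auto
		thus ?thesis unfolding 1 using gauss_linear_normal[of a n] 2 by simp
	qed
	have normal2: "normal_law gsp (%x. Gd p x - Gd q x) (K p p + K q q - 2 * K p q) & 0 <= K p p + K q q - 2 * K p q"
		if "p : D" "q : D" for p q
		using normal[of "{True, False}" "%b. if b then p else q" "%b. if b then 1 else - 1"] that sym[of q p] by (simp add: algebra_simps)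
	\<comment> \<open>One set of pairs serves two purposes: the links from \<open>dyv l u\<close> to
	  \<open>dyv (Suc l) u\<close>, and the neighbours \<open>dyv l u\<close>, \<open>dyv l v\<close>
	  in the proof of continuity.\<close>
	define Tl :: "nat => ((real^'p) \<times> (real^'p)) set" where "Tl l = {t : dygrid (Suc l) \<times> dygrid (Suc l). ALL k. abs (fst t $ k - snd t $ k) <= 2 / 2 ^ l}" for l
	have Tlf: "finite (Tl l)" for l
		unfolding Tl_def by (rule finite_subset[of _ "dygrid (Suc l) \<times> dygrid (Suc l)"]) (auto intro!: finite_dygrid)
	have Tl0: "Tl l ~= {}" for l
	proof -
		have "(0 :: real^'p) : cube" by (simp add: cube_def)
		hence "dyv (Suc l) (0 :: real^'p) : dygrid (Suc l)" by (rule dyv_dygrid)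
		hence "(dyv (Suc l) 0, dyv (Suc l) 0) : Tl l" unfolding Tl_def by simp
		thus ?thesis by blast
	qed
	have TlD: "fst t : D" "snd t : D" if "t : Tl l" for t l using that unfolding Tl_def D_def by auto
	define Mx where "Mx l x = Max ((%t. abs (Gd (fst t) x - Gd (snd t) x)) ` Tl l)" for l x
	have Mxm [measurable]: "Mx l : bm gsp" for l
		unfolding Mx_def by (intro borel_measurable_Max Tlf) auto
	have Mx_ge: "abs (Gd p x - Gd q x) <= Mx l x" if "(p, q) : Tl l" for p q l x
		unfolding Mx_def using Max_abs_ge[OF Tlf that, of "%t. Gd (fst t) x - Gd (snd t) x"] by simp
	have Mx0: "0 <= Mx l x" for l x
	proof -
		obtain t where "t : Tl l" using Tl0 by blast
		thus ?thesis using Mx_ge[of "fst t" "snd t" l x] by simp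
	qed
	define d where "d = real CARD('p)"
	define rh :: real where "rh = 5 / (4 * sqrt 2)"
	have rh: "0 < rh" "rh < 1"
	proof -
		have "(5 / 4 :: real) < sqrt 2" by (rule real_less_rsqrt) (simp add: power2_eq_square)
		thus "rh < 1" by (simp add: rh_def)
	qed (simp add: rh_def)
	have EM: "(\<integral>\<^sup>+x. ennreal (Mx l x) \<partial>gsp) <= ennreal ((2 + 8 * d + C) * rh ^ l)" for l
	proof -
		define N where "N = (2 * 2 ^ l + 1 :: real) ^ (2 * CARD('p))"
		have cT: "real (card (Tl l)) <= N"
		proof -
			have "card (Tl l) <= card ((dygrid (Suc l) :: (real^'p) set) \<times> (dygrid (Suc l) :: (real^'p) set))"
				unfolding Tl_def by (intro card_mono finite_cartesian_product finite_dygrid) auto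
			also have "... <= (2 ^ Suc l + 1) ^ CARD('p) * (2 ^ Suc l + 1) ^ CARD('p)"
				unfolding card_cartesian_product by (intro mult_le_mono card_dygrid)
			also have "... = (2 ^ Suc l + 1) ^ (2 * CARD('p))" by (simp only: mult_2[of "CARD('p)"] power_add)
			finally have "real (card (Tl l)) <= real ((2 ^ Suc l + 1) ^ (2 * CARD('p)))" by (simp only: of_nat_le_iff)
			also have "... = N" by (simp add: N_def add.commute)
			finally show ?thesis .
		qed
		have "(\<integral>\<^sup>+x. ennreal (Mx l x) \<partial>gsp) <= ennreal ((1 + ln (2 * N)) / sqrt 2 ^ l + sqrt 2 ^ l * (C * (2 / 2 ^ l)) / 2)"
			unfolding Mx_def
		proof (rule gaussian_max[OF prob_space_gauss Tlf Tl0 _ cT])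
			fix t assume t: "t : Tl l"
			show "normal_law gsp (%x. Gd (fst t) x - Gd (snd t) x) (K (fst t) (fst t) + K (snd t) (snd t) - 2 * K (fst t) (snd t))"
				using normal2 TlD[OF t] by blast
			have "K (fst t) (fst t) + K (snd t) (snd t) - 2 * K (fst t) (snd t) <= C * (2 / 2 ^ l)"
				using t TlD[OF t] Dcube by (intro inc) (auto simp: Tl_def)
			thus "0 <= K (fst t) (fst t) + K (snd t) (snd t) - 2 * K (fst t) (snd t) & K (fst t) (fst t) + K (snd t) (snd t) - 2 * K (fst t) (snd t) <= C * (2 / 2 ^ l)"
				using normal2 TlD[OF t] by blast
		qed auto
		also have "... <= ennreal ((2 + 8 * d + C) * rh ^ l)"
		proof (rule ennreal_leI)
			have s: "sqrt 2 ^ l * sqrt 2 ^ l = (2::real) ^ l" by (simp flip: power_mult_distrib)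
			have "sqrt 2 ^ l * (C * (2 / 2 ^ l)) / 2 = C / sqrt 2 ^ l"
				unfolding s[symmetric] by (simp add: field_simps)
			hence "(1 + ln (2 * N)) / sqrt 2 ^ l + sqrt 2 ^ l * (C * (2 / 2 ^ l)) / 2 = (1 + ln (2 * N) + C) / sqrt 2 ^ l"
				by (simp add: add_divide_distrib)
			also have "... <= ((2 + 8 * d + C) * (5 / 4) ^ l) / sqrt 2 ^ l"
			proof (rule divide_right_mono)
				have "1 + real l * (1 / 4) <= (1 + 1 / 4) ^ l" by (rule Bernoulli_inequality) simp
				hence l: "real l + 4 <= 4 * (5 / 4) ^ l" by simp
				have one: "1 <= (5 / 4 :: real) ^ l" by (rule one_le_power) simp
				have "1 + ln (2 * N) + C <= (2 + C) * 1 + 2 * d * (real l + 4)"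
					using ln_card_bound[of l "CARD('p)"] unfolding N_def d_def by (simp add: algebra_simps)
				also have "... <= (2 + C) * (5 / 4) ^ l + 2 * d * (4 * (5 / 4) ^ l)"
					using l one C by (intro add_mono mult_left_mono) (auto simp: d_def)
				finally show "1 + ln (2 * N) + C <= (2 + 8 * d + C) * (5 / 4) ^ l" by (simp add: algebra_simps)
			qed simp
			also have "... = (2 + 8 * d + C) * rh ^ l" by (simp add: rh_def power_divide power_mult_distrib)
			finally show "(1 + ln (2 * N)) / sqrt 2 ^ l + sqrt 2 ^ l * (C * (2 / 2 ^ l)) / 2 <= (2 + 8 * d + C) * rh ^ l" .
		qed
		finally show ?thesis .
	qed
	\<comment> \<open>The zeros on \<open>D Int Zs\<close> are part of the event. Off this almost sure
	  event the path is set to 0, so continuity and the zeros hold for every \<open>x\<close>.\<close>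
	define good where "good x \<longleftrightarrow> (\<Sum>l. ennreal (Mx l x)) ~= top & (ALL u:D Int Zs. Gd u x = 0)" for x
	have good_sum: "summable (%l. Mx l x)" if "good x" for x
		using that Mx0 unfolding good_def by (intro summable_suminf_not_top) auto
	have goodm [measurable]: "Measurable.pred gsp good"
	proof -
		have "countable (D Int Zs)" using Dc by blast
		thus ?thesis unfolding good_def by measurable
	qed
	have AEgood: "AE x in gsp. good x"
	proof -
		have "(\<integral>\<^sup>+x. (\<Sum>l. ennreal (Mx l x)) \<partial>gsp) = (\<Sum>l. \<integral>\<^sup>+x. ennreal (Mx l x) \<partial>gsp)"
			by (rule nn_integral_suminf) simp
		also have "... <= (\<Sum>l. ennreal ((2 + 8 * d + C) * rh ^ l))" by (intro suminf_le EM) auto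
		also have "... < top"
		proof -
			have "summable (%l. (2 + 8 * d + C) * rh ^ l)" using rh by (intro summable_mult summable_geometric) simp
			hence "(\<Sum>l. ennreal ((2 + 8 * d + C) * rh ^ l)) = ennreal (\<Sum>l. (2 + 8 * d + C) * rh ^ l)"
				using rh C by (intro suminf_ennreal2) (auto simp: d_def)
			thus ?thesis by simp
		qed
		finally have "(\<integral>\<^sup>+x. (\<Sum>l. ennreal (Mx l x)) \<partial>gsp) ~= \<infinity>" by simp
		hence 1: "AE x in gsp. (\<Sum>l. ennreal (Mx l x)) ~= \<infinity>" by (intro nn_integral_PInf_AE) auto
		have "AE x in gsp. ALL u:D Int Zs. Gd u x = 0"
		proof (subst AE_ball_countable)
			show "countable (D Int Zs)" using Dc by blast
			show "ALL u:D Int Zs. AE x in gsp. Gd u x = 0"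
			proof
				fix u assume u: "u : D Int Zs"
				have "normal_law gsp (%x. Gd u x) (K u u)"
					using normal[of "{()}" "%_. u" "%_. 1"] u by simp
				hence eq: "distr gsp borel (Gd u) = return borel 0" using zero u by (simp add: normal_law_def)
				have "AE y in distr gsp borel (Gd u). y = 0" unfolding eq by (subst AE_return) auto
				thus "AE x in gsp. Gd u x = 0" by (subst (asm) AE_distr_iff) auto
			qed
		qed
		with 1 show ?thesis unfolding good_def by (auto simp: infinity_ennreal_def)
	qed
	define B where "B x u = (if good x then lim (%l. Gd (dyv l u) x) else 0)" for x u
	have step: "abs (Gd (dyv (Suc l) u) x - Gd (dyv l u) x) <= Mx l x" if "u : cube" for l u x
	proof (rule Mx_ge)
		have "abs (dyr (Suc l) t - dyr l t) <= 2 / 2 ^ l" for t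
			using dyr_Suc[of l t] by (rule order_trans) (simp add: divide_right_mono)
		thus "(dyv (Suc l) u, dyv l u) : Tl l" unfolding Tl_def using dyv_dygrid[OF that] dygrid_Suc by auto
	qed
	have conv: "(%l. Gd (dyv l u) x) \<longlonglongrightarrow> B x u" and tail: "abs (B x u - Gd (dyv l u) x) <= (\<Sum>i. Mx (i + l) x)"
		if "good x" "u : cube" for x u l
	proof -
		note t = telescoping_limit[where a="%l. Gd (dyv l u) x" and m="%l. Mx l x", OF step[OF that(2)] good_sum[OF that(1)]]
		show "(%l. Gd (dyv l u) x) \<longlonglongrightarrow> B x u" using t(1) that by (simp add: B_def convergent_LIMSEQ_iff)
		show "abs (B x u - Gd (dyv l u) x) <= (\<Sum>i. Mx (i + l) x)" using t(2)[of l] that by (simp add: B_def)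
	qed
	have Bcont: "continuous_on cube (B x)" for x
	proof (cases "good x")
		case False
		thus ?thesis by (simp add: B_def)
	next
		case True
		show ?thesis unfolding continuous_on_iff
		proof (intro ballI allI impI)
			fix u :: "real^'p" and ep :: real assume u: "u : cube" and ep: "ep > 0"
			obtain l where l: "norm (\<Sum>i. Mx (i + l) x) < ep / 3"
				using suminf_exist_split[OF _ good_sum[OF True], of "ep / 3"] ep by auto
			have Ml: "Mx l x <= (\<Sum>i. Mx (i + l) x)"
				using sum_le_suminf[OF summable_ignore_initial_segment[OF good_sum[OF True], of l], of "{0}"] Mx0 by simp
			show "EX de>0. ALL v:cube. dist v u < de --> dist (B x v) (B x u) < ep"
			proof (intro exI[of _ "1 / 2 ^ l"] conjI ballI impI)
				fix v assume v: "v : cube" "dist v u < 1 / 2 ^ l"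
				have "abs (v $ k - u $ k) <= 1 / 2 ^ l" for k
					using component_le_norm_cart[of "v - u" k] v(2) by (simp add: dist_norm)
				hence "(dyv l v, dyv l u) : Tl l"
					unfolding Tl_def using dyv_dygrid[OF u, of l] dyv_dygrid[OF v(1), of l] dygrid_Suc[of l] dyr_close by auto
				hence "abs (Gd (dyv l v) x - Gd (dyv l u) x) <= Mx l x" by (rule Mx_ge)
				thus "dist (B x v) (B x u) < ep"
					using tail[OF True u, of l] tail[OF True v(1), of l] Ml l unfolding dist_real_def by (simp add: abs_if split: if_splits)
			qed simp
		qed
	qed
	have Bm: "(%x. B x u) : bm gsp" if "u : cube" for u
	proof (rule borel_measurable_LIMSEQ_real[where u="%l x. if good x then Gd (dyv l u) x else 0"])
		fix x
		show "(%l. if good x then Gd (dyv l u) x else 0) \<longlonglongrightarrow> B x u"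
			using conv[of x u] that by (cases "good x") (auto simp: B_def)
	qed measurable
	have "gaussian_proc gsp B K" unfolding gaussian_proc_def
	proof (intro conjI ballI allI impI)
		show "(%x. B x u) : bm gsp" if "u : cube" for u using that by (rule Bm)
		fix S :: "(real^'p) set" and c assume S: "finite S & S \<subseteq> cube"
		let ?s = "%l. SUM u:S. SUM v:S. c u * c v * K (dyv l u) (dyv l v)"
		let ?s' = "SUM u:S. SUM v:S. c u * c v * K u v"
		have wD: "dyv l u : D" if "u : S" for u l using that S dyv_dygrid unfolding D_def by blast
		have n: "normal_law gsp (%x. SUM u:S. c u * Gd (dyv l u) x) (?s l)" "0 <= ?s l" for l
			using normal[of S "dyv l" c] S wD by auto
		have sl: "?s \<longlonglongrightarrow> ?s'" using S by (intro tendsto_intros cont) auto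
		have s0: "0 <= ?s'" using sl by (rule LIMSEQ_le_const) (use n(2) in blast)
		have m1: "(%x. SUM u:S. c u * Gd (dyv l u) x) : bm gsp" for l by measurable
		have m2: "(%x. SUM u:S. c u * B x u) : bm gsp" using S Bm by (intro borel_measurable_sum borel_measurable_times) auto
		have "(\<integral>x. cis (t * (SUM u:S. c u * B x u)) \<partial>gsp) = exp (- (?s' * t^2) / 2)" for t
		proof (rule LIMSEQ_unique)
			show "(%l. \<integral>x. cis (t * (SUM u:S. c u * Gd (dyv l u) x)) \<partial>gsp) \<longlonglongrightarrow> (\<integral>x. cis (t * (SUM u:S. c u * B x u)) \<partial>gsp)"
			proof (rule integral_dominated_convergence[where w="%_. 1"])
				show "AE x in gsp. (%l. cis (t * (SUM u:S. c u * Gd (dyv l u) x))) \<longlonglongrightarrow> cis (t * (SUM u:S. c u * B x u))"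
					using AEgood
				proof eventually_elim
					case (elim x)
					have "continuous_on UNIV cis" by (intro continuous_intros)
					hence ic: "isCont cis y" for y by (simp add: continuous_on_eq_continuous_at)
					have "(%l. t * (SUM u:S. c u * Gd (dyv l u) x)) \<longlonglongrightarrow> t * (SUM u:S. c u * B x u)"
						using S elim by (intro tendsto_intros conv) auto
					thus ?case by (rule isCont_tendsto_compose[OF ic])
				qed
			qed (use m1 m2 in auto)
			have "(\<integral>x. cis (t * (SUM u:S. c u * Gd (dyv l u) x)) \<partial>gsp) = exp (- (?s l * t^2) / 2)" for l
				using n[of l] normal_law_iff_char[OF prob_space_gauss m1 n(2)] by blast
			moreover have "(%l. cor (exp (- (?s l * t^2) / 2))) \<longlonglongrightarrow> cor (exp (- (?s' * t^2) / 2))"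
				by (intro tendsto_of_real tendsto_exp tendsto_divide tendsto_minus tendsto_mult sl tendsto_const) auto
			ultimately show "(%l. \<integral>x. cis (t * (SUM u:S. c u * Gd (dyv l u) x)) \<partial>gsp) \<longlonglongrightarrow> exp (- (?s' * t^2) / 2)"
				by simp
		qed
		thus "normal_law gsp (%x. SUM u:S. c u * B x u) ?s'"
			by (subst normal_law_iff_char[OF prob_space_gauss m2 s0]) blast
	qed
	moreover have "B x u = 0" if "u : Zs" for x u
	proof (cases "good x")
		case True
		have "Gd (dyv l u) x = 0" for l
			using True zero[OF that] dyv_dygrid[of u l] unfolding good_def D_def by blast
		thus ?thesis using conv[OF True, of u] zero[OF that] by (simp add: LIMSEQ_const_iff)
	qed (simp add: B_def)
	ultimately show ?thesis using Bcont by (intro that)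
qed

declare gauss_coord_measurable [measurable del]

section \<open>Weak convergence in the sense of Hoffmann-Jorgensen\<close>

lemma cube_nonempty: "(cube :: (real^'p::finite) set) ~= {}"
proof -
	have "(0 :: real^'p) : cube" by (simp add: cube_def)
	thus ?thesis by blast
qed

lemma supdist_bdd:
	fixes g g' :: "nat => real^'p::finite => real"
	assumes "g : lspace M" "g' : lspace M"
	shows "bdd_above ((%x. abs (g (fst x) (snd x) - g' (fst x) (snd x))) ` ({..M} \<times> cube))"
proof -
	obtain K K' where "!!j u. abs (g j u) <= K" "!!j u. abs (g' j u) <= K'" using assms unfolding lspace_def by blast
	hence "abs (g j u - g' j u) <= K + K'" for j u by (meson abs_triangle_ineq4 add_mono order_trans)
	thus ?thesis by (intro bdd_aboveI2[where M="K + K'"]) auto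
qed

lemma supdist_ge:
	fixes g g' :: "nat => real^'p::finite => real"
	assumes "g : lspace M" "g' : lspace M" "j <= M" "u : cube"
	shows "abs (g j u - g' j u) <= supdist M g g'"
	unfolding supdist_def using cSUP_upper[OF _ supdist_bdd[OF assms(1,2)], of "(j, u)"] assms by simp

lemma supdist_le:
	fixes g g' :: "nat => real^'p::finite => real"
	assumes "!!j u. j <= M ==> u : cube ==> abs (g j u - g' j u) <= c"
	shows "supdist M g g' <= c"
	unfolding supdist_def using assms cube_nonempty by (intro cSUP_least) auto

lemma supdist_nonneg:
	fixes g g' :: "nat => real^'p::finite => real"
	assumes "g : lspace M" "g' : lspace M"
	shows "0 <= supdist M g g'"
proof -
	obtain u :: "real^'p" where "u : cube" using cube_nonempty by blast
	hence "abs (g 0 u - g' 0 u) <= supdist M g g'" using assms by (intro supdist_ge) auto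
	thus ?thesis by linarith
qed

lemma supdist_self: "supdist M g g = (0 :: real)" for g :: "nat => real^'p::finite => real"
proof -
	have "({..M} \<times> (cube :: (real^'p) set)) ~= {}" using cube_nonempty by auto
	thus ?thesis unfolding supdist_def by simp
qed

lemma supdist_commute: "supdist M g g' = supdist M g' g"
	unfolding supdist_def by (simp add: abs_minus_commute)

lemma supdist_triangle:
	fixes g1 g2 g3 :: "nat => real^'p::finite => real"
	assumes "g1 : lspace M" "g2 : lspace M" "g3 : lspace M"
	shows "supdist M g1 g3 <= supdist M g1 g2 + supdist M g2 g3"
proof (rule supdist_le)
	fix j u assume ju: "j <= M" "u : (cube :: (real^'p) set)"
	have "abs (g1 j u - g3 j u) <= abs (g1 j u - g2 j u) + abs (g2 j u - g3 j u)" by linarith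
	thus "abs (g1 j u - g3 j u) <= supdist M g1 g2 + supdist M g2 g3"
		using supdist_ge[OF assms(1,2) ju] supdist_ge[OF assms(2,3) ju] by linarith
qed

section \<open>Lipschitz test functions and inf-convolution\<close>

definition lsp_lipschitz :: "nat => real => ((nat => real^'p => real) => real) => bool" where
	"lsp_lipschitz M L h \<longleftrightarrow> 0 <= L & (ALL g:lspace M. ALL g':lspace M. abs (h g - h g') <= L * supdist M g g')"

lemma lipschitz_bcont:
	fixes h :: "(nat => real^'p::finite => real) => real"
	assumes "lsp_lipschitz M L h" "!!g. g : lspace M ==> abs (h g) <= K"
	shows "bcont M h"
	unfolding bcont_def
proof (intro conjI ballI allI impI)
	show "EX K. ALL g:lspace M. abs (h g) <= K" using assms by blast
	fix g :: "nat => real^'p => real" and ep assume g: "g : lspace M" and ep: "0 < (ep::real)"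
	have L: "L >= 0" using assms by (simp add: lsp_lipschitz_def)
	show "EX de>0. ALL g':lspace M. supdist M g g' < de --> abs (h g - h g') < ep"
	proof (intro exI[of _ "ep / (L + 1)"] conjI ballI impI)
		show "0 < ep / (L + 1)" using ep L by simp
		fix g' :: "nat => real^'p => real" assume g': "g' : lspace M" "supdist M g g' < ep / (L + 1)"
		have "abs (h g - h g') <= L * supdist M g g'" using assms g g' by (simp add: lsp_lipschitz_def)
		also have "... <= (L + 1) * supdist M g g'" using supdist_nonneg[OF g g'(1)] by (simp add: mult_right_mono)
		also have "... < ep" using g'(2) L by (simp add: pos_less_divide_eq mult.commute)
		finally show "abs (h g - h g') < ep" .
	qed
qed

lemma sets_lsp_borel: "sets (lsp_borel M) = sigma_sets (lspace M) {U. lopen M U}"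
	and space_lsp_borel: "space (lsp_borel M) = lspace M"
proof -
	have *: "{U. lopen M U} \<subseteq> Pow (lspace M)" by (auto simp: lopen_def)
	show "sets (lsp_borel M) = sigma_sets (lspace M) {U. lopen M U}"
		unfolding lsp_borel_def by (rule sets_measure_of[OF *])
	show "space (lsp_borel M) = lspace M"
		unfolding lsp_borel_def by (rule space_measure_of[OF *])
qed

lemma bcont_measurable:
	fixes h :: "(nat => real^'p::finite => real) => real"
	assumes "bcont M h"
	shows "h : bm (lsp_borel M)"
	unfolding borel_measurable_iff_greater
proof
	fix a
	have "lopen M {g : lspace M. a < h g}" unfolding lopen_def
	proof (intro conjI ballI)
		fix g :: "nat => real^'p => real" assume "g : {g : lspace M. a < h g}"
		hence g: "g : lspace M" "0 < h g - a" by auto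
		then obtain de where de: "de > 0" "ALL g':lspace M. supdist M g g' < de --> abs (h g - h g') < h g - a"
			using assms unfolding bcont_def by blast
		have "a < h g'" if "g' : lspace M" "supdist M g g' < de" for g' :: "nat => real^'p => real"
		proof -
			have "abs (h g - h g') < h g - a" using de that by blast
			thus ?thesis by linarith
		qed
		thus "EX e>0. ALL g':lspace M. supdist M g g' < e --> g' : {g : lspace M. a < h g}" using de(1) by blast
	qed auto
	thus "{w : space (lsp_borel M). a < h w} : sets (lsp_borel M)"
		unfolding sets_lsp_borel space_lsp_borel by (intro sigma_sets.Basic) simp
qed

text \<open>Pasch-Hausdorff envelope: the infimal convolution of \<open>h\<close> with
  \<open>r\<close> times the distance, that is, the largest \<open>r\<close>-Lipschitz minorant of a
  bounded \<open>h\<close>.\<close>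

definition lower_env :: "nat => ((nat => real^'p => real) => real) => nat => (nat => real^'p => real) => real" where
	"lower_env M h r g = (INF g'\<in>lspace M. h g' + real r * supdist M g g')"

context
	fixes M :: nat and h :: "(nat => real^'p::finite => real) => real" and K :: real
	assumes bd: "!!g. g : lspace M ==> abs (h g) <= K"
begin

lemma lower_env_bdd:
	assumes "(g :: nat => real^'p => real) : lspace M"
	shows "bdd_below ((%g'. h g' + real r * supdist M g g') ` lspace M)"
proof (rule bdd_belowI2[where m="- K"])
	fix g' :: "nat => real^'p => real" assume g': "g' : lspace M"
	have "0 <= real r * supdist M g g'" using supdist_nonneg[OF assms g'] by simp
	thus "- K <= h g' + real r * supdist M g g'" using bd[OF g'] by linarith
qed

lemma lower_env_le:
	assumes "(g :: nat => real^'p => real) : lspace M" "g' : lspace M"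
	shows "lower_env M h r g <= h g' + real r * supdist M g g'"
	unfolding lower_env_def using assms by (intro cINF_lower lower_env_bdd)

lemma lower_env_le_self: "g : lspace M ==> lower_env M h r g <= h g"
	using lower_env_le[of g g r] by (simp add: supdist_self)

lemma lower_env_ge:
	assumes "(g :: nat => real^'p => real) : lspace M"
	shows "- K <= lower_env M h r g"
	unfolding lower_env_def
proof (rule cINF_greatest)
	fix g' :: "nat => real^'p => real" assume g': "g' : lspace M"
	have "0 <= real r * supdist M g g'" using supdist_nonneg[OF assms g'] by simp
	thus "- K <= h g' + real r * supdist M g g'" using bd[OF g'] by linarith
qed (use assms in blast)

lemma lower_env_abs: "g : lspace M ==> abs (lower_env M h r g) <= K"
	using lower_env_ge[of g r] lower_env_le_self[of g r] bd[of g] by linarith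

lemma lower_env_lipschitz: "lsp_lipschitz M (real r) (lower_env M h r)"
	unfolding lsp_lipschitz_def
proof (intro conjI ballI)
	have *: "lower_env M h r g <= lower_env M h r g' + real r * supdist M g g'" if g: "g : lspace M" "g' : lspace M" for g g' :: "nat => real^'p => real"
	proof -
		have "lower_env M h r g - real r * supdist M g g' <= lower_env M h r g'"
			unfolding lower_env_def[of M h r g']
		proof (rule cINF_greatest)
			fix g'' :: "nat => real^'p => real" assume g'': "g'' : lspace M"
			have "real r * supdist M g g'' <= real r * (supdist M g g' + supdist M g' g'')"
				using supdist_triangle[OF g g''] by (intro mult_left_mono) auto
			thus "lower_env M h r g - real r * supdist M g g' <= h g'' + real r * supdist M g' g''"
				using lower_env_le[OF g(1) g'', of r] by (simp add: distrib_left)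
		qed (use g in blast)
		thus ?thesis by linarith
	qed
	fix g g' :: "nat => real^'p => real" assume "g : lspace M" "g' : lspace M"
	thus "abs (lower_env M h r g - lower_env M h r g') <= real r * supdist M g g'"
		using *[of g g'] *[of g' g] by (simp add: abs_le_iff supdist_commute[of M g' g])
qed simp

text \<open>Points at distance \<open>de\<close> or more are penalised by at least
  \<open>r * de >= 2 * K\<close> and cannot fall below \<open>h g\<close>; nearer points are covered
  by continuity at \<open>g\<close>.\<close>

lemma lower_env_tendsto:
	assumes c: "bcont M h" and g: "g : lspace M"
	shows "(%r. lower_env M h r g) \<longlonglongrightarrow> h g"
proof (rule LIMSEQ_I)
	fix ep :: real assume ep: "ep > 0"
	then obtain de where de: "de > 0" "ALL g':lspace M. supdist M g g' < de --> abs (h g - h g') < ep / 2"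
		using c g unfolding bcont_def by (meson half_gt_zero)
	obtain r0 :: nat where r0: "2 * K / de <= real r0" using real_arch_simple by blast
	have K0: "0 <= K" using bd[OF g] by linarith
	have "norm (lower_env M h r g - h g) < ep" if r: "r >= r0" for r
	proof -
		have "h g - ep / 2 <= lower_env M h r g" unfolding lower_env_def
		proof (rule cINF_greatest)
			fix g' :: "nat => real^'p => real" assume g': "g' : lspace M"
			show "h g - ep / 2 <= h g' + real r * supdist M g g'"
			proof (cases "supdist M g g' < de")
				case True
				have "abs (h g - h g') < ep / 2" using de(2) g' True by blast
				moreover have "0 <= real r * supdist M g g'" using supdist_nonneg[OF g g'] by simp
				ultimately show ?thesis by linarith
			next
				case False
				have "2 * K <= real r0 * de" using r0 de(1) by (simp add: pos_divide_le_eq)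
				also have "... <= real r * supdist M g g'" using r False de(1) by (intro mult_mono) auto
				finally show ?thesis using bd[OF g] bd[OF g'] ep by linarith
			qed
		qed (use g in blast)
		thus ?thesis using lower_env_le_self[OF g, of r] ep by simp
	qed
	thus "EX no. ALL r>=no. norm (lower_env M h r g - h g) < ep" by blast
qed

end

section \<open>Outer expectations and the reduction to Lipschitz functions\<close>

lemma outer_exp_mono:
	assumes P: "prob_space P" and f: "!!om. om : space P ==> abs (f1 om) <= K" "!!om. om : space P ==> abs (f2 om) <= K"
		and le: "!!om. om : space P ==> f1 om <= f2 om"
	shows "outer_exp P f1 <= outer_exp P f2"
proof -
	interpret prob_space P by fact
	show ?thesis unfolding outer_exp_def
	proof (rule cInf_superset_mono)
		have "f2 om <= K" if "om : space P" for om using f(2)[OF that] by linarith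
		thus "{integral\<^sup>L P g |g. g : bm P & integrable P g & (ALL om:space P. f2 om <= g om)} ~= {}"
			by (auto intro!: exI[of _ "%_. K"])
		show "bdd_below {integral\<^sup>L P g |g. g : bm P & integrable P g & (ALL om:space P. f1 om <= g om)}"
		proof (rule bdd_belowI[of _ "- K"], clarify)
			fix g assume g: "integrable P g" "ALL om:space P. f1 om <= g om"
			have "(\<integral>om. - K \<partial>P) <= integral\<^sup>L P g"
			proof (rule integral_mono)
				fix om assume "om : space P"
				thus "- K <= g om" using g(2) f(1)[of om] by (force simp: abs_le_iff)
			qed (use g in auto)
			thus "- K <= integral\<^sup>L P g" by (simp add: prob_space)
		qed
		show "{integral\<^sup>L P g |g. g : bm P & integrable P g & (ALL om:space P. f2 om <= g om)} \<subseteq> {integral\<^sup>L P g |g. g : bm P & integrable P g & (ALL om:space P. f1 om <= g om)}"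
		proof clarify
			fix g assume g: "g : bm P" "integrable P g" "ALL om:space P. f2 om <= g om"
			hence "ALL om:space P. f1 om <= g om" by (meson le order_trans)
			with g show "EX ga. integral\<^sup>L P g = integral\<^sup>L P ga & ga : bm P & integrable P ga & (ALL om:space P. f1 om <= ga om)"
				by blast
		qed
	qed
qed

text \<open>Trades the outer expectation of a possibly nonmeasurable \<open>f\<close> for an
  ordinary integral. Off \<open>E\<close> the two functions differ by at most \<open>ep\<close>, on
  \<open>E\<close> by at most \<open>2 * K\<close>.\<close>

lemma outer_exp_approx:
	fixes f F :: "'w => real"
	assumes P: "prob_space P" and f: "!!om. om : space P ==> abs (f om) <= K"
		and F: "F : bm P" "!!om. om : space P ==> abs (F om) <= K"
		and E: "E : sets P" "measure P E <= et" and near: "!!om. om : space P - E ==> abs (f om - F om) <= ep" and ep: "ep >= 0"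
	shows "abs (outer_exp P f - integral\<^sup>L P F) <= ep + 2 * K * et"
proof -
	interpret prob_space P by fact
	have K0: "K >= 0"
	proof -
		obtain om where "om : space P" using not_empty by blast
		thus ?thesis using F(2)[of om] by linarith
	qed
	let ?S = "{integral\<^sup>L P g |g. g : bm P & integrable P g & (ALL om:space P. f om <= g om)}"
	have iF: "integrable P F" using F by (rule integrable_bounded)
	have iE: "integrable P (%om. indicator E om :: real)" by (rule integrable_bounded[where K=1]) (use E in auto)
	have EE: "(\<integral>om. indicator E om \<partial>P) = measure P E" using E by simp
	have up: "f om <= F om + ep + 2 * K * indicator E om" and lo: "F om - ep - 2 * K * indicator E om <= f om" if "om : space P" for om
	proof -
		have a: "abs (f om) <= K" "abs (F om) <= K" using f F that by auto
		show "f om <= F om + ep + 2 * K * indicator E om"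
			using a near[of om] that ep by (cases "om : E") (auto simp: abs_le_iff)
		show "F om - ep - 2 * K * indicator E om <= f om"
			using a near[of om] that ep by (cases "om : E") (auto simp: abs_le_iff)
	qed
	have lb: "integral\<^sup>L P F - (ep + 2 * K * et) <= y" if "y : ?S" for y
	proof -
		from that obtain g where g: "integrable P g" "ALL om:space P. f om <= g om" "y = integral\<^sup>L P g" by blast
		have "(\<integral>om. F om - ep - 2 * K * indicator E om \<partial>P) <= integral\<^sup>L P g"
		proof (rule integral_mono)
			show "F om - ep - 2 * K * indicator E om <= g om" if "om : space P" for om
				using lo[OF that] g(2) that by (meson order_trans)
		qed (use iF iE g in auto)
		moreover have "(\<integral>om. F om - ep - 2 * K * indicator E om \<partial>P) = integral\<^sup>L P F - ep - 2 * K * measure P E"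
			using iF iE E by (simp add: prob_space)
		moreover have "2 * K * measure P E <= 2 * K * et" using E K0 by (intro mult_left_mono) auto
		ultimately show ?thesis unfolding g(3) by linarith
	qed
	have mem: "(\<integral>om. F om + ep + 2 * K * indicator E om \<partial>P) : ?S"
		using iF iE up by (intro CollectI exI[of _ "%om. F om + ep + 2 * K * indicator E om"] conjI) auto
	have "outer_exp P f <= (\<integral>om. F om + ep + 2 * K * indicator E om \<partial>P)"
		unfolding outer_exp_def using lb by (intro cInf_lower mem bdd_belowI) auto
	also have "... = integral\<^sup>L P F + ep + 2 * K * measure P E" using iF iE E by (simp add: prob_space)
	also have "... <= integral\<^sup>L P F + ep + 2 * K * et" using E K0 by (intro add_left_mono mult_left_mono) auto
	finally have 1: "outer_exp P f <= integral\<^sup>L P F + ep + 2 * K * et" .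
	have "integral\<^sup>L P F - (ep + 2 * K * et) <= outer_exp P f"
		unfolding outer_exp_def using lb mem by (intro cInf_greatest) auto
	with 1 show ?thesis by (simp add: abs_le_iff)
qed

text \<open>\<open>h\<close> lies between Lipschitz lower and upper envelopes that converge to it
  pointwise. On the sample side monotonicity suffices, which matters because outer expectation is
  not additive; on the limit side dominated convergence applies since \<open>G\<close> is
  measurable.\<close>

theorem hj_weak_conv_lipschitzI:
	fixes X :: "nat => 'w => nat => real^'p::finite => real" and G :: "'v => nat => real^'p => real"
	assumes P: "prob_space P" and Q: "prob_space Q"
		and X: "!!n om. om : space P ==> X n om : lspace M"
		and G: "G : measurable Q (lsp_borel M)"
		and lim: "!!h K L. (!!g. g : lspace M ==> abs (h g) <= K) ==> lsp_lipschitz M L h ==>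
			 (%n. outer_exp P (%om. h (X n om))) \<longlonglongrightarrow> (\<integral>x. h (G x) \<partial>Q)"
	shows "hj_weak_conv M P X Q G"
	unfolding hj_weak_conv_def
proof (intro allI impI)
	fix h :: "(nat => real^'p => real) => real" assume h: "bcont M h"
	interpret Q: prob_space Q by fact
	obtain K where bd: "!!g. g : lspace M ==> abs (h g) <= K" using h unfolding bcont_def by blast
	hence bd': "!!g. g : lspace M ==> abs (- h g) <= K" by simp
	have h': "bcont M (%g. - h g)" unfolding bcont_def
	proof (intro conjI ballI allI impI)
		show "EX K. ALL g:lspace M. abs (- h g) <= K" using bd' by blast
		fix g :: "nat => real^'p => real" and ep :: real assume "g : lspace M" "0 < ep"
		then obtain de where "de > 0" "ALL g':lspace M. supdist M g g' < de --> abs (h g - h g') < ep"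
			using h unfolding bcont_def by blast
		thus "EX de>0. ALL g':lspace M. supdist M g g' < de --> abs (- h g - - h g') < ep"
			by (intro exI[of _ de]) (auto simp: abs_minus_commute)
	qed
	define lo where "lo r = lower_env M h r" for r
	define hi where "hi r g = - lower_env M (%g. - h g) r g" for r g
	have Gs: "G x : lspace M" if "x : space Q" for x
		using measurable_space[OF G that] by (simp add: space_lsp_borel)
	have lo_lip: "lsp_lipschitz M (real r) (lo r)" for r unfolding lo_def by (rule lower_env_lipschitz[where h=h and M=M and K=K, OF bd])
	have hi_lip: "lsp_lipschitz M (real r) (hi r)" for r
		using lower_env_lipschitz[where h="%g. - h g" and M=M and K=K, OF bd', of r] unfolding hi_def lsp_lipschitz_def by (auto simp: abs_minus_commute)
	have lo_b: "abs (lo r g) <= K" if "g : lspace M" for r and g :: "nat => real^'p => real" unfolding lo_def by (rule lower_env_abs[where h=h and M=M and K=K, OF bd that])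
	have hi_b: "abs (hi r g) <= K" if "g : lspace M" for r and g :: "nat => real^'p => real"
		unfolding hi_def using lower_env_abs[where h="%g. - h g" and M=M and K=K, OF bd' that, of r] by simp
	have lo_le: "lo r g <= h g" if "g : lspace M" for r and g :: "nat => real^'p => real" unfolding lo_def by (rule lower_env_le_self[where h=h and M=M and K=K, OF bd that])
	have hi_ge: "h g <= hi r g" if "g : lspace M" for r and g :: "nat => real^'p => real"
		using lower_env_le_self[where h="%g. - h g" and M=M and K=K, OF bd' that, of r] unfolding hi_def by simp
	have meas: "(%x. k (G x)) : bm Q" if "bcont M k" for k
		using measurable_compose[OF G bcont_measurable[OF that]] .
	have lo_i: "(%r. \<integral>x. lo r (G x) \<partial>Q) \<longlonglongrightarrow> (\<integral>x. h (G x) \<partial>Q)"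
	proof (rule integral_dominated_convergence[where w="%_. K"])
		show "AE x in Q. (%r. lo r (G x)) \<longlonglongrightarrow> h (G x)"
			unfolding lo_def by (rule AE_I2) (rule lower_env_tendsto[where h=h and M=M and K=K, OF bd h Gs])
		show "AE x in Q. norm (lo r (G x)) <= K" for r using lo_b[OF Gs] by (intro AE_I2) simp
	qed (auto intro!: meas h lipschitz_bcont[OF lo_lip, where K=K] lo_b)
	have hi_i: "(%r. \<integral>x. hi r (G x) \<partial>Q) \<longlonglongrightarrow> (\<integral>x. h (G x) \<partial>Q)"
	proof (rule integral_dominated_convergence[where w="%_. K"])
		show "AE x in Q. (%r. hi r (G x)) \<longlonglongrightarrow> h (G x)"
			using tendsto_minus[OF lower_env_tendsto[where h="%g. - h g" and M=M and K=K, OF bd' h' Gs]] unfolding hi_def by (intro AE_I2) simp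
		show "AE x in Q. norm (hi r (G x)) <= K" for r using hi_b[OF Gs] by (intro AE_I2) simp
	qed (auto intro!: meas h lipschitz_bcont[OF hi_lip, where K=K] hi_b)
	show "(%n. outer_exp P (%om. h (X n om))) \<longlonglongrightarrow> (\<integral>x. h (G x) \<partial>Q)"
	proof (rule order_tendstoI)
		fix a assume "a < (\<integral>x. h (G x) \<partial>Q)"
		hence "\<forall>\<^sub>F r in sequentially. a < (\<integral>x. lo r (G x) \<partial>Q)" using lo_i by (rule order_tendstoD(1)[rotated])
		then obtain r where "a < (\<integral>x. lo r (G x) \<partial>Q)" by (auto simp: eventually_sequentially)
		hence "\<forall>\<^sub>F n in sequentially. a < outer_exp P (%om. lo r (X n om))"
			using lim[OF lo_b lo_lip, of r] by (rule order_tendstoD(1)[rotated])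
		thus "\<forall>\<^sub>F n in sequentially. a < outer_exp P (%om. h (X n om))"
		proof eventually_elim
			case (elim n)
			have "outer_exp P (%om. lo r (X n om)) <= outer_exp P (%om. h (X n om))"
				by (rule outer_exp_mono[OF P, where K=K]) (simp_all add: X lo_b bd lo_le)
			thus ?case using elim by linarith
		qed
	next
		fix a assume "(\<integral>x. h (G x) \<partial>Q) < a"
		hence "\<forall>\<^sub>F r in sequentially. (\<integral>x. hi r (G x) \<partial>Q) < a" using hi_i by (rule order_tendstoD(2)[rotated])
		then obtain r where "(\<integral>x. hi r (G x) \<partial>Q) < a" by (auto simp: eventually_sequentially)
		hence "\<forall>\<^sub>F n in sequentially. outer_exp P (%om. hi r (X n om)) < a"
			using lim[OF hi_b hi_lip, of r] by (rule order_tendstoD(2)[rotated])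
		thus "\<forall>\<^sub>F n in sequentially. outer_exp P (%om. h (X n om)) < a"
		proof eventually_elim
			case (elim n)
			have "outer_exp P (%om. h (X n om)) <= outer_exp P (%om. hi r (X n om))"
				by (rule outer_exp_mono[OF P, where K=K]) (simp_all add: X hi_b bd hi_ge)
			thus ?case using elim by linarith
		qed
	qed
qed

section \<open>The delta method for the empirical copula\<close>

lemma vupd_nth [simp]: "vupd u k t $ i = (if i = k then t else u $ i)" by (simp add: vupd_def)

lemma vupd_vupd [simp]: "vupd (vupd u k s) k t = vupd u k t" by (simp add: vec_eq_iff)

lemma vupd_same [simp]: "vupd u k (u $ k) = u" by (simp add: vec_eq_iff)

lemma vupd_cube: "u : cube ==> 0 <= t ==> t <= 1 ==> vupd u k t : cube" by (auto simp: cube_def)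

lemma one_cube [simp]: "vec 1 : cube" "1 : cube" by (simp_all add: cube_def)

lemma cubeD: "u : cube ==> 0 <= u $ k" "u : cube ==> u $ k <= 1" by (auto simp: cube_def)

lemma compact_cube_slab: "compact {u :: real^'p::finite. u : cube & a <= u $ k & u $ k <= b}"
proof -
	have "{u :: real^'p. u : cube & a <= u $ k & u $ k <= b} = (\<Inter>i. {u. 0 <= u $ i} Int {u. u $ i <= 1}) Int {u. a <= u $ k} Int {u. u $ k <= b}"
		by (auto simp: cube_def)
	hence "closed {u :: real^'p. u : cube & a <= u $ k & u $ k <= b}"
		by (auto intro!: closed_Int closed_INT closed_Collect_le continuous_intros)
	moreover have "bounded {u :: real^'p. u : cube & a <= u $ k & u $ k <= b}"
	proof (rule boundedI)
		fix u :: "real^'p" assume "u : {u. u : cube & a <= u $ k & u $ k <= b}"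
		hence u: "u : cube" by simp
		have "norm u <= (SUM i:UNIV. abs (u $ i))" by (rule norm_le_l1_cart)
		also have "... <= (SUM i:(UNIV::'p set). 1)" using u by (intro sum_mono) (auto simp: cube_def)
		finally show "norm u <= real CARD('p)" by simp
	qed
	ultimately show ?thesis by (simp add: compact_eq_bounded_closed)
qed

text \<open>What the delta method needs of a path, at one accuracy only: a bound \<open>C\<close>,
  oscillation at most \<open>e\<close> over distances up to \<open>dl\<close>, and zeros on the
  lower faces. Being uniform over all paths with these constants makes the deterministic estimates
  usable on an event of high probability.\<close>

definition reg :: "(real^'p => real) => real => real => real => bool" where
	"reg b C e dl \<longleftrightarrow> (ALL u:cube. abs (b u) <= C) &
		 (ALL u:cube. ALL v:cube. (ALL k. abs (u $ k - v $ k) <= dl) --> abs (b u - b v) <= e) &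
		 (ALL u:cube. (EX k. u $ k = 0) --> b u = 0)"

lemma reg_mono: assumes "reg b C e dl" "e <= e'" shows "reg b C e' dl"
proof -
	have "abs (b u - b v) <= e'" if "u : cube" "v : cube" "ALL k. abs (u $ k - v $ k) <= dl" for u v
		using assms that unfolding reg_def by (meson order_trans)
	thus ?thesis using assms(1) unfolding reg_def by simp
qed

locale smooth_copula =
	fixes D :: "real^'p::finite => real" and pa :: real and pd :: "'p => real^'p => real"
	assumes lipD: "!!u v. u : cube ==> v : cube ==> abs (D u - D v) <= (SUM k:UNIV. abs (u $ k - v $ k))"
		and pa: "pa > 0"
		and pd_deriv: "!!u k. u : cube ==> 0 < u $ k ==> u $ k < 1 ==> ((%t. D (vupd u k t)) has_real_derivative pd k u) (at (u $ k))"
		and pd_cont: "!!k. continuous_on {u : cube. 0 < u $ k & u $ k < 1} (pd k)"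
		and pd_out: "!!u k. ~ (0 < u $ k & u $ k < 1) ==> pd k u = 0"
begin

text \<open>The marginal bridge. It vanishes at \<open>t = 1\<close> by construction, and at
  \<open>t = 0\<close> for paths with zeros on the lower faces; this makes up for partial
  derivatives that need not be continuous at the faces.\<close>

definition cb :: "(real^'p => real) => 'p => real => real" where
	"cb b k t = b (vupd (vec 1) k t) - t * b (vec 1)"

definition Phi :: "(real^'p => real) => real^'p => real" where
	"Phi b u = b u - (1 / pa) * (SUM k:UNIV. pd k u * cb b k (u $ k))"

lemma lipD1:
	assumes "u : cube" "0 <= s" "s <= 1" "0 <= t" "t <= 1"
	shows "abs (D (vupd u k s) - D (vupd u k t)) <= abs (s - t)"
proof -
	have "abs (D (vupd u k s) - D (vupd u k t)) <= (SUM i:UNIV. abs (vupd u k s $ i - vupd u k t $ i))"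
		using assms by (intro lipD vupd_cube)
	also have "... = (SUM i:UNIV. if i = k then (abs (s - t)) else 0)" by (intro sum.cong) auto
	finally show ?thesis by simp
qed

lemma pd_bound: assumes u: "u : cube" shows "abs (pd k u) <= 1"
proof (cases "0 < u $ k & u $ k < 1")
	case False
	thus ?thesis by (simp add: pd_out)
next
	case True
	have "((%t. (D (vupd u k t) - D (vupd u k (u $ k))) / (t - u $ k)) \<longlongrightarrow> pd k u) (at (u $ k))"
		using pd_deriv[OF u, of k] True by (simp add: has_field_derivative_iff)
	hence lim: "((%t. abs ((D (vupd u k t) - D (vupd u k (u $ k))) / (t - u $ k))) \<longlongrightarrow> abs (pd k u)) (at (u $ k))"
		by (rule tendsto_rabs)
	have ev: "\<forall>\<^sub>F t in at (u $ k). t : {0<..<1}"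
		using True by (intro eventually_at_in_open') auto
	have "\<forall>\<^sub>F t in at (u $ k). abs ((D (vupd u k t) - D (vupd u k (u $ k))) / (t - u $ k)) <= 1"
		using ev
	proof eventually_elim
		case (elim t)
		have "abs (D (vupd u k t) - D (vupd u k (u $ k))) <= abs (t - u $ k)"
			using elim True u by (intro lipD1) auto
		thus ?case by (cases "t = u $ k") (auto simp: abs_divide)
	qed
	thus ?thesis by (intro tendsto_upperbound[OF lim]) auto
qed

text \<open>Differentiability is known only inside (0, 1), which is all that the mean value theorem
  asks for; continuity up to the endpoints comes from the Lipschitz property. The closed range for
  \<open>zt\<close> admits \<open>s = t\<close>, where both sides are 0.\<close>

lemma mvt_pd:
	assumes u: "u : cube" and s: "0 <= s" "s <= 1" and t: "0 <= t" "t <= 1"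
	obtains zt where "0 <= zt" "zt <= 1" "min s t <= zt" "zt <= max s t" "D (vupd u k t) - D (vupd u k s) = pd k (vupd u k zt) * (t - s)"
proof -
	have main: "EX zt. s < zt & zt < t & D (vupd u k t) - D (vupd u k s) = pd k (vupd u k zt) * (t - s)"
		if st: "s < t" and s: "0 <= s" and t: "t <= 1" for s t
	proof -
		let ?f = "%x. D (vupd u k x)"
		have der: "(?f has_real_derivative pd k (vupd u k x)) (at x)" if "s < x" "x < t" for x
			using pd_deriv[of "vupd u k x" k] vupd_cube[OF u, of x k] that s t by simp
		have "continuous_on {s..t} ?f"
		proof (rule continuous_onI)
			fix x e :: real assume x: "x : {s..t}" and e: "e > 0"
			show "EX d>0. ALL x':{s..t}. dist x' x < d --> dist (?f x') (?f x) <= e"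
			proof (intro exI[of _ e] conjI ballI impI e)
				fix x' assume x': "x' : {s..t}" "dist x' x < e"
				have "abs (?f x' - ?f x) <= abs (x' - x)" using x x' s t by (intro lipD1[OF u]) auto
				thus "dist (?f x') (?f x) <= e" using x'(2) by (simp add: dist_real_def)
			qed
		qed
		moreover have "?f differentiable (at x)" if "s < x" "x < t" for x
			using der[OF that] by (auto simp: real_differentiable_def)
		ultimately obtain l z where z: "s < z" "z < t" "DERIV ?f z :> l" "?f t - ?f s = (t - s) * l"
			using MVT[OF st, of ?f] by blast
		hence "l = pd k (vupd u k z)" using der[of z] DERIV_unique by blast
		thus ?thesis using z by (auto simp: mult.commute)
	qed
	consider "s < t" | "t < s" | "s = t" by linarith
	thus ?thesis
	proof cases
		case 1
		then obtain zt where "s < zt" "zt < t" "D (vupd u k t) - D (vupd u k s) = pd k (vupd u k zt) * (t - s)"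
			using main[OF 1] s t by blast
		thus ?thesis using s t 1 by (intro that[of zt]) auto
	next
		case 2
		then obtain zt where z: "t < zt" "zt < s" "D (vupd u k s) - D (vupd u k t) = pd k (vupd u k zt) * (s - t)"
			using main[OF 2] s t by blast
		hence "D (vupd u k t) - D (vupd u k s) = pd k (vupd u k zt) * (t - s)" by (simp add: algebra_simps)
		thus ?thesis using s t 2 z by (intro that[of zt]) auto
	next
		case 3
		thus ?thesis using s t by (intro that[of s]) auto
	qed
qed

lemma pd_uniform:
	assumes ep: "ep > 0" and kp: "kp > 0"
	obtains de where "de > 0" "!!k u v. u : cube ==> v : cube ==> kp <= u $ k ==> u $ k <= 1 - kp ==> kp <= v $ k ==> v $ k <= 1 - kp ==>
		 (ALL i. abs (u $ i - v $ i) <= de) ==> abs (pd k u - pd k v) <= ep"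
proof -
	define Qd where "Qd k de \<longleftrightarrow> (ALL u v. u : cube --> v : cube --> kp <= u $ k --> u $ k <= 1 - kp --> kp <= v $ k --> v $ k <= 1 - kp -->
		 (ALL i. abs (u $ i - v $ i) <= de) --> abs (pd k u - pd k v) <= ep)" for k de
	have ex: "ALL k. EX de. de > 0 & Qd k de"
	proof
		fix k
		show "EX de. de > 0 & Qd k de"
	proof -
		let ?S = "{u. u : cube & kp <= u $ k & u $ k <= 1 - kp}"
		have "uniformly_continuous_on ?S (pd k)"
			using kp by (intro compact_uniformly_continuous compact_cube_slab continuous_on_subset[OF pd_cont]) auto
		from this[unfolded uniformly_continuous_on_def, rule_format, OF ep]
		obtain d where d: "d > 0" "ALL u:?S. ALL v:?S. dist v u < d --> dist (pd k v) (pd k u) < ep" by blast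
		show ?thesis unfolding Qd_def
		proof (intro exI[of _ "d / (2 * real CARD('p))"] conjI allI impI)
			show "0 < d / (2 * real CARD('p))" using d(1) by simp
			fix u v assume uv: "u : cube" "v : cube" "kp <= u $ k" "u $ k <= 1 - kp" "kp <= v $ k" "v $ k <= 1 - kp"
				and c: "ALL i. abs (u $ i - v $ i) <= d / (2 * real CARD('p))"
			have "dist v u = norm (u - v)" by (simp add: dist_norm norm_minus_commute)
			also have "... <= (SUM i:UNIV. abs ((u - v) $ i))" by (rule norm_le_l1_cart)
			also have "... <= (SUM i:(UNIV::'p set). d / (2 * real CARD('p)))" using c by (intro sum_mono) auto
			also have "... = d / 2" by simp
			also have "... < d" using d(1) by simp
			finally have "dist (pd k v) (pd k u) < ep" using uv d(2) by blast
			thus "abs (pd k u - pd k v) <= ep" by (simp add: dist_real_def abs_minus_commute)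
		qed
	qed
	qed
	from choice[OF ex] obtain de where de: "ALL k. de k > 0 & Qd k (de k)" by blast
	hence d0: "!!k. de k > 0" by blast
	show ?thesis
	proof (rule that[of "Min (range de)"])
		show "Min (range de) > 0" using d0 by (subst Min_gr_iff) auto
		fix k :: 'p and u v :: "real^'p" assume uv: "u : cube" "v : cube" "kp <= u $ k" "u $ k <= 1 - kp" "kp <= v $ k" "v $ k <= 1 - kp"
			 and c: "ALL i. abs (u $ i - v $ i) <= Min (range de)"
		have "Min (range de) <= de k" by (rule Min_le) auto
		hence "ALL i. abs (u $ i - v $ i) <= de k" using c order_trans by blast
		thus "abs (pd k u - pd k v) <= ep" using de uv unfolding Qd_def by blast
	qed
qed

lemma cb_bound:
	fixes b :: "real^'p => real"
	assumes "reg b C e dl" "0 <= t" "t <= 1"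
	shows "abs (cb b k t) <= 2 * C"
proof -
	have 1: "abs (b (vupd (vec 1) k t)) <= C" "abs (b (vec 1)) <= C" using assms vupd_cube[OF one_cube(1), of t k] by (auto simp: reg_def)
	hence "abs (t * b (vec 1)) <= 1 * C" unfolding abs_mult using assms by (intro mult_mono) auto
	thus ?thesis using 1 unfolding cb_def by linarith
qed

text \<open>Near 0 both terms are small, one by the zero on the face and one by the factor
  \<open>t\<close>. Near 1 the bridge is rewritten as an increment of \<open>b\<close> plus
  \<open>(1 - t) * b (vec 1)\<close>.\<close>

lemma cb_edge:
	fixes b :: "real^'p => real"
	assumes r: "reg b C e dl" and t: "0 <= t" "t <= 1" and edge: "t <= kp \<or> 1 - kp <= t" and k: "0 <= kp" "kp <= dl" "kp * C <= e"
	shows "abs (cb b k t) <= 2 * e"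
proof -
	have b1: "abs (b (vec 1)) <= C" using r by (auto simp: reg_def)
	have C0: "0 <= C" using b1 by linarith
	have mod: "abs (b u - b v) <= e" if "u : cube" "v : cube" "ALL k. abs (u $ k - v $ k) <= dl" for u v
		using r that unfolding reg_def by blast
	have dl0: "0 <= dl" using k by linarith
	show ?thesis using edge
	proof
		assume tk: "t <= kp"
		have z: "b (vupd (vec 1) k 0) = 0" using r vupd_cube[OF one_cube(1), of 0 k] unfolding reg_def by force
		have "abs (b (vupd (vec 1) k t) - b (vupd (vec 1) k 0)) <= e"
			using t tk k dl0 by (intro mod vupd_cube) auto
		moreover have "abs (t * b (vec 1)) <= kp * C" unfolding abs_mult using t tk b1 C0 by (intro mult_mono) auto
		ultimately show ?thesis unfolding cb_def using k(3) z by linarith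
	next
		assume tk: "1 - kp <= t"
		have o: "vupd (vec 1) k 1 = (vec 1 :: real^'p)" by (simp add: vec_eq_iff)
		have "abs (b (vupd (vec 1) k t) - b (vupd (vec 1) k 1)) <= e"
			using t tk k dl0 by (intro mod vupd_cube) auto
		moreover have "abs ((1 - t) * b (vec 1)) <= kp * C" unfolding abs_mult using t tk b1 C0 by (intro mult_mono) auto
		moreover have "cb b k t = (b (vupd (vec 1) k t) - b (vec 1)) + (1 - t) * b (vec 1)" unfolding cb_def by (simp add: algebra_simps)
		ultimately show ?thesis using k(3) o by (smt (verit))
	qed
qed

lemma cb_mod:
	fixes b :: "real^'p => real"
	assumes r: "reg b C e dl" and s: "0 <= s" "s <= 1" and t: "0 <= t" "t <= 1" and c: "abs (s - t) <= dl" "abs (s - t) * C <= e"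
	shows "abs (cb b k s - cb b k t) <= 2 * e"
proof -
	have b1: "abs (b (vec 1)) <= C" using r by (auto simp: reg_def)
	have "0 <= dl" using c(1) by linarith
	hence "abs (b (vupd (vec 1) k s) - b (vupd (vec 1) k t)) <= e"
		using r s t c(1) vupd_cube[OF one_cube(1), of s k] vupd_cube[OF one_cube(1), of t k] unfolding reg_def by (auto simp: abs_le_iff)
	moreover have "abs ((s - t) * b (vec 1)) <= abs (s - t) * C" unfolding abs_mult using b1 by (intro mult_left_mono) auto
	moreover have "cb b k s - cb b k t = (b (vupd (vec 1) k s) - b (vupd (vec 1) k t)) - (s - t) * b (vec 1)" unfolding cb_def by (simp add: algebra_simps)
	ultimately show ?thesis using c(2) by (smt (verit))
qed

lemma Phi_bound:
	assumes b: "!!u. u : cube ==> abs (b u) <= C" and u: "u : cube"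
	shows "abs (Phi b u) <= (1 + 2 * real CARD('p) / pa) * C"
proof -
	have C0: "0 <= C" using b[OF u] by linarith
	have "abs (pd k u * cb b k (u $ k)) <= 2 * C" for k
	proof -
		have v: "vupd (vec 1) k (u $ k) : cube" using u by (intro vupd_cube) (auto simp: cube_def)
		have "abs (u $ k * b (vec 1)) <= 1 * C" unfolding abs_mult using u b[of "vec 1"] C0 by (intro mult_mono) (auto simp: cube_def)
		hence "abs (cb b k (u $ k)) <= 2 * C" unfolding cb_def using b[OF v] by linarith
		hence "abs (pd k u) * abs (cb b k (u $ k)) <= 1 * (2 * C)" using pd_bound[OF u, of k] by (intro mult_mono) auto
		thus ?thesis by (simp add: abs_mult)
	qed
	hence "abs (SUM k:UNIV. pd k u * cb b k (u $ k)) <= (SUM k:(UNIV::'p set). 2 * C)"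
		by (intro order_trans[OF sum_abs] sum_mono)
	hence "abs ((1 / pa) * (SUM k:UNIV. pd k u * cb b k (u $ k))) <= (1 / pa) * (real CARD('p) * (2 * C))"
		unfolding abs_mult using pa by (intro mult_mono) auto
	hence "abs (Phi b u) <= C + (1 / pa) * (real CARD('p) * (2 * C))"
		unfolding Phi_def using b[OF u] by linarith
	thus ?thesis using pa by (simp add: field_simps)
qed

lemma Phi_diff: fixes b :: "real^'p => real" shows "Phi (%u. b u - b' u) u = Phi b u - Phi b' u"
proof -
	have "cb (%u. b u - b' u) k t = cb b k t - cb b' k t" for k t unfolding cb_def by (simp add: algebra_simps)
	thus ?thesis unfolding Phi_def by (simp add: right_diff_distrib sum_subtractf)
qed

text \<open>\<open>e\<close> depends on \<open>ep\<close> and \<open>C\<close> alone and is fixed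
  before \<open>dl\<close>, because the paths offer some \<open>dl\<close> only after
  \<open>e\<close> is named. Coordinates well inside use uniform continuity of \<open>pd k\<close>;
  near a face both bridge values are small and \<open>pd k\<close> is bounded.\<close>

lemma Phi_modulus:
	assumes ep: "ep > 0" and C: "C >= 0"
	obtains e where "e > 0" "!!dl. dl > 0 ==> EX de>0. ALL b. reg b C e dl --> (ALL u:cube. ALL v:cube. (ALL i. abs (u $ i - v $ i) <= de) --> abs (Phi b u - Phi b v) <= ep)"
proof -
	define d where "d = real CARD('p)"
	have d0: "d > 0" by (simp add: d_def)
	define e where "e = ep / (1 + 4 * d / pa)"
	have den: "1 + 4 * d / pa > 0" using d0 pa by (simp add: add_pos_pos)
	have e: "e > 0" unfolding e_def using ep den by simp
	show ?thesis
	proof (rule that[OF e])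
		fix dl :: real assume dl: "dl > 0"
		define kp where "kp = min dl (e / (C + 1))"
		have kp: "kp > 0" "kp <= dl" using dl e C by (auto simp: kp_def)
		have "kp * C <= kp * (C + 1)" using kp by simp
		also have "... <= e / (C + 1) * (C + 1)" using C by (intro mult_right_mono) (auto simp: kp_def)
		finally have kpC: "kp * C <= e" using C by simp
		have kp2: "kp / 2 > 0" using kp by simp
		have e2: "e / (2 * C + 1) > 0" using e C by simp
		obtain de0 where de0: "de0 > 0" and uc: "!!k u v. u : cube ==> v : cube ==> kp / 2 <= u $ k ==> u $ k <= 1 - kp / 2 ==> kp / 2 <= v $ k ==> v $ k <= 1 - kp / 2 ==>
			 (ALL i. abs (u $ i - v $ i) <= de0) ==> abs (pd k u - pd k v) <= e / (2 * C + 1)"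
			by (rule pd_uniform[OF e2 kp2]) blast
		define de where "de = min de0 (kp / 2)"
		have de: "de > 0" "de <= de0" "de <= kp / 2" using de0 kp by (auto simp: de_def)
		show "EX de>0. ALL b. reg b C e dl --> (ALL u:cube. ALL v:cube. (ALL i. abs (u $ i - v $ i) <= de) --> abs (Phi b u - Phi b v) <= ep)"
		proof (intro exI[of _ de] conjI allI impI ballI de(1))
			fix b :: "real^'p => real" and u v :: "real^'p" assume r: "reg b C e dl" and u: "u : cube" and v: "v : cube" and uv: "ALL i. abs (u $ i - v $ i) <= de"
			have bb: "abs (b u - b v) <= e"
			proof -
				have "de <= dl" using de kp by linarith
				hence "ALL i. abs (u $ i - v $ i) <= dl" using uv order_trans by blast
				thus ?thesis using r u v unfolding reg_def by blast
			qed
			have tk: "abs (pd k u * cb b k (u $ k) - pd k v * cb b k (v $ k)) <= 4 * e" for k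
			proof -
				note uk = cubeD[OF u, of k] cubeD[OF v, of k]
				have uvk: "abs (u $ k - v $ k) <= kp / 2" using uv de(3) order_trans by blast
				show ?thesis
				proof (cases "kp / 2 <= u $ k & u $ k <= 1 - kp / 2 & kp / 2 <= v $ k & v $ k <= 1 - kp / 2")
					case True
					have "ALL i. abs (u $ i - v $ i) <= de0" using uv de(2) order_trans by blast
					hence p: "abs (pd k u - pd k v) <= e / (2 * C + 1)" using True u v by (intro uc) auto
					have "abs ((pd k u - pd k v) * cb b k (u $ k)) <= e / (2 * C + 1) * (2 * C)"
						unfolding abs_mult using p cb_bound[OF r uk(1,2)] e2 by (intro mult_mono) auto
					also have "... <= e / (2 * C + 1) * (2 * C + 1)" using e2 by (intro mult_left_mono) auto
					also have "... = e" using C by simp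
					finally have 1: "abs ((pd k u - pd k v) * cb b k (u $ k)) <= e" .
					have "abs (u $ k - v $ k) * C <= kp * C" using uvk kp C by (intro mult_right_mono) auto
					hence "abs (cb b k (u $ k) - cb b k (v $ k)) <= 2 * e"
						using uvk kp kpC uk by (intro cb_mod[OF r]) auto
					hence 2: "abs (pd k v * (cb b k (u $ k) - cb b k (v $ k))) <= 1 * (2 * e)"
						unfolding abs_mult using pd_bound[OF v, of k] by (intro mult_mono) auto
					have "pd k u * cb b k (u $ k) - pd k v * cb b k (v $ k) = (pd k u - pd k v) * cb b k (u $ k) + pd k v * (cb b k (u $ k) - cb b k (v $ k))"
						by (simp add: algebra_simps)
					thus ?thesis using 1 2 e by (smt (verit))
				next
					case False
					\<comment> \<open>The two coordinates are within \<open>kp / 2\<close> of each other, so if one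
					  is within \<open>kp / 2\<close> of a face, both are within \<open>kp\<close> of it.\<close>
					hence "(u $ k <= kp \<or> 1 - kp <= u $ k) & (v $ k <= kp \<or> 1 - kp <= v $ k)" using uvk kp(1) by (smt (verit) field_sum_of_halves)
					hence "abs (cb b k (u $ k)) <= 2 * e" "abs (cb b k (v $ k)) <= 2 * e"
						using uk kp kpC by (auto intro!: cb_edge[OF r, of _ kp])
					hence "abs (pd k u) * abs (cb b k (u $ k)) <= 1 * (2 * e)" "abs (pd k v) * abs (cb b k (v $ k)) <= 1 * (2 * e)"
						using pd_bound[OF u, of k] pd_bound[OF v, of k] by (intro mult_mono; simp)+
					hence "abs (pd k u * cb b k (u $ k)) <= 2 * e" "abs (pd k v * cb b k (v $ k)) <= 2 * e" by (simp_all add: abs_mult)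
					thus ?thesis by linarith
				qed
			qed
			have "abs (SUM k:UNIV. pd k u * cb b k (u $ k) - pd k v * cb b k (v $ k)) <= (SUM k:(UNIV::'p set). 4 * e)"
				by (intro order_trans[OF sum_abs] sum_mono tk)
			hence "(1 / pa) * abs (SUM k:UNIV. pd k u * cb b k (u $ k) - pd k v * cb b k (v $ k)) <= (1 / pa) * (d * (4 * e))"
				using pa by (intro mult_left_mono) (auto simp: d_def)
			moreover have "Phi b u - Phi b v = (b u - b v) - (1 / pa) * (SUM k:UNIV. pd k u * cb b k (u $ k) - pd k v * cb b k (v $ k))"
				unfolding Phi_def by (simp add: sum_subtractf right_diff_distrib)
			ultimately have "abs (Phi b u - Phi b v) <= e + (1 / pa) * (d * (4 * e))"
				using bb pa abs_triangle_ineq4[of "b u - b v" "(1 / pa) * (SUM k:UNIV. pd k u * cb b k (u $ k) - pd k v * cb b k (v $ k))"]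
				by (simp add: abs_mult)
			also have "... = e * (1 + 4 * d / pa)" by (simp add: algebra_simps)
			also have "... = ep" unfolding e_def using den by simp
			finally show "abs (Phi b u - Phi b v) <= ep" .
		qed
	qed
qed

end

lemma eventually_div_sqrt_le:
	fixes H m :: real
	assumes "m > 0"
	shows "\<forall>\<^sub>F n in sequentially. H / rt n <= m"
proof -
	have "filterlim (%n. rt n) at_top sequentially"
		by (rule filterlim_compose[OF sqrt_at_top filterlim_real_sequentially])
	hence "(%n. H / rt n) \<longlonglongrightarrow> 0"
		by (intro tendsto_divide_0[OF tendsto_const] filterlim_at_top_imp_at_infinity)
	hence "\<forall>\<^sub>F n in sequentially. H / rt n < m" using assms by (rule order_tendstoD)
	thus ?thesis by eventually_elim simp
qed

lemma difference_step:
	fixes u :: real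
	assumes "0 <= u" "u <= 1" "n >= 1"
	defines "up \<equiv> min (u + 1 / rt n) 1" and "um \<equiv> max (u - 1 / rt n) 0"
	shows "0 <= um" "um <= u" "u <= up" "up <= 1" "1 / rt n <= up - um" "up - u <= 1 / rt n" "u - um <= 1 / rt n"
proof -
	have "0 < 1 / rt n" "1 / rt n <= 1" using assms(3) by auto
	thus "0 <= um" "um <= u" "u <= up" "up <= 1" "1 / rt n <= up - um" "up - u <= 1 / rt n" "u - um <= 1 / rt n"
		unfolding up_def um_def using assms(1,2) by (auto simp: min_def max_def)
qed

section \<open>Linearisation of the empirical copula process and of its bootstrap\<close>

context smooth_copula
begin

text \<open>\<open>v u\<close> stands for the margins evaluated at the empirical quantiles. The
  relation expresses \<open>F_n (F_n^-1 u) = u\<close> up to one observation, multiplied by the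
  random frequency of \<open>A\<close> so that no division by it occurs; \<open>1 / rt n\<close> is
  one observation after scaling.\<close>

definition qrel :: "nat => (real^'p => real) => (real^'p => real^'p) => bool" where
	"qrel n al v \<longleftrightarrow> (ALL u:cube. v u : cube &
		 (ALL k. abs (pa * (rt n * (v u $ k - u $ k)) + al (vupd (vec 1) k (v u $ k)) - u $ k * al (vec 1)) <= 1 / rt n))"

definition DP :: "nat => (real^'p => real) => (real^'p => real^'p) => real^'p => real" where
	"DP n al v u = al (v u) + rt n * (D (v u) - D u)"

lemma qrel_dist:
	assumes r: "reg al C e dl" and q: "qrel n al v" and u: "u : cube" and n: "n >= 1"
	shows "abs (rt n * (v u $ k - u $ k)) <= (2 * C + 1) / pa" "abs (v u $ k - u $ k) <= ((2 * C + 1) / pa) / rt n"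
proof -
	have vc: "v u : cube" using q u by (simp add: qrel_def)
	have 1: "abs (al (vupd (vec 1) k (v u $ k))) <= C" "abs (al (vec 1)) <= C"
		using r vupd_cube[OF one_cube(1), of "v u $ k" k] cubeD[OF vc, of k] by (auto simp: reg_def)
	have 2: "abs (u $ k * al (vec 1)) <= 1 * C" unfolding abs_mult using 1 cubeD[OF u, of k] by (intro mult_mono) auto
	have 3: "1 / rt n <= 1" using n by simp
	have "abs (pa * (rt n * (v u $ k - u $ k)) + al (vupd (vec 1) k (v u $ k)) - u $ k * al (vec 1)) <= 1 / rt n"
		using q u by (simp add: qrel_def)
	hence "abs (pa * (rt n * (v u $ k - u $ k))) <= 2 * C + 1" using 1 2 3 by linarith
	hence "pa * abs (rt n * (v u $ k - u $ k)) <= 2 * C + 1" using pa by (simp add: abs_mult)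
	thus a: "abs (rt n * (v u $ k - u $ k)) <= (2 * C + 1) / pa" using pa by (simp add: pos_le_divide_eq mult.commute)
	have "rt n > 0" using n by simp
	thus "abs (v u $ k - u $ k) <= ((2 * C + 1) / pa) / rt n"
		using a by (subst pos_le_divide_eq) (auto simp: abs_mult mult.commute)
qed

lemma DP_bound:
	assumes r: "reg al C e dl" and q: "qrel n al v" and u: "u : cube" and n: "n >= 1"
	shows "abs (DP n al v u) <= C + real CARD('p) * ((2 * C + 1) / pa)"
proof -
	have vc: "v u : cube" using q u by (simp add: qrel_def)
	have "abs (rt n * (D (v u) - D u)) <= rt n * (SUM k:UNIV. abs (v u $ k - u $ k))"
		unfolding abs_mult using lipD[OF vc u] by (intro mult_mono) auto
	also have "... = (SUM k:UNIV. abs (rt n * (v u $ k - u $ k)))" by (simp add: sum_distrib_left abs_mult)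
	also have "... <= (SUM k:(UNIV::'p set). (2 * C + 1) / pa)" by (intro sum_mono qrel_dist(1)[OF r q u n])
	finally have "abs (rt n * (D (v u) - D u)) <= real CARD('p) * ((2 * C + 1) / pa)" by simp
	moreover have "abs (al (v u)) <= C" using r vc by (auto simp: reg_def)
	ultimately show ?thesis unfolding DP_def by linarith
qed

text \<open>The increment \<open>D (v u) - D u\<close> is taken one coordinate at a time by the mean
  value theorem. \<open>qrel\<close> says that \<open>pa * s k\<close> is close to
  \<open>- cb al k (u $ k)\<close>: interior coordinates then use uniform continuity of
  \<open>pd\<close>, and near a face the displacement \<open>s k\<close> is itself small.\<close>

lemma DP_approx:
	assumes ep: "ep > 0" and C: "C >= 0"
	obtains e where "e > 0" "!!dl. dl > 0 ==> \<forall>\<^sub>F n in sequentially. ALL al v. reg al C e dl --> qrel n al v --> (ALL u:cube. abs (DP n al v u - Phi al u) <= ep)"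
proof -
	define d where "d = real CARD('p)"
	define H where "H = (2 * C + 1) / pa"
	have d0: "d > 0" by (simp add: d_def)
	have H0: "H > 0" using C pa by (simp add: H_def)
	\<comment> \<open>The denominator adds up the three errors at the end: \<open>e\<close> from
	  \<open>al\<close>, \<open>d * ta\<close> with \<open>ta = e + 8 * e / pa\<close> from the
	  increments, and \<open>d * (2 * e / pa)\<close> from the bridges.\<close>
	define e where "e = ep / (1 + d * (1 + 10 / pa))"
	have den: "1 + d * (1 + 10 / pa) > 0" using d0 pa by (simp add: add_pos_pos)
	have e: "e > 0" unfolding e_def using ep den by simp
	show ?thesis
	proof (rule that[OF e])
		fix dl :: real assume dl: "dl > 0"
		define kp where "kp = min dl (e / (C + 1))"
		have kp: "kp > 0" "kp <= dl" using dl e C by (auto simp: kp_def)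
		have "kp * C <= kp * (C + 1)" using kp by simp
		also have "... <= e / (C + 1) * (C + 1)" using C by (intro mult_right_mono) (auto simp: kp_def)
		finally have kpC: "kp * C <= e" using C by simp
		have kp2: "kp / 2 > 0" using kp by simp
		have eH: "e / H > 0" using e H0 by simp
		obtain de0 where de0: "de0 > 0" and uc: "!!k u v. u : cube ==> v : cube ==> kp / 2 <= u $ k ==> u $ k <= 1 - kp / 2 ==> kp / 2 <= v $ k ==> v $ k <= 1 - kp / 2 ==>
			 (ALL i. abs (u $ i - v $ i) <= de0) ==> abs (pd k u - pd k v) <= e / H"
			by (rule pd_uniform[OF eH kp2]) blast
		define m where "m = min de0 (kp / 2)"
		have m: "m > 0" "m <= de0" "m <= kp / 2" "m <= dl" using de0 kp by (auto simp: m_def)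
		have "\<forall>\<^sub>F n in sequentially. H / rt n <= m" "\<forall>\<^sub>F n in sequentially. 1 / rt n <= e" "\<forall>\<^sub>F n in sequentially. n >= 1"
			using m(1) e by (auto intro: eventually_div_sqrt_le eventually_ge_at_top)
		thus "\<forall>\<^sub>F n in sequentially. ALL al v. reg al C e dl --> qrel n al v --> (ALL u:cube. abs (DP n al v u - Phi al u) <= ep)"
		proof eventually_elim
			case (elim n)
			show ?case
			proof (intro allI impI ballI)
				fix al :: "real^'p => real" and v :: "real^'p => real^'p" and u :: "real^'p" assume r: "reg al C e dl" and q: "qrel n al v" and u: "u : cube"
				define s where "s k = rt n * (v u $ k - u $ k)" for k
				have vc: "v u : cube" using q u by (simp add: qrel_def)
				have n: "n >= 1" using elim by simp
				have sH: "abs (s k) <= H" for k unfolding s_def H_def by (rule qrel_dist(1)[OF r q u n])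
				have vu: "abs (v u $ k - u $ k) <= m" for k using qrel_dist(2)[OF r q u n, of k] elim(1) unfolding H_def by linarith
				have alv: "abs (al (v u) - al u) <= e"
				proof -
					have "ALL k. abs (v u $ k - u $ k) <= dl" using vu m(4) order_trans by blast
					thus ?thesis using r u vc unfolding reg_def by blast
				qed
				have ek: "abs (pa * s k + cb al k (u $ k)) <= 2 * e" for k
				proof -
					have "abs (pa * s k + al (vupd (vec 1) k (v u $ k)) - u $ k * al (vec 1)) <= 1 / rt n"
						using q u unfolding s_def by (simp add: qrel_def)
					moreover have "abs (al (vupd (vec 1) k (v u $ k)) - al (vupd (vec 1) k (u $ k))) <= e"
					proof -
						have "ALL i. abs (vupd (vec 1) k (v u $ k) $ i - vupd (vec 1) k (u $ k) $ i) <= dl" using vu[of k] m(4) dl by auto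
						thus ?thesis using r vupd_cube[OF one_cube(1), of "v u $ k" k] vupd_cube[OF one_cube(1), of "u $ k" k] cubeD[OF u, of k] cubeD[OF vc, of k]
							unfolding reg_def by blast
					qed
					ultimately show ?thesis using elim(2) unfolding cb_def by linarith
				qed
				define ta where "ta = e + 8 * e / pa"
				have key: "abs ((p' - pd k u) * s k) <= ta"
					if z: "z : cube" "p' = pd k z" "ALL i. abs (z $ i - u $ i) <= m" for z k p'
				proof (cases "kp <= u $ k & u $ k <= 1 - kp")
					case True
					have zk: "abs (z $ k - u $ k) <= kp / 2" using z(3) m(3) order_trans by blast
					have zu: "ALL i. abs (z $ i - u $ i) <= de0" using z(3) m(2) order_trans by blast
					have "abs (pd k z - pd k u) <= e / H"
					proof (rule uc[OF z(1) u _ _ _ _ zu])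
						show "kp / 2 <= z $ k" "z $ k <= 1 - kp / 2" "kp / 2 <= u $ k" "u $ k <= 1 - kp / 2" using zk True kp(1) by linarith+
					qed
					hence "abs ((p' - pd k u) * s k) <= e / H * H" unfolding abs_mult z(2) using sH[of k] eH by (intro mult_mono) auto
					hence "abs ((p' - pd k u) * s k) <= e" using H0 by simp
					moreover have "0 < 8 * e / pa" using e pa by simp
					ultimately show ?thesis unfolding ta_def by linarith
				next
					case False
					have "abs (cb al k (u $ k)) <= 2 * e"
						using False cubeD[OF u, of k] kp kpC by (intro cb_edge[OF r, of _ kp]) auto
					hence "abs (pa * s k) <= 4 * e" using ek[of k] by linarith
					hence "pa * abs (s k) <= 4 * e" using pa by (simp add: abs_mult)
					hence sk: "abs (s k) <= 4 * e / pa" using pa by (simp add: pos_le_divide_eq mult.commute)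
					have "abs (p' - pd k u) <= 2" using pd_bound[OF z(1), of k] pd_bound[OF u, of k] z(2) by linarith
					hence "abs ((p' - pd k u) * s k) <= 2 * (4 * e / pa)" unfolding abs_mult using sk by (intro mult_mono) auto
					thus ?thesis using e by (simp add: ta_def)
				qed
				\<comment> \<open>\<open>w S\<close> has moved the coordinates in \<open>S\<close> from
				  \<open>u\<close> to \<open>v u\<close>; induction over \<open>S\<close> telescopes the
				  increment of \<open>D\<close>.\<close>
				define w where "w S = (\<chi> i. if i : S then v u $ i else u $ i)" for S
				have wc: "w S : cube" for S using u vc unfolding w_def cube_def by auto
				have tele: "abs (rt n * (D (w S) - D u) - (SUM k:S. pd k u * s k)) <= real (card S) * ta" if "finite S" for S
					using that
				proof (induction S rule: finite_induct)
					case empty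
					have "w {} = u" by (simp add: w_def vec_eq_iff)
					thus ?case by simp
				next
					case (insert k S)
					have w1: "w (insert k S) = vupd (w S) k (v u $ k)" and w2: "w S = vupd (w S) k (u $ k)"
						using insert(2) by (auto simp: w_def vec_eq_iff)
					obtain zt where zt: "0 <= zt" "zt <= 1" "min (u $ k) (v u $ k) <= zt" "zt <= max (u $ k) (v u $ k)"
						"D (vupd (w S) k (v u $ k)) - D (vupd (w S) k (u $ k)) = pd k (vupd (w S) k zt) * (v u $ k - u $ k)"
						by (rule mvt_pd[OF wc cubeD(1)[OF u] cubeD(2)[OF u] cubeD(1)[OF vc] cubeD(2)[OF vc]])
					have "rt n * (D (w (insert k S)) - D (w S)) = pd k (vupd (w S) k zt) * s k"
						unfolding w1 s_def using zt(5) w2 by (simp add: mult_ac)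
					moreover have "abs ((pd k (vupd (w S) k zt) - pd k u) * s k) <= ta"
					proof (rule key)
						show "vupd (w S) k zt : cube" using wc zt by (intro vupd_cube)
						show "ALL i. abs (vupd (w S) k zt $ i - u $ i) <= m"
						proof
							fix i
							show "abs (vupd (w S) k zt $ i - u $ i) <= m"
							proof (cases "i = k")
								case True
								have "abs (zt - u $ k) <= abs (v u $ k - u $ k)" using zt(3,4) by (auto simp: min_def max_def split: if_splits)
								thus ?thesis using True vu[of k] by simp
							next
								case False
								thus ?thesis using vu[of i] m(1) by (simp add: w_def)
							qed
						qed
					qed simp
					ultimately have "abs (rt n * (D (w (insert k S)) - D (w S)) - pd k u * s k) <= ta" by (simp add: left_diff_distrib)
					moreover have "rt n * (D (w (insert k S)) - D u) = rt n * (D (w (insert k S)) - D (w S)) + rt n * (D (w S) - D u)"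
						by (simp add: right_diff_distrib)
					moreover have "(SUM k:insert k S. pd k u * s k) = pd k u * s k + (SUM k:S. pd k u * s k)" using insert by simp
					moreover have "real (card (insert k S)) * ta = ta + real (card S) * ta" using insert by (simp add: distrib_right)
					ultimately show ?case using insert.IH by linarith
				qed
				have "w UNIV = v u" by (simp add: w_def vec_eq_iff)
				hence t1: "abs (rt n * (D (v u) - D u) - (SUM k:UNIV. pd k u * s k)) <= d * ta" using tele[of UNIV] by (simp add: d_def)
				have t2: "abs ((SUM k:UNIV. pd k u * s k) + (1 / pa) * (SUM k:UNIV. pd k u * cb al k (u $ k))) <= d * (2 * e / pa)"
				proof -
					have "(SUM k:UNIV. pd k u * s k) + (1 / pa) * (SUM k:UNIV. pd k u * cb al k (u $ k)) = (SUM k:UNIV. pd k u * ((pa * s k + cb al k (u $ k)) / pa))"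
						using pa by (simp add: sum.distrib[symmetric] sum_distrib_left add_divide_distrib distrib_left)
					also have "abs (...) <= (SUM k:(UNIV::'p set). 2 * e / pa)"
					proof (rule order_trans[OF sum_abs], rule sum_mono)
						fix k
						have "abs (pd k u) * abs ((pa * s k + cb al k (u $ k)) / pa) <= 1 * (2 * e / pa)"
							using pd_bound[OF u, of k] ek[of k] pa by (intro mult_mono) (auto simp: divide_right_mono)
						thus "abs (pd k u * ((pa * s k + cb al k (u $ k)) / pa)) <= 2 * e / pa" by (simp add: abs_mult)
					qed
					finally show ?thesis by (simp add: d_def)
				qed
				have "abs (DP n al v u - Phi al u) <= e + d * ta + d * (2 * e / pa)"
				proof -
					have gen: "abs ((x1 + y) - (x2 - z)) <= a + b + c" if "abs (x1 - x2) <= a" "abs (y - s) <= b" "abs (s + z) <= c" for x1 x2 y s z a b c :: real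
						using that by linarith
					show ?thesis unfolding DP_def Phi_def by (rule gen[OF alv t1 t2])
				qed
				also have "... = e * (1 + d * (1 + 10 / pa))" unfolding ta_def by (simp add: algebra_simps add_divide_distrib)
				also have "... = ep" unfolding e_def using den by simp
				finally show "abs (DP n al v u - Phi al u) <= ep" .
			qed
		qed
	qed
qed

definition Db :: "nat => (real^'p => real) => (real^'p => real^'p) => real^'p => real" where
	"Db n al v u = D u + DP n al v u / rt n"

definition dq :: "nat => (real^'p => real) => (real^'p => real^'p) => 'p => real^'p => real" where
	"dq n al v k u = (let up = min (u $ k + 1 / rt n) 1; um = max (u $ k - 1 / rt n) 0
		 in (Db n al v (vupd u k up) - Db n al v (vupd u k um)) / (up - um))"

text \<open>\<open>pa + al (vec 1) / rt n\<close> is the observed frequency of \<open>A\<close>. The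
  process \<open>be\<close> is read at \<open>v\<close>, because the bootstrap keeps the quantiles
  of the original sample.\<close>

definition Dt :: "nat => (real^'p => real) => (real^'p => real) => (real^'p => real^'p) => real^'p => real" where
	"Dt n al be v u = be (v u) - (1 / (pa + al (vec 1) / rt n)) *
		 (SUM k:UNIV. dq n al v k u * (be (v (vupd (vec 1) k (u $ k))) - u $ k * be (v (vec 1))))"

text \<open>The estimated derivative is a difference quotient of \<open>D\<close> plus a difference
  of \<open>DP\<close> divided by \<open>rt n * (up - um) >= 1\<close>. In the interior the second
  part is small, since \<open>DP\<close> is close to \<open>Phi al\<close>, which has a modulus of
  continuity. Near a face boundedness by \<open>R\<close> suffices, because it multiplies a small
  bridge.\<close>

lemma Dt_approx:
	assumes ep: "ep > 0" and C: "C >= 0"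
	obtains e where "e > 0" "!!dl. dl > 0 ==> \<forall>\<^sub>F n in sequentially. ALL al be v. reg al C e dl --> reg be C e dl --> qrel n al v -->
			(ALL u:cube. abs (Dt n al be v u - Phi be u) <= ep)"
proof -
	define d where "d = real CARD('p)"
	define H where "H = (2 * C + 1) / pa"
	\<comment> \<open>1 for the difference quotient of the Lipschitz function \<open>D\<close>, plus
	  twice the bound from \<open>DP_bound\<close>.\<close>
	define R where "R = 1 + 2 * (C + d * H)"
	have d0: "d > 0" by (simp add: d_def)
	have H0: "H > 0" using C pa by (simp add: H_def)
	have R0: "R >= 1" using C d0 H0 by (simp add: R_def)
	define e3 where "e3 = ep * pa / (8 * d * (C + 1))"
	have e3: "e3 > 0" using ep pa d0 C by (simp add: e3_def)
	have e34: "e3 / 4 > 0" using e3 by simp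
	obtain eA where eA: "eA > 0" "!!dl. dl > 0 ==> EX de>0. ALL b. reg b C eA dl --> (ALL u:cube. ALL v:cube. (ALL i. abs (u $ i - v $ i) <= de) --> abs (Phi b u - Phi b v) <= e3 / 4)"
		by (rule Phi_modulus[OF e34 C]) blast
	obtain eB where eB: "eB > 0" "!!dl. dl > 0 ==> \<forall>\<^sub>F n in sequentially. ALL al v. reg al C eB dl --> qrel n al v --> (ALL u:cube. abs (DP n al v u - Phi al u) <= e3 / 4)"
		by (rule DP_approx[OF e34 C]) blast
	define eC where "eC = (ep / 4) / (1 + d / pa * (2 + 4 * R))"
	have denC: "1 + d / pa * (2 + 4 * R) > 0" using d0 pa R0 by (intro add_pos_pos mult_pos_pos) auto
	have eC: "eC > 0" using ep denC by (simp add: eC_def)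
	define e where "e = min eA (min eB eC)"
	have e: "e > 0" "e <= eA" "e <= eB" "e <= eC" using eA(1) eB(1) eC by (auto simp: e_def)
	show ?thesis
	proof (rule that[OF e(1)])
		fix dl :: real assume dl: "dl > 0"
		define kp where "kp = min dl (e / (C + 1))"
		have kp: "kp > 0" "kp <= dl" using dl e C by (auto simp: kp_def)
		have "kp * C <= kp * (C + 1)" using kp by simp
		also have "... <= e / (C + 1) * (C + 1)" using C by (intro mult_right_mono) (auto simp: kp_def)
		finally have kpC: "kp * C <= e" using C by simp
		have kp2: "kp / 2 > 0" using kp by simp
		obtain deA where deA: "deA > 0" "!!b u v. reg b C eA dl ==> u : cube ==> v : cube ==> (ALL i. abs (u $ i - v $ i) <= deA) ==> abs (Phi b u - Phi b v) <= e3 / 4"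
			using eA(2)[OF dl] by blast
		obtain de0 where de0: "de0 > 0" and uc: "!!k u v. u : cube ==> v : cube ==> kp / 2 <= u $ k ==> u $ k <= 1 - kp / 2 ==> kp / 2 <= v $ k ==> v $ k <= 1 - kp / 2 ==>
			 (ALL i. abs (u $ i - v $ i) <= de0) ==> abs (pd k u - pd k v) <= e3 / 4"
			by (rule pd_uniform[OF e34 kp2]) blast
		define m where "m = min de0 (min (kp / 2) deA)"
		have m: "m > 0" "m <= de0" "m <= kp / 2" "m <= deA" using de0 kp deA(1) by (auto simp: m_def)
		have "\<forall>\<^sub>F n in sequentially. H / rt n <= dl" by (rule eventually_div_sqrt_le[OF dl])
		moreover have "\<forall>\<^sub>F n in sequentially. 2 / rt n <= m" by (rule eventually_div_sqrt_le[OF m(1)])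
		moreover have "\<forall>\<^sub>F n in sequentially. n >= (1::nat)" by (rule eventually_ge_at_top)
		moreover have "\<forall>\<^sub>F n in sequentially. C / rt n <= pa / 2" using pa by (intro eventually_div_sqrt_le) simp
		moreover have "\<forall>\<^sub>F n in sequentially. (4 * C * C * d * R / (pa * pa)) / rt n <= ep / 4" using ep by (intro eventually_div_sqrt_le) simp
		ultimately show "\<forall>\<^sub>F n in sequentially. ALL al be v. reg al C e dl --> reg be C e dl --> qrel n al v --> (ALL u:cube. abs (Dt n al be v u - Phi be u) <= ep)"
			using eB(2)[OF dl]
		proof eventually_elim
			case (elim n)
			show ?case
			proof (intro allI impI ballI)
				fix al be :: "real^'p => real" and v :: "real^'p => real^'p" and u :: "real^'p" assume ra: "reg al C e dl" and rb: "reg be C e dl" and q: "qrel n al v" and u: "u : cube"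
				have n: "n >= 1" using elim by simp
				have sn: "rt n > 0" using n by simp
				have DPa: "abs (DP n al v w - Phi al w) <= e3 / 4" if "w : cube" for w
					using elim(6) reg_mono[OF ra e(3)] q that by blast
				have vm: "abs (be (v w) - be w) <= e" if w: "w : cube" for w
				proof -
					have "v w : cube" using q w by (simp add: qrel_def)
					moreover have "ALL k. abs (v w $ k - w $ k) <= dl" using qrel_dist(2)[OF ra q w n] elim(1) unfolding H_def by (meson order_trans)
					ultimately show ?thesis using rb w unfolding reg_def by blast
				qed
				define b' where "b' k = be (v (vupd (vec 1) k (u $ k))) - u $ k * be (v (vec 1))" for k
				have b'c: "abs (b' k - cb be k (u $ k)) <= 2 * e" for k
				proof -
					have 1: "abs (be (v (vupd (vec 1) k (u $ k))) - be (vupd (vec 1) k (u $ k))) <= e" using cubeD[OF u, of k] by (intro vm vupd_cube) auto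
					have "abs (u $ k * (be (v (vec 1)) - be (vec 1))) <= 1 * e" unfolding abs_mult using cubeD[OF u, of k] vm[of "vec 1"] by (intro mult_mono) auto
					thus ?thesis using 1 unfolding b'_def cb_def by (simp add: right_diff_distrib)
				qed
				have b'b: "abs (b' k) <= 2 * C" for k
				proof -
					have "v (vupd (vec 1) k (u $ k)) : cube" "v (vec 1) : cube" using q vupd_cube[OF one_cube(1), of "u $ k" k] cubeD[OF u, of k] by (auto simp: qrel_def)
					hence 1: "abs (be (v (vupd (vec 1) k (u $ k)))) <= C" "abs (be (v (vec 1))) <= C" using rb by (auto simp: reg_def)
					hence "abs (u $ k * be (v (vec 1))) <= 1 * C" unfolding abs_mult using cubeD[OF u, of k] by (intro mult_mono) auto
					thus ?thesis using 1 unfolding b'_def by linarith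
				qed
				have dqk: "abs (dq n al v k u) <= R" "kp <= u $ k ==> u $ k <= 1 - kp ==> abs (dq n al v k u - pd k u) <= e3" for k
				proof -
					define up where "up = min (u $ k + 1 / rt n) 1"
					define um where "um = max (u $ k - 1 / rt n) 0"
					note st = difference_step[OF cubeD(1)[OF u, of k] cubeD(2)[OF u, of k] n, folded up_def um_def]
					have pos: "up - um > 0" using st(5) sn by (meson less_le_trans zero_less_divide_1_iff)
					have upc: "vupd u k up : cube" "vupd u k um : cube" using st u by (auto intro!: vupd_cube)
					have dqe: "dq n al v k u = (D (vupd u k up) - D (vupd u k um)) / (up - um) + (DP n al v (vupd u k up) - DP n al v (vupd u k um)) / (rt n * (up - um))"
						unfolding dq_def Db_def Let_def up_def[symmetric] um_def[symmetric] by (simp add: add_divide_distrib diff_divide_distrib)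
					have ge1: "1 <= rt n * (up - um)" using st(5) sn by (simp add: pos_divide_le_eq mult.commute)
					have small: "abs (x / (rt n * (up - um))) <= abs x" for x
					proof -
						have "abs x / (rt n * (up - um)) <= abs x / 1" using ge1 by (intro divide_left_mono) auto
						thus ?thesis using ge1 by (simp add: abs_divide)
					qed
					have "abs ((D (vupd u k up) - D (vupd u k um)) / (up - um)) <= 1"
					proof -
						have "abs (D (vupd u k up) - D (vupd u k um)) <= abs (up - um)" by (rule lipD1[OF u]) (use st in linarith)+
						thus ?thesis using pos by (simp add: abs_divide)
					qed
					moreover have "abs ((DP n al v (vupd u k up) - DP n al v (vupd u k um)) / (rt n * (up - um))) <= 2 * (C + d * H)"
					proof -
						have gen: "abs z <= 2 * c" if "abs z <= abs (x - y)" "abs x <= c" "abs y <= c" for x y z c :: real using that by linarith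
						show ?thesis unfolding d_def H_def by (rule gen[OF small DP_bound[OF ra q upc(1) n] DP_bound[OF ra q upc(2) n]])
					qed
					ultimately show "abs (dq n al v k u) <= R" unfolding dqe R_def by linarith
					assume k: "kp <= u $ k" "u $ k <= 1 - kp"
					obtain zt where zt: "0 <= zt" "zt <= 1" "min um up <= zt" "zt <= max um up"
						"D (vupd u k up) - D (vupd u k um) = pd k (vupd u k zt) * (up - um)"
						by (rule mvt_pd[OF u, of um up k]) (use st in auto)
					have h1: "1 / rt n <= m / 2" using elim(2) by simp
					have zu: "abs (zt - u $ k) <= m" using zt(3,4) st h1 m(1) by (auto simp: min_def max_def abs_le_iff split: if_splits)
					have "abs (pd k (vupd u k zt) - pd k u) <= e3 / 4"
					proof (rule uc)
						show "vupd u k zt : cube" using zt u by (intro vupd_cube)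
						show "ALL i. abs (vupd u k zt $ i - u $ i) <= de0" using zu m(2) de0 by auto
					qed (use zu k m(3) kp(1) u in \<open>auto simp: abs_le_iff\<close>)
					hence 1: "abs ((D (vupd u k up) - D (vupd u k um)) / (up - um) - pd k u) <= e3 / 4" using zt(5) pos by simp
					have "abs (Phi al (vupd u k up) - Phi al (vupd u k um)) <= e3 / 4"
					proof (rule deA(2)[OF reg_mono[OF ra e(2)] upc])
						show "ALL i. abs (vupd u k up $ i - vupd u k um $ i) <= deA" using st h1 m(4) deA(1) by (auto simp: abs_le_iff)
					qed
					hence "abs (DP n al v (vupd u k up) - DP n al v (vupd u k um)) <= 3 * (e3 / 4)"
						using DPa[OF upc(1)] DPa[OF upc(2)] by linarith
					hence "abs ((DP n al v (vupd u k up) - DP n al v (vupd u k um)) / (rt n * (up - um))) <= 3 * (e3 / 4)"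
						using small order_trans by blast
					thus "abs (dq n al v k u - pd k u) <= e3" using 1 unfolding dqe by linarith
				qed
				have tk: "abs (dq n al v k u * b' k - pd k u * cb be k (u $ k)) <= 2 * C * e3 + (2 + 4 * R) * e" for k
				proof (cases "kp <= u $ k & u $ k <= 1 - kp")
					case True
					have 1: "abs ((dq n al v k u - pd k u) * b' k) <= e3 * (2 * C)"
						unfolding abs_mult using dqk(2)[of k] True b'b[of k] e3 by (intro mult_mono) auto
					have 2: "abs (pd k u * (b' k - cb be k (u $ k))) <= 1 * (2 * e)"
						unfolding abs_mult using pd_bound[OF u, of k] b'c[of k] by (intro mult_mono) auto
					have 3: "dq n al v k u * b' k - pd k u * cb be k (u $ k) = (dq n al v k u - pd k u) * b' k + pd k u * (b' k - cb be k (u $ k))"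
						by (simp add: algebra_simps)
					have "0 <= 4 * R * e" using R0 e by simp
					thus ?thesis unfolding 3 using 1 2 by (simp add: algebra_simps)
				next
					case False
					have c: "abs (cb be k (u $ k)) <= 2 * e"
						using False cubeD[OF u, of k] kp kpC by (intro cb_edge[OF rb, of _ kp]) auto
					hence "abs (b' k) <= 4 * e" using b'c[of k] by linarith
					hence 1: "abs (dq n al v k u * b' k) <= R * (4 * e)" unfolding abs_mult using dqk(1)[of k] R0 by (intro mult_mono) auto
					have 2: "abs (pd k u * cb be k (u $ k)) <= 1 * (2 * e)" unfolding abs_mult using pd_bound[OF u, of k] c by (intro mult_mono) auto
					have "0 <= 2 * C * e3" using C e3 by simp
					thus ?thesis using 1 2 by (simp add: algebra_simps)
				qed
				have S1: "abs ((SUM k:UNIV. dq n al v k u * b' k) - (SUM k:UNIV. pd k u * cb be k (u $ k))) <= d * (2 * C * e3 + (2 + 4 * R) * e)"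
				proof -
					have "abs (SUM k:UNIV. dq n al v k u * b' k - pd k u * cb be k (u $ k)) <= (SUM k:(UNIV::'p set). 2 * C * e3 + (2 + 4 * R) * e)"
						by (intro order_trans[OF sum_abs] sum_mono tk)
					thus ?thesis by (simp add: sum_subtractf d_def)
				qed
				have S2: "abs (SUM k:UNIV. dq n al v k u * b' k) <= d * (R * (2 * C))"
				proof -
					have "abs (dq n al v k u * b' k) <= R * (2 * C)" for k unfolding abs_mult using dqk(1)[of k] b'b[of k] R0 by (intro mult_mono) auto
					hence "abs (SUM k:UNIV. dq n al v k u * b' k) <= (SUM k:(UNIV::'p set). R * (2 * C))"
						by (intro order_trans[OF sum_abs] sum_mono)
					thus ?thesis by (simp add: d_def)
				qed
				define ph where "ph = pa + al (vec 1) / rt n"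
				have al1: "abs (al (vec 1) / rt n) <= C / rt n" using ra sn by (auto simp: reg_def abs_divide divide_right_mono)
				hence ph: "ph >= pa / 2" unfolding ph_def using elim(4) by linarith
				have inv: "abs (1 / ph - 1 / pa) <= (2 * C / (pa * pa)) / rt n"
				proof -
					have php: "ph > 0" using ph pa by linarith
					have "1 / ph - 1 / pa = (pa - ph) / (ph * pa)" using pa php by (simp add: field_simps)
					hence "abs (1 / ph - 1 / pa) = abs (pa - ph) / (ph * pa)" using pa php by (simp add: abs_divide)
					also have "... <= (C / rt n) / ((pa / 2) * pa)"
						using al1 ph pa C sn by (intro frac_le mult_right_mono mult_pos_pos) (auto simp: ph_def)
					also have "... = (2 * C / (pa * pa)) / rt n" by (simp add: mult_ac)
					finally show ?thesis .
				qed
				have S3: "abs ((1 / ph - 1 / pa) * (SUM k:UNIV. dq n al v k u * b' k)) <= ep / 4"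
				proof -
					have "abs ((1 / ph - 1 / pa) * (SUM k:UNIV. dq n al v k u * b' k)) <= ((2 * C / (pa * pa)) / rt n) * (d * (R * (2 * C)))"
						unfolding abs_mult using inv S2 C pa sn by (intro mult_mono) auto
					also have "... = (4 * C * C * d * R / (pa * pa)) / rt n" by (simp add: mult_ac)
					finally show ?thesis using elim(5) by linarith
				qed
				have S4: "abs ((1 / pa) * ((SUM k:UNIV. dq n al v k u * b' k) - (SUM k:UNIV. pd k u * cb be k (u $ k)))) <= ep / 4 + d / pa * ((2 + 4 * R) * e)"
				proof -
					have "abs ((1 / pa) * ((SUM k:UNIV. dq n al v k u * b' k) - (SUM k:UNIV. pd k u * cb be k (u $ k)))) <= (1 / pa) * (d * (2 * C * e3 + (2 + 4 * R) * e))"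
						unfolding abs_mult using S1 pa by (intro mult_mono) auto
					also have "... = d / pa * (2 * C * e3) + d / pa * ((2 + 4 * R) * e)" by (simp add: distrib_left add_divide_distrib)
					also have "d / pa * (2 * C * e3) <= ep / 4"
					proof -
						obtain c where c: "c = C + 1" "c > 0" using C by simp
						have "d / pa * (2 * C * e3) = ep / 4 * (C / (C + 1))" unfolding e3_def c(1)[symmetric] using d0 pa c(2) by (simp add: field_simps)
						also have "... <= ep / 4 * 1" using ep C by (intro mult_left_mono) auto
						finally show ?thesis by simp
					qed
					finally show ?thesis by simp
				qed
				have S5: "e + d / pa * ((2 + 4 * R) * e) <= ep / 4"
				proof -
					have "e + d / pa * ((2 + 4 * R) * e) = e * (1 + d / pa * (2 + 4 * R))" by (simp add: algebra_simps)
					also have "... <= eC * (1 + d / pa * (2 + 4 * R))" using e(4) denC by (intro mult_right_mono) auto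
					also have "... = ep / 4" using denC by (metis eC_def less_irrefl nonzero_eq_divide_eq)
					finally show ?thesis .
				qed
				have eqn: "Dt n al be v u - Phi be u = (be (v u) - be u) - (1 / ph - 1 / pa) * (SUM k:UNIV. dq n al v k u * b' k)
						- (1 / pa) * ((SUM k:UNIV. dq n al v k u * b' k) - (SUM k:UNIV. pd k u * cb be k (u $ k)))"
					unfolding Dt_def Phi_def b'_def ph_def by (simp add: algebra_simps)
				have gen: "abs (x - y - z) <= ep" if "abs x <= e" "abs y <= ep / 4" "abs z <= ep / 4 + r" "e + r <= ep / 4" for x y z r :: real
					using that ep by linarith
				show "abs (Dt n al be v u - Phi be u) <= ep" unfolding eqn by (rule gen[OF vm[OF u] S3 S4 S5])
			qed
		qed
	qed
qed

end

section \<open>A central limit theorem conditional on the weights\<close>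

lemma exp_minus_quadratic:
	fixes y :: real
	assumes "y >= 0"
	shows "abs (exp (- y) - (1 - y)) <= y^2 / 2"
proof -
	have q: "1 + y + y^2 / 2 <= exp y" by (rule exp_lower_Taylor_quadratic[OF assms])
	have pos: "1 + y + y^2 / 2 > 0" using assms by (simp add: add_pos_nonneg)
	have "exp (- y) <= 1 / (1 + y + y^2 / 2)" unfolding exp_minus inverse_eq_divide using q pos by (intro divide_left_mono) auto
	also have "... <= 1 - y + y^2 / 2"
	proof -
		have "(1 - y + y^2 / 2) * (1 + y + y^2 / 2) = 1 + (y^2)^2 / 4" by (simp add: algebra_simps power2_eq_square)
		hence "1 <= (1 - y + y^2 / 2) * (1 + y + y^2 / 2)" by simp
		thus ?thesis using pos by (simp add: pos_divide_le_eq)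
	qed
	finally have "exp (- y) <= 1 - y + y^2 / 2" .
	moreover have "1 - y <= exp (- y)" using exp_ge_add_one_self[of "- y"] by simp
	ultimately show ?thesis by linarith
qed

lemma exp_diff_le:
	fixes x y :: real
	assumes "x <= 0" "abs (x - y) <= d"
	shows "abs (exp x - exp y) <= exp d - 1"
proof -
	have d: "0 <= d" using assms(2) by linarith
	have "exp y <= exp (x + d)" using assms by simp
	moreover have "exp (x - d) <= exp y" using assms by simp
	moreover have "exp (x + d) - exp x <= exp d - 1"
	proof -
		have "exp (x + d) - exp x = exp x * (exp d - 1)" by (simp add: exp_add algebra_simps)
		also have "... <= 1 * (exp d - 1)" using assms d by (intro mult_right_mono) auto
		finally show ?thesis by simp
	qed
	moreover have "exp x - exp (x - d) <= exp d - 1"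
	proof -
		have "exp x - exp (x - d) = exp (x - d) * (exp d - 1)" by (simp add: right_diff_distrib exp_add[symmetric])
		also have "... <= 1 * (exp d - 1)" using assms d by (intro mult_right_mono) auto
		finally show ?thesis by simp
	qed
	ultimately show ?thesis by linarith
qed

lemma cmod_cis_quadratic: "cmod (cis x - (1 + \<i> * cor x - cor (x^2 / 2))) <= abs x ^ 3 / 6"
proof -
	have "cmod (iexp x - (SUM k<=2. (\<i> * x) ^ k / fact k)) <= abs x ^ (Suc 2) / fact (Suc 2)" by (rule iexp_approx1)
	moreover have "(SUM k<=2. (\<i> * x) ^ k / fact k) = 1 + \<i> * cor x - cor (x^2 / 2)"
		by (simp add: numeral_2_eq_2 power_mult_distrib power2_eq_square)
	moreover have "iexp x = cis x" by (simp add: cis_conv_exp)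
	ultimately show ?thesis by (simp add: eval_nat_numeral)
qed

context box_class
begin

definition ze :: "real^'p => 'x => real" where "ze u x = bi u x - Dm u"

definition cv :: "real^'p => real^'p => real" where "cv u v = (\<integral>x. ze u x * ze v x \<partial>mm)"

lemma ze_measurable [measurable]: "ze u : bm mm" unfolding ze_def by measurable

lemma ze_bound: "abs (ze u x) <= 1" unfolding ze_def using bi_range[of u x] Dm_range[of u] by linarith

lemma ze_mult_bound: "abs (ze u x * ze v x) <= 1"
	unfolding abs_mult using mult_mono[OF ze_bound[of u x] ze_bound[of v x]] by simp

lemma ze_integrable: "integrable mm (ze u)" by (rule mu.integrable_bounded[where K=1]) (auto simp: ze_bound)

lemma ze_mult_integrable: "integrable mm (%x. ze u x * ze v x)"
	by (rule mu.integrable_bounded[where K=1]) (auto simp: ze_mult_bound)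

lemma ze_mean: "(\<integral>x. ze u x \<partial>mm) = 0"
	unfolding ze_def using bi_integrable by (simp add: Dm_def mu.prob_space)

lemma cv_bound: "abs (cv u v) <= 1"
proof -
	have "abs (cv u v) <= (\<integral>x. abs (ze u x * ze v x) \<partial>mm)" unfolding cv_def by (rule integral_abs_bound)
	also have "... <= (\<integral>x. 1 \<partial>mm)" using ze_mult_integrable[of u v] by (intro integral_mono) (auto simp: ze_mult_bound)
	finally show ?thesis by (simp add: mu.prob_space)
qed

text \<open>The error is proportional to the variance \<open>sg\<close> and can therefore be summed
  over the sample: the total variance stays bounded while the size \<open>c\<close> of a single term
  tends to 0.\<close>

lemma char_quadratic:
	fixes tt :: "'x => real"
	assumes m [measurable]: "tt : bm mm" and b: "!!x. abs (tt x) <= c" and mean: "(\<integral>x. tt x \<partial>mm) = 0"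
	defines "sg \<equiv> \<integral>x. (tt x)^2 \<partial>mm"
	shows "cmod ((\<integral>x. cis (tt x) \<partial>mm) - cor (exp (- sg / 2))) <= (c + c^2) * sg"
proof -
	have c: "0 <= c" using b abs_ge_zero order_trans by blast
	have sq: "(tt x)^2 <= c^2" for x using b[of x] by (metis abs_ge_zero power2_abs power_mono)
	have i1: "integrable mm tt" by (rule mu.integrable_bounded[where K=c]) (auto simp: b)
	have i2: "integrable mm (%x. (tt x)^2)" by (rule mu.integrable_bounded[where K="c^2"]) (auto simp: sq)
	have i3: "integrable mm (%x. cis (tt x))" by (rule mu.integrable_cis) measurable
	have sg0: "0 <= sg" unfolding sg_def by simp
	have sgc: "sg <= c^2"
	proof -
		have "sg <= (\<integral>x. c^2 \<partial>mm)" unfolding sg_def using i2 sq by (intro integral_mono) auto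
		thus ?thesis by (simp add: mu.prob_space)
	qed
	let ?q = "%x. 1 + \<i> * cor (tt x) - cor ((tt x)^2 / 2)"
	have i2': "integrable mm (%x. cor ((tt x)^2 / 2))" using i2 by (intro integrable_of_real) simp
	have iq: "integrable mm ?q" by (intro Bochner_Integration.integrable_diff Bochner_Integration.integrable_add i2' Bochner_Integration.integrable_mult_right integrable_of_real i1) simp
	have qv: "(\<integral>x. ?q x \<partial>mm) = cor (1 - sg / 2)"
	proof -
		have "(\<integral>x. ?q x \<partial>mm) = (\<integral>x. 1 + \<i> * cor (tt x) \<partial>mm) - (\<integral>x. cor ((tt x)^2 / 2) \<partial>mm)"
			using i1 by (intro Bochner_Integration.integral_diff i2') auto
		also have "(\<integral>x. cor ((tt x)^2 / 2) \<partial>mm) = cor (\<integral>x. (tt x)^2 / 2 \<partial>mm)" by (rule integral_of_real) (use i2 in simp)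
		also have "(\<integral>x. (tt x)^2 / 2 \<partial>mm) = sg / 2" by (simp add: sg_def)
		also have "(\<integral>x. 1 + \<i> * cor (tt x) \<partial>mm) = 1" using i1 mean by (simp add: mu.prob_space)
		finally show ?thesis by simp
	qed
	have "cmod ((\<integral>x. cis (tt x) \<partial>mm) - cor (1 - sg / 2)) = cmod (\<integral>x. cis (tt x) - ?q x \<partial>mm)"
		unfolding qv[symmetric] using i3 iq by simp
	also have "... <= (\<integral>x. cmod (cis (tt x) - ?q x) \<partial>mm)" by (rule integral_norm_bound)
	also have "... <= (\<integral>x. c * (tt x)^2 / 6 \<partial>mm)"
	proof (rule integral_mono)
		show "integrable mm (%x. cmod (cis (tt x) - ?q x))" using i3 iq by auto
		show "integrable mm (%x. c * (tt x)^2 / 6)" using i2 by auto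
		fix x
		have "abs (tt x) ^ 3 = abs (tt x) * (tt x)^2" by (simp add: power3_eq_cube power2_eq_square)
		also have "... <= c * (tt x)^2" using b[of x] by (intro mult_right_mono) auto
		finally show "cmod (cis (tt x) - ?q x) <= c * (tt x)^2 / 6" using cmod_cis_quadratic[of "tt x"] by linarith
	qed
	also have "... = c * sg / 6" by (simp add: sg_def)
	finally have A: "cmod ((\<integral>x. cis (tt x) \<partial>mm) - cor (1 - sg / 2)) <= c * sg / 6" .
	have "abs (exp (- (sg / 2)) - (1 - sg / 2)) <= (sg / 2)^2 / 2" using sg0 by (intro exp_minus_quadratic) simp
	also have "... = sg * sg / 8" by (simp add: power2_eq_square)
	also have "... <= c^2 * sg / 8" using mult_right_mono[OF sgc sg0] by (intro divide_right_mono) auto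
	finally have B: "abs (exp (- sg / 2) - (1 - sg / 2)) <= c^2 * sg / 8" by simp
	have B': "cmod (cor (1 - sg / 2) - cor (exp (- sg / 2))) <= c^2 * sg / 8"
		using B unfolding of_real_diff[symmetric] norm_of_real by (simp add: abs_minus_commute)
	have "0 <= c * sg" "0 <= c^2 * sg" using c sg0 by auto
	moreover have "cmod ((\<integral>x. cis (tt x) \<partial>mm) - cor (exp (- sg / 2))) <= c * sg / 6 + c^2 * sg / 8"
		using norm_triangle_mono[OF A B'] by simp
	ultimately show ?thesis by (simp add: distrib_right)
qed

text \<open>A Lindeberg argument with frozen weights: \<open>kp\<close> bounds the single terms and
  the deviation of the Gram matrix of the weight rows from the identity. The exponent
  \<open>Vr\<close> has no terms between different rows, which is where the independence of the
  limit processes comes from.\<close>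

lemma conditional_char:
	fixes S :: "(nat \<times> (real^'p)) set" and t :: "nat \<times> (real^'p) => real" and a :: "nat => nat => real"
	assumes S: "finite S" and I: "finite I" and kp: "kp >= 0"
		and small: "!!s i. s : S ==> i : I ==> abs (a (fst s) i) <= kp"
		and cross: "!!s s'. s : S ==> s' : S ==> abs ((SUM i:I. a (fst s) i * a (fst s') i) - (if fst s = fst s' then 1 else 0)) <= kp"
	defines "B \<equiv> SUM s:S. abs (t s)"
		and "Vr \<equiv> SUM s:S. SUM s':S. t s * t s' * (if fst s = fst s' then cv (snd s) (snd s') else 0)"
	shows "cmod ((\<integral>x. cis (SUM s:S. t s * (SUM i:I. a (fst s) i * ze (snd s) (x i))) \<partial>(PiM I (%i. mm))) - cor (exp (- Vr / 2)))
		 <= (B * kp + (B * kp)^2) * (B^2 * (1 + kp)) + (exp (B^2 * kp) - 1)"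
proof -
	interpret product_prob_space "%_::nat. mm" by unfold_locales
	define tt where "tt i x = (SUM s:S. t s * (a (fst s) i * ze (snd s) x))" for i x
	define sg where "sg i = (\<integral>x. (tt i x)^2 \<partial>mm)" for i
	define cr where "cr s s' = (SUM i:I. a (fst s) i * a (fst s') i)" for s s' :: "nat \<times> (real^'p)"
	have B0: "0 <= B" unfolding B_def by (intro sum_nonneg) auto
	have ttm [measurable]: "tt i : bm mm" for i unfolding tt_def by measurable
	have ttb: "abs (tt i x) <= B * kp" if i: "i : I" for i x
	proof -
		have "abs (tt i x) <= (SUM s:S. abs (t s) * kp)" unfolding tt_def
		proof (rule order_trans[OF sum_abs], rule sum_mono)
			fix s assume s: "s : S"
			have "abs (a (fst s) i) * abs (ze (snd s) x) <= kp * 1" using small[OF s i] ze_bound[of "snd s" x] kp by (intro mult_mono) auto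
			thus "abs (t s * (a (fst s) i * ze (snd s) x)) <= abs (t s) * kp" unfolding abs_mult by (intro mult_left_mono) auto
		qed
		thus ?thesis by (simp add: B_def sum_distrib_right)
	qed
	have mean: "(\<integral>x. tt i x \<partial>mm) = 0" for i unfolding tt_def using ze_integrable ze_mean by simp
	have fac: "(\<integral>x. cis (SUM s:S. t s * (SUM i:I. a (fst s) i * ze (snd s) (x i))) \<partial>(PiM I (%i. mm))) = (PROD i:I. \<integral>x. cis (tt i x) \<partial>mm)"
	proof -
		have "(SUM s:S. t s * (SUM i:I. a (fst s) i * ze (snd s) (x i))) = (SUM i:I. tt i (x i))" for x
			unfolding tt_def sum_distrib_left by (rule sum.swap)
		moreover have "cis (SUM i:I. tt i (x i)) = (PROD i:I. cis (tt i (x i)))" for x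
			by (simp add: cis_conv_exp sum_distrib_left exp_sum[OF I])
		ultimately show ?thesis using product_integral_prod[OF I, of "%i x. cis (tt i x)"] mu.integrable_cis[OF ttm] by simp
	qed
	have sg0: "0 <= sg i" for i unfolding sg_def by simp
	have step: "cmod ((PROD i:I. \<integral>x. cis (tt i x) \<partial>mm) - (PROD i:I. cor (exp (- sg i / 2)))) <= (SUM i:I. (B * kp + (B * kp)^2) * sg i)"
	proof (rule order_trans[OF norm_prod_diff])
		fix i
		have "cmod (\<integral>x. cis (tt i x) \<partial>mm) <= (\<integral>x. cmod (cis (tt i x)) \<partial>mm)" by (rule integral_norm_bound)
		thus "cmod (\<integral>x. cis (tt i x) \<partial>mm) <= 1" by (simp add: mu.prob_space)
		show "cmod (cor (exp (- sg i / 2))) <= 1" using sg0[of i] by simp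
	next
		show "(SUM i:I. cmod ((\<integral>x. cis (tt i x) \<partial>mm) - cor (exp (- sg i / 2)))) <= (SUM i:I. (B * kp + (B * kp)^2) * sg i)"
			unfolding sg_def using mean ttb by (intro sum_mono char_quadratic[OF ttm]) auto
	qed
	have ex: "(PROD i:I. cor (exp (- sg i / 2))) = cor (exp (- (SUM i:I. sg i) / 2))"
		by (simp add: exp_sum[OF I] sum_divide_distrib sum_negf[symmetric] of_real_prod[symmetric] del: of_real_prod of_real_exp)
	have sgv: "sg i = (SUM s:S. SUM s':S. t s * t s' * cv (snd s) (snd s') * (a (fst s) i * a (fst s') i))" for i
	proof -
		have "(tt i x)^2 = (SUM s:S. SUM s':S. t s * t s' * (a (fst s) i * a (fst s') i) * (ze (snd s) x * ze (snd s') x))" for x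
			unfolding tt_def power2_eq_square sum_product by (intro sum.cong refl) (simp add: mult_ac)
		hence "sg i = (SUM s:S. SUM s':S. t s * t s' * (a (fst s) i * a (fst s') i) * cv (snd s) (snd s'))"
			unfolding sg_def cv_def using ze_mult_integrable by (simp add: Bochner_Integration.integral_sum)
		thus ?thesis by (simp add: mult_ac)
	qed
	have tot: "(SUM i:I. sg i) = (SUM s:S. SUM s':S. t s * t s' * cv (snd s) (snd s') * cr s s')"
	proof -
		have "(SUM i:I. sg i) = (SUM s:S. SUM i:I. SUM s':S. t s * t s' * cv (snd s) (snd s') * (a (fst s) i * a (fst s') i))" unfolding sgv by (rule sum.swap)
		also have "... = (SUM s:S. SUM s':S. SUM i:I. t s * t s' * cv (snd s) (snd s') * (a (fst s) i * a (fst s') i))" by (intro sum.cong refl sum.swap)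
		finally show ?thesis unfolding cr_def by (simp add: sum_distrib_left)
	qed
	have B2: "B^2 = (SUM s:S. SUM s':S. abs (t s) * abs (t s'))" unfolding B_def power2_eq_square sum_product by simp
	have tot_le: "(SUM i:I. sg i) <= B^2 * (1 + kp)"
	proof -
		have "t s * t s' * cv (snd s) (snd s') * cr s s' <= abs (t s) * abs (t s') * (1 + kp)" if s: "s : S" "s' : S" for s s'
		proof -
			have "abs (cr s s') <= 1 + kp" using cross[OF s] unfolding cr_def by (auto split: if_splits)
			hence "abs (cv (snd s) (snd s')) * abs (cr s s') <= 1 * (1 + kp)" using cv_bound by (intro mult_mono) auto
			hence "abs (t s) * abs (t s') * (abs (cv (snd s) (snd s')) * abs (cr s s')) <= abs (t s) * abs (t s') * (1 + kp)" by (intro mult_left_mono) auto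
			moreover have "t s * t s' * cv (snd s) (snd s') * cr s s' <= abs (t s * t s' * cv (snd s) (snd s') * cr s s')" by (rule abs_ge_self)
			ultimately show ?thesis by (simp add: abs_mult mult_ac)
		qed
		thus ?thesis unfolding tot B2 sum_distrib_right by (intro sum_mono)
	qed
	have tot_V: "abs ((SUM i:I. sg i) - Vr) <= B^2 * kp"
	proof -
		have "(SUM i:I. sg i) - Vr = (SUM s:S. SUM s':S. t s * t s' * cv (snd s) (snd s') * (cr s s' - (if fst s = fst s' then 1 else 0)))"
			unfolding tot Vr_def sum_subtractf[symmetric] by (intro sum.cong refl) (auto simp: algebra_simps)
		also have "abs (...) <= (SUM s:S. SUM s':S. abs (t s) * abs (t s') * kp)"
		proof (rule order_trans[OF sum_abs], rule sum_mono, rule order_trans[OF sum_abs], rule sum_mono)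
			fix s s' assume s: "s : S" "s' : S"
			have "abs (cv (snd s) (snd s')) * abs (cr s s' - (if fst s = fst s' then 1 else 0)) <= 1 * kp"
				using cross[OF s] cv_bound unfolding cr_def by (intro mult_mono) auto
			hence "abs (t s) * abs (t s') * (abs (cv (snd s) (snd s')) * abs (cr s s' - (if fst s = fst s' then 1 else 0))) <= abs (t s) * abs (t s') * kp"
				by (intro mult_left_mono) auto
			thus "abs (t s * t s' * cv (snd s) (snd s') * (cr s s' - (if fst s = fst s' then 1 else 0))) <= abs (t s) * abs (t s') * kp"
				by (simp only: abs_mult mult.assoc)
		qed
		finally show ?thesis unfolding B2 sum_distrib_right .
	qed
	have "abs (exp (- (SUM i:I. sg i) / 2) - exp (- Vr / 2)) <= exp (B^2 * kp) - 1"
	proof (rule exp_diff_le)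
		show "- (SUM i:I. sg i) / 2 <= 0" using sg0 by (simp add: sum_nonneg)
		show "abs (- (SUM i:I. sg i) / 2 - - Vr / 2) <= B^2 * kp" using tot_V by linarith
	qed
	hence E: "cmod (cor (exp (- (SUM i:I. sg i) / 2)) - cor (exp (- Vr / 2))) <= exp (B^2 * kp) - 1"
		unfolding of_real_diff[symmetric] norm_of_real .
	have "(SUM i:I. (B * kp + (B * kp)^2) * sg i) <= (B * kp + (B * kp)^2) * (B^2 * (1 + kp))"
		unfolding sum_distrib_left[symmetric] using tot_le B0 kp by (intro mult_left_mono) auto
	hence F: "cmod ((PROD i:I. \<integral>x. cis (tt i x) \<partial>mm) - cor (exp (- (SUM i:I. sg i) / 2))) <= (B * kp + (B * kp)^2) * (B^2 * (1 + kp))"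
		using step unfolding ex by linarith
	show ?thesis unfolding fac using norm_triangle_mono[OF F E] by simp
qed

lemma conditional_char_limit:
	fixes S :: "(nat \<times> (real^'p)) set" and t :: "nat \<times> (real^'p) => real"
	assumes S: "finite S" and ep: "ep > 0"
	defines "Vr \<equiv> SUM s:S. SUM s':S. t s * t s' * (if fst s = fst s' then cv (snd s) (snd s') else 0)"
	obtains kp where "kp > 0" "!!(I :: nat set) (a :: nat => nat => real). finite I ==> (!!s i. s : S ==> i : I ==> abs (a (fst s) i) <= kp) ==>
		 (!!s s'. s : S ==> s' : S ==> abs ((SUM i:I. a (fst s) i * a (fst s') i) - (if fst s = fst s' then 1 else 0)) <= kp) ==>
		 cmod ((\<integral>x. cis (SUM s:S. t s * (SUM i:I. a (fst s) i * ze (snd s) (x i))) \<partial>(PiM I (%i. mm))) - cor (exp (- Vr / 2))) <= ep"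
proof -
	define B where "B = (SUM s:S. abs (t s))"
	define f where "f kp = (B * kp + (B * kp)^2) * (B^2 * (1 + kp)) + (exp (B^2 * kp) - 1)" for kp :: real
	have "isCont f 0" unfolding f_def by (intro continuous_intros)
	hence "(f \<longlongrightarrow> 0) (at 0)" unfolding isCont_def by (simp add: f_def)
	hence "(f \<longlongrightarrow> 0) (at_right 0)" by (rule filterlim_mono) (auto simp: at_within_le_at)
	hence "\<forall>\<^sub>F kp in at_right 0. f kp < ep" using ep by (rule order_tendstoD)
	moreover have "\<forall>\<^sub>F kp in at_right (0::real). kp > 0" by (rule eventually_at_right_less)
	ultimately have "\<forall>\<^sub>F kp in at_right 0. f kp < ep & kp > 0" by eventually_elim simp
	then obtain kp where kp: "f kp < ep" "kp > 0" using eventually_happens'[OF trivial_limit_at_right_real] by blast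
	show ?thesis
	proof (rule that[OF kp(2)])
		fix I :: "nat set" and a :: "nat => nat => real"
		assume I: "finite I" and sm: "!!s i. s : S ==> i : I ==> abs (a (fst s) i) <= kp"
			and cr: "!!s s'. s : S ==> s' : S ==> abs ((SUM i:I. a (fst s) i * a (fst s') i) - (if fst s = fst s' then 1 else 0)) <= kp"
		have "kp >= 0" using kp by simp
		from conditional_char[OF S I this sm cr, of t]
		show "cmod ((\<integral>x. cis (SUM s:S. t s * (SUM i:I. a (fst s) i * ze (snd s) (x i))) \<partial>(PiM I (%i. mm))) - cor (exp (- Vr / 2))) <= ep"
			using kp(1) unfolding f_def B_def Vr_def by linarith
	qed
qed

end

section \<open>The sample\<close>

locale copula_data =
	fixes P :: "'w measure" and V :: "nat => 'w => (real^'p::finite) \<times> (real^'q::finite)" and A :: "(real^'q) set"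
	assumes prob: "prob_space P"
		and indepV: "prob_space.indep_vars P (%_. borel) V UNIV"
		and idV: "ALL i. distr P borel (V i) = distr P borel (V 0)"
		and A_borel: "A : sets borel" and pA_pos: "pA P V A > 0"
		and margins_cont: "ALL k. continuous_on UNIV (condF P V A k)"
		and C: "condC P V A"
begin

sublocale P: prob_space P by (rule prob)

definition mu :: "((real^'p) \<times> (real^'q)) measure" where "mu = distr P borel (V 0)"
definition As :: "((real^'p) \<times> (real^'q)) set" where "As = {x. snd x : A}"
definition Uf :: "(real^'p) \<times> (real^'q) => 'p => real" where "Uf x k = condF P V A k (fst x $ k)"
abbreviation "pAA \<equiv> pA P V A"

lemma V_measurable [measurable]: "V i : measurable P borel"
	using indepV unfolding P.indep_vars_def2 by auto

lemma prob_mu: "prob_space mu" unfolding mu_def by (intro P.prob_space_distr) simp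

sublocale mu: prob_space mu by (rule prob_mu)

lemma space_mu [simp]: "space mu = UNIV" and sets_mu [measurable_cong]: "sets mu = sets borel"
	by (simp_all add: mu_def)

lemma fst_comp_measurable [measurable]: "(%x :: (real^'p) \<times> (real^'q). fst x $ k) : bm borel"
	by (intro borel_measurable_continuous_onI continuous_intros)

lemma snd_borel [measurable]: "(%x :: (real^'p) \<times> (real^'q). snd x) : measurable borel borel"
	by (intro borel_measurable_continuous_onI continuous_intros)

lemma As_borel [measurable]: "As : sets borel"
proof -
	have "As = (%x :: (real^'p) \<times> (real^'q). snd x) -` A Int space borel" by (auto simp: As_def)
	thus ?thesis using measurable_sets[OF snd_borel A_borel] by simp
qed

lemma condF_borel [measurable]: "condF P V A k : bm borel"
	using margins_cont by (intro borel_measurable_continuous_onI) auto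

lemma Uf_borel [measurable]: "(%x. Uf x k) : bm borel"
	unfolding Uf_def by measurable

lemma measure_mu: "S : sets borel ==> measure mu S = measure P {om : space P. V 0 om : S}"
	unfolding mu_def by (subst measure_distr) (auto intro!: arg_cong[where f="measure P"])

lemma measure_V: "S : sets borel ==> measure P {om : space P. V i om : S} = measure mu S"
proof -
	assume S: "S : sets borel"
	have "mu = distr P borel (V i)" unfolding mu_def using idV by metis
	thus ?thesis using S by (simp add: measure_distr) (auto intro!: arg_cong[where f="measure P"])
qed

lemma pA_mu: "pAA = measure mu As"
	unfolding measure_mu[OF As_borel] by (simp add: pA_def As_def)

lemma pA_le_1: "pAA <= 1" unfolding pA_mu by simp

lemma condF_mu: "condF P V A k t = measure mu {x : As. fst x $ k <= t} / pAA"
proof -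
	have "{x : As. fst x $ k <= t} = {x : space borel. x : As & fst x $ k <= t}" by auto
	also have "... : sets borel" by measurable
	finally show ?thesis by (subst measure_mu) (auto simp: condF_def As_def conj_commute)
qed

lemma As_le_borel: "{x : As. fst x $ k <= t} : sets borel"
proof -
	have "{x : As. fst x $ k <= t} = {x : space borel. x : As & fst x $ k <= t}" by auto
	also have "... : sets borel" by measurable
	finally show ?thesis .
qed

lemma condF_mono: "s <= t ==> condF P V A k s <= condF P V A k t"
	unfolding condF_mu using pA_pos As_le_borel by (intro divide_right_mono mu.finite_measure_mono) (auto simp: mu_def)

lemma condF_range: "0 <= condF P V A k t" "condF P V A k t <= 1"
proof -
	show "0 <= condF P V A k t" unfolding condF_mu using pA_pos by simp
	have "measure mu {x : As. fst x $ k <= t} <= pAA" unfolding pA_mu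
		by (intro mu.finite_measure_mono) (auto simp: sets_mu)
	thus "condF P V A k t <= 1" unfolding condF_mu using pA_pos by simp
qed

lemma condF_top: assumes "t < 1" shows "EX s. t < condF P V A k s"
proof -
	have "(%n. measure mu {x : As. fst x $ k <= real n}) \<longlonglongrightarrow> measure mu (\<Union>n. {x : As. fst x $ k <= real n})"
		using As_le_borel by (intro mu.finite_Lim_measure_incseq) (auto simp: incseq_def sets_mu)
	also have "(\<Union>n. {x : As. fst x $ k <= real n}) = As" using real_arch_simple by auto
	finally have "(%n. condF P V A k (real n)) \<longlonglongrightarrow> measure mu As / pAA" unfolding condF_mu by (intro tendsto_intros) (use pA_pos in auto)
	hence "(%n. condF P V A k (real n)) \<longlonglongrightarrow> 1" using pA_pos by (simp add: pA_mu)
	hence "\<forall>\<^sub>F n in sequentially. t < condF P V A k (real n)" using assms by (rule order_tendstoD)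
	thus ?thesis by (auto simp: eventually_sequentially)
qed

lemma condF_bot: assumes "0 < t" shows "EX s. condF P V A k s < t"
proof -
	have "(%n. measure mu {x : As. fst x $ k <= - real n}) \<longlonglongrightarrow> measure mu (\<Inter>n. {x : As. fst x $ k <= - real n})"
		using As_le_borel by (intro mu.finite_Lim_measure_decseq) (auto simp: decseq_def sets_mu)
	also have "(\<Inter>n. {x : As. fst x $ k <= - real n}) = {}"
	proof -
		have "EX n. ~ fst x $ k <= - real n" for x :: "(real^'p) \<times> (real^'q)"
			using reals_Archimedean2[of "- (fst x $ k)"] unfolding not_le by (metis minus_less_iff)
		thus ?thesis by blast
	qed
	finally have "(%n. condF P V A k (- real n)) \<longlonglongrightarrow> measure mu {} / pAA" unfolding condF_mu by (intro tendsto_intros) (use pA_pos in auto)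
	hence "(%n. condF P V A k (- real n)) \<longlonglongrightarrow> 0" by simp
	hence "\<forall>\<^sub>F n in sequentially. condF P V A k (- real n) < t" using assms by (rule order_tendstoD)
	thus ?thesis by (auto simp: eventually_sequentially)
qed

lemma Uf_le_borel: "{x : As. Uf x k <= t} : sets borel"
proof -
	have "{x : As. Uf x k <= t} = {x : space borel. x : As & Uf x k <= t}" by auto
	also have "... : sets borel" by measurable
	finally show ?thesis .
qed

text \<open>Probability integral transform with total mass \<open>pAA\<close> in place of 1.
  \<open>condF\<close> may be flat, so the event \<open>U <= t\<close> is described by the largest
  point \<open>Sup ?S\<close> of the level set; continuity places the value \<open>t\<close>
  there.\<close>

lemma uniform_margin: assumes "0 <= t" shows "measure mu {x : As. Uf x k <= t} = pAA * min t 1"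
proof -
	have mid: "measure mu {x : As. Uf x k <= t} = pAA * t" if t: "0 < t" "t < 1" for t
	proof -
		let ?F = "condF P V A k" and ?S = "{s. condF P V A k s <= t}"
		obtain a where a: "?F a < t" using condF_bot[OF t(1)] by blast
		obtain b where b: "t < ?F b" using condF_top[OF t(2)] by blast
		have ab: "a < b" using a b condF_mono[of b a k] by (meson less_trans not_le order.asym less_le_not_le)
		have "EX s>=a. s <= b & ?F s = t"
			using ab a b margins_cont by (intro IVT') (auto intro: continuous_on_subset)
		then obtain s0 where s0: "?F s0 = t" by blast
		have bdd: "bdd_above ?S"
		proof (rule bdd_aboveI[of _ b])
			fix s assume "s : ?S"
			thus "s <= b" using b condF_mono[of b s k] by (smt (verit) mem_Collect_eq)
		qed
		have "closed ?S" using margins_cont by (intro closed_Collect_le) auto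
		hence in_S: "Sup ?S : ?S" using s0 bdd by (intro closed_contains_Sup) auto
		have "s0 <= Sup ?S" using s0 bdd by (intro cSup_upper) auto
		hence FS: "?F (Sup ?S) = t" using condF_mono[of s0 "Sup ?S" k] in_S s0 by auto
		have "{x : As. Uf x k <= t} = {x : As. fst x $ k <= Sup ?S}"
		proof (intro set_eqI iffI; clarify)
			fix x y assume "(x, y) : As" "Uf (x, y) k <= t"
			thus "fst (x, y) $ k <= Sup ?S" using bdd by (intro cSup_upper) (auto simp: Uf_def)
		next
			fix x y assume "(x, y) : As" "fst (x, y) $ k <= Sup ?S"
			thus "Uf (x, y) k <= t" using condF_mono[of "x $ k" "Sup ?S" k] FS by (simp add: Uf_def)
		qed
		thus ?thesis using FS pA_pos unfolding condF_mu by (simp add: field_simps)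
	qed
	consider "t = 0" | "0 < t" "t < 1" | "1 <= t" using assms by linarith
	thus ?thesis
	proof cases
		case 1
		have "measure mu {x : As. Uf x k <= 0} <= ep" if "ep > 0" for ep
		proof -
			define s where "s = min ep (1 / 2)"
			have s: "0 < s" "s < 1" "s <= ep" using that by (auto simp: s_def)
			have "measure mu {x : As. Uf x k <= 0} <= measure mu {x : As. Uf x k <= s}"
				using s Uf_le_borel by (intro mu.finite_measure_mono) (auto simp: sets_mu)
			also have "... = pAA * s" using s by (intro mid)
			also have "... <= 1 * s" using pA_le_1 s by (intro mult_right_mono) auto
			finally show ?thesis using s by linarith
		qed
		hence "measure mu {x : As. Uf x k <= 0} <= 0" by (rule field_le_epsilon[where y=0, simplified])
		thus ?thesis using 1 by (simp add: measure_le_0_iff)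
	next
		case 2
		thus ?thesis using mid by simp
	next
		case 3
		have "{x : As. Uf x k <= t} = As" using condF_range(2) 3 by (auto simp: Uf_def intro: order_trans)
		thus ?thesis using 3 by (simp add: pA_mu)
	qed
qed

lemma slab_mu: assumes "0 <= s" "s <= t" shows "measure mu {x : As. s < Uf x k & Uf x k <= t} <= t - s"
proof -
	have "measure mu ({x : As. Uf x k <= t} - {x : As. Uf x k <= s}) = measure mu {x : As. Uf x k <= t} - measure mu {x : As. Uf x k <= s}"
		using Uf_le_borel assms by (intro mu.finite_measure_Diff) (auto simp: sets_mu)
	moreover have "{x : As. s < Uf x k & Uf x k <= t} = {x : As. Uf x k <= t} - {x : As. Uf x k <= s}" by auto
	ultimately have "measure mu {x : As. s < Uf x k & Uf x k <= t} = measure mu {x : As. Uf x k <= t} - measure mu {x : As. Uf x k <= s}"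
		by (simp only:)
	also have "... = pAA * (min t 1 - min s 1)" using assms by (simp add: uniform_margin right_diff_distrib)
	also have "... <= 1 * (min t 1 - min s 1)" using pA_le_1 assms by (intro mult_right_mono) auto
	also have "... <= t - s" using assms by (auto simp: min_def)
	finally show ?thesis .
qed

sublocale bx: box_class mu As Uf
proof
	show "As : sets mu" by (simp add: sets_mu)
	show "(%x. Uf x k) : bm mu" for k by measurable
qed (use prob_mu slab_mu in auto)

lemma box_borel: "{x : As. ALL k. Uf x k <= u $ k} : sets borel"
proof -
	have "{x : As. ALL k. Uf x k <= u $ k} = {x : space borel. x : As & (ALL k. Uf x k <= u $ k)}" by auto
	also have "... : sets borel" by measurable
	finally show ?thesis .
qed

lemma Dm_measure: "bx.Dm u = measure mu {x : As. ALL k. Uf x k <= u $ k}"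
proof -
	have "bx.Dm u = (\<integral>x. indicator {x : As. ALL k. Uf x k <= u $ k} x \<partial>mu)"
		unfolding bx.Dm_def by (rule Bochner_Integration.integral_cong) (auto simp: bx.bi_def)
	thus ?thesis using box_borel by (simp add: sets_mu)
qed

lemma DD_Dm: "DD P V A u = bx.Dm u"
	unfolding Dm_measure using box_borel by (subst measure_mu) (auto simp: DD_def As_def Uf_def conj_commute)

lemma cond_copula_Dm: "cond_copula P V A u = bx.Dm u / pAA"
	using DD_Dm[of u] by (simp add: cond_copula_def DD_def)

lemma covB_Dm: "covB P V A u v = bx.Dm (vmin u v) - bx.Dm u * bx.Dm v"
	unfolding covB_def cond_copula_Dm using pA_pos by (simp add: power2_eq_square)

lemma Dm_margin: assumes "0 <= t" "t <= 1" shows "bx.Dm (vupd (vec 1) k t) = pAA * t"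
proof -
	have "{x : As. ALL i. Uf x i <= vupd (vec 1) k t $ i} = {x : As. Uf x k <= t}"
		using condF_range(2) by (auto simp: Uf_def split: if_splits)
	thus ?thesis unfolding Dm_measure using uniform_margin[of t k] assms by simp
qed

lemma Dm_one: "bx.Dm (vec 1) = pAA"
proof -
	have "{x : As. ALL i. Uf x i <= vec 1 $ i} = As" using condF_range(2) by (auto simp: Uf_def)
	thus ?thesis unfolding Dm_measure by (simp add: pA_mu)
qed

lemma Dm_zero: assumes "u $ k = 0" shows "bx.Dm u = 0"
proof -
	have "bx.Dm u <= measure mu {x : As. Uf x k <= 0}" unfolding Dm_measure
		using Uf_le_borel assms by (intro mu.finite_measure_mono) (auto simp: sets_mu, metis)
	thus ?thesis using uniform_margin[of 0 k] bx.Dm_range(1)[of u] by simp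
qed

sublocale sc: smooth_copula "DD P V A" pAA "pdD P V A"
proof
	show "abs (DD P V A u - DD P V A v) <= (SUM k:UNIV. abs (u $ k - v $ k))" if "u : cube" "v : cube" for u v
		unfolding DD_Dm using that by (rule bx.Dm_diff)
	show "((%t. DD P V A (vupd u k t)) has_real_derivative pdD P V A k u) (at (u $ k))" if "u : cube" "0 < u $ k" "u $ k < 1" for u k
		using C that unfolding condC_def pdD_def by (simp add: DERIV_deriv_iff_real_differentiable)
	show "continuous_on {u : cube. 0 < u $ k & u $ k < 1} (pdD P V A k)" for k using C unfolding condC_def by blast
qed (use pA_pos in \<open>auto simp: pdD_def\<close>)

lemma Dinf_Phi: "Dinf P V A b u = sc.Phi b u"
	by (simp add: Dinf_def sc.Phi_def sc.cb_def)

lemma bi_vmin: "bx.bi u x * bx.bi v x = bx.bi (vmin u v) x"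
	by (auto simp: bx.bi_def vmin_def)

text \<open>A product of two box indicators is the indicator of the box at the componentwise
  minimum, so \<open>covB\<close> is the covariance of the box indicators.\<close>

lemma covB_integral: "covB P V A u v = (\<integral>x. (bx.bi u x - bx.Dm u) * (bx.bi v x - bx.Dm v) \<partial>mu)"
proof -
	have "(\<integral>x. (bx.bi u x - bx.Dm u) * (bx.bi v x - bx.Dm v) \<partial>mu) = (\<integral>x. bx.bi (vmin u v) x - bx.Dm u * bx.bi v x - bx.Dm v * bx.bi u x + bx.Dm u * bx.Dm v \<partial>mu)"
		by (intro Bochner_Integration.integral_cong) (auto simp: algebra_simps bi_vmin[symmetric])
	also have "... = bx.Dm (vmin u v) - bx.Dm u * bx.Dm v - bx.Dm v * bx.Dm u + bx.Dm u * bx.Dm v"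
		using bx.bi_integrable by (simp add: bx.Dm_def[symmetric])
	finally show ?thesis unfolding covB_Dm by simp
qed

text \<open>Ties have probability zero: cover the tie event of two observations by \<open>h\<close> squares of probability at most \<open>1 / h\<^sup>2\<close>.\<close>

lemma no_tie_AE:
	assumes ij: "i ~= j"
	shows "AE om in P. ~ (V i om : As & V j om : As & Uf (V i om) k = Uf (V j om) k & Uf (V i om) k > 0)"
proof -
	let ?T = "{om : space P. V i om : As & V j om : As & Uf (V i om) k = Uf (V j om) k & Uf (V i om) k > 0}"
	have Tm: "?T : sets P" by measurable
	have bnd: "measure P ?T <= 1 / real h" if h: "h > 0" for h :: nat
	proof -
		\<comment> \<open>The slabs are open on the left, hence the condition \<open>Uf > 0\<close> in the
		  tie event; the value 0 is excluded separately by \<open>pos_AE\<close>.\<close>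
		define S where "S r = {x : As. real r / real h < Uf x k & Uf x k <= (real r + 1) / real h}" for r :: nat
		have Sm: "S r : sets borel" for r
		proof -
			have "S r = {x : space borel. x : As & real r / real h < Uf x k & Uf x k <= (real r + 1) / real h}" by (auto simp: S_def)
			also have "... : sets borel" by measurable
			finally show ?thesis .
		qed
		have Sp: "measure mu (S r) <= 1 / real h" for r
		proof -
			have "measure mu (S r) <= (real r + 1) / real h - real r / real h" unfolding S_def by (intro slab_mu) (auto simp: divide_right_mono)
			thus ?thesis by (simp add: diff_divide_distrib[symmetric])
		qed
		let ?B = "%r. {om : space P. V i om : S r} Int {om : space P. V j om : S r}"
		have Bm: "?B r : sets P" for r using Sm by measurable
		have cover: "?T \<subseteq> (\<Union>r<h. ?B r)"
		proof
			fix om assume w: "om : ?T"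
			define y where "y = Uf (V i om) k"
			have y: "0 < y" "y <= 1" using w condF_range(2) by (auto simp: y_def Uf_def)
			\<comment> \<open>Ceiling minus one, not floor, because the slabs contain their right
			  endpoints.\<close>
			define r where "r = nat (\<lceil>real h * y\<rceil> - 1)"
			have hy: "0 < real h * y" "real h * y <= real h" using y h by auto
			have c1: "1 <= \<lceil>real h * y\<rceil>" using hy(1) by linarith
			have c2: "\<lceil>real h * y\<rceil> <= int h" using hy(2) by (simp add: ceiling_le_iff)
			have rr: "real r = of_int \<lceil>real h * y\<rceil> - 1" unfolding r_def using c1 by simp
			have "r < h" unfolding r_def using c1 c2 h by linarith
			moreover have "real r < real h * y" "real h * y <= real r + 1" unfolding rr by linarith+
			hence "real r / real h < y" "y <= (real r + 1) / real h" using h by (simp_all add: pos_divide_less_eq pos_le_divide_eq mult.commute)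
			ultimately show "om : (\<Union>r<h. ?B r)" using w unfolding S_def y_def by auto
		qed
		have "measure P ?T <= measure P (\<Union>r<h. ?B r)" using cover Bm by (intro P.finite_measure_mono) auto
		also have "... <= (SUM r<h. measure P (?B r))" using Bm by (intro P.finite_measure_subadditive_finite) auto
		also have "... <= (SUM r<h. 1 / real h * (1 / real h))"
		proof (rule sum_mono)
			fix r
			have "measure P (\<Inter>l\<in>{i, j}. V l -` S r Int space P) = (PROD l:{i, j}. measure P (V l -` S r Int space P))"
				using Sm by (intro P.indep_varsD[OF indepV]) auto
			moreover have "V l -` S r Int space P = {om : space P. V l om : S r}" for l by auto
			ultimately have "measure P (?B r) = measure mu (S r) * measure mu (S r)" using ij Sm by (simp add: measure_V)
			also have "... <= 1 / real h * (1 / real h)" using Sp by (intro mult_mono) auto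
			finally show "measure P (?B r) <= 1 / real h * (1 / real h)" .
		qed
		also have "... = 1 / real h" using h by simp
		finally show ?thesis .
	qed
	have "measure P ?T <= 0"
	proof (rule field_le_epsilon)
		fix e :: real assume "e > 0"
		then obtain h :: nat where "1 / real (Suc h) < e" using nat_approx_posE by (metis of_nat_Suc)
		thus "measure P ?T <= 0 + e" using bnd[of "Suc h"] by simp
	qed
	hence "measure P ?T = 0" by (simp add: measure_le_0_iff)
	hence "?T : null_sets P" using Tm by (simp add: P.emeasure_eq_measure null_setsI)
	from AE_not_in[OF this] AE_space show ?thesis by eventually_elim blast
qed

lemma pos_AE: "AE om in P. V i om : As --> Uf (V i om) k > 0"
proof -
	let ?T = "{om : space P. V i om : {x : As. Uf x k <= 0}}"
	have "measure P ?T = 0" using measure_V[OF Uf_le_borel] uniform_margin[of 0 k] by simp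
	moreover have "?T : sets P" using Uf_le_borel[of k 0] by measurable
	ultimately have "?T : null_sets P" by (simp add: P.emeasure_eq_measure null_setsI)
	from AE_not_in[OF this] AE_space show ?thesis by eventually_elim (auto simp: not_le)
qed

text \<open>Ties are excluded for the transformed values \<open>Uf\<close>, which is more than
  excluding them for the observations: \<open>condF\<close> may be flat, and the order of the
  observations has to agree with the order of their \<open>Uf\<close>.\<close>

definition generic :: "'w => bool" where
	"generic om \<longleftrightarrow> (ALL i k. V i om : As --> Uf (V i om) k > 0) &
		 (ALL i j k. i ~= j --> V i om : As --> V j om : As --> Uf (V i om) k ~= Uf (V j om) k)"

lemma generic_AE: "AE om in P. generic om"
proof -
	have "AE om in P. ALL i j. ALL k:UNIV. i ~= j --> ~ (V i om : As & V j om : As & Uf (V i om) k = Uf (V j om) k & Uf (V i om) k > 0)"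
		unfolding AE_all_countable
	proof (intro allI)
		fix i j
		show "AE om in P. ALL k:UNIV. i ~= j --> ~ (V i om : As & V j om : As & Uf (V i om) k = Uf (V j om) k & Uf (V i om) k > 0)"
			using no_tie_AE[of i j] by (subst AE_finite_all) (auto cong: conj_cong)
	qed
	moreover have "AE om in P. ALL i. ALL k:UNIV. V i om : As --> Uf (V i om) k > 0"
		unfolding AE_all_countable using pos_AE by (subst AE_finite_all) auto
	ultimately show ?thesis unfolding generic_def by eventually_elim blast
qed

end

section \<open>Bootstrap weights\<close>

text \<open>The tail \<open>p\<close> decreases, so \<open>t * sqrt (p t)\<close> is at most the
  integral of \<open>sqrt p\<close> up to \<open>t\<close>, hence at most \<open>K\<close>. In the
  layer cake formula this bounds \<open>2 * t * p t\<close> by \<open>2 * K * sqrt (p t)\<close>,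
  whose integral is controlled by assumption.\<close>

lemma (in prob_space) tail_sqrt_second_moment:
	fixes X :: "'a => real"
	assumes X [measurable]: "X : bm M" and K: "K >= 0"
		and tail: "(\<integral>\<^sup>+t\<in>{0..}. ennreal (sqrt (measure M {x : space M. abs (X x) > t})) \<partial>lborel) <= ennreal K"
	shows "(\<integral>\<^sup>+x. ennreal ((X x)^2) \<partial>M) <= ennreal (2 * K * K)"
proof -
	define p where "p t = measure M {x : space M. abs (X x) > t}" for t
	have p0: "0 <= p t" for t by (simp add: p_def)
	have anti: "p t <= p s" if "s <= t" for s t unfolding p_def using that by (intro finite_measure_mono) auto
	have "mono (%t. - p t)" using anti by (auto simp: mono_def)
	hence "(%t. - p t) : bm borel" by (rule borel_measurable_mono)
	hence "(%t. - (- p t)) : bm borel" by (rule borel_measurable_uminus)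
	hence pm [measurable]: "p : bm borel" by simp
	have tp: "t * sqrt (p t) <= K" if t: "0 <= t" for t
	proof -
		have "ennreal (sqrt (p t)) * emeasure lborel {0..t} = (\<integral>\<^sup>+s. ennreal (sqrt (p t)) * indicator {0..t} s \<partial>lborel)"
			by (rule nn_integral_cmult_indicator[symmetric]) simp
		also have "... <= (\<integral>\<^sup>+s\<in>{0..}. ennreal (sqrt (p s)) \<partial>lborel)"
			using anti by (intro nn_integral_mono) (auto simp: indicator_def intro!: ennreal_leI)
		also have "... <= ennreal K" using tail by (simp add: p_def)
		finally have "ennreal (sqrt (p t) * t) <= ennreal K" using t p0 by (simp add: ennreal_mult)
		thus ?thesis using K by (simp add: mult.commute)
	qed
	interpret pair_sigma_finite M lborel by unfold_locales
	have sq: "ennreal (y^2) = (\<integral>\<^sup>+t. ennreal (2 * t) * indicator {0..<abs y} t \<partial>lborel)" for y :: real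
	proof -
		have "(\<integral>\<^sup>+t. ennreal (2 * t) * indicator {0..<abs y} t \<partial>lborel) = (\<integral>\<^sup>+t. ennreal (2 * t) * indicator {0..abs y} t \<partial>lborel)"
			using AE_lborel_singleton[of "abs y"] by (intro nn_integral_cong_AE) (auto elim!: eventually_mono simp: indicator_def)
		also have "... = ennreal (abs y^2 - 0^2)"
			by (rule nn_integral_FTC_Icc) (auto intro!: derivative_eq_intros)
		finally show ?thesis by simp
	qed
	have "(\<integral>\<^sup>+x. ennreal ((X x)^2) \<partial>M) = (\<integral>\<^sup>+x. \<integral>\<^sup>+t. ennreal (2 * t) * indicator {0..<abs (X x)} t \<partial>lborel \<partial>M)"
		by (simp only: sq)
	also have "... = (\<integral>\<^sup>+t. \<integral>\<^sup>+x. ennreal (2 * t) * indicator {0..<abs (X x)} t \<partial>M \<partial>lborel)"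
	proof (rule Fubini'[symmetric])
		have "(%z. ennreal (2 * snd z) * indicator {z : space (M \<Otimes>\<^sub>M lborel). 0 <= snd z & snd z < abs (X (fst z))} z) : bm (M \<Otimes>\<^sub>M lborel)"
			by measurable
		thus "(%(x, t). ennreal (2 * t) * indicator {0..<abs (X x)} t) : bm (M \<Otimes>\<^sub>M lborel)"
			by (rule measurable_cong[THEN iffD1, rotated]) (auto simp: indicator_def space_pair_measure split: prod.splits)
	qed
	also have "... <= (\<integral>\<^sup>+t. ennreal (2 * K) * (ennreal (sqrt (p t)) * indicator {0..} t) \<partial>lborel)"
	proof (rule nn_integral_mono)
		fix t :: real
		show "(\<integral>\<^sup>+x. ennreal (2 * t) * indicator {0..<abs (X x)} t \<partial>M) <= ennreal (2 * K) * (ennreal (sqrt (p t)) * indicator {0..} t)"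
		proof (cases "0 <= t")
			case True
			have "(\<integral>\<^sup>+x. ennreal (2 * t) * indicator {0..<abs (X x)} t \<partial>M) = (\<integral>\<^sup>+x. ennreal (2 * t) * indicator {x : space M. abs (X x) > t} x \<partial>M)"
				using True by (intro nn_integral_cong) (auto simp: indicator_def)
			also have "... = ennreal (2 * t) * emeasure M {x : space M. abs (X x) > t}" by (rule nn_integral_cmult_indicator) simp
			also have "... = ennreal (2 * t * p t)" using True p0 by (simp add: emeasure_eq_measure p_def ennreal_mult)
			also have "... <= ennreal (2 * K * sqrt (p t))"
			proof (rule ennreal_leI)
				have "2 * t * p t = 2 * (t * sqrt (p t)) * sqrt (p t)" using p0[of t] by (simp add: mult.assoc)
				also have "... <= 2 * K * sqrt (p t)" using tp[OF True] p0[of t] by (intro mult_right_mono) auto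
				finally show "2 * t * p t <= 2 * K * sqrt (p t)" .
			qed
			finally show ?thesis using True K p0[of t] by (simp add: ennreal_mult)
		next
			case False
			hence "(\<integral>\<^sup>+x. ennreal (2 * t) * indicator {0..<abs (X x)} t \<partial>M) = (\<integral>\<^sup>+x. 0 \<partial>M)" by (intro nn_integral_cong) auto
			thus ?thesis by simp
		qed
	qed
	also have "... = ennreal (2 * K) * (\<integral>\<^sup>+t\<in>{0..}. ennreal (sqrt (p t)) \<partial>lborel)"
	proof (rule nn_integral_cmult)
		have "(%t. ennreal (sqrt (p t))) : bm lborel" using pm by simp
		thus "(%t. ennreal (sqrt (p t)) * indicator {0..} t) : bm lborel"
			by (intro borel_measurable_times_ennreal borel_measurable_indicator) auto
	qed
	also have "... <= ennreal (2 * K) * ennreal K" using tail by (intro mult_left_mono) (auto simp: p_def)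
	also have "... = ennreal (2 * K * K)" using K by (simp add: ennreal_mult)
	finally show ?thesis .
qed

lemma (in prob_space) chebyshev_second_moment:
	fixes X :: "'a => real"
	assumes "X : bm M" "integrable M (%x. (X x)^2)" "ep > 0"
	shows "measure M {x : space M. abs (X x) > ep} <= (\<integral>x. (X x)^2 \<partial>M) / ep^2"
proof -
	have "measure M {x : space M. abs (X x) > ep} <= measure M {x : space M. (X x)^2 >= ep^2}"
	proof (rule finite_measure_mono)
		have "ep^2 <= y^2" if "abs y > ep" for y :: real
		proof -
			have "abs ep <= abs y" using that assms(3) by simp
			thus ?thesis by (simp only: abs_le_square_iff)
		qed
		thus "{x : space M. abs (X x) > ep} \<subseteq> {x : space M. (X x)^2 >= ep^2}" by blast
		show "{x : space M. (X x)^2 >= ep^2} : sets M" using assms(1) by measurable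
	qed
	also have "... <= (\<integral>x. (X x)^2 \<partial>M) / ep^2"
		using integral_Markov_inequality_measure[OF assms(2) sets.empty_sets, of "ep^2"] assms(3) by simp
	finally show ?thesis .
qed

definition xi :: "(nat => nat => 'w => real) => nat => nat => 'w => real" where
	"xi W n i om = W n i om - Wbar W n om"

lemma sum_xi: "n >= 1 ==> (SUM i<n. xi W n i om) = 0"
	by (simp add: xi_def sum_subtractf Wbar_def)

locale boot_weights = prob_space P for P :: "'w measure" +
	fixes W :: "nat => nat => 'w => real"
	assumes exch: "exch_weights P W" and cw: "condW P W"
begin

lemma W_measurable: "i < n ==> W n i : bm P"
	using exch by (simp add: exch_weights_def)

lemma xi_measurable: "i < n ==> xi W n i : bm P"
	unfolding xi_def[abs_def] Wbar_def using W_measurable by (intro borel_measurable_diff borel_measurable_divide borel_measurable_sum) auto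

text \<open>The mean weight is invariant under permutations, so the centred weights inherit
  exchangeability. The version with nonnegative integrals is what yields integrability of the
  squares in the first place.\<close>

lemma xi_permute:
	assumes pp: "pp permutes {..<n}" and ab: "a < n" "b < n"
	shows "(\<integral>om. xi W n (pp a) om * xi W n (pp b) om \<partial>P) = (\<integral>om. xi W n a om * xi W n b om \<partial>P)"
		and "(\<integral>\<^sup>+om. ennreal (xi W n (pp a) om * xi W n (pp b) om) \<partial>P) = (\<integral>\<^sup>+om. ennreal (xi W n a om * xi W n b om) \<partial>P)"
proof -
	define F :: "(nat => real) => real" where "F w = (w a - (SUM i<n. w i) / real n) * (w b - (SUM i<n. w i) / real n)" for w
	let ?N = "Pi\<^sub>M {..<n} (%_. borel :: real measure)"
	have Fm: "F : bm ?N" unfolding F_def[abs_def] using ab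
		by (intro borel_measurable_times borel_measurable_diff borel_measurable_divide borel_measurable_sum measurable_component_singleton borel_measurable_const) auto
	have ppn: "pp i < n" if "i < n" for i using permutes_in_image[OF pp, of i] that by simp
	have m1: "(%om. \<lambda>i\<in>{..<n}. W n (pp i) om) : measurable P ?N" using W_measurable ppn by (intro measurable_restrict) auto
	have m2: "(%om. \<lambda>i\<in>{..<n}. W n i om) : measurable P ?N" using W_measurable by (intro measurable_restrict) auto
	have "(SUM i<n. W n (pp i) om) = (SUM i<n. W n i om)" for om
		using sum.permute[OF pp, of "%i. W n i om"] by (simp add: o_def)
	hence F1: "F (\<lambda>i\<in>{..<n}. W n (pp i) om) = xi W n (pp a) om * xi W n (pp b) om" for om
		unfolding F_def xi_def Wbar_def using ab by simp
	have F2: "F (\<lambda>i\<in>{..<n}. W n i om) = xi W n a om * xi W n b om" for om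
		unfolding F_def xi_def Wbar_def using ab by simp
	have eq: "distr P ?N (%om. \<lambda>i\<in>{..<n}. W n (pp i) om) = distr P ?N (%om. \<lambda>i\<in>{..<n}. W n i om)"
		using exch pp by (simp add: exch_weights_def)
	show "(\<integral>om. xi W n (pp a) om * xi W n (pp b) om \<partial>P) = (\<integral>om. xi W n a om * xi W n b om \<partial>P)"
		using integral_distr[OF m1 Fm] integral_distr[OF m2 Fm] unfolding eq F1 F2 by simp
	have Fm': "(%w. ennreal (F w)) : bm ?N" using Fm by simp
	show "(\<integral>\<^sup>+om. ennreal (xi W n (pp a) om * xi W n (pp b) om) \<partial>P) = (\<integral>\<^sup>+om. ennreal (xi W n a om * xi W n b om) \<partial>P)"
	proof -
		have "(\<integral>\<^sup>+w. ennreal (F w) \<partial>distr P ?N (%om. \<lambda>i\<in>{..<n}. W n (pp i) om)) = (\<integral>\<^sup>+om. ennreal (xi W n (pp a) om * xi W n (pp b) om) \<partial>P)"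
			unfolding F1[symmetric] by (rule nn_integral_distr[OF m1]) (use Fm' in simp)
		moreover have "(\<integral>\<^sup>+w. ennreal (F w) \<partial>distr P ?N (%om. \<lambda>i\<in>{..<n}. W n i om)) = (\<integral>\<^sup>+om. ennreal (xi W n a om * xi W n b om) \<partial>P)"
			unfolding F2[symmetric] by (rule nn_integral_distr[OF m2]) (use Fm' in simp)
		ultimately show ?thesis unfolding eq by simp
	qed
qed

lemma second_moment:
	obtains K where "K >= 0" "!!n i. i < n ==> integrable P (%om. (xi W n i om)^2)" "!!n i. i < n ==> (\<integral>om. (xi W n i om)^2 \<partial>P) <= K"
proof -
	obtain K where K: "!!n. n >= 1 ==> (\<integral>\<^sup>+ t\<in>{0..}. ennreal (sqrt (measure P {om : space P. abs (W n 0 om - Wbar W n om) > t})) \<partial>lborel) <= ennreal K"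
		using cw unfolding condW_def by blast
	define K' where "K' = max K 0"
	have nn: "(\<integral>\<^sup>+om. ennreal ((xi W n i om)^2) \<partial>P) <= ennreal (2 * K' * K')" if i: "i < n" for n i
	proof -
		have n: "0 < n" using i by simp
		\<comment> \<open>The moment condition speaks of the first weight only; a transposition carries it
		  to weight \<open>i\<close>.\<close>
		have pp: "Transposition.transpose 0 i permutes {..<n}" using i n by (intro permutes_swap_id) auto
		have "(\<integral>\<^sup>+om. ennreal ((xi W n i om)^2) \<partial>P) = (\<integral>\<^sup>+om. ennreal ((xi W n 0 om)^2) \<partial>P)"
			using xi_permute(2)[OF pp n n] by (simp add: power2_eq_square)
		also have "... <= ennreal (2 * K' * K')"
		proof (rule tail_sqrt_second_moment[OF xi_measurable[OF n]])
			have "(\<integral>\<^sup>+ t\<in>{0..}. ennreal (sqrt (measure P {om : space P. abs (xi W n 0 om) > t})) \<partial>lborel) <= ennreal K"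
				using K[of n] n by (simp add: xi_def)
			also have "... <= ennreal K'" by (rule ennreal_leI) (simp add: K'_def)
			finally show "(\<integral>\<^sup>+ t\<in>{0..}. ennreal (sqrt (measure P {om : space P. abs (xi W n 0 om) > t})) \<partial>lborel) <= ennreal K'" .
		qed (simp add: K'_def)
		finally show ?thesis .
	qed
	have int: "integrable P (%om. (xi W n i om)^2)" if i: "i < n" for n i
	proof (rule integrableI_bounded)
		show "(%om. (xi W n i om)^2) : bm P" using xi_measurable[OF i] by measurable
		show "(\<integral>\<^sup>+om. ennreal (norm ((xi W n i om)^2)) \<partial>P) < \<infinity>" using nn[OF i] by (simp add: le_less_trans ennreal_less_top)
	qed
	have "(\<integral>om. (xi W n i om)^2 \<partial>P) <= 2 * K' * K'" if i: "i < n" for n i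
	proof -
		have "ennreal (\<integral>om. (xi W n i om)^2 \<partial>P) <= ennreal (2 * K' * K')"
			using nn[OF i] nn_integral_eq_integral[OF int[OF i]] by simp
		thus ?thesis by (simp add: K'_def ennreal_le_iff)
	qed
	thus ?thesis using int by (intro that[of "2 * K' * K'"]) (auto simp: K'_def)
qed

lemma xi_sq_integrable: "i < n ==> integrable P (%om. (xi W n i om)^2)"
	by (rule second_moment) blast

lemma xi_prod_integrable: assumes "i < n" "l < n" shows "integrable P (%om. xi W n i om * xi W n l om)"
proof (rule Bochner_Integration.integrable_bound)
	show "integrable P (%om. (xi W n i om)^2 + (xi W n l om)^2)" using assms xi_sq_integrable by auto
	show "(%om. xi W n i om * xi W n l om) : bm P" using assms xi_measurable by auto
	have "abs (x * y) <= x^2 + y^2" for x y :: real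
	proof -
		have "2 * (abs x * abs y) <= x^2 + y^2" using zero_le_power2[of "abs x - abs y"] by (simp add: power2_diff)
		moreover have "0 <= abs x * abs y" by simp
		ultimately show ?thesis unfolding abs_mult by linarith
	qed
	thus "AE om in P. norm (xi W n i om * xi W n l om) <= norm ((xi W n i om)^2 + (xi W n l om)^2)" by auto
qed

lemma xi_integrable: assumes i: "i < n" shows "integrable P (xi W n i)"
proof (rule Bochner_Integration.integrable_bound)
	show "integrable P (%om. 1 + (xi W n i om)^2)" using i xi_sq_integrable by auto
	show "xi W n i : bm P" using i xi_measurable by auto
	have "abs x <= 1 + x^2" for x :: real
		using zero_le_power2[of "abs x - 1"] by (simp add: power2_diff)
	thus "AE om in P. norm (xi W n i om) <= norm (1 + (xi W n i om)^2)" by auto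
qed

lemma xi_variance: assumes "i < n" shows "(\<integral>om. xi W n i om * xi W n i om \<partial>P) = (\<integral>om. xi W n 0 om * xi W n 0 om \<partial>P)"
proof -
	have n: "0 < n" using assms by simp
	have pp: "Transposition.transpose 0 i permutes {..<n}" using assms n by (intro permutes_swap_id) auto
	show ?thesis using xi_permute(1)[OF pp n n] by simp
qed

text \<open>The centred weights sum to zero. Multiplying that sum by \<open>xi W n i\<close> and
  taking expectations leaves one variance and \<open>n - 1\<close> equal covariances.\<close>

lemma xi_covariance:
	assumes il: "i < n" "l < n" "i ~= l"
	shows "(\<integral>om. xi W n i om * xi W n l om \<partial>P) = - (\<integral>om. xi W n 0 om * xi W n 0 om \<partial>P) / (real n - 1)"
proof -
	have n: "n >= 2" using il by linarith
	have eq: "(\<integral>om. xi W n i om * xi W n m om \<partial>P) = (\<integral>om. xi W n i om * xi W n l om \<partial>P)" if m: "m < n" "m ~= i" for m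
	proof -
		have pp: "Transposition.transpose l m permutes {..<n}" using m il by (intro permutes_swap_id) auto
		have "Transposition.transpose l m i = i" using m il by (simp add: Transposition.transpose_def)
		thus ?thesis using xi_permute(1)[OF pp il(1) il(2)] by simp
	qed
	have "0 = (\<integral>om. xi W n i om * (SUM m<n. xi W n m om) \<partial>P)" using sum_xi[of n W] n by simp
	also have "... = (SUM m<n. \<integral>om. xi W n i om * xi W n m om \<partial>P)"
		unfolding sum_distrib_left using il xi_prod_integrable by (intro Bochner_Integration.integral_sum) auto
	also have "... = (\<integral>om. xi W n i om * xi W n i om \<partial>P) + (SUM m:{..<n} - {i}. \<integral>om. xi W n i om * xi W n m om \<partial>P)"
		using il by (subst sum.remove[of _ i]) auto
	also have "(SUM m:{..<n} - {i}. \<integral>om. xi W n i om * xi W n m om \<partial>P) = (SUM m:{..<n} - {i}. \<integral>om. xi W n i om * xi W n l om \<partial>P)"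
		by (intro sum.cong refl eq) auto
	also have "... = (real n - 1) * (\<integral>om. xi W n i om * xi W n l om \<partial>P)" using il n by (simp add: card_Diff_singleton of_nat_diff)
	finally have "(real n - 1) * (\<integral>om. xi W n i om * xi W n l om \<partial>P) = - (\<integral>om. xi W n 0 om * xi W n 0 om \<partial>P)"
		using xi_variance[OF il(1)] by linarith
	moreover have "real n - 1 > 0" using n by simp
	ultimately show ?thesis by (subst nonzero_eq_divide_eq) (auto simp: mult.commute)
qed

lemma max_xi_small:
	assumes kp: "kp > 0"
	shows "(%n. measure P {om : space P. EX i<n. abs (xi W n i om / rt n) > kp}) \<longlonglongrightarrow> 0"
proof -
	define mx where "mx n om = Max ((%i. abs (W n i om - Wbar W n om)) ` {..<n})" for n om
	have lim: "(%n. (\<integral>om. mx n om \<partial>P) / rt n) \<longlonglongrightarrow> 0" using cw unfolding condW_def mx_def by blast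
	have bnd: "measure P {om : space P. EX i<n. abs (xi W n i om / rt n) > kp} <= (\<integral>om. mx n om \<partial>P) / rt n / kp" if n: "n >= 1" for n
	proof -
		have ne: "(%i. abs (W n i om - Wbar W n om)) ` {..<n} ~= {}" for om using n by (auto simp: lessThan_empty_iff)
		have mxm: "mx n : bm P"
			unfolding mx_def[abs_def] using xi_measurable[unfolded xi_def[abs_def]] n
			by (intro borel_measurable_Max) (auto simp: lessThan_empty_iff)
		have mx_ge: "abs (xi W n i om) <= mx n om" if "i < n" for i om unfolding mx_def xi_def using that by (intro Max_ge) auto
		have mx_le: "abs (mx n om) <= (SUM i<n. abs (xi W n i om))" for om
		proof -
			have "mx n om : (%i. abs (W n i om - Wbar W n om)) ` {..<n}" unfolding mx_def using ne by (intro Max_in) auto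
			then obtain i where "i < n" "mx n om = abs (xi W n i om)" by (auto simp: xi_def)
			thus ?thesis using member_le_sum[of i "{..<n}" "%i. abs (xi W n i om)"] by simp
		qed
		have int: "integrable P (mx n)"
		proof (rule Bochner_Integration.integrable_bound)
			show "integrable P (%om. SUM i<n. abs (xi W n i om))" using xi_integrable by auto
			show "AE om in P. norm (mx n om) <= norm (SUM i<n. abs (xi W n i om))"
				using mx_le by (intro AE_I2) (auto simp: abs_of_nonneg sum_nonneg)
		qed (rule mxm)
		have sn: "rt n > 0" using n by simp
		have "measure P {om : space P. EX i<n. abs (xi W n i om / rt n) > kp} <= measure P {om : space P. mx n om >= kp * rt n}"
		proof (rule finite_measure_mono)
			show "{om : space P. mx n om >= kp * rt n} : sets P" using mxm by measurable
			show "{om : space P. EX i<n. abs (xi W n i om / rt n) > kp} \<subseteq> {om : space P. mx n om >= kp * rt n}"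
			proof safe
				fix om i assume i: "i < n" "kp < abs (xi W n i om / rt n)"
				hence "kp * rt n < abs (xi W n i om)" using sn by (simp add: pos_less_divide_eq)
				thus "kp * rt n <= mx n om" using mx_ge[OF i(1), of om] by linarith
			qed
		qed
		also have "... <= (\<integral>om. mx n om \<partial>P) / (kp * rt n)"
		proof (rule integral_Markov_inequality_measure[OF int sets.empty_sets])
			show "AE om in P. 0 <= mx n om" using mx_ge[of 0] n by (intro AE_I2) (meson abs_ge_zero less_le_trans order_trans zero_less_one)
			show "0 < kp * rt n" using kp sn by simp
		qed
		finally show ?thesis by (simp add: mult.commute)
	qed
	have "(%n. (\<integral>om. mx n om \<partial>P) / rt n / kp) \<longlonglongrightarrow> 0 / kp" using lim kp by (intro tendsto_divide) auto
	hence lim': "(%n. (\<integral>om. mx n om \<partial>P) / rt n / kp) \<longlonglongrightarrow> 0" by simp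
	show ?thesis
	proof (rule tendsto_sandwich[OF _ _ tendsto_const lim'])
		show "\<forall>\<^sub>F n in sequentially. measure P {om : space P. EX i<n. abs (xi W n i om / rt n) > kp} <= (\<integral>om. mx n om \<partial>P) / rt n / kp"
			using eventually_ge_at_top[of 1] by eventually_elim (rule bnd)
	qed simp
qed

lemma sum_sq_xi: assumes "ep > 0"
	shows "(%n. measure P {om : space P. abs ((SUM i<n. (xi W n i om / rt n) * (xi W n i om / rt n)) - 1) > ep}) \<longlonglongrightarrow> 0"
proof -
	have "conv_in_prob P (%n om. (SUM i<n. (W n i om - Wbar W n om)^2) / real n) 1" using cw by (simp add: condW_def)
	hence "(%n. measure P {om : space P. abs ((SUM i<n. (W n i om - Wbar W n om)^2) / real n - 1) > ep}) \<longlonglongrightarrow> 0"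
		using assms unfolding conv_in_prob_def by blast
	moreover have "(SUM i<n. (xi W n i om / rt n) * (xi W n i om / rt n)) = (SUM i<n. (W n i om - Wbar W n om)^2) / real n" for n om
		by (simp add: xi_def power2_eq_square sum_divide_distrib)
	ultimately show ?thesis by simp
qed

end

text \<open>The second moment of the sum consists of \<open>n\<close> products of variances and
  \<open>n * (n - 1)\<close> products of two covariances, each covariance of order
  \<open>1 / n\<close>. It is therefore of order \<open>n\<close>, and Chebyshev's inequality
  applies after division by \<open>n\<close>.\<close>

lemma cross_weights:
	assumes W: "boot_weights P W" and W': "boot_weights P W'"
		and ind: "!!n i l. i < n ==> l < n ==> prob_space.indep_var P borel (%om. xi W n i om * xi W n l om) borel (%om. xi W' n i om * xi W' n l om)"
		and ep: "ep > 0"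
	shows "(%n. measure P {om : space P. abs (SUM i<n. (xi W n i om / rt n) * (xi W' n i om / rt n)) > ep}) \<longlonglongrightarrow> 0"
proof -
	interpret A: boot_weights P W by fact
	interpret B: boot_weights P W' by fact
	obtain K where K: "K >= 0" "!!n i. i < n ==> (\<integral>om. (xi W n i om)^2 \<partial>P) <= K" by (rule A.second_moment) blast
	obtain K' where K': "K' >= 0" "!!n i. i < n ==> (\<integral>om. (xi W' n i om)^2 \<partial>P) <= K'" by (rule B.second_moment) blast
	define S where "S n om = (SUM i<n. xi W n i om * xi W' n i om)" for n om
	have bnd: "measure P {om : space P. abs (SUM i<n. (xi W n i om / rt n) * (xi W' n i om / rt n)) > ep} <= (2 * K * K' / ep^2) / real n" if n: "n >= 2" for n
	proof -
		let ?X = "%i l om. xi W n i om * xi W n l om" and ?Y = "%i l om. xi W' n i om * xi W' n l om"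
		define s where "s = (\<integral>om. ?X 0 0 om \<partial>P)"
		define s' where "s' = (\<integral>om. ?Y 0 0 om \<partial>P)"
		have s: "0 <= s" "s <= K" using K(2)[of 0 n] n by (auto simp: s_def power2_eq_square)
		have s': "0 <= s'" "s' <= K'" using K'(2)[of 0 n] n by (auto simp: s'_def power2_eq_square)
		have sq: "(S n om)^2 = (SUM i<n. SUM l<n. ?X i l om * ?Y i l om)" for om
			unfolding S_def power2_eq_square sum_product by (intro sum.cong refl) (simp add: mult_ac)
		have int: "integrable P (%om. ?X i l om * ?Y i l om)" and val: "(\<integral>om. ?X i l om * ?Y i l om \<partial>P) = (\<integral>om. ?X i l om \<partial>P) * (\<integral>om. ?Y i l om \<partial>P)" if "i < n" "l < n" for i l
			using A.indep_var_integrable[OF ind[OF that]] A.indep_var_lebesgue_integral[OF ind[OF that]] A.xi_prod_integrable[OF that] B.xi_prod_integrable[OF that] by auto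
		have intS: "integrable P (%om. (S n om)^2)" unfolding sq using int by (intro Bochner_Integration.integrable_sum) auto
		have "(\<integral>om. (S n om)^2 \<partial>P) = (SUM i<n. SUM l<n. (\<integral>om. ?X i l om \<partial>P) * (\<integral>om. ?Y i l om \<partial>P))"
		proof -
			have "(\<integral>om. (S n om)^2 \<partial>P) = (SUM i<n. \<integral>om. (SUM l<n. ?X i l om * ?Y i l om) \<partial>P)"
				unfolding sq by (rule Bochner_Integration.integral_sum) (use int in \<open>auto intro!: Bochner_Integration.integrable_sum\<close>)
			also have "... = (SUM i<n. SUM l<n. \<integral>om. ?X i l om * ?Y i l om \<partial>P)"
				by (intro sum.cong refl Bochner_Integration.integral_sum) (use int in auto)
			also have "... = (SUM i<n. SUM l<n. (\<integral>om. ?X i l om \<partial>P) * (\<integral>om. ?Y i l om \<partial>P))"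
				by (intro sum.cong refl val) auto
			finally show ?thesis .
		qed
		also have "... = (SUM i<n. SUM l<n. if l = i then s * s' else s * s' / (real n - 1)^2)"
		proof (intro sum.cong refl)
			fix i l assume "i : {..<n}" "l : {..<n}"
			hence il: "i < n" "l < n" by auto
			show "(\<integral>om. ?X i l om \<partial>P) * (\<integral>om. ?Y i l om \<partial>P) = (if l = i then s * s' else s * s' / (real n - 1)^2)"
			proof (cases "l = i")
				case True
				thus ?thesis using A.xi_variance[OF il(1)] B.xi_variance[OF il(1)] by (simp add: s_def s'_def)
			next
				case False
				show ?thesis unfolding A.xi_covariance[OF il False[symmetric]] B.xi_covariance[OF il False[symmetric]] s_def s'_def
					using False by (simp add: power2_eq_square)
			qed
		qed
		also have "... = (SUM i<n. s * s' + (real n - 1) * (s * s' / (real n - 1)^2))"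
		proof (rule sum.cong[OF refl])
			fix i assume i: "i : {..<n}"
			have "(SUM l<n. if l = i then s * s' else s * s' / (real n - 1)^2) = s * s' + (SUM l:{..<n} - {i}. if l = i then s * s' else s * s' / (real n - 1)^2)"
				using i by (subst sum.remove[of _ i]) auto
			also have "(SUM l:{..<n} - {i}. if l = i then s * s' else s * s' / (real n - 1)^2) = (SUM l:{..<n} - {i}. s * s' / (real n - 1)^2)"
				by (intro sum.cong) auto
			also have "... = (real n - 1) * (s * s' / (real n - 1)^2)" using i n by (simp add: card_Diff_singleton of_nat_diff)
			finally show "(SUM l<n. if l = i then s * s' else s * s' / (real n - 1)^2) = s * s' + (real n - 1) * (s * s' / (real n - 1)^2)" .
		qed
		also have "... = real n * (s * s' + s * s' / (real n - 1))" using n by (simp add: power2_eq_square)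
		also have "... <= real n * (2 * K * K')"
		proof (intro mult_left_mono)
			have ss: "s * s' <= K * K'" using s s' K(1) by (intro mult_mono) auto
			have "0 <= s * s'" using s s' by simp
			hence "s * s' / (real n - 1) <= s * s' / 1" using n by (intro divide_left_mono) auto
			thus "s * s' + s * s' / (real n - 1) <= 2 * K * K'" using ss by linarith
		qed simp
		finally have E: "(\<integral>om. (S n om)^2 \<partial>P) <= real n * (2 * K * K')" .
		have Sm: "S n : bm P" unfolding S_def[abs_def] using A.xi_measurable B.xi_measurable by auto
		have rn: "real n > 0" using n by simp
		have "(SUM i<n. (xi W n i om / rt n) * (xi W' n i om / rt n)) = S n om / real n" for om
			by (simp add: S_def sum_divide_distrib)
		hence "measure P {om : space P. abs (SUM i<n. (xi W n i om / rt n) * (xi W' n i om / rt n)) > ep} = measure P {om : space P. abs (S n om) > ep * real n}"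
			using rn by (simp add: pos_less_divide_eq)
		also have "... <= (\<integral>om. (S n om)^2 \<partial>P) / (ep * real n)^2"
			using ep rn by (intro A.chebyshev_second_moment Sm intS) auto
		also have "... <= (real n * (2 * K * K')) / (ep * real n)^2" using E by (intro divide_right_mono) auto
		also have "... = (2 * K * K' / ep^2) / real n" using rn ep by (simp add: power2_eq_square)
		finally show ?thesis .
	qed
	have lim: "(%n. (2 * K * K' / ep^2) / real n) \<longlonglongrightarrow> 0"
		by (intro tendsto_divide_0[OF tendsto_const] filterlim_at_top_imp_at_infinity filterlim_real_sequentially)
	show ?thesis
	proof (rule tendsto_sandwich[OF _ _ tendsto_const lim])
		show "\<forall>\<^sub>F n in sequentially. measure P {om : space P. abs (SUM i<n. (xi W n i om / rt n) * (xi W' n i om / rt n)) > ep} <= (2 * K * K' / ep^2) / real n"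
			using eventually_ge_at_top[of 2] by eventually_elim (rule bnd)
	qed simp
qed

text \<open>\<open>F\<close> is a step function jumping only at observations, so the infimum is
  attained at one of them. The two counting bounds locate \<open>u\<close> within that jump; without
  ties the counts differ by one.\<close>

lemma geninv_step:
	fixes x :: "'i => real"
	assumes S: "finite S" "S ~= {}" and u: "0 < u" "u <= 1"
		and F: "!!t. F t = real (card {i : S. x i <= t}) / real (card S)"
	obtains m where "m : S" "geninv F u = ereal (x m)" "u * real (card S) <= real (card {i : S. x i <= x m})"
		"real (card {i : S. x i < x m}) < u * real (card S)"
proof -
	have N: "real (card S) > 0" using S by (simp add: card_gt_0_iff)
	have uF: "u <= F t \<longleftrightarrow> u * real (card S) <= real (card {i : S. x i <= t})" for t
		unfolding F using N by (simp add: pos_le_divide_eq)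
	define T where "T = {i : S. u <= F (x i)}"
	\<comment> \<open>Going down from \<open>t\<close> to the largest observation not above it leaves
	  \<open>F\<close> unchanged, so it is enough to compare observations.\<close>
	have down: "EX i:T. x i <= t" if t: "u <= F t" for t
	proof -
		let ?R = "{i : S. x i <= t}"
		have "?R ~= {}"
		proof
			assume "?R = {}"
			hence "card ?R = 0" by (simp only: card.empty)
			hence "F t = 0" unfolding F by simp
			thus False using t u by simp
		qed
		hence fin: "finite (x ` ?R)" "x ` ?R ~= {}" using S by auto
		from Max_in[OF fin] obtain i where i: "i : ?R" "x i = Max (x ` ?R)" by auto
		have "{j : S. x j <= x i} = ?R"
		proof (intro set_eqI iffI)
			fix j assume "j : {j : S. x j <= x i}"
			thus "j : ?R" using i(1) by auto
		next
			fix j assume j: "j : ?R"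
			hence "x j <= Max (x ` ?R)" using fin by (intro Max_ge) auto
			thus "j : {j : S. x j <= x i}" using j i(2) by auto
		qed
		hence "F (x i) = F t" unfolding F by simp
		thus ?thesis using i(1) t unfolding T_def by (intro bexI[of _ i]) auto
	qed
	have "u <= F (Max (x ` S))"
	proof -
		have "{i : S. x i <= Max (x ` S)} = S" using S by auto
		hence "F (Max (x ` S)) = 1" unfolding F using N by simp
		thus ?thesis using u by simp
	qed
	from down[OF this] have T: "finite (x ` T)" "x ` T ~= {}" using S by (auto simp: T_def)
	from Min_in[OF T] obtain m where m: "m : T" "x m = Min (x ` T)" by auto
	have mle: "x m <= x i" if "i : T" for i unfolding m(2) using T that by (intro Min_le) auto
	have lower: "x m <= t" if t: "u <= F t" for t using down[OF t] mle by (meson order_trans)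
	have inv: "geninv F u = ereal (x m)" unfolding geninv_def
	proof (rule antisym)
		show "Inf {ereal t |t. u <= F t} <= ereal (x m)" using m(1) by (intro Inf_lower) (auto simp: T_def)
		show "ereal (x m) <= Inf {ereal t |t. u <= F t}" using lower by (intro Inf_greatest) auto
	qed
	have lt: "real (card {i : S. x i < x m}) < u * real (card S)"
	proof (cases "{i : S. x i < x m} = {}")
		case True
		hence "card {i : S. x i < x m} = 0" by (simp only: card.empty)
		thus ?thesis using u N by simp
	next
		case False
		let ?R = "{i : S. x i < x m}"
		have fin: "finite (x ` ?R)" "x ` ?R ~= {}" using S False by auto
		have "Max (x ` ?R) < x m" using fin by auto
		hence n: "~ u <= F (Max (x ` ?R))" using lower by (meson not_le)
		have "{i : S. x i <= Max (x ` ?R)} = ?R"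
		proof (intro set_eqI iffI)
			fix j assume "j : {i : S. x i <= Max (x ` ?R)}"
			thus "j : ?R" using \<open>Max (x ` ?R) < x m\<close> by auto
		next
			fix j assume j: "j : ?R"
			hence "x j <= Max (x ` ?R)" using fin by (intro Max_ge) auto
			thus "j : {i : S. x i <= Max (x ` ?R)}" using j by auto
		qed
		thus ?thesis using n unfolding uF by simp
	qed
	show ?thesis
		by (rule that[of m]) (use m inv lt uF[of "x m"] in \<open>auto simp: T_def\<close>)
qed

lemma geninv_zero: "geninv F 0 = - \<infinity>" if "!!t. 0 <= F t"
proof -
	have "geninv F 0 <= ereal t" for t unfolding geninv_def using that by (intro Inf_lower) auto
	thus ?thesis by (meson ereal_infty_less_eq2(2) ereal_le_real not_le ereal_bot)
qed

lemma sqrt_over: "sqrt x / x = 1 / sqrt x" if "x > 0" for x :: real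
	by (subst frac_eq_eq) (use that in auto)

section \<open>Rank-based processes as functionals of weighted empirical processes\<close>

context copula_data
begin

definition zp :: "nat => (nat => real) => 'w => real^'p => real" where
	"zp n a om u = (SUM i<n. a i * (bx.bi u (V i om) - bx.Dm u))"

text \<open>For \<open>u $ k <= 0\<close> the generalized inverse is minus infinity, which
  \<open>real_of_ereal\<close> would turn into the number 0; the limit 0 of the margin at minus
  infinity is therefore put in by hand.\<close>

definition vq :: "nat => 'w => real^'p => real^'p" where
	"vq n om u = (\<chi> k. if u $ k <= 0 then 0 else condF P V A k (real_of_ereal (geninv (Fn V A n k om) (u $ k))))"

abbreviation "alp n om \<equiv> zp n (%i. 1 / rt n) om"
abbreviation "bet W n om \<equiv> zp n (%i. xi W n i om / rt n) om"

lemma vq_cube: "vq n om u : cube"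
	using condF_range by (auto simp: cube_def vq_def)

definition obsA :: "nat => 'w => nat set" where "obsA n om = {i. i < n & V i om : As}"

lemma finite_obsA: "finite (obsA n om)" by (simp add: obsA_def)

lemma phat_obsA: "phat V A n om = real (card (obsA n om)) / real n"
proof -
	have "(SUM i<n. if snd (V i om) : A then 1 else 0) = (SUM i:{i : {..<n}. snd (V i om) : A}. 1::real)" by (rule sum.inter_filter[symmetric]) simp
	also have "{i : {..<n}. snd (V i om) : A} = obsA n om" by (auto simp: obsA_def As_def)
	finally show ?thesis by (simp add: phat_def)
qed

lemma Fn_obsA: assumes "n >= 1" shows "Fn V A n k om t = real (card {i : obsA n om. fst (V i om) $ k <= t}) / real (card (obsA n om))"
proof -
	have "(SUM i<n. if fst (V i om) $ k <= t & snd (V i om) : A then 1 else 0) = (SUM i:{i : {..<n}. fst (V i om) $ k <= t & snd (V i om) : A}. 1::real)" by (rule sum.inter_filter[symmetric]) simp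
	also have "{i : {..<n}. fst (V i om) $ k <= t & snd (V i om) : A} = {i : obsA n om. fst (V i om) $ k <= t}" by (auto simp: obsA_def As_def)
	finally show ?thesis using assms by (simp add: Fn_def phat_obsA)
qed

lemma Fn_nonneg: "0 <= Fn V A n k om t"
	unfolding Fn_def phat_def by (intro divide_nonneg_nonneg mult_nonneg_nonneg sum_nonneg) auto

text \<open>Without ties of \<open>Uf\<close>, comparing an observation with the quantile is the
  same as comparing their \<open>Uf\<close>, so rank conditions become box conditions at
  \<open>vq\<close>. At the quantile the count jumps by exactly one, which is the error 1 in the
  second claim.\<close>

lemma vq_link:
	assumes g: "generic om" and n: "n >= 1" and ph: "phat V A n om > 0" and u: "u : cube"
	shows "i : obsA n om ==> ereal (fst (V i om) $ k) <= geninv (Fn V A n k om) (u $ k) \<longleftrightarrow> Uf (V i om) k <= vq n om u $ k"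
		and "abs (real (card {i : obsA n om. Uf (V i om) k <= vq n om u $ k}) - u $ k * real (card (obsA n om))) <= 1"
proof -
	have "(i : obsA n om --> (ereal (fst (V i om) $ k) <= geninv (Fn V A n k om) (u $ k) \<longleftrightarrow> Uf (V i om) k <= vq n om u $ k)) &
		abs (real (card {i : obsA n om. Uf (V i om) k <= vq n om u $ k}) - u $ k * real (card (obsA n om))) <= 1"
	proof (cases "u $ k = 0")
		case True
		hence v: "vq n om u $ k = 0" by (simp add: vq_def)
		have pos: "~ Uf (V i om) k <= 0" if "i : obsA n om" for i
			using g that unfolding generic_def obsA_def by (auto simp: not_le)
		have "{i : obsA n om. Uf (V i om) k <= vq n om u $ k} = {}" using pos v by auto
		moreover have "geninv (Fn V A n k om) (u $ k) = - \<infinity>" unfolding True by (rule geninv_zero[OF Fn_nonneg])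
		ultimately show ?thesis using v pos True by (auto simp del: Collect_empty_eq)
	next
		case False
		hence uk: "0 < u $ k" "u $ k <= 1" using cubeD[OF u, of k] by auto
		have ne: "obsA n om ~= {}" using ph unfolding phat_obsA by auto
		obtain m where m: "m : obsA n om" "geninv (Fn V A n k om) (u $ k) = ereal (fst (V m om) $ k)"
			"u $ k * real (card (obsA n om)) <= real (card {i : obsA n om. fst (V i om) $ k <= fst (V m om) $ k})"
			"real (card {i : obsA n om. fst (V i om) $ k < fst (V m om) $ k}) < u $ k * real (card (obsA n om))"
			by (rule geninv_step[OF finite_obsA ne uk Fn_obsA[OF n]]) blast
		have v: "vq n om u $ k = Uf (V m om) k" using uk m(2) by (simp add: vq_def Uf_def)
		have inj: "Uf (V i om) k ~= Uf (V m om) k" if "i : obsA n om" "i ~= m" for i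
			using g that m(1) unfolding generic_def obsA_def by blast
		have eq: "fst (V i om) $ k <= fst (V m om) $ k \<longleftrightarrow> Uf (V i om) k <= Uf (V m om) k" if i: "i : obsA n om" for i
		proof
			assume "fst (V i om) $ k <= fst (V m om) $ k"
			thus "Uf (V i om) k <= Uf (V m om) k" unfolding Uf_def by (rule condF_mono)
		next
			assume le: "Uf (V i om) k <= Uf (V m om) k"
			show "fst (V i om) $ k <= fst (V m om) $ k"
			proof (rule ccontr)
				assume n: "~ fst (V i om) $ k <= fst (V m om) $ k"
				hence "Uf (V m om) k <= Uf (V i om) k" unfolding Uf_def by (intro condF_mono) simp
				moreover have "i ~= m" using n by auto
				ultimately show False using le inj[OF i] by simp
			qed
		qed
		have xinj: "fst (V i om) $ k ~= fst (V m om) $ k" if "i : obsA n om" "i ~= m" for i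
			using inj[OF that] by (auto simp: Uf_def)
		have "{i : obsA n om. fst (V i om) $ k <= fst (V m om) $ k} = insert m {i : obsA n om. fst (V i om) $ k < fst (V m om) $ k}"
			using m(1) xinj by (auto simp: order_le_less)
		hence "card {i : obsA n om. fst (V i om) $ k <= fst (V m om) $ k} = Suc (card {i : obsA n om. fst (V i om) $ k < fst (V m om) $ k})"
			using finite_obsA by simp
		moreover have "{i : obsA n om. Uf (V i om) k <= vq n om u $ k} = {i : obsA n om. fst (V i om) $ k <= fst (V m om) $ k}"
			using eq v by auto
		ultimately show ?thesis using m(2,3,4) eq v by auto
	qed
	thus "i : obsA n om ==> ereal (fst (V i om) $ k) <= geninv (Fn V A n k om) (u $ k) \<longleftrightarrow> Uf (V i om) k <= vq n om u $ k"
		and "abs (real (card {i : obsA n om. Uf (V i om) k <= vq n om u $ k}) - u $ k * real (card (obsA n om))) <= 1" by auto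
qed

lemma indic_obs_bi:
	assumes "generic om" "n >= 1" "phat V A n om > 0" "u : cube" and i: "i < n"
	shows "indic_obs V A n om u i = bx.bi (vq n om u) (V i om)"
proof (cases "V i om : As")
	case True
	hence "i : obsA n om" using i by (simp add: obsA_def)
	thus ?thesis using vq_link(1)[OF assms(1-4)] True unfolding indic_obs_def bx.bi_def by (auto simp: As_def)
next
	case False
	hence "snd (V i om) \<notin> A" by (simp add: As_def)
	thus ?thesis using False by (simp add: indic_obs_def bx.bi_def)
qed

lemma sum_bi_margin: "(SUM i<n. bx.bi (vupd (vec 1) k t) (V i om)) = real (card {i : obsA n om. Uf (V i om) k <= t})"
proof -
	have "(SUM i<n. bx.bi (vupd (vec 1) k t) (V i om)) = (SUM i<n. if V i om : As & Uf (V i om) k <= t then 1 else 0)"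
		using condF_range(2) by (intro sum.cong) (auto simp: bx.bi_def Uf_def)
	also have "... = (SUM i:{i : {..<n}. V i om : As & Uf (V i om) k <= t}. 1)" by (rule sum.inter_filter[symmetric]) simp
	also have "{i : {..<n}. V i om : As & Uf (V i om) k <= t} = {i : obsA n om. Uf (V i om) k <= t}" by (auto simp: obsA_def)
	finally show ?thesis by simp
qed

lemma sum_bi_one: "(SUM i<n. bx.bi (vec 1) (V i om)) = real (card (obsA n om))"
proof -
	have "(SUM i<n. bx.bi (vec 1) (V i om)) = (SUM i<n. if V i om : As then 1 else 0)"
		using condF_range(2) by (intro sum.cong) (auto simp: bx.bi_def Uf_def)
	also have "... = (SUM i:{i : {..<n}. V i om : As}. 1)" by (rule sum.inter_filter[symmetric]) simp
	also have "{i : {..<n}. V i om : As} = obsA n om" by (auto simp: obsA_def)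
	finally show ?thesis by simp
qed

lemma alp_eq: assumes "n >= 1" shows "alp n om u = rt n * ((SUM i<n. bx.bi u (V i om)) / real n - bx.Dm u)"
proof -
	have "alp n om u = ((SUM i<n. bx.bi u (V i om)) - real n * bx.Dm u) / rt n"
		unfolding zp_def by (simp add: sum_subtractf sum_divide_distrib[symmetric] diff_divide_distrib)
	also have "... = ((SUM i<n. bx.bi u (V i om)) - real n * bx.Dm u) * (1 / rt n)" by simp
	also have "... = ((SUM i<n. bx.bi u (V i om)) - real n * bx.Dm u) * (rt n / real n)" using assms sqrt_over[of "real n"] by simp
	also have "((SUM i<n. bx.bi u (V i om)) - real n * bx.Dm u) * (rt n / real n) = rt n * (((SUM i<n. bx.bi u (V i om)) - real n * bx.Dm u) / real n)" by simp
	finally show ?thesis using assms by (simp add: diff_divide_distrib)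
qed

lemma bet_eq: assumes "n >= 1" shows "bet W n om u = (SUM i<n. xi W n i om * bx.bi u (V i om)) / rt n"
proof -
	have "bet W n om u = (SUM i<n. xi W n i om * bx.bi u (V i om)) / rt n - (SUM i<n. xi W n i om) * (bx.Dm u / rt n)"
		unfolding zp_def by (simp add: sum_subtractf sum_divide_distrib sum_distrib_right right_diff_distrib)
	thus ?thesis using sum_xi[OF assms, of W om] by simp
qed

lemma phat_alp: assumes "n >= 1" shows "phat V A n om = pAA + alp n om (vec 1) / rt n"
	using assms unfolding alp_eq[OF assms] Dm_one sum_bi_one phat_obsA by simp

lemma qrel_vq:
	assumes g: "generic om" and n: "n >= 1" and ph: "phat V A n om > 0"
	shows "sc.qrel n (alp n om) (vq n om)"
	unfolding sc.qrel_def
proof (intro ballI conjI allI)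
	fix u :: "real^'p" and k :: 'p assume u: "u : cube"
	show "vq n om u : cube" by (rule vq_cube)
	let ?v = "vq n om u $ k" and ?c = "real (card {i : obsA n om. Uf (V i om) k <= vq n om u $ k})" and ?N = "real (card (obsA n om))"
	have sn: "rt n > 0" using n by simp
	have "pAA * (rt n * (?v - u $ k)) + alp n om (vupd (vec 1) k ?v) - u $ k * alp n om (vec 1) = rt n * ((?c - u $ k * ?N) / real n)"
		unfolding alp_eq[OF n] Dm_one sum_bi_one sum_bi_margin Dm_margin[OF cubeD(1)[OF vq_cube] cubeD(2)[OF vq_cube]]
		by (simp add: algebra_simps diff_divide_distrib)
	also have "abs (...) = rt n * (abs (?c - u $ k * ?N) / real n)" by (simp add: abs_mult)
	also have "... <= rt n * (1 / real n)"
		using vq_link(2)[OF g n ph u, of k] sn by (intro mult_left_mono divide_right_mono) auto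
	also have "... = 1 / rt n" using n sqrt_over[of "real n"] by simp
	finally show "abs (pAA * (rt n * (?v - u $ k)) + alp n om (vupd (vec 1) k ?v) - u $ k * alp n om (vec 1)) <= 1 / rt n" .
qed

lemma Dbar_sum:
	assumes "generic om" "n >= 1" "phat V A n om > 0" "u : cube"
	shows "Dbar V A n om u = (SUM i<n. bx.bi (vq n om u) (V i om)) / real n"
	unfolding Dbar_def using indic_obs_bi[OF assms] by simp

lemma DbarProc_DP:
	assumes "generic om" "n >= 1" "phat V A n om > 0" "u : cube"
	shows "DbarProc P V A n om u = sc.DP n (alp n om) (vq n om) u"
	unfolding DbarProc_def Dbar_sum[OF assms] sc.DP_def alp_eq[OF assms(2)] DD_Dm by (simp add: right_diff_distrib)

lemma Dbar_Db:
	assumes "generic om" "n >= 1" "phat V A n om > 0" "u : cube"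
	shows "Dbar V A n om u = sc.Db n (alp n om) (vq n om) u"
	unfolding sc.Db_def DbarProc_DP[OF assms, symmetric] using assms(2) by (simp add: DbarProc_def)

lemma pd_hat_dq:
	assumes "generic om" "n >= 1" "phat V A n om > 0" "u : cube"
	shows "pd_hat V A n om k u = sc.dq n (alp n om) (vq n om) k u"
proof -
	note st = difference_step[OF cubeD(1)[OF assms(4), of k] cubeD(2)[OF assms(4), of k] assms(2)]
	have "vupd u k (min (u $ k + 1 / rt n) 1) : cube" "vupd u k (max (u $ k - 1 / rt n) 0) : cube"
		using st cubeD[OF assms(4), of k] by (intro vupd_cube[OF assms(4)]; linarith)+
	thus ?thesis unfolding pd_hat_def sc.dq_def Let_def using Dbar_Db[OF assms(1-3)] by simp
qed

lemma Dstar_bet: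
	assumes "generic om" "n >= 1" "phat V A n om > 0" "u : cube"
	shows "Dstar V A W n om u = bet W n om (vq n om u)"
proof -
	let ?b = "%i. bx.bi (vq n om u) (V i om)"
	have s: "rt n / real n = 1 / rt n" using assms(2) by (intro sqrt_over) simp
	have "rt n * Wbar W n om * ((SUM i<n. ?b i) / real n) = (rt n / real n) * (Wbar W n om * (SUM i<n. ?b i))" by simp
	also have "... = (SUM i<n. Wbar W n om * ?b i) / rt n" unfolding s by (simp add: sum_distrib_left sum_divide_distrib)
	finally have "Dstar V A W n om u = (SUM i<n. W n i om * ?b i) / rt n - (SUM i<n. Wbar W n om * ?b i) / rt n"
		unfolding Dstar_def Dbar_sum[OF assms] using indic_obs_bi[OF assms] by simp
	also have "... = (SUM i<n. xi W n i om * ?b i) / rt n"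
		by (simp add: xi_def sum_subtractf left_diff_distrib diff_divide_distrib)
	finally show ?thesis unfolding bet_eq[OF assms(2)] .
qed

lemma Dtilde_Dt:
	assumes "generic om" "n >= 1" "phat V A n om > 0" "u : cube"
	shows "Dtilde V A W n om u = sc.Dt n (alp n om) (bet W n om) (vq n om) u"
proof -
	have "vupd (vec 1) k (u $ k) : cube" for k using cubeD[OF assms(4), of k] by (intro vupd_cube) auto
	thus ?thesis
		unfolding Dtilde_def sc.Dt_def phat_alp[OF assms(2), symmetric]
		using Dstar_bet[OF assms(1-3), of _ W] pd_hat_dq[OF assms] assms(4) one_cube(1) by simp
qed

text \<open>On a generic outcome no observation in \<open>A\<close> has \<open>Uf = 0\<close>, so a
  box with a vanishing side is empty. This supplies the zeros on the lower faces that
  \<open>reg\<close> demands.\<close>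

lemma zp_zero:
	assumes g: "generic om" and u: "u $ k = 0"
	shows "zp n a om u = 0"
proof -
	have "bx.bi u (V i om) = 0" for i
	proof (cases "V i om : As")
		case True
		hence "~ Uf (V i om) k <= u $ k" using g u unfolding generic_def by (auto simp: not_le)
		thus ?thesis by (auto simp: bx.bi_def)
	qed (simp add: bx.bi_def)
	thus ?thesis using Dm_zero[OF u] by (simp add: zp_def)
qed

lemma pd_hat_bound: assumes u: "u : cube" shows "abs (pd_hat V A n om k u) <= rt n"
proof -
	have ind: "0 <= indic_obs V A n om w i" "indic_obs V A n om w i <= 1" for w i by (auto simp: indic_obs_def)
	have Db: "0 <= Dbar V A n om w" "Dbar V A n om w <= 1" for w
	proof -
		show "0 <= Dbar V A n om w" unfolding Dbar_def using ind by (intro divide_nonneg_nonneg sum_nonneg) auto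
		have "(SUM i<n. indic_obs V A n om w i) <= (SUM i<n. 1)" using ind by (intro sum_mono)
		thus "Dbar V A n om w <= 1" unfolding Dbar_def by (cases "n = 0") (auto simp: divide_le_eq_1)
	qed
	show ?thesis
	proof (cases "n >= 1")
		case True
		define up where "up = min (u $ k + 1 / rt n) 1"
		define um where "um = max (u $ k - 1 / rt n) 0"
		note st = difference_step[OF cubeD(1)[OF u, of k] cubeD(2)[OF u, of k] True, folded up_def um_def]
		have sn: "rt n > 0" using True by simp
		have pos: "up - um > 0" using st(5) sn by (meson less_le_trans zero_less_divide_1_iff)
		have "abs (pd_hat V A n om k u) = abs (Dbar V A n om (vupd u k up) - Dbar V A n om (vupd u k um)) / (up - um)"
			unfolding pd_hat_def Let_def up_def[symmetric] um_def[symmetric] using pos by simp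
		also have "... <= 1 / (1 / rt n)"
			using Db[of "vupd u k up"] Db[of "vupd u k um"] st(5) sn by (intro frac_le) auto
		finally show ?thesis by simp
	next
		case False
		hence "n = 0" by simp
		\<comment> \<open>For \<open>n = 0\<close> the step \<open>1 / rt n\<close> is 0 by convention,
		  both endpoints equal \<open>u $ k\<close>, and the quotient is 0.\<close>
		hence "min (u $ k + 1 / rt n) 1 - max (u $ k - 1 / rt n) 0 = 0" using cubeD[OF u, of k] by simp
		hence "pd_hat V A n om k u = 0" unfolding pd_hat_def Let_def by (simp only: div_by_0)
		thus ?thesis by simp
	qed
qed

text \<open>Required at every outcome, generic or not: the test functions are controlled only on
  \<open>lspace\<close>, and the outer expectation looks at all outcomes. Crude bounds depending on
  \<open>n\<close> and the outcome are enough.\<close>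

lemma bootproc_lspace: "bootproc P V A W M n om : lspace M"
proof -
	have ind: "0 <= indic_obs V A n om w i" "indic_obs V A n om w i <= 1" for w i by (auto simp: indic_obs_def)
	have Db: "abs (Dbar V A n om w) <= 1" for w
	proof -
		have "0 <= Dbar V A n om w" unfolding Dbar_def using ind by (intro divide_nonneg_nonneg sum_nonneg) auto
		moreover have "(SUM i<n. indic_obs V A n om w i) <= (SUM i<n. 1)" using ind by (intro sum_mono)
		hence "Dbar V A n om w <= 1" unfolding Dbar_def by (cases "n = 0") (auto simp: divide_le_eq_1)
		ultimately show ?thesis by simp
	qed
	define s where "s = rt n"
	have s0: "s >= 0" by (simp add: s_def)
	have b0: "abs (DbarProc P V A n om w) <= 2 * s" for w
	proof -
		have "abs (Dbar V A n om w - DD P V A w) <= 2" using Db[of w] bx.Dm_range[of w] unfolding DD_Dm by linarith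
		hence "s * abs (Dbar V A n om w - DD P V A w) <= s * 2" using s0 by (intro mult_left_mono)
		thus ?thesis unfolding DbarProc_def abs_mult s_def by simp
	qed
	define c where "c j = (SUM i<n. abs (W j n i om)) / s + abs (s * Wbar (W j) n om)" for j
	have st: "abs (Dstar V A (W j) n om w) <= c j" for j w
	proof -
		have "abs (SUM i<n. W j n i om * indic_obs V A n om w i) <= (SUM i<n. abs (W j n i om))"
			by (rule order_trans[OF sum_abs], rule sum_mono) (use ind in \<open>auto simp: abs_mult intro!: mult_left_le\<close>)
		hence "abs ((SUM i<n. W j n i om * indic_obs V A n om w i) / s) <= (SUM i<n. abs (W j n i om)) / s"
			using s0 by (simp add: divide_right_mono)
		moreover have "abs (s * Wbar (W j) n om * Dbar V A n om w) <= abs (s * Wbar (W j) n om) * 1"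
			unfolding abs_mult[of _ "Dbar V A n om w"] using Db[of w] by (intro mult_left_mono) auto
		ultimately show ?thesis unfolding Dstar_def c_def s_def by linarith
	qed
	define K where "K j = c j + abs (1 / phat V A n om) * (real CARD('p) * (s * (2 * c j)))" for j
	have c0: "c j >= 0" for j using st[of j undefined] by linarith
	have bj: "abs (Dtilde V A (W j) n om u) <= K j" if u: "u : cube" for j u
	proof -
		have "abs (pd_hat V A n om k u * (Dstar V A (W j) n om (vupd (vec 1) k (u $ k)) - u $ k * Dstar V A (W j) n om (vec 1))) <= s * (2 * c j)" for k
		proof -
			have "abs (u $ k * Dstar V A (W j) n om (vec 1)) <= 1 * c j" unfolding abs_mult using cubeD[OF u, of k] st[of j "vec 1"] by (intro mult_mono) auto
			hence "abs (Dstar V A (W j) n om (vupd (vec 1) k (u $ k)) - u $ k * Dstar V A (W j) n om (vec 1)) <= 2 * c j"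
				using st[of j "vupd (vec 1) k (u $ k)"] by linarith
			thus ?thesis unfolding abs_mult using pd_hat_bound[OF u, of n om k] s0 unfolding s_def[symmetric] by (intro mult_mono) auto
		qed
		hence "abs (SUM k:UNIV. pd_hat V A n om k u * (Dstar V A (W j) n om (vupd (vec 1) k (u $ k)) - u $ k * Dstar V A (W j) n om (vec 1))) <= (SUM k:(UNIV::'p set). s * (2 * c j))"
			by (intro order_trans[OF sum_abs] sum_mono)
		hence "abs ((1 / phat V A n om) * (SUM k:UNIV. pd_hat V A n om k u * (Dstar V A (W j) n om (vupd (vec 1) k (u $ k)) - u $ k * Dstar V A (W j) n om (vec 1))))
				<= abs (1 / phat V A n om) * (real CARD('p) * (s * (2 * c j)))"
			unfolding abs_mult[of "1 / phat V A n om"] by (intro mult_left_mono) auto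
		thus ?thesis unfolding Dtilde_def K_def using st[of j u] by linarith
	qed
	have K0: "0 <= K j" for j unfolding K_def using c0 s0 by (intro add_nonneg_nonneg mult_nonneg_nonneg) auto
	have "abs (bootproc P V A W M n om j u) <= 2 * s + (SUM j<=M. K j)" for j u
	proof (cases "j <= M & u : cube")
		case True
		have "K j <= (SUM j<=M. K j)" using True K0 by (intro member_le_sum) auto
		moreover have "0 <= (SUM j<=M. K j)" using K0 by (intro sum_nonneg)
		ultimately show ?thesis using True b0[of u] bj[of u j] s0 by (auto simp: bootproc_def)
	next
		case False
		moreover have "0 <= (SUM j<=M. K j)" using K0 by (intro sum_nonneg)
		ultimately show ?thesis using s0 by (auto simp: bootproc_def)
	qed
	moreover have "ALL j u. ~ (j <= M & u : cube) --> bootproc P V A W M n om j u = 0" by (simp add: bootproc_def)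
	ultimately show ?thesis unfolding lspace_def by blast
qed

end

section \<open>Step functions on the grid and measurability of processes with uniformly continuous
  paths\<close>

definition gstep :: "nat => nat => (nat \<times> (real^'p) => real) => nat => real^'p => real" where
	"gstep M l y = (%j u. if j <= M & u : cube then y (j, dyv l u) else 0)"

lemma gstep_bound:
	fixes y :: "nat \<times> (real^'p::finite) => real"
	shows "abs (gstep M l y j u) <= (SUM s:{..M} \<times> dygrid l. abs (y s))"
proof (cases "j <= M & u : cube")
	case True
	hence "(j, dyv l u) : {..M} \<times> dygrid l" using dyv_dygrid by auto
	hence "abs (y (j, dyv l u)) <= (SUM s:{..M} \<times> dygrid l. abs (y s))" by (intro member_le_sum) (auto simp: finite_dygrid)
	thus ?thesis using True by (simp add: gstep_def)
qed (auto simp: gstep_def intro!: sum_nonneg)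

lemma gstep_lspace: "gstep M l y : lspace M" for y :: "nat \<times> (real^'p::finite) => real"
proof -
	have "ALL j u. ~ (j <= M & u : cube) --> gstep M l y j u = 0" by (simp add: gstep_def)
	thus ?thesis unfolding lspace_def using gstep_bound[of M l y] by blast
qed

lemma dygrid_cubeD: "u : dygrid l ==> u : cube" using dygrid_cube[of l] by blast

lemma dyv_dist: "abs (dyv l u $ k - u $ k) <= 1 / 2 ^ l"
	using dyr_bounds[where l=l and t="u $ k"] by simp

lemma eventually_half_power: "de > 0 ==> \<forall>\<^sub>F l in sequentially. 1 / 2 ^ l <= (de :: real)"
proof -
	assume "de > 0"
	have "(%l. (1 / 2 :: real) ^ l) \<longlonglongrightarrow> 0" by (intro LIMSEQ_power_zero) auto
	hence "\<forall>\<^sub>F l in sequentially. (1 / 2 :: real) ^ l < de" using \<open>de > 0\<close> by (rule order_tendstoD)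
	thus ?thesis by eventually_elim (simp add: power_one_over)
qed

context
	fixes Q :: "'v measure" and G :: "'v => nat => real^'p::finite => real" and M :: nat
	assumes lsp: "!!x. x : space Q ==> G x : lspace M"
		and coord: "!!j u. j <= M ==> u : cube ==> (%x. G x j u) : bm Q"
		and unif: "!!x ep. x : space Q ==> ep > 0 ==> EX de>0. ALL j<=M. ALL u:cube. ALL v:cube. (ALL k. abs (u $ k - v $ k) <= de) --> abs (G x j u - G x j v) <= ep"
begin

text \<open>Sampling the path on the grid of level \<open>l\<close> gives a Lipschitz function of
  finitely many coordinates, hence a measurable one; uniform continuity of the paths lets
  \<open>l\<close> tend to infinity.\<close>

lemma lipschitz_process_measurable:
	assumes h: "!!g. g : lspace M ==> abs (h g) <= K" and L: "lsp_lipschitz M L h"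
	shows "(%x. h (G x)) : bm Q"
proof (rule borel_measurable_LIMSEQ_real)
	have L0: "0 <= L" and Lip: "!!g g'. g : lspace M ==> g' : lspace M ==> abs (h g - h g') <= L * supdist M g g'"
		using L unfolding lsp_lipschitz_def by auto
	let ?S = "%l x. h (gstep M l (%s. G x (fst s) (snd s)))"
	show "?S l : bm Q" for l
	proof (rule borel_measurable_lipschitz_finite[where I="{..M} \<times> dygrid l" and g="%y. h (gstep M l y)" and K=K and L=L])
		show "abs (h (gstep M l y)) <= K" for y :: "nat \<times> (real^'p) => real" by (rule h[OF gstep_lspace])
		show "ALL y y' d. (ALL i:{..M} \<times> dygrid l. abs (y i - y' i) <= d) --> 0 <= d --> abs (h (gstep M l y) - h (gstep M l y')) <= L * d"
		proof (intro allI impI)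
			fix y y' :: "nat \<times> (real^'p) => real" and d :: real assume d: "ALL i:{..M} \<times> dygrid l. abs (y i - y' i) <= d" "0 <= d"
			have "supdist M (gstep M l y) (gstep M l y') <= d"
				using d dyv_dygrid by (intro supdist_le) (auto simp: gstep_def)
			hence "L * supdist M (gstep M l y) (gstep M l y') <= L * d" using L0 by (rule mult_left_mono)
			thus "abs (h (gstep M l y) - h (gstep M l y')) <= L * d" using Lip[OF gstep_lspace gstep_lspace, of l y l y'] by linarith
		qed
		show "(%x. G x (fst s) (snd s)) : bm Q" if "s : {..M} \<times> dygrid l" for s
			using that by (intro coord) (auto intro: dygrid_cubeD)
	qed (use L0 finite_dygrid in auto)
	fix x assume x: "x : space Q"
	show "(%l. ?S l x) \<longlonglongrightarrow> h (G x)"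
	proof (rule LIMSEQ_I)
		fix r :: real assume r: "r > 0"
		define ep where "ep = r / (2 * (L + 1))"
		have ep: "ep > 0" using r L0 by (simp add: ep_def)
		obtain de where de: "de > 0" "ALL j<=M. ALL u:cube. ALL v:cube. (ALL k. abs (u $ k - v $ k) <= de) --> abs (G x j u - G x j v) <= ep"
			using unif[OF x ep] by blast
		have "\<forall>\<^sub>F l in sequentially. norm (?S l x - h (G x)) < r"
			using eventually_half_power[OF de(1)]
		proof eventually_elim
			case (elim l)
			let ?g = "gstep M l (%s. G x (fst s) (snd s))"
			have "supdist M ?g (G x) <= ep"
			proof (rule supdist_le)
				fix j and u :: "real^'p" assume ju: "j <= M" "u : cube"
				have "ALL k. abs (dyv l u $ k - u $ k) <= de" using dyv_dist elim order_trans by blast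
				hence "abs (G x j (dyv l u) - G x j u) <= ep" using de(2) ju dyv_cube by blast
				thus "abs (?g j u - G x j u) <= ep" using ju by (simp add: gstep_def)
			qed
			hence "L * supdist M ?g (G x) <= L * ep" using L0 by (rule mult_left_mono)
			also have "... <= (L + 1) * ep" using ep by (intro mult_right_mono) auto
			also have "... = r / 2"
			proof -
				obtain c where c: "c = L + 1" "c > 0" using L0 by simp
				show ?thesis unfolding ep_def c(1)[symmetric] using c(2) by simp
			qed
			finally show ?case using Lip[OF gstep_lspace lsp[OF x], of l "%s. G x (fst s) (snd s)"] r by simp
		qed
		thus "EX no. ALL l>=no. norm (?S l x - h (G x)) < r" by (simp add: eventually_sequentially)
	qed
qed

text \<open>The function space is not separable, so its open sets cannot be reduced to countably
  many balls. Instead the path lies in an open \<open>U\<close> exactly when the Lipschitz envelope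
  of the indicator of \<open>U\<close> is positive there.\<close>

lemma process_measurable: "G : measurable Q (lsp_borel M)"
	unfolding lsp_borel_def
proof (rule measurable_measure_of)
	show "{U. lopen M U} \<subseteq> Pow (lspace M)" by (auto simp: lopen_def)
	show "G : space Q \<rightarrow> lspace M" using lsp by auto
	fix U :: "(nat => real^'p => real) set" assume "U : {U. lopen M U}"
	hence U: "U \<subseteq> lspace M" "!!g. g : U ==> EX e>0. ALL g':lspace M. supdist M g g' < e --> g' : U" by (auto simp: lopen_def)
	define h :: "(nat => real^'p => real) => real" where "h g = indicator U g" for g
	have hb: "abs (h g) <= 1" if "g : lspace M" for g by (auto simp: h_def indicator_def)
	let ?H = "lower_env M h 1"
	have "(%x. ?H (G x)) : bm Q"
		by (rule lipschitz_process_measurable[OF lower_env_abs[where h=h and K=1, OF hb] lower_env_lipschitz[where h=h and K=1, OF hb]])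
	hence "{x : space Q. ?H (G x) > 0} : sets Q" by measurable
	moreover have "?H g > 0 \<longleftrightarrow> g : U" if g: "g : lspace M" for g
	proof
		assume "?H g > 0"
		hence "0 < h g" using lower_env_le_self[where h=h and K=1 and r=1, OF hb g] by simp
		thus "g : U" by (cases "g : U") (auto simp: h_def)
	next
		assume "g : U"
		from U(2)[OF this] obtain e where e: "e > 0" "!!g'. g' : lspace M ==> supdist M g g' < e ==> g' : U" by blast
		have "min 1 e <= ?H g" unfolding lower_env_def
		proof (rule cINF_greatest)
			fix g' :: "nat => real^'p => real" assume g': "g' : lspace M"
			have "0 <= supdist M g g'" by (rule supdist_nonneg[OF g g'])
			moreover have "supdist M g g' < e ==> h g' = 1" using e(2)[OF g'] by (simp add: h_def)
			moreover have "0 <= h g'" by (simp add: h_def)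
			ultimately show "min 1 e <= h g' + real 1 * supdist M g g'" by (cases "supdist M g g' < e") auto
		qed (use g in blast)
		thus "?H g > 0" using e(1) by linarith
	qed
	moreover have "{x : space Q. ?H (G x) > 0} = G -` U Int space Q" using calculation(2) lsp by auto
	ultimately show "G -` U Int space Q : sets Q" by simp
qed

end

section \<open>Independent copies on the real line\<close>

text \<open>Arrays of reals have the cardinality of the continuum: with a bijection between sets of
  naturals and reals, an array becomes the set of all its coded membership facts, which is again a
  set of naturals.\<close>

lemma inj_array_real: obtains ff :: "(nat => nat => real) => real" where "inj ff"
proof -
	obtain g :: "nat set => real" where g: "bij g"
		using nat_sets_eqpoll_reals unfolding eqpoll_def by blast
	define c :: "(nat => nat => real) => nat set" where "c f = {prod_encode (i, prod_encode (j, k)) | i j k. k : inv g (f i j)}" for f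
	have mem: "prod_encode (i, prod_encode (j, k)) : c f \<longleftrightarrow> k : inv g (f i j)" for i j k f unfolding c_def by auto
	have "inj c"
	proof (rule injI)
		fix f f' assume "c f = c f'"
		hence "inv g (f i j) = inv g (f' i j)" for i j using mem[of i j _ f] mem[of i j _ f'] by blast
		thus "f = f'" using g by (metis bij_inv_eq_iff ext)
	qed
	from inj_compose[OF bij_is_inj[OF g] this] have "inj (%f. g (c f))" by (simp add: comp_def)
	thus ?thesis by (rule that)
qed

text \<open>The sigma-algebra put on the reals is the pullback along \<open>ps\<close>, not the
  Borel one. Hence \<open>ff\<close> only has to be injective, and \<open>ps\<close> inverts it on
  the image of \<open>space N\<close>, with a fixed dummy value elsewhere.\<close>

lemma real_copy:
	fixes N :: "(nat => nat => real) measure"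
	assumes "prob_space N"
	obtains Q :: "real measure" and ps where "prob_space Q" "ps : measurable Q N" "distr Q N ps = N"
proof -
	interpret N: prob_space N by fact
	obtain ff :: "(nat => nat => real) => real" where ff: "inj ff" by (rule inj_array_real)
	define ps where "ps r = (if r : ff ` space N then inv ff r else (SOME x. x : space N))" for r
	have some: "(SOME x. x : space N) : space N" using N.not_empty by (simp add: some_in_eq)
	have pss: "ps r : space N" for r unfolding ps_def using some ff by (auto simp: inv_f_f)
	have psff: "ps (ff x) = x" if "x : space N" for x unfolding ps_def using that ff by (auto simp: inv_f_f)
	define T where "T = vimage_algebra UNIV ps N"
	have id: "(%x. ps (ff x)) : measurable N N"
		by (rule measurable_cong[THEN iffD2, OF _ measurable_ident_sets[OF refl]]) (simp add: psff)
	have ffm: "ff : measurable N T" unfolding T_def using id by (intro measurable_vimage_algebra2) auto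
	have psT: "ps : measurable T N" unfolding T_def using pss by (intro measurable_vimage_algebra1) auto
	show ?thesis
	proof (rule that[of "distr N T ff" ps])
		show "prob_space (distr N T ff)" by (rule N.prob_space_distr[OF ffm])
		show "ps : measurable (distr N T ff) N" using psT by simp
		have "distr (distr N T ff) N ps = distr N N (ps \<circ> ff)" by (rule distr_distr[OF psT ffm])
		also have "... = distr N N (%x. x)" by (rule distr_cong) (auto simp: psff)
		finally show "distr (distr N T ff) N ps = N" by (simp add: distr_id)
	qed
qed

text \<open>The copies are the coordinates of a product of \<open>gsp\<close> over
  \<open>{..M}\<close>, moved to the reals. The joint characteristic function factors over
  \<open>j\<close>, which is why its exponent has no terms between different processes.\<close>

lemma gaussian_proc_copies:
	fixes K :: "real^'p::finite => real^'p => real" and B1 :: "(nat => real) => real^'p => real" and M :: nat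
	assumes B1: "gaussian_proc gsp B1 K"
		and pos: "!!S c. finite S ==> S \<subseteq> cube ==> 0 <= (SUM u:S. SUM v:S. c u * c v * K u v)"
	obtains Q :: "real measure" and ps where "prob_space Q"
		"!!j. j <= M ==> gaussian_proc Q (%x. B1 (ps x j)) K"
		"prob_space.indep_sets Q (%j. gen_sigma Q (%u x. B1 (ps x j) u) cube) {..M}"
		"!!S t. finite S ==> S \<subseteq> {..M} \<times> cube ==> (\<integral>x. cis (SUM s:S. t s * B1 (ps x (fst s)) (snd s)) \<partial>Q) =
				cor (exp (- (SUM s:S. SUM s':S. t s * t s' * (if fst s = fst s' then K (snd s) (snd s') else 0)) / 2))"
proof -
	interpret G: prob_space gsp by (rule prob_space_gauss)
	let ?PP = "\<Pi>\<^sub>M j\<in>{..M}. gsp"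
	interpret PP: prob_space ?PP by (rule prob_space_PiM) (rule prob_space_gauss)
	interpret prod: product_prob_space "%_::nat. gsp" by unfold_locales
	have B1m: "(%y. B1 y u) : bm gsp" if "u : cube" for u using B1 that by (simp add: gaussian_proc_def)
	have B1n: "normal_law gsp (%y. SUM u:S. c u * B1 y u) (SUM u:S. SUM v:S. c u * c v * K u v)" if "finite S" "S \<subseteq> cube" for S c
		using B1 that by (simp add: gaussian_proc_def)
	obtain Q :: "real measure" and ps where Q: "prob_space Q" and ps: "ps : measurable Q ?PP" and law: "distr Q ?PP ps = ?PP"
		by (rule real_copy[OF PP.prob_space_axioms])
	interpret Q: prob_space Q by (rule Q)
	have cm: "(%x. ps x j) : measurable Q gsp" if "j <= M" for j
		using that by (intro measurable_compose[OF ps measurable_component_singleton]) auto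
	have cl: "distr Q gsp (%x. ps x j) = gsp" if j: "j <= M" for j
	proof -
		have "distr Q gsp (%x. ps x j) = distr (distr Q ?PP ps) gsp (%y. y j)"
			using j by (subst distr_distr[OF _ ps]) (auto simp: comp_def)
		also have "... = gsp" unfolding law using j by (intro distr_PiM_component prob_space_gauss) auto
		finally show ?thesis .
	qed
	show ?thesis
	proof (rule that[OF Q, of ps])
		fix j assume j: "j <= M"
		have eqd: "distr Q borel (%x. f (ps x j)) = distr gsp borel f" if "f : bm gsp" for f :: "(nat => real) => real"
		proof -
			have "distr gsp borel f = distr (distr Q gsp (%x. ps x j)) borel f" by (simp only: cl[OF j])
			also have "... = distr Q borel (%x. f (ps x j))" using that by (subst distr_distr[OF _ cm[OF j]]) (auto simp: comp_def)
			finally show ?thesis ..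
		qed
		show "gaussian_proc Q (%x. B1 (ps x j)) K" unfolding gaussian_proc_def
		proof (intro conjI ballI allI impI)
			fix u :: "real^'p" assume "u : cube"
			thus "(%x. B1 (ps x j) u) : bm Q" by (intro measurable_compose[OF cm[OF j] B1m])
		next
			fix S :: "(real^'p) set" and c :: "real^'p => real" assume S: "finite S & S \<subseteq> cube"
			have "(%y. SUM u:S. c u * B1 y u) : bm gsp" using S B1m by (intro borel_measurable_sum borel_measurable_times) auto
			from eqd[OF this] B1n[of S c] S show "normal_law Q (%x. SUM u:S. c u * B1 (ps x j) u) (SUM u:S. SUM v:S. c u * c v * K u v)"
				by (simp add: normal_law_def)
		qed
	next
		have "Q.indep_vars (%_. gsp) (%j x. ps x j) {..M}"
		proof (subst Q.indep_vars_iff_distr_eq_PiM')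
			have "distr Q ?PP (%x. \<lambda>j\<in>{..M}. ps x j) = distr Q ?PP ps"
				using measurable_space[OF ps] by (intro distr_cong refl) (auto simp: space_PiM PiE_iff extensional_restrict)
			also have "... = (\<Pi>\<^sub>M j\<in>{..M}. distr Q gsp (%x. ps x j))" unfolding law using cl by (intro PiM_cong) auto
			finally show "distr Q ?PP (%x. \<lambda>j\<in>{..M}. ps x j) = (\<Pi>\<^sub>M j\<in>{..M}. distr Q gsp (%x. ps x j))" .
		qed (use cm in auto)
		hence "Q.indep_sets (%j. {(%x. ps x j) -` S Int space Q | S. S : sets gsp}) {..M}" by (simp add: Q.indep_vars_def2)
		thus "Q.indep_sets (%j. gen_sigma Q (%u x. B1 (ps x j) u) cube) {..M}"
		proof (rule Q.indep_sets_mono_sets)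
			fix j assume "j : {..M}"
			hence j: "j <= M" by simp
			let ?R = "{(%x. ps x j) -` S Int space Q | S. S : sets gsp}"
			have sp: "(%x. ps x j) : space Q \<rightarrow> space gsp" using measurable_space[OF cm[OF j]] by auto
			have R: "sets (vimage_algebra (space Q) (%x. ps x j) gsp) = ?R" by (rule sets_vimage_algebra2[OF sp])
			show "gen_sigma Q (%u x. B1 (ps x j) u) cube \<subseteq> ?R"
				unfolding gen_sigma_def R[symmetric]
			proof (rule sets.sigma_sets_subset'[of _ "vimage_algebra (space Q) (%x. ps x j) gsp", unfolded space_vimage_algebra])
				show "(UN u:cube. {(%x. B1 (ps x j) u) -` S Int space Q | S. S : sets borel}) \<subseteq> sets (vimage_algebra (space Q) (%x. ps x j) gsp)"
				proof safe
					fix u :: "real^'p" and S :: "real set" assume u: "u : cube" and S: "S : sets borel"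
					have "(%x. ps x j) : measurable (vimage_algebra (space Q) (%x. ps x j) gsp) gsp" by (rule measurable_vimage_algebra1[OF sp])
					hence "(%x. B1 (ps x j) u) : bm (vimage_algebra (space Q) (%x. ps x j) gsp)" by (rule measurable_compose[OF _ B1m[OF u]])
					from measurable_sets[OF this S] show "(%x. B1 (ps x j) u) -` S Int space Q : sets (vimage_algebra (space Q) (%x. ps x j) gsp)" by simp
				qed
				show "space Q : sets (vimage_algebra (space Q) (%x. ps x j) gsp)"
					using sets.top[of "vimage_algebra (space Q) (%x. ps x j) gsp"] by simp
			qed
		qed
	next
		fix S :: "(nat \<times> (real^'p)) set" and t :: "nat \<times> (real^'p) => real" assume S: "finite S" "S \<subseteq> {..M} \<times> cube"
		define Sj where "Sj j = {u. (j, u) : S}" for j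
		have Sjc: "Sj j \<subseteq> cube" for j using S(2) by (auto simp: Sj_def)
		have Sjf: "finite (Sj j)" for j
		proof -
			have "Sj j \<subseteq> snd ` S" by (force simp: Sj_def)
			thus ?thesis using S(1) by (meson finite_imageI finite_subset)
		qed
		have Sig: "S = (SIGMA j:{..M}. Sj j)" using S(2) by (auto simp: Sj_def)
		define f where "f j y = (SUM u:Sj j. t (j, u) * B1 y u)" for j y
		define q where "q j = (SUM u:Sj j. SUM v:Sj j. t (j, u) * t (j, v) * K u v)" for j
		have fm: "f j : bm gsp" for j unfolding f_def[abs_def] using B1m Sjc by (intro borel_measurable_sum borel_measurable_times) auto
		have sumS: "(SUM s:S. g s) = (SUM j<=M. SUM u:Sj j. g (j, u))" for g :: "nat \<times> (real^'p) => real"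
			unfolding Sig using sum.Sigma[of "{..M}" Sj "%j u. g (j, u)"] Sjf by (simp add: case_prod_unfold)
		have "(SUM s:S. SUM s':S. t s * t s' * (if fst s = fst s' then K (snd s) (snd s') else 0)) = (SUM j<=M. q j)"
		proof -
			have "(SUM s':S. t (j, u) * t s' * (if fst (j, u) = fst s' then K (snd (j, u)) (snd s') else 0)) = (SUM v:Sj j. t (j, u) * t (j, v) * K u v)" if j: "j <= M" for j u
			proof -
				have "(SUM s':S. t (j, u) * t s' * (if fst (j, u) = fst s' then K (snd (j, u)) (snd s') else 0)) = (SUM i<=M. if i = j then (SUM v:Sj j. t (j, u) * t (j, v) * K u v) else 0)"
					unfolding sumS by (intro sum.cong refl) auto
				thus ?thesis using j by simp
			qed
			thus ?thesis unfolding sumS q_def by (intro sum.cong refl) auto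
		qed
		moreover have "(\<integral>x. cis (SUM s:S. t s * B1 (ps x (fst s)) (snd s)) \<partial>Q) = cor (exp (- (SUM j<=M. q j) / 2))"
		proof -
			have cisf: "(%y. cis (f j y)) : bm gsp" for j by (rule measurable_compose[OF fm measurable_cis])
			have pm: "(%y. \<Prod>j\<le>M. cis (f j (y j))) : bm ?PP"
			proof (intro borel_measurable_prod)
				fix j assume "j : {..M}"
				hence "(%y. y j) : measurable ?PP gsp" by (rule measurable_component_singleton)
				thus "(%y. cis (f j (y j))) : bm ?PP" using cisf by (rule measurable_compose)
			qed
			have "(SUM s:S. t s * B1 (ps x (fst s)) (snd s)) = (SUM j<=M. f j (ps x j))" for x unfolding sumS f_def by simp
			moreover have "cis (SUM j<=M. f j (y j)) = (\<Prod>j\<le>M. cis (f j (y j)))" for y :: "nat => nat => real"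
				by (simp add: cis_conv_exp sum_distrib_left exp_sum)
			ultimately have "(\<integral>x. cis (SUM s:S. t s * B1 (ps x (fst s)) (snd s)) \<partial>Q) = (\<integral>x. (\<Prod>j\<le>M. cis (f j (ps x j))) \<partial>Q)" by simp
			also have "... = (\<integral>y. (\<Prod>j\<le>M. cis (f j (y j))) \<partial>distr Q ?PP ps)" by (rule integral_distr[OF ps pm, symmetric])
			also have "... = (\<Prod>j\<le>M. \<integral>y. cis (f j y) \<partial>gsp)" unfolding law
				by (rule prod.product_integral_prod) (auto intro!: G.integrable_cis fm)
			also have "... = (\<Prod>j\<le>M. cor (exp (- q j / 2)))"
			proof (rule prod.cong[OF refl])
				fix j
				have n: "normal_law gsp (f j) (q j)" unfolding f_def[abs_def] q_def by (rule B1n[OF Sjf Sjc])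
				have q0: "q j >= 0" unfolding q_def by (rule pos[OF Sjf Sjc])
				from n[unfolded normal_law_iff_char[OF prob_space_gauss fm q0], rule_format, of 1]
				show "(\<integral>y. cis (f j y) \<partial>gsp) = cor (exp (- q j / 2))" by simp
			qed
			also have "... = cor (exp (- (SUM j<=M. q j) / 2))"
				by (simp add: exp_sum sum_divide_distrib sum_negf[symmetric] of_real_prod[symmetric] del: of_real_prod of_real_exp)
			finally show ?thesis .
		qed
		ultimately show "(\<integral>x. cis (SUM s:S. t s * B1 (ps x (fst s)) (snd s)) \<partial>Q) =
				cor (exp (- (SUM s:S. SUM s':S. t s * t s' * (if fst s = fst s' then K (snd s) (snd s') else 0)) / 2))" by simp
	qed
qed

section \<open>Disintegration along the weights\<close>

lemma gen_sigma_sets: "gen_sigma P Y I = sets (sigma (space P) (UN i:I. {Y i -` S Int space P | S. S : sets borel}))"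
	unfolding gen_sigma_def by (rule sets_measure_of[symmetric]) auto

lemma gen_sigma_Int_stable: "Int_stable (gen_sigma P Y I)"
	unfolding gen_sigma_sets by (intro Int_stableI) auto

lemma gen_sigma_Pow: "gen_sigma P Y I \<subseteq> Pow (space P)"
proof -
	have "(UN i:I. {Y i -` S Int space P | S. S : sets borel}) \<subseteq> Pow (space P)" by auto
	thus ?thesis unfolding gen_sigma_def using sigma_sets_into_sp by blast
qed

lemma gen_sigma_vimage: "i : I ==> S : sets borel ==> Y i -` S Int space P : gen_sigma P Y I"
	unfolding gen_sigma_def by (intro sigma_sets.Basic) auto

locale boot_sample = copula_data P V A
	for P :: "'w measure" and V :: "nat => 'w => (real^'p::finite) \<times> (real^'q::finite)" and A :: "(real^'q) set" +
	fixes W :: "nat => nat => nat => 'w => real" and M :: nat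
	assumes Wcond: "ALL j:{1..M}. exch_weights P (W j) & condW P (W j)"
		and indepW: "prob_space.indep_sets P
				(%j. if j = 0 then gen_sigma P V UNIV
						 else gen_sigma P (%(n, i). W j n i) {(n, i). i < n}) {..M}"
begin

definition Gs :: "nat => 'w set set" where
	"Gs j = (if j = 0 then gen_sigma P V UNIV else gen_sigma P (%(n, i). W j n i) {(n, i). i < n})"

text \<open>Information in the blocks \<open>J\<close>: block 0 is the sample, block
  \<open>j\<close> the \<open>j\<close>-th family of weights. Freezing the weights means holding
  \<open>WS {1..M}\<close> fixed while integrating over \<open>WS {0}\<close>.\<close>

definition WS :: "nat set => 'w measure" where "WS J = sigma (space P) (UN j:J. Gs j)"

lemma Gs_indep: "P.indep_sets Gs {..M}"
	using indepW unfolding Gs_def[abs_def] .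

lemma Gs_Pow: "Gs j \<subseteq> Pow (space P)" by (cases "j = 0") (simp_all add: Gs_def gen_sigma_Pow)

lemma space_WS [simp]: "space (WS J) = space P" unfolding WS_def using Gs_Pow by (intro space_measure_of) auto

lemma sets_WS: "sets (WS J) = sigma_sets (space P) (UN j:J. Gs j)" unfolding WS_def using Gs_Pow by (intro sets_measure_of) auto

lemma W_WS: "j : J ==> j ~= 0 ==> i < n ==> W j n i : measurable (WS J) borel"
proof (rule measurableI)
	fix S assume a: "j : J" "j ~= 0" "i < n" "S : sets (borel :: real measure)"
	have "(case (n, i) of (n, i) => W j n i) -` S Int space P : gen_sigma P (%(n, i). W j n i) {(n, i). i < n}"
		using a by (intro gen_sigma_vimage) auto
	hence "W j n i -` S Int space P : Gs j" using a by (simp add: Gs_def)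
	thus "W j n i -` S Int space (WS J) : sets (WS J)" unfolding sets_WS space_WS using a by (intro sigma_sets.Basic) auto
qed simp

lemma V_WS: "V i : measurable (WS {0}) borel"
proof (rule measurableI)
	fix S assume "S : sets (borel :: ((real^'p) \<times> (real^'q)) measure)"
	hence "V i -` S Int space P : Gs 0" unfolding Gs_def by (simp add: gen_sigma_vimage)
	thus "V i -` S Int space (WS {0}) : sets (WS {0})" unfolding sets_WS space_WS by (intro sigma_sets.Basic) auto
qed simp

lemma sets_WS_P: assumes "J \<subseteq> {..M}" shows "sets (WS J) \<subseteq> sets P"
proof -
	have "Gs j \<subseteq> sets P" if "j : J" for j using Gs_indep assms that unfolding P.indep_sets_def by auto
	thus ?thesis unfolding sets_WS by (intro sets.sigma_sets_subset) auto
qed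

lemma WS_measurable_P: assumes "J \<subseteq> {..M}" "X : measurable (WS J) N" shows "X : measurable P N"
	using assms(2) sets_WS_P[OF assms(1)] unfolding measurable_def by auto

lemma WS_indep_set:
	assumes J: "J \<subseteq> {..M}" "J' \<subseteq> {..M}" "J Int J' = {}"
	shows "P.indep_set (sets (WS J)) (sets (WS J'))"
proof -
	have "P.indep_sets (%b. sigma_sets (space P) (UN i:case_bool J J' b. Gs i)) UNIV"
	proof (rule P.indep_sets_collect_sigma)
		show "P.indep_sets Gs (UN b:UNIV. case_bool J J' b)"
			by (rule P.indep_sets_mono_index[OF _ Gs_indep]) (use J in \<open>auto split: bool.splits\<close>)
		show "Int_stable (Gs i)" for i unfolding Gs_def by (simp add: gen_sigma_Int_stable)
		show "disjoint_family_on (case_bool J J') UNIV" using J(3) by (auto simp: disjoint_family_on_def split: bool.splits)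
	qed
	moreover have "(%b. sigma_sets (space P) (UN i:case_bool J J' b. Gs i)) = case_bool (sets (WS J)) (sets (WS J'))"
		by (auto simp: sets_WS split: bool.splits)
	ultimately show ?thesis unfolding P.indep_set_def by simp
qed

lemma WS_indep_var:
	assumes J: "J \<subseteq> {..M}" "J' \<subseteq> {..M}" "J Int J' = {}" and X: "X : measurable (WS J) N" and Y: "Y : measurable (WS J') N'"
	shows "P.indep_var N X N' Y"
	unfolding P.indep_var_eq
proof (intro conjI)
	show "X : measurable P N" "Y : measurable P N'" using WS_measurable_P J X Y by auto
	have "sigma_sets (space P) {X -` S Int space P |S. S : sets N} \<subseteq> sets (WS J)"
		using sets.sigma_sets_subset[of "{X -` S Int space P |S. S : sets N}" "WS J"] measurable_sets[OF X] by auto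
	moreover have "sigma_sets (space P) {Y -` S Int space P |S. S : sets N'} \<subseteq> sets (WS J')"
		using sets.sigma_sets_subset[of "{Y -` S Int space P |S. S : sets N'}" "WS J'"] measurable_sets[OF Y] by auto
	ultimately show "P.indep_set (sigma_sets (space P) {X -` S Int space P |S. S : sets N}) (sigma_sets (space P) {Y -` S Int space P |S. S : sets N'})"
		using WS_indep_set[OF J] unfolding P.indep_set_def by (elim P.indep_sets_mono_sets) (auto split: bool.splits)
qed

text \<open>The sample process is row 0, with constant weights, so that the same estimates cover the
  original and the bootstrap processes and their joint law.\<close>

definition aw :: "nat => nat => nat => 'w => real" where
	"aw n j i om = (if j = 0 then 1 / rt n else xi (W j) n i om / rt n)"

definition av :: "nat => 'w => nat \<times> nat => real" where
	"av n om = (\<lambda>q\<in>{..M} \<times> {..<n}. aw n (fst q) (snd q) om)"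

definition ZZ :: "nat => nat => 'w => real^'p => real" where
	"ZZ n j om = zp n (%i. aw n j i om) om"

abbreviation "Nn n \<equiv> \<Pi>\<^sub>M q\<in>{..M} \<times> {..<n}. (borel :: real measure)"
abbreviation "Kn n \<equiv> \<Pi>\<^sub>M i\<in>{..<n}. mu"

lemma boot_weights: "j : {1..M} ==> boot_weights P (W j)"
	using Wcond prob by (simp add: boot_weights_def boot_weights_axioms_def)

lemma xi_WS: assumes "j : J" "j ~= 0" "i < n" shows "xi (W j) n i : measurable (WS J) borel"
	unfolding xi_def[abs_def] Wbar_def using assms W_WS by (intro borel_measurable_diff borel_measurable_divide borel_measurable_sum) auto

lemma aw_WS: assumes "j <= M" "i < n" shows "aw n j i : measurable (WS {1..M}) borel"
proof (cases "j = 0")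
	case False
	hence "(%om. xi (W j) n i om / rt n) : measurable (WS {1..M}) borel"
		using assms xi_WS[of j "{1..M}" i n] by (intro borel_measurable_divide) auto
	thus ?thesis using False by (simp add: aw_def[abs_def])
qed (simp add: aw_def[abs_def])

lemma aw_measurable: "j <= M ==> i < n ==> aw n j i : bm P"
	using aw_WS by (rule WS_measurable_P[rotated]) auto

lemma av_WS: "av n : measurable (WS {1..M}) (Nn n)"
	unfolding av_def[abs_def] using aw_WS by (intro measurable_restrict) auto

definition Vv :: "nat => 'w => nat => (real^'p) \<times> (real^'q)" where "Vv n om = (\<lambda>i\<in>{..<n}. V i om)"

lemma Vv_WS: "Vv n : measurable (WS {0}) (Kn n)"
	unfolding Vv_def[abs_def] using V_WS sets_mu by (intro measurable_restrict) (simp add: measurable_cong_sets[OF refl sets_mu])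

lemma distr_Vv: assumes n: "n >= 1" shows "distr P (Kn n) (Vv n) = Kn n"
proof -
	have "P.indep_vars (%_. borel) V {..<n}" by (rule P.indep_vars_subset[OF indepV]) simp
	moreover have "{..<n} ~= {}" using n by (auto simp: lessThan_empty_iff)
	ultimately have "distr P (\<Pi>\<^sub>M i\<in>{..<n}. borel) (%x. \<lambda>i\<in>{..<n}. V i x) = (\<Pi>\<^sub>M i\<in>{..<n}. distr P borel (V i))"
		by (subst (asm) P.indep_vars_iff_distr_eq_PiM') auto
	also have "(\<Pi>\<^sub>M i\<in>{..<n}. distr P borel (V i)) = Kn n"
		using idV by (intro PiM_cong refl) (metis mu_def)
	also have "distr P (\<Pi>\<^sub>M i\<in>{..<n}. borel) (%x. \<lambda>i\<in>{..<n}. V i x) = distr P (Kn n) (Vv n)"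
		by (intro distr_cong refl sets_PiM_cong) (auto simp: Vv_def sets_mu)
	finally show ?thesis .
qed

lemma av_measurable [measurable]: "av n : measurable P (Nn n)"
	using av_WS by (rule WS_measurable_P[rotated]) auto

lemma Vv_measurable [measurable]: "Vv n : measurable P (Kn n)"
	using Vv_WS by (rule WS_measurable_P[rotated]) auto

lemma prob_Kn: "prob_space (Kn n)" using prob_mu by (intro prob_space_PiM)

text \<open>Independence of the blocks \<open>{1..M}\<close> and \<open>{0}\<close> together with
  the i.i.d. sample. This is what justifies fixing the weights and integrating over a product of
  copies of \<open>mu\<close>.\<close>

lemma joint_law: assumes n: "n >= 1"
	shows "distr P (Nn n \<Otimes>\<^sub>M Kn n) (%om. (av n om, Vv n om)) = distr P (Nn n) (av n) \<Otimes>\<^sub>M Kn n"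
proof (rule pair_measure_eqI[symmetric])
	interpret K: prob_space "Kn n" by (rule prob_Kn)
	interpret N: prob_space "distr P (Nn n) (av n)" by (rule P.prob_space_distr[OF av_measurable])
	show "sigma_finite_measure (distr P (Nn n) (av n))" by unfold_locales
	show "sigma_finite_measure (Kn n)" by unfold_locales
	show "sets (distr P (Nn n) (av n) \<Otimes>\<^sub>M Kn n) = sets (distr P (Nn n \<Otimes>\<^sub>M Kn n) (%om. (av n om, Vv n om)))"
		by (simp add: sets_pair_measure_cong[OF sets_distr refl])
	fix S T assume S: "S : sets (distr P (Nn n) (av n))" and T: "T : sets (Kn n)"
	hence S': "S : sets (Nn n)" by simp
	let ?S = "av n -` S Int space P" and ?T = "Vv n -` T Int space P"
	have "?S : sets (WS {1..M})" using measurable_sets[OF av_WS S'] by simp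
	moreover have "?T : sets (WS {0})" using measurable_sets[OF Vv_WS T] by simp
	ultimately have "P.prob (?S Int ?T) = P.prob ?S * P.prob ?T"
		by (rule P.indep_setD[OF WS_indep_set, rotated 3]) auto
	hence "emeasure P (?S Int ?T) = emeasure P ?S * emeasure P ?T" by (simp add: P.emeasure_eq_measure ennreal_mult)
	moreover have "emeasure P ?S = emeasure (distr P (Nn n) (av n)) S" by (rule emeasure_distr[OF av_measurable S', symmetric])
	moreover have "emeasure P ?T = emeasure (Kn n) T" using emeasure_distr[OF Vv_measurable T] unfolding distr_Vv[OF n] by simp
	moreover have "emeasure (distr P (Nn n \<Otimes>\<^sub>M Kn n) (%om. (av n om, Vv n om))) (S \<times> T) = emeasure P (?S Int ?T)"
		using S' T by (subst emeasure_distr) (auto intro!: arg_cong[where f="emeasure P"])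
	ultimately show "emeasure (distr P (Nn n) (av n)) S * emeasure (Kn n) T = emeasure (distr P (Nn n \<Otimes>\<^sub>M Kn n) (%om. (av n om, Vv n om))) (S \<times> T)" by simp
qed

lemma disintegration_nn:
	assumes n: "n >= 1" and F: "F : bm (Nn n \<Otimes>\<^sub>M Kn n)"
	shows "(\<integral>\<^sup>+om. F (av n om, Vv n om) \<partial>P) = (\<integral>\<^sup>+om. \<integral>\<^sup>+x. F (av n om, x) \<partial>Kn n \<partial>P)"
proof -
	interpret K: prob_space "Kn n" by (rule prob_Kn)
	have F': "F : bm (distr P (Nn n) (av n) \<Otimes>\<^sub>M Kn n)"
		using F by (simp add: measurable_cong_sets[OF sets_pair_measure_cong[OF sets_distr refl] refl])
	have "(\<integral>\<^sup>+om. F (av n om, Vv n om) \<partial>P) = (\<integral>\<^sup>+z. F z \<partial>(distr P (Nn n) (av n) \<Otimes>\<^sub>M Kn n))"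
		unfolding joint_law[OF n, symmetric] using F by (subst nn_integral_distr) auto
	also have "... = (\<integral>\<^sup>+a. \<integral>\<^sup>+x. F (a, x) \<partial>Kn n \<partial>(distr P (Nn n) (av n)))" by (rule K.nn_integral_fst[OF F', symmetric])
	also have "... = (\<integral>\<^sup>+om. \<integral>\<^sup>+x. F (av n om, x) \<partial>Kn n \<partial>P)"
		using K.borel_measurable_nn_integral_fst[OF F] by (subst nn_integral_distr) auto
	finally show ?thesis .
qed

lemma disintegration:
	fixes F :: "_ => complex"
	assumes n: "n >= 1" and F: "F : bm (Nn n \<Otimes>\<^sub>M Kn n)" and b: "!!z. cmod (F z) <= 1"
	shows "(\<integral>om. F (av n om, Vv n om) \<partial>P) = (\<integral>om. \<integral>x. F (av n om, x) \<partial>Kn n \<partial>P)"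
		and "(%om. \<integral>x. F (av n om, x) \<partial>Kn n) : bm P"
proof -
	interpret K: prob_space "Kn n" by (rule prob_Kn)
	interpret N: prob_space "distr P (Nn n) (av n)" by (rule P.prob_space_distr) simp
	interpret NK: pair_prob_space "distr P (Nn n) (av n)" "Kn n" ..
	have F': "F : bm (distr P (Nn n) (av n) \<Otimes>\<^sub>M Kn n)"
		using F by (simp add: measurable_cong_sets[OF sets_pair_measure_cong[OF sets_distr refl] refl])
	have int: "integrable (distr P (Nn n) (av n) \<Otimes>\<^sub>M Kn n) F"
		using F' b by (intro NK.integrable_const_bound[where B=1]) auto
	have m: "(%a. \<integral>x. F (a, x) \<partial>Kn n) : bm (Nn n)"
		using K.borel_measurable_lebesgue_integral[of "%a x. F (a, x)" "Nn n"] F by simp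
	have "(\<integral>om. F (av n om, Vv n om) \<partial>P) = (\<integral>z. F z \<partial>(distr P (Nn n) (av n) \<Otimes>\<^sub>M Kn n))"
		unfolding joint_law[OF n, symmetric] using F by (subst integral_distr) auto
	also have "... = (\<integral>a. \<integral>x. F (a, x) \<partial>Kn n \<partial>(distr P (Nn n) (av n)))" by (rule NK.integral_fst'[OF int, symmetric])
	also have "... = (\<integral>om. \<integral>x. F (av n om, x) \<partial>Kn n \<partial>P)"
		using m by (subst integral_distr) auto
	finally show "(\<integral>om. F (av n om, Vv n om) \<partial>P) = (\<integral>om. \<integral>x. F (av n om, x) \<partial>Kn n \<partial>P)" .
	show "(%om. \<integral>x. F (av n om, x) \<partial>Kn n) : bm P" using measurable_compose[OF av_measurable m] .
qed

text \<open>Good weights: the rows are uniformly small and nearly orthonormal. Both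
  \<open>conditional_char_limit\<close> and \<open>box_equicontinuity\<close> accept such rows, with
  no further knowledge of the weights.\<close>

definition gw :: "nat => real => (nat \<times> nat => real) => bool" where
	"gw n kp a \<longleftrightarrow> (ALL j:{..M}. ALL i:{..<n}. abs (a (j, i)) <= kp) &
		 (ALL j:{..M}. ALL k:{..M}. abs ((SUM i<n. a (j, i) * a (k, i)) - (if j = k then 1 else 0)) <= kp)"

lemma gw_measurable: "{a : space (Nn n). gw n kp a} : sets (Nn n)"
	unfolding gw_def by measurable

lemma gw_event: "{om : space P. ~ gw n kp (av n om)} : sets P"
proof -
	have "{om : space P. ~ gw n kp (av n om)} = space P - (av n -` {a : space (Nn n). gw n kp a} Int space P)"
		using measurable_space[OF av_measurable] by auto
	thus ?thesis using measurable_sets[OF av_measurable gw_measurable] by auto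
qed

lemma gw_prob: assumes kp: "kp > 0" shows "(%n. measure P {om : space P. ~ gw n kp (av n om)}) \<longlonglongrightarrow> 0"
proof -
	define EA where "EA j n = {om : space P. EX i<n. abs (aw n j i om) > kp}" for j n
	define EB where "EB j k n = {om : space P. abs ((SUM i<n. aw n j i om * aw n k i om) - (if j = k then 1 else 0)) > kp}" for j k n
	have EAm: "EA j n : sets P" if "j <= M" for j n
	proof -
		have "EA j n = (UN i:{..<n}. {om : space P. abs (aw n j i om) > kp})" by (auto simp: EA_def)
		also have "... : sets P"
		proof (intro sets.finite_UN)
			fix i assume "i : {..<n}"
			hence [measurable]: "aw n j i : bm P" using that by (intro aw_measurable) auto
			show "{om : space P. abs (aw n j i om) > kp} : sets P" by measurable
		qed simp
		finally show ?thesis .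
	qed
	have EBm: "EB j k n : sets P" if "j <= M" "k <= M" for j k n
	proof -
		have [measurable]: "(%om. (SUM i<n. aw n j i om * aw n k i om)) : bm P"
			using that aw_measurable by (intro borel_measurable_sum borel_measurable_times) auto
		show ?thesis unfolding EB_def by measurable
	qed
	have A0: "(%n. measure P (EA j n)) \<longlonglongrightarrow> 0" if j: "j : {..M}" for j
	proof (cases "j = 0")
		case True
		have "\<forall>\<^sub>F n in sequentially. 1 / rt n <= kp" using kp by (rule eventually_div_sqrt_le)
		hence "\<forall>\<^sub>F n in sequentially. measure P (EA j n) = 0"
		proof eventually_elim
			case (elim n)
			hence "EA j n = {}" unfolding EA_def aw_def using True by (auto simp: not_less)
			thus ?case by simp
		qed
		thus ?thesis by (rule tendsto_eventually)
	next
		case False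
		hence j1: "j : {1..M}" using j by auto
		show ?thesis using boot_weights.max_xi_small[OF boot_weights[OF j1] kp] False unfolding EA_def aw_def by simp
	qed
	have B0: "(%n. measure P (EB j k n)) \<longlonglongrightarrow> 0" if jk: "j : {..M}" "k : {..M}" for j k
	proof -
		have swap: "EB j k n = EB k j n" for j k n unfolding EB_def by (auto simp: mult.commute)
		have zero: "(%n. measure P (EB 0 k n)) \<longlonglongrightarrow> 0" for k
		proof (rule tendsto_eventually, rule eventually_mono[OF eventually_ge_at_top[of 1]])
			fix n :: nat assume n: "1 <= n"
			have "(SUM i<n. aw n 0 i om * aw n k i om) = (if 0 = k then 1 else 0)" for om
			proof (cases "k = 0")
				case True
				thus ?thesis using n by (simp add: aw_def)
			next
				case False
				have "(SUM i<n. aw n 0 i om * aw n k i om) = (SUM i<n. xi (W k) n i om) / real n" using False by (simp add: aw_def sum_divide_distrib)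
				thus ?thesis using sum_xi[OF n, of "W k" om] False by simp
			qed
			hence "EB 0 k n = {}" unfolding EB_def using kp by auto
			thus "measure P (EB 0 k n) = 0" by simp
		qed
		\<comment> \<open>Products with the constant row have their exact values, since centred weights
		  sum to zero; the remaining diagonal is the variance condition of \<open>condW\<close>, and two
		  different bootstrap rows need \<open>cross_weights\<close>.\<close>
		consider "j = 0" | "k = 0" | "j ~= 0" "j = k" | "j ~= 0" "k ~= 0" "j ~= k" by blast
		thus ?thesis
		proof cases
			case 1 thus ?thesis using zero by simp
		next
			case 2 thus ?thesis using zero[of j] swap[of j 0] by simp
		next
			case 3
			hence j1: "j : {1..M}" using jk by auto
			show ?thesis using boot_weights.sum_sq_xi[OF boot_weights[OF j1] kp] 3 unfolding EB_def aw_def by simp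
		next
			case 4
			hence j1: "j : {1..M}" "k : {1..M}" using jk by auto
			have "(%n. measure P {om : space P. abs (SUM i<n. (xi (W j) n i om / rt n) * (xi (W k) n i om / rt n)) > kp}) \<longlonglongrightarrow> 0"
			proof (rule cross_weights[OF boot_weights[OF j1(1)] boot_weights[OF j1(2)] _ kp])
				fix n i l :: nat assume il: "i < n" "l < n"
				show "P.indep_var borel (%om. xi (W j) n i om * xi (W j) n l om) borel (%om. xi (W k) n i om * xi (W k) n l om)"
					by (rule WS_indep_var[of "{j}" "{k}"]) (use j1 4 il xi_WS in \<open>auto intro!: borel_measurable_times\<close>)
			qed
			thus ?thesis using 4 unfolding EB_def aw_def by simp
		qed
	qed
	have "(%n. (SUM j:{..M}. measure P (EA j n)) + (SUM j:{..M}. SUM k:{..M}. measure P (EB j k n))) \<longlonglongrightarrow> (SUM j:{..M}. 0) + (SUM j:{..M}. SUM k:{..M}. 0)"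
		by (intro tendsto_add tendsto_sum A0 B0)
	hence lim: "(%n. (SUM j:{..M}. measure P (EA j n)) + (SUM j:{..M}. SUM k:{..M}. measure P (EB j k n))) \<longlonglongrightarrow> 0" by simp
	show ?thesis
	proof (rule tendsto_sandwich[OF _ _ tendsto_const lim])
		show "\<forall>\<^sub>F n in sequentially. measure P {om : space P. ~ gw n kp (av n om)} <= (SUM j:{..M}. measure P (EA j n)) + (SUM j:{..M}. SUM k:{..M}. measure P (EB j k n))"
		proof (rule always_eventually, rule allI)
			fix n
			have mA: "(UN j:{..M}. EA j n) : sets P" using EAm by auto
			have mB: "(UN k:{..M}. EB j k n) : sets P" if "j <= M" for j using EBm that by auto
			have mBB: "(UN j:{..M}. UN k:{..M}. EB j k n) : sets P" by (rule sets.finite_UN) (auto intro: mB)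
			have "measure P {om : space P. ~ gw n kp (av n om)} <= measure P ((UN j:{..M}. EA j n) Un (UN j:{..M}. UN k:{..M}. EB j k n))"
			proof (rule P.finite_measure_mono)
				show "{om : space P. ~ gw n kp (av n om)} \<subseteq> (UN j:{..M}. EA j n) Un (UN j:{..M}. UN k:{..M}. EB j k n)"
				proof
					fix om assume "om : {om : space P. ~ gw n kp (av n om)}"
					hence w: "om : space P" "~ gw n kp (av n om)" by auto
					have ave: "av n om (j, i) = aw n j i om" if "j : {..M}" "i : {..<n}" for j i using that by (simp add: av_def)
					have sme: "(SUM i<n. av n om (j, i) * av n om (k, i)) = (SUM i<n. aw n j i om * aw n k i om)" if "j : {..M}" "k : {..M}" for j k
						using that ave by (intro sum.cong refl) simp
					from w(2) consider j i where "j : {..M}" "i : {..<n}" "~ abs (av n om (j, i)) <= kp"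
						| j k where "j : {..M}" "k : {..M}" "~ abs ((SUM i<n. av n om (j, i) * av n om (k, i)) - (if j = k then 1 else 0)) <= kp"
						unfolding gw_def by blast
					thus "om : (UN j:{..M}. EA j n) Un (UN j:{..M}. UN k:{..M}. EB j k n)"
					proof cases
						case (1 j i)
						hence "om : EA j n" unfolding EA_def using w(1) ave[OF 1(1,2)] by (auto simp: not_le)
						thus ?thesis using 1(1) by blast
					next
						case (2 j k)
						hence "om : EB j k n" unfolding EB_def using w(1) sme[OF 2(1,2)] by (simp add: not_le)
						thus ?thesis using 2(1,2) by blast
					qed
				qed
			qed (use mA mBB in auto)
			also have "... <= measure P (UN j:{..M}. EA j n) + measure P (UN j:{..M}. UN k:{..M}. EB j k n)"
				using mA mBB by (rule measure_Un_le)
			also have "measure P (UN j:{..M}. EA j n) <= (SUM j:{..M}. measure P (EA j n))"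
				using EAm by (intro P.finite_measure_subadditive_finite) auto
			also have "measure P (UN j:{..M}. UN k:{..M}. EB j k n) <= (SUM j:{..M}. measure P (UN k:{..M}. EB j k n))"
				using mB by (intro P.finite_measure_subadditive_finite) auto
			also have "... <= (SUM j:{..M}. SUM k:{..M}. measure P (EB j k n))"
				using EBm by (intro sum_mono P.finite_measure_subadditive_finite) auto
			finally show "measure P {om : space P. ~ gw n kp (av n om)} <= (SUM j:{..M}. measure P (EA j n)) + (SUM j:{..M}. SUM k:{..M}. measure P (EB j k n))"
				by simp
		qed
	qed simp
qed

lemma ZZ_eq: "j <= M ==> ZZ n j om u = (SUM i<n. av n om (j, i) * (bx.bi u (Vv n om i) - bx.Dm u))"
	unfolding ZZ_def zp_def av_def Vv_def by (intro sum.cong refl) auto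

lemma ZZ_measurable: "j <= M ==> (%om. ZZ n j om u) : bm P"
proof -
	assume j: "j <= M"
	have [measurable]: "bx.bi u : bm borel" using bx.bi_measurable[of u] by (simp add: measurable_cong_sets[OF sets_mu refl])
	show ?thesis unfolding ZZ_def zp_def using j aw_measurable by (intro borel_measurable_sum borel_measurable_times borel_measurable_diff) auto
qed

text \<open>On good weights the conditional characteristic function is within \<open>r / 4\<close>
  of the Gaussian one. The other weights have small probability, and there the difference is at most
  \<open>Dc\<close>.\<close>

theorem char_limit:
	fixes t :: "nat \<times> (real^'p) => real"
	assumes S: "finite S" "!!s. s : S ==> fst s <= M"
	shows "(%n. \<integral>om. cis (SUM s:S. t s * ZZ n (fst s) om (snd s)) \<partial>P) \<longlonglongrightarrow>
		 cor (exp (- (SUM s:S. SUM s':S. t s * t s' * (if fst s = fst s' then covB P V A (snd s) (snd s') else 0)) / 2))"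
proof (rule LIMSEQ_I)
	fix r :: real assume r: "r > 0"
	define Vr where "Vr = (SUM s:S. SUM s':S. t s * t s' * (if fst s = fst s' then covB P V A (snd s) (snd s') else 0))"
	have cvB: "bx.cv u v = covB P V A u v" for u v unfolding bx.cv_def bx.ze_def covB_integral ..
	have r4: "r / 4 > 0" using r by simp
	obtain kp where kp: "kp > 0" and lim: "!!(I :: nat set) (a :: nat => nat => real). finite I ==> (!!s i. s : S ==> i : I ==> abs (a (fst s) i) <= kp) ==>
		 (!!s s'. s : S ==> s' : S ==> abs ((SUM i:I. a (fst s) i * a (fst s') i) - (if fst s = fst s' then 1 else 0)) <= kp) ==>
		 cmod ((\<integral>x. cis (SUM s:S. t s * (SUM i:I. a (fst s) i * bx.ze (snd s) (x i))) \<partial>(\<Pi>\<^sub>M i\<in>I. mu)) - cor (exp (- Vr / 2))) <= r / 4"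
		using bx.conditional_char_limit[OF S(1) r4, of t thesis, unfolded cvB] unfolding Vr_def by blast
	define F where "F n z = cis (SUM s:S. t s * (SUM i<n. fst z (fst s, i) * bx.ze (snd s) (snd z i)))" for n and z :: "(nat \<times> nat => real) \<times> (nat => (real^'p) \<times> (real^'q))"
	have Fm: "F n : bm (Nn n \<Otimes>\<^sub>M Kn n)" for n
	proof -
		have "(%z. fst z (fst s, i)) : bm (Nn n \<Otimes>\<^sub>M Kn n)" if "s : S" "i < n" for s i
			using S(2)[OF that(1)] that(2) by (intro measurable_compose[OF measurable_fst] measurable_component_singleton) auto
		moreover have "(%z. bx.ze (snd s) (snd z i)) : bm (Nn n \<Otimes>\<^sub>M Kn n)" if "i < n" for s i
			using that by (intro measurable_compose[OF _ bx.ze_measurable] measurable_compose[OF measurable_snd] measurable_component_singleton) auto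
		ultimately show ?thesis unfolding F_def[abs_def]
			by (intro measurable_compose[OF _ measurable_cis] borel_measurable_sum borel_measurable_times borel_measurable_const) auto
	qed
	have Fe: "cis (SUM s:S. t s * ZZ n (fst s) om (snd s)) = F n (av n om, Vv n om)" for n om
		unfolding F_def bx.ze_def using S(2) by (simp add: ZZ_eq)
	have Fb: "cmod (F n z) <= 1" for n z unfolding F_def by simp
	define Dc where "Dc = 1 + cmod (cor (exp (- Vr / 2)))"
	have Dc: "Dc > 0" unfolding Dc_def by (simp add: add_pos_nonneg)
	hence "r / 4 / Dc > 0" using r by simp
	with gw_prob[OF kp] have "\<forall>\<^sub>F n in sequentially. measure P {om : space P. ~ gw n kp (av n om)} < r / 4 / Dc" by (rule order_tendstoD)
	hence "\<forall>\<^sub>F n in sequentially. cmod ((\<integral>om. cis (SUM s:S. t s * ZZ n (fst s) om (snd s)) \<partial>P) - cor (exp (- Vr / 2))) < r"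
		using eventually_ge_at_top[of 1]
	proof eventually_elim
		case (elim n)
		let ?G = "%om. \<integral>x. F n (av n om, x) \<partial>Kn n" and ?E = "{om : space P. ~ gw n kp (av n om)}" and ?c = "cor (exp (- Vr / 2))"
		interpret K: prob_space "Kn n" by (rule prob_Kn)
		have Gb: "cmod (?G om) <= 1" for om
		proof -
			have "cmod (?G om) <= (\<integral>x. cmod (F n (av n om, x)) \<partial>Kn n)" by (rule integral_norm_bound)
			also have "... = 1" unfolding F_def by (simp add: K.prob_space)
			finally show ?thesis .
		qed
		have Gm: "?G : bm P" using disintegration(2)[OF elim(2) Fm Fb] .
		have near: "cmod (?G om - ?c) <= r / 4" if w: "gw n kp (av n om)" for om
		proof -
			have "cmod ((\<integral>x. cis (SUM s:S. t s * (SUM i:{..<n}. av n om (fst s, i) * bx.ze (snd s) (x i))) \<partial>Kn n) - ?c) <= r / 4"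
			proof (rule lim[of "{..<n}" "%j i. av n om (j, i)"])
				fix s i assume s: "s : S" and "i : {..<n}"
				thus "abs (av n om (fst s, i)) <= kp" using w S(2)[OF s] unfolding gw_def by auto
			next
				fix s s' assume s: "s : S" "s' : S"
				thus "abs ((SUM i<n. av n om (fst s, i) * av n om (fst s', i)) - (if fst s = fst s' then 1 else 0)) <= kp"
					using w S(2)[OF s(1)] S(2)[OF s(2)] unfolding gw_def by auto
			qed simp
			thus ?thesis unfolding F_def by simp
		qed
		have Gi: "integrable P ?G" using Gm Gb by (intro P.integrable_const_bound[where B=1]) auto
		have "cmod ((\<integral>om. cis (SUM s:S. t s * ZZ n (fst s) om (snd s)) \<partial>P) - ?c) = cmod (\<integral>om. ?G om - ?c \<partial>P)"
			unfolding Fe disintegration(1)[OF elim(2) Fm Fb] using Gi by (simp add: P.prob_space)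
		also have "... <= (\<integral>om. cmod (?G om - ?c) \<partial>P)" by (rule integral_norm_bound)
		also have "... <= (\<integral>om. r / 4 + Dc * indicator ?E om \<partial>P)"
		proof (rule integral_mono)
			show "integrable P (%om. cmod (?G om - ?c))" using Gi by auto
			show "integrable P (%om. r / 4 + Dc * indicator ?E om)" using gw_event[of n kp]
				by (intro Bochner_Integration.integrable_add P.integrable_const Bochner_Integration.integrable_mult_right integrable_real_indicator) (auto simp: P.emeasure_eq_measure)
			fix om assume w: "om : space P"
			show "cmod (?G om - ?c) <= r / 4 + Dc * indicator ?E om"
			proof (cases "gw n kp (av n om)")
				case True
				thus ?thesis using near by simp
			next
				case False
				have "cmod (?G om - ?c) <= cmod (?G om) + cmod ?c" by (rule norm_triangle_ineq4)
				thus ?thesis using Gb[of om] r4 w False unfolding Dc_def by simp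
			qed
		qed
		also have "... = r / 4 + Dc * measure P ?E" using gw_event[of n kp] by (simp add: P.prob_space P.emeasure_eq_measure)
		also have "... <= r / 4 + Dc * (r / 4 / Dc)" using elim(1) Dc by (intro add_left_mono mult_left_mono) auto
		also have "... < r" using Dc r by simp
		finally show ?case .
	qed
	thus "EX no. ALL n>=no. norm ((\<integral>om. cis (SUM s:S. t s * ZZ n (fst s) om (snd s)) \<partial>P) - cor (exp (- (SUM s:S. SUM s':S. t s * t s' * (if fst s = fst s' then covB P V A (snd s) (snd s') else 0)) / 2))) < r"
		unfolding Vr_def eventually_sequentially .
qed

end

section \<open>Asymptotic equicontinuity\<close>

text \<open>The covering set \<open>E\<close> is there because the properties \<open>R\<close>
  involve suprema over the cube and need not be measurable. The level \<open>et\<close> is fixed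
  while \<open>n\<close> grows.\<close>

definition hp :: "'w measure => real => (nat => 'w => bool) => bool" where
	"hp P et R \<longleftrightarrow> (\<forall>\<^sub>F n in sequentially. EX E:sets P. measure P E < et & (ALL om:space P - E. R n om))"

lemma hpD: "hp P et R ==> \<forall>\<^sub>F n in sequentially. EX E:sets P. measure P E < et & (ALL om:space P - E. R n om)"
	by (simp add: hp_def)

lemma hp_mono:
	assumes "hp P et R" "et <= et'" "\<forall>\<^sub>F n in sequentially. ALL om:space P. R n om --> R' n om"
	shows "hp P et' R'"
	unfolding hp_def using hpD[OF assms(1)] assms(3)
proof eventually_elim
	case (elim n)
	then obtain E where "E : sets P" "measure P E < et" "ALL om:space P - E. R n om" by blast
	thus ?case using assms(2) elim(2) by (intro bexI[of _ E]) auto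
qed

lemma (in prob_space) hp_conj:
	assumes "hp M et R" "hp M et' R'"
	shows "hp M (et + et') (%n om. R n om & R' n om)"
	unfolding hp_def using hpD[OF assms(1)] hpD[OF assms(2)]
proof eventually_elim
	case (elim n)
	then obtain E E' where E: "E : sets M" "measure M E < et" "ALL om:space M - E. R n om"
		and E': "E' : sets M" "measure M E' < et'" "ALL om:space M - E'. R' n om" by blast
	have "measure M (E Un E') <= measure M E + measure M E'" using E E' by (intro measure_Un_le) auto
	thus ?case using E E' by (intro bexI[of _ "E Un E'"]) auto
qed

lemma (in prob_space) hp_ball:
	assumes "finite J" "!!j. j : J ==> hp M et (R j)" "et > 0"
	shows "hp M ((real (card J) + 1) * et) (%n om. ALL j:J. R j n om)"
	using assms(1,2)
proof (induction J rule: finite_induct)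
	case empty
	show ?case unfolding hp_def using assms(3) by (intro always_eventually allI bexI[of _ "{}"]) auto
next
	case (insert j J)
	have "hp M (et + (real (card J) + 1) * et) (%n om. R j n om & (ALL j:J. R j n om))"
		using insert by (intro hp_conj) auto
	thus ?case using insert by (elim hp_mono) (auto simp: algebra_simps)
qed

lemma (in prob_space) hp_AE:
	assumes "AE om in M. R om" "et > 0"
	shows "hp M et (%n om. R om)"
proof -
	obtain N where N: "{om : space M. ~ R om} \<subseteq> N" "emeasure M N = 0" "N : sets M" using assms(1) by (rule AE_E)
	hence "measure M N = 0" by (simp add: measure_def)
	thus ?thesis unfolding hp_def using N assms(2) by (intro always_eventually allI bexI[of _ N]) auto
qed

text \<open>Rounding upwards, unlike \<open>dyv\<close>: box indicators are right-continuous in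
  \<open>u\<close>, so their values at \<open>dyu l u\<close> converge to the value at
  \<open>u\<close>.\<close>

definition dyu :: "nat => real^'p => real^'p" where
	"dyu l u = (\<chi> k. of_int \<lceil>2 ^ l * u $ k\<rceil> / 2 ^ l)"

lemma dyu_bounds: "u $ k <= dyu l u $ k" "dyu l u $ k <= u $ k + 1 / 2 ^ l"
proof -
	have p: "(2::real) ^ l > 0" by simp
	have "2 ^ l * u $ k <= of_int \<lceil>2 ^ l * u $ k\<rceil>" "of_int \<lceil>2 ^ l * u $ k\<rceil> <= 2 ^ l * u $ k + 1" by linarith+
	thus "u $ k <= dyu l u $ k" "dyu l u $ k <= u $ k + 1 / 2 ^ l"
		unfolding dyu_def using p by (simp_all add: field_simps)
qed

lemma dyu_dygrid: assumes u: "u : cube" shows "dyu l u : dygrid l"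
proof -
	define f where "f k = nat \<lceil>2 ^ l * u $ k\<rceil>" for k
	have c: "0 <= \<lceil>2 ^ l * u $ k\<rceil>" "\<lceil>2 ^ l * u $ k\<rceil> <= 2 ^ l" for k
	proof -
		have "0 <= 2 ^ l * u $ k" "2 ^ l * u $ k <= 2 ^ l * 1" using u by (auto simp: cube_def intro: mult_left_mono)
		thus "0 <= \<lceil>2 ^ l * u $ k\<rceil>" "\<lceil>2 ^ l * u $ k\<rceil> <= 2 ^ l" by (auto simp: ceiling_le_iff)
	qed
	have "f k <= 2 ^ l" for k unfolding f_def using c(2)[of k] by (simp add: nat_le_iff)
	hence "f : (\<Pi>\<^sub>E k\<in>UNIV. {0..2 ^ l :: nat})" by (auto simp: PiE_iff)
	moreover have "dyu l u = (\<chi> k. real (f k) / 2 ^ l)" using c(1) by (simp add: dyu_def f_def)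
	ultimately show ?thesis unfolding dygrid_def by blast
qed

lemma dyu_tendsto: "(%l. dyu l u $ k) \<longlonglongrightarrow> u $ k"
proof (rule tendsto_sandwich[where f="%_. u $ k" and h="%l. u $ k + 1 / 2 ^ l"])
	have "(%l. u $ k + (1 / 2) ^ l) \<longlonglongrightarrow> u $ k + 0" by (intro tendsto_intros LIMSEQ_power_zero) auto
	thus "(%l. u $ k + 1 / 2 ^ l) \<longlonglongrightarrow> u $ k" by (simp add: power_one_over)
qed (auto intro!: always_eventually dyu_bounds)

lemma (in box_class) bi_dyu: "(%l. bi (dyu l u) x) \<longlonglongrightarrow> bi u x"
proof (rule tendsto_eventually)
	show "\<forall>\<^sub>F l in sequentially. bi (dyu l u) x = bi u x"
	proof (cases "ALL k. U x k <= u $ k")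
		case True
		hence "ALL k. U x k <= dyu l u $ k" for l using dyu_bounds(1) order_trans by blast
		thus ?thesis using True by (simp add: bi_def)
	next
		case False
		then obtain k where k: "u $ k < U x k" by (auto simp: not_le)
		have "\<forall>\<^sub>F l in sequentially. dyu l u $ k < U x k" using dyu_tendsto k by (rule order_tendstoD)
		thus ?thesis
		proof eventually_elim
			case (elim l)
			hence "~ (ALL k. U x k <= dyu l u $ k)" by (auto simp: not_le)
			thus ?case using False by (simp add: bi_def)
		qed
	qed
qed

lemma (in box_class) Dm_dyu: assumes u: "u : cube" shows "(%l. Dm (dyu l u)) \<longlonglongrightarrow> Dm u"
proof -
	have c: "dyu l u : cube" for l using dyu_dygrid[OF u] dygrid_cube[of l] by blast
	have "(%l. SUM k:UNIV. abs (dyu l u $ k - u $ k)) \<longlonglongrightarrow> (SUM k:(UNIV::'p set). abs (u $ k - u $ k))"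
		by (intro tendsto_intros dyu_tendsto)
	hence lim: "(%l. SUM k:UNIV. abs (dyu l u $ k - u $ k)) \<longlonglongrightarrow> 0" by simp
	have "(%l. Dm (dyu l u) - Dm u) \<longlonglongrightarrow> 0"
		by (rule tendsto_0_le[OF lim, where K=1]) (use Dm_diff[OF c u] in auto)
	thus ?thesis by (simp add: LIM_zero_iff)
qed

text \<open>The segment from 0 to \<open>u\<close> is walked in \<open>h\<close> steps that move
  each coordinate by at most \<open>1 / h\<close>; every step changes \<open>b\<close> by at most
  1.\<close>

lemma bounded_from_modulus:
	fixes b :: "real^'p => real"
	assumes h: "h > (0::nat)" and m: "!!u v. u : cube ==> v : cube ==> (ALL k. abs (u $ k - v $ k) <= 1 / real h) ==> abs (b u - b v) <= 1"
		and z: "b 0 = 0" and u: "u : cube"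
	shows "abs (b u) <= real h"
proof -
	have c: "(real r / real h) *\<^sub>R u : cube" if "r <= h" for r
	proof -
		have q: "0 <= real r / real h" "real r / real h <= 1" using that h by auto
		have "real r / real h * u $ k <= 1 * 1" for k using q u by (intro mult_mono) (auto simp: cube_def)
		thus ?thesis using q u by (auto simp: cube_def)
	qed
	have "abs (b ((real r / real h) *\<^sub>R u)) <= real r" if "r <= h" for r
		using that
	proof (induction r)
		case 0
		thus ?case by (simp add: z)
	next
		case (Suc r)
		have "ALL k. abs (((real (Suc r) / real h) *\<^sub>R u) $ k - ((real r / real h) *\<^sub>R u) $ k) <= 1 / real h"
		proof
			fix k
			have "((real (Suc r) / real h) *\<^sub>R u) $ k - ((real r / real h) *\<^sub>R u) $ k = (1 / real h) * u $ k" by (simp add: field_simps add_divide_distrib)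
			moreover have "abs ((1 / real h) * u $ k) <= (1 / real h) * 1" unfolding abs_mult using u by (intro mult_mono) (auto simp: cube_def)
			ultimately show "abs (((real (Suc r) / real h) *\<^sub>R u) $ k - ((real r / real h) *\<^sub>R u) $ k) <= 1 / real h" by simp
		qed
		hence "abs (b ((real (Suc r) / real h) *\<^sub>R u) - b ((real r / real h) *\<^sub>R u)) <= 1" using Suc by (intro m c) auto
		thus ?case using Suc by simp
	qed
	from this[of h] show ?thesis using h by simp
qed

section \<open>Regularity of the weighted processes with high probability\<close>

context boot_sample
begin

lemma ZZ_dyu: assumes "u : cube" shows "(%l. ZZ n j om (dyu l u)) \<longlonglongrightarrow> ZZ n j om u"
	unfolding ZZ_def zp_def using assms by (intro tendsto_sum tendsto_mult tendsto_const tendsto_diff bx.bi_dyu bx.Dm_dyu)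

text \<open>Markov's inequality for the maximum over the finite set \<open>T m\<close> of grid
  pairs, with a bound that does not depend on \<open>m\<close>. The events increase with
  \<open>m\<close>, so the bound survives their union, and right-continuity carries the estimate
  from the grids to the cube.\<close>

lemma equicontinuity:
	assumes j: "j <= M" and ep: "ep > 0" and et: "et > 0"
	obtains h :: nat where "h > 0"
		"hp P et (%n om. ALL u:cube. ALL v:cube. (ALL k. abs (u $ k - v $ k) <= 1 / real h) --> abs (ZZ n j om u - ZZ n j om v) <= ep)"
proof -
	\<comment> \<open>An expected maximum of this size gives probability at most \<open>et / 4\<close>
	  of exceeding \<open>ep\<close>.\<close>
	define ep' where "ep' = ep * (et / 4)"
	have ep': "ep' > 0" using ep et by (simp add: ep'_def)
	obtain h kp where h: "h > 0" and kp: "kp > 0" and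
		eq: "!!(I::nat set) a T. finite I ==> (SUM i:I. (a i)^2) <= 2 ==> (!!i. i : I ==> abs (a i) <= kp) ==> finite T ==> T ~= {} ==>
			 (!!u v. (u, v) : T ==> u : cube & v : cube & (ALL k. abs (u $ k - v $ k) <= 1 / real h)) ==>
			 (\<integral>\<^sup>+x. ennreal (Max ((%t. abs (SUM i:I. a i * ((bx.bi (fst t) (x i) - bx.Dm (fst t)) - (bx.bi (snd t) (x i) - bx.Dm (snd t))))) ` T)) \<partial>(\<Pi>\<^sub>M i\<in>I. mu)) <= ennreal ep'"
		by (rule bx.box_equicontinuity[OF ep']) blast
	define kp' where "kp' = min kp 1"
	have kp': "kp' > 0" "kp' <= kp" "kp' <= 1" using kp by (auto simp: kp'_def)
	define T :: "nat => ((real^'p) \<times> (real^'p)) set" where "T m = {t : dygrid m \<times> dygrid m. ALL k. abs (fst t $ k - snd t $ k) <= 1 / real h}" for m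
	have Tfin: "finite (T m)" for m unfolding T_def by (intro finite_subset[OF _ finite_cartesian_product[OF finite_dygrid finite_dygrid]]) auto
	have "(dyu m (0 :: real^'p), dyu m 0) : T m" for m using dyu_dygrid[of "0 :: real^'p" m] h by (auto simp: T_def cube_def)
	hence Tne: "T m ~= {}" for m by blast
	have Tmono: "T m \<subseteq> T (Suc m)" for m unfolding T_def using dygrid_Suc by auto
	have Tc: "u : cube & v : cube & (ALL k. abs (u $ k - v $ k) <= 1 / real h)" if "(u, v) : T m" for u v m
		using that dygrid_cube[of m] unfolding T_def by auto
	define E where "E n m = {om : space P. gw n kp' (av n om) & (EX t:T m. abs (ZZ n j om (fst t) - ZZ n j om (snd t)) > ep)}" for n m
	have Em: "E n m : sets P" for n m
	proof -
		have eq: "E n m = (space P - {om : space P. ~ gw n kp' (av n om)}) Int (UN t:T m. {om : space P. abs (ZZ n j om (fst t) - ZZ n j om (snd t)) > ep})"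
			unfolding E_def by auto
		have m1: "{om : space P. abs (ZZ n j om (fst t) - ZZ n j om (snd t)) > ep} : sets P" for t
		proof -
			have [measurable]: "(%om. ZZ n j om (fst t)) : bm P" "(%om. ZZ n j om (snd t)) : bm P" using ZZ_measurable[OF j] by auto
			show ?thesis by measurable
		qed
		show ?thesis unfolding eq by (intro sets.Int sets.Diff sets.top gw_event sets.finite_UN[OF Tfin] m1)
	qed
	have EP: "measure P (E n m) <= et / 4" if n: "n >= 1" for n m
	proof -
		define G where "G a x = Max ((%t. abs (SUM i:{..<n}. a (j, i) * ((bx.bi (fst t) (x i) - bx.Dm (fst t)) - (bx.bi (snd t) (x i) - bx.Dm (snd t))))) ` T m)"
			for a :: "nat \<times> nat => real" and x :: "nat => (real^'p) \<times> (real^'q)"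
		define F where "F z = indicator {a : space (Nn n). gw n kp' a} (fst z) * ennreal (G (fst z) (snd z))" for z
		have Gm: "(%z. G (fst z) (snd z)) : bm (Nn n \<Otimes>\<^sub>M Kn n)"
			unfolding G_def
		proof (intro borel_measurable_Max Tfin Tne)
			fix t
			have [measurable]: "(%z. fst z (j, i)) : bm (Nn n \<Otimes>\<^sub>M Kn n)" if "i < n" for i
				using j that by (intro measurable_compose[OF measurable_fst] measurable_component_singleton) auto
			have [measurable]: "(%z. bx.bi u (snd z i)) : bm (Nn n \<Otimes>\<^sub>M Kn n)" if "i < n" for i u
				using that by (intro measurable_compose[OF _ bx.bi_measurable] measurable_compose[OF measurable_snd] measurable_component_singleton) auto
			show "(%z. abs (SUM i:{..<n}. fst z (j, i) * ((bx.bi (fst t) (snd z i) - bx.Dm (fst t)) - (bx.bi (snd t) (snd z i) - bx.Dm (snd t))))) : bm (Nn n \<Otimes>\<^sub>M Kn n)"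
				by (intro borel_measurable_abs borel_measurable_sum borel_measurable_times borel_measurable_diff borel_measurable_const) auto
		qed
		have Fm: "F : bm (Nn n \<Otimes>\<^sub>M Kn n)"
			unfolding F_def using gw_measurable[of n kp'] Gm
			by (intro borel_measurable_times_ennreal measurable_compose[OF measurable_fst] borel_measurable_indicator measurable_compose[OF Gm measurable_ennreal])
		have inner: "(\<integral>\<^sup>+x. F (av n om, x) \<partial>Kn n) <= ennreal ep'" for om
		proof (cases "gw n kp' (av n om)")
			case True
			have "(\<integral>\<^sup>+x. F (av n om, x) \<partial>Kn n) <= (\<integral>\<^sup>+x. ennreal (G (av n om) x) \<partial>Kn n)"
				by (intro nn_integral_mono) (auto simp: F_def indicator_def)
			also have "... <= ennreal ep'" unfolding G_def
			proof (rule eq[of "{..<n}" "%i. av n om (j, i)" "T m"])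
				have gA: "ALL j:{..M}. ALL i:{..<n}. abs (av n om (j, i)) <= kp'"
					and gB: "ALL j:{..M}. ALL k:{..M}. abs ((SUM i<n. av n om (j, i) * av n om (k, i)) - (if j = k then 1 else 0)) <= kp'"
					using True unfolding gw_def by blast+
				have jM: "j : {..M}" using j by simp
				from gB[rule_format, OF jM jM] have "abs ((SUM i<n. av n om (j, i) * av n om (j, i)) - 1) <= kp'" by simp
				thus "(SUM i:{..<n}. (av n om (j, i))^2) <= 2" using kp'(3) by (simp add: power2_eq_square)
				show "abs (av n om (j, i)) <= kp" if "i : {..<n}" for i using gA[rule_format, OF jM that] kp'(2) by linarith
			qed (use Tfin Tne Tc in auto)
			finally show ?thesis .
		next
			case False
			thus ?thesis by (simp add: F_def)
		qed
		have "ennreal ep * emeasure P (E n m) = (\<integral>\<^sup>+om. ennreal ep * indicator (E n m) om \<partial>P)"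
			using Em by (simp add: nn_integral_cmult_indicator)
		also have "... <= (\<integral>\<^sup>+om. F (av n om, Vv n om) \<partial>P)"
		proof (rule nn_integral_mono)
			fix om assume w: "om : space P"
			show "ennreal ep * indicator (E n m) om <= F (av n om, Vv n om)"
			proof (cases "om : E n m")
				case True
				then obtain t where t: "t : T m" "abs (ZZ n j om (fst t) - ZZ n j om (snd t)) > ep" and g: "gw n kp' (av n om)" unfolding E_def by auto
				have "ZZ n j om (fst t) - ZZ n j om (snd t) = (SUM i:{..<n}. av n om (j, i) * ((bx.bi (fst t) (Vv n om i) - bx.Dm (fst t)) - (bx.bi (snd t) (Vv n om i) - bx.Dm (snd t))))"
					unfolding ZZ_eq[OF j] sum_subtractf[symmetric] right_diff_distrib[symmetric] ..
				hence "abs (ZZ n j om (fst t) - ZZ n j om (snd t)) <= G (av n om) (Vv n om)" unfolding G_def using t(1) Tfin by (intro Max_ge) auto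
				hence "ep <= G (av n om) (Vv n om)" using t(2) by linarith
				moreover have "av n om : space (Nn n)" using measurable_space[OF av_measurable w] .
				ultimately show ?thesis using True g by (simp add: F_def ennreal_leI)
			qed simp
		qed
		also have "... = (\<integral>\<^sup>+om. \<integral>\<^sup>+x. F (av n om, x) \<partial>Kn n \<partial>P)" by (rule disintegration_nn[OF n Fm])
		also have "... <= (\<integral>\<^sup>+om. ennreal ep' \<partial>P)" using inner by (intro nn_integral_mono)
		also have "... = ennreal ep'" by (simp add: P.emeasure_space_1)
		finally have "ennreal (ep * measure P (E n m)) <= ennreal ep'" using ep by (simp add: P.emeasure_eq_measure ennreal_mult)
		hence "ep * measure P (E n m) <= ep * (et / 4)" using ep' unfolding ep'_def by (subst (asm) ennreal_le_iff) auto
		thus ?thesis using ep by simp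
	qed
	define EE where "EE n = (\<Union>m. E n m) Un {om : space P. ~ gw n kp' (av n om)}" for n
	have EEm: "EE n : sets P" for n unfolding EE_def using Em gw_event[of n kp'] by auto
	have "\<forall>\<^sub>F n in sequentially. measure P {om : space P. ~ gw n kp' (av n om)} < et / 4" using et by (intro order_tendstoD(2)[OF gw_prob[OF kp'(1)]]) simp
	hence small: "\<forall>\<^sub>F n in sequentially. measure P (EE n) < et"
		using eventually_ge_at_top[of 1]
	proof eventually_elim
		case (elim n)
		have Emono: "E n m \<subseteq> E n (Suc m)" for m unfolding E_def using Tmono[of m] by auto
		have "(%m. measure P (E n m)) \<longlonglongrightarrow> measure P (\<Union>m. E n m)"
			using Em Emono by (intro P.finite_Lim_measure_incseq incseq_SucI) auto
		hence "measure P (\<Union>m. E n m) <= et / 4" using EP[OF elim(2)] by (intro LIMSEQ_le_const2) auto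
		moreover have "measure P (EE n) <= measure P (\<Union>m. E n m) + measure P {om : space P. ~ gw n kp' (av n om)}"
			unfolding EE_def using Em gw_event[of n kp'] by (intro measure_Un_le) auto
		ultimately show ?case using elim(1) et by linarith
	qed
	have good: "abs (ZZ n j om u - ZZ n j om v) <= ep"
		if w: "om : space P - EE n" and u: "u : cube" and v: "v : cube" and uv: "ALL k. abs (u $ k - v $ k) <= 1 / real (2 * h)" for n om u v
	proof -
		have "(%l. (1 / 2 :: real) ^ l) \<longlonglongrightarrow> 0" by (intro LIMSEQ_power_zero) auto
		hence "\<forall>\<^sub>F l in sequentially. (1 / 2 :: real) ^ l < 1 / real (2 * h)" by (rule order_tendstoD) (use h in simp)
		hence ev: "\<forall>\<^sub>F l in sequentially. abs (ZZ n j om (dyu l u) - ZZ n j om (dyu l v)) <= ep"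
		proof eventually_elim
			case (elim l)
			have "abs (dyu l u $ k - dyu l v $ k) <= 1 / real h" for k
			proof -
				have "abs (dyu l u $ k - dyu l v $ k) <= abs (u $ k - v $ k) + 1 / 2 ^ l"
					using dyu_bounds[where u=u and k=k and l=l] dyu_bounds[where u=v and k=k and l=l] by linarith
				also have "... <= 1 / real (2 * h) + 1 / real (2 * h)" using uv elim by (intro add_mono) (auto simp: power_one_over)
				also have "... = 1 / real h" by simp
				finally show ?thesis .
			qed
			hence t: "(dyu l u, dyu l v) : T l" unfolding T_def using dyu_dygrid u v by auto
			have "om \<notin> E n l" "gw n kp' (av n om)" "om : space P" using w unfolding EE_def by auto
			thus ?case using t unfolding E_def by (auto simp: not_less)
		qed
		have "(%l. abs (ZZ n j om (dyu l u) - ZZ n j om (dyu l v))) \<longlonglongrightarrow> abs (ZZ n j om u - ZZ n j om v)"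
			by (intro tendsto_rabs tendsto_diff ZZ_dyu u v)
		thus ?thesis using ev by (intro tendsto_upperbound[where F=sequentially]) auto
	qed
	show ?thesis
	\<comment> \<open>Half the mesh: rounding both points up increases their distance by at most
	  \<open>1 / 2 ^ l\<close>, eventually below \<open>1 / real (2 * h)\<close>.\<close>
	proof (rule that[of "2 * h"])
		show "hp P et (%n om. ALL u:cube. ALL v:cube. (ALL k. abs (u $ k - v $ k) <= 1 / real (2 * h)) --> abs (ZZ n j om u - ZZ n j om v) <= ep)"
			unfolding hp_def using small
		proof eventually_elim
			case (elim n)
			show ?case using elim EEm[of n] good[of _ n] by (intro bexI[of _ "EE n"] conjI ballI impI) auto
		qed
	qed (use h in simp)
qed

text \<open>\<open>C\<close> is obtained from the modulus at accuracy 1 by walking from the origin,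
  where the processes vanish. It is therefore available before \<open>e\<close>, the order in which
  the delta method needs its constants.\<close>

theorem regularity:
	assumes et: "et > 0"
	obtains C where "C >= 0" "!!e. e > 0 ==> EX dl>0. hp P et (%n om. generic om & (ALL j<=M. reg (ZZ n j om) C e dl))"
proof -
	\<comment> \<open>One share goes to \<open>generic\<close> and \<open>M + 2\<close> shares to each
	  of the two moduli, in total \<open>2 * M + 5\<close>.\<close>
	define et' where "et' = et / (2 * (real M + 3))"
	have et': "et' > 0" using et by (simp add: et'_def)
	define md where "md h ep n j om \<longleftrightarrow> (ALL u:cube. ALL v:cube. (ALL k. abs (u $ k - v $ k) <= 1 / real h) --> abs (ZZ n j om u - ZZ n j om v) <= ep)" for h :: nat and ep n j om
	have ex: "ALL j:{..M}. EX h>0. hp P et' (%n om. md h ep n j om)" if e0: "ep > 0" for ep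
	proof
		fix j assume "j : {..M}"
		hence j: "j <= M" by simp
		obtain h :: nat where "h > 0" "hp P et' (%n om. ALL u:cube. ALL v:cube. (ALL k. abs (u $ k - v $ k) <= 1 / real h) --> abs (ZZ n j om u - ZZ n j om v) <= ep)"
			by (rule equicontinuity[OF j e0 et'])
		thus "EX h>0. hp P et' (%n om. md h ep n j om)" unfolding md_def by blast
	qed
	have md_mono: "md h' ep n j om" if m: "md h ep n j om" and hh: "h <= h'" "h > 0" for h h' ep n j om
		unfolding md_def
	proof (intro ballI impI)
		fix u v :: "real^'p" assume uv: "u : cube" "v : cube" "ALL k. abs (u $ k - v $ k) <= 1 / real h'"
		have "1 / real h' <= 1 / real h" using hh by (intro divide_left_mono) auto
		hence "ALL k. abs (u $ k - v $ k) <= 1 / real h" using uv(3) order_trans by blast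
		thus "abs (ZZ n j om u - ZZ n j om v) <= ep" using m uv unfolding md_def by blast
	qed
	have joint: "EX h>0. hp P ((real M + 2) * et') (%n om. ALL j:{..M}. md h ep n j om)" if ep: "ep > 0" for ep
	proof -
		from bchoice[OF ex[OF ep]] obtain h where h: "ALL j:{..M}. h j > 0 & hp P et' (%n om. md (h j) ep n j om)" by blast
		\<comment> \<open>A larger \<open>h\<close> restricts the pairs further, so the sum of all
		  \<open>h j\<close> serves every process at once.\<close>
		have "h 0 <= (SUM j:{..M}. h j)" by (intro member_le_sum) auto
		hence h0: "(SUM j:{..M}. h j) > 0" using h by (metis atMost_iff less_le_trans zero_le)
		have "hp P et' (%n om. md (SUM j:{..M}. h j) ep n j om)" if j: "j : {..M}" for j
		proof -
			have le: "h j <= (SUM j:{..M}. h j)" using j by (intro member_le_sum) auto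
			have ev: "\<forall>\<^sub>F n in sequentially. ALL om:space P. md (h j) ep n j om --> md (SUM j:{..M}. h j) ep n j om"
			proof (intro always_eventually allI ballI impI)
				fix n om assume "md (h j) ep n j om"
				thus "md (SUM j:{..M}. h j) ep n j om" by (rule md_mono) (use le h j in auto)
			qed
			have H: "hp P et' (%n om. md (h j) ep n j om)" using h j by blast
			show ?thesis by (rule hp_mono[OF H order_refl ev])
		qed
		from P.hp_ball[OF _ this et', of "{..M}"] have "hp P ((real M + 2) * et') (%n om. ALL j:{..M}. md (SUM j:{..M}. h j) ep n j om)" by (simp add: add.commute)
		thus ?thesis using h0 by blast
	qed
	obtain h0 where h0: "h0 > 0" "hp P ((real M + 2) * et') (%n om. ALL j:{..M}. md h0 1 n j om)" using joint[of 1] by auto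
	have gen: "hp P et' (%n om. generic om)" by (rule P.hp_AE[OF generic_AE et'])
	show ?thesis
	proof (rule that[of "real h0"])
		fix e :: real assume e: "e > 0"
		obtain h1 where h1: "h1 > 0" "hp P ((real M + 2) * et') (%n om. ALL j:{..M}. md h1 e n j om)" using joint[OF e] by blast
		have tot: "et' + ((real M + 2) * et' + (real M + 2) * et') <= et"
		proof -
			have "et' + ((real M + 2) * et' + (real M + 2) * et') = (2 * real M + 5) * et'" by (simp add: algebra_simps)
			also have "... <= (2 * (real M + 3)) * et'" using et' by (intro mult_right_mono) auto
			also have "... = et" unfolding et'_def by simp
			finally show ?thesis .
		qed
		have "hp P et (%n om. generic om & (ALL j<=M. reg (ZZ n j om) (real h0) e (1 / real h1)))"
		proof (rule hp_mono[OF P.hp_conj[OF gen P.hp_conj[OF h0(2) h1(2)]] tot], intro always_eventually allI ballI impI)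
			fix n om assume a: "generic om & (ALL j:{..M}. md h0 1 n j om) & (ALL j:{..M}. md h1 e n j om)"
			show "generic om & (ALL j<=M. reg (ZZ n j om) (real h0) e (1 / real h1))"
			proof (intro conjI allI impI)
				fix j assume j: "j <= M"
				have z: "ZZ n j om u = 0" if "u $ k = 0" for u k unfolding ZZ_def using a that by (intro zp_zero) auto
				have 0: "ZZ n j om 0 = 0" by (rule z[of 0 undefined]) simp
				have m0: "md h0 1 n j om" and m1: "md h1 e n j om" using a j by auto
				have "abs (ZZ n j om u) <= real h0" if "u : cube" for u
					by (rule bounded_from_modulus[where b="ZZ n j om", OF h0(1) _ 0 that]) (use m0 in \<open>auto simp: md_def\<close>)
				thus "reg (ZZ n j om) (real h0) e (1 / real h1)" unfolding reg_def using m1 z by (auto simp: md_def)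
			qed (use a in simp)
		qed
		thus "EX dl>0. hp P et (%n om. generic om & (ALL j<=M. reg (ZZ n j om) (real h0) e dl))"
			using h1(1) by (intro exI[of _ "1 / real h1"]) auto
	qed simp
qed

end

section \<open>Weak convergence\<close>

lemma (in box_class) Dm_tendsto:
	assumes x: "!!l. x l : cube" and u: "u : cube" and lim: "!!k. (%l. x l $ k) \<longlonglongrightarrow> u $ k"
	shows "(%l. Dm (x l)) \<longlonglongrightarrow> Dm u"
proof -
	have "(%l. SUM k:UNIV. abs (x l $ k - u $ k)) \<longlonglongrightarrow> (SUM k:(UNIV::'p set). abs (u $ k - u $ k))"
		by (intro tendsto_intros lim)
	hence lim0: "(%l. SUM k:UNIV. abs (x l $ k - u $ k)) \<longlonglongrightarrow> 0" by simp
	have "(%l. Dm (x l) - Dm u) \<longlonglongrightarrow> 0"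
		by (rule tendsto_0_le[OF lim0, where K=1]) (use Dm_diff[OF x u] in auto)
	thus ?thesis by (simp add: LIM_zero_iff)
qed

lemma dyv_tendsto: "(%l. dyv l u $ k) \<longlonglongrightarrow> u $ k"
proof (rule tendsto_sandwich[where f="%l. u $ k - 1 / 2 ^ l" and h="%_. u $ k"])
	have "(%l. u $ k - (1 / 2) ^ l) \<longlonglongrightarrow> u $ k - 0" by (intro tendsto_intros LIMSEQ_power_zero) auto
	thus "(%l. u $ k - 1 / 2 ^ l) \<longlonglongrightarrow> u $ k" by (simp add: power_one_over)
qed (auto intro!: always_eventually dyr_bounds)

lemma vmin_cube: "u : cube ==> v : cube ==> vmin u v : cube" by (auto simp: cube_def vmin_def min_le_iff_disj)

lemma continuous_reg:
	fixes b :: "real^'p::finite => real"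
	assumes c: "continuous_on cube b" and z: "!!u k. u : cube ==> u $ k = 0 ==> b u = 0"
	obtains C where "C >= 0" "!!e. e > 0 ==> EX dl>0. reg b C e dl"
proof -
	have eq: "cube = {u :: real^'p. u : cube & 0 <= u $ undefined & u $ undefined <= 1}" by (auto simp: cube_def)
	have cp: "compact (cube :: (real^'p) set)" using compact_cube_slab[of 0 "undefined :: 'p" 1] by (simp only: eq[symmetric])
	have "bounded (b ` cube)" using c cp by (intro compact_imp_bounded compact_continuous_image)
	then obtain C where C: "!!u. u : cube ==> abs (b u) <= C" unfolding bounded_iff by auto
	have uc: "uniformly_continuous_on cube b" using c cp by (rule compact_uniformly_continuous)
	have C0: "C >= 0" using C[OF one_cube(1)] by linarith
	show ?thesis
	proof (rule that[OF C0])
		fix e :: real assume e: "e > 0"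
		from uc[unfolded uniformly_continuous_on_def, rule_format, OF e]
		obtain d where d: "d > 0" "ALL u:cube. ALL v:cube. dist v u < d --> dist (b v) (b u) < e" by blast
		have "reg b C e (d / (2 * real CARD('p)))" unfolding reg_def
		proof (intro conjI ballI impI)
			fix u v :: "real^'p" assume uv: "u : cube" "v : cube" "ALL k. abs (u $ k - v $ k) <= d / (2 * real CARD('p))"
			have "dist v u = norm (u - v)" by (simp add: dist_norm norm_minus_commute)
			also have "... <= (SUM i:UNIV. abs ((u - v) $ i))" by (rule norm_le_l1_cart)
			also have "... <= (SUM i:(UNIV::'p set). d / (2 * real CARD('p)))" using uv by (intro sum_mono) auto
			also have "... = d / 2" by simp
			also have "... < d" using d(1) by simp
			finally have "dist (b v) (b u) < e" using uv d(2) by blast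
			thus "abs (b u - b v) <= e" by (simp add: dist_real_def abs_minus_commute)
		qed (use C z in auto)
		thus "EX dl>0. reg b C e dl" using d(1) by (intro exI[of _ "d / (2 * real CARD('p))"]) auto
	qed
qed

section \<open>The Gaussian limit process\<close>

context copula_data
begin

lemma covB_quadratic: "(SUM i:I. SUM j:I. c i * c j * covB P V A (w i) (w j)) = (\<integral>x. (SUM i:I. c i * bx.ze (w i) x)^2 \<partial>mu)" if "finite I"
proof -
	have cv: "covB P V A u v = (\<integral>x. bx.ze u x * bx.ze v x \<partial>mu)" for u v unfolding covB_integral bx.ze_def ..
	have "(SUM i:I. c i * bx.ze (w i) x)^2 = (SUM i:I. SUM j:I. c i * c j * (bx.ze (w i) x * bx.ze (w j) x))" for x
		unfolding power2_eq_square sum_product by (intro sum.cong refl) (simp add: mult_ac)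
	hence "(\<integral>x. (SUM i:I. c i * bx.ze (w i) x)^2 \<partial>mu) = (\<integral>x. (SUM i:I. SUM j:I. c i * c j * (bx.ze (w i) x * bx.ze (w j) x)) \<partial>mu)" by (simp only:)
	also have "... = (SUM i:I. \<integral>x. (SUM j:I. c i * c j * (bx.ze (w i) x * bx.ze (w j) x)) \<partial>mu)"
		by (rule Bochner_Integration.integral_sum) (use bx.ze_mult_integrable in auto)
	also have "... = (SUM i:I. SUM j:I. \<integral>x. c i * c j * (bx.ze (w i) x * bx.ze (w j) x) \<partial>mu)"
		by (intro sum.cong refl Bochner_Integration.integral_sum) (use bx.ze_mult_integrable in auto)
	finally show ?thesis unfolding cv by simp
qed

lemma vmin_self: "vmin u u = u" by (simp add: vmin_def vec_eq_iff)

text \<open>The variance of an increment is \<open>D u + D v - 2 * D (vmin u v)\<close> minus a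
  square, hence linear in the distance by the Lipschitz property of \<open>D\<close>. The lower
  faces form \<open>Zs\<close>: there \<open>D\<close> is 0, and rounding down keeps a point on its
  face.\<close>

lemma gaussian_limit:
	obtains B1 where "gaussian_proc gsp B1 (covB P V A)" "!!x. continuous_on cube (B1 x)" "!!x u k. u : cube ==> u $ k = 0 ==> B1 x u = 0"
proof -
	define Zs :: "(real^'p) set" where "Zs = {u : cube. EX k. u $ k = 0}"
	have sym: "covB P V A u v = covB P V A v u" for u v
	proof -
		have "vmin u v = vmin v u" by (simp add: vmin_def vec_eq_iff min.commute)
		thus ?thesis by (simp add: covB_Dm)
	qed
	have inc: "covB P V A u u + covB P V A v v - 2 * covB P V A u v <= (2 * real CARD('p)) * r"
		if u: "u : cube" and v: "v : cube" and uv: "ALL k. abs (u $ k - v $ k) <= r" for u v r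
	proof -
		have "abs (bx.Dm w - bx.Dm (vmin u v)) <= real CARD('p) * r" if w: "w : {u, v}" for w
		proof -
			have "abs (bx.Dm w - bx.Dm (vmin u v)) <= (SUM k:UNIV. abs (w $ k - vmin u v $ k))" using w u v vmin_cube[OF u v] by (intro bx.Dm_diff) auto
			also have "... <= (SUM k:(UNIV::'p set). r)"
			proof (rule sum_mono)
				fix k
				have "abs (u $ k - v $ k) <= r" using uv by blast
				thus "abs (w $ k - vmin u v $ k) <= r" using w by (auto simp: vmin_def min_def)
			qed
			finally show ?thesis by simp
		qed
		from this[of u] this[of v] have "bx.Dm u - bx.Dm (vmin u v) <= real CARD('p) * r" "bx.Dm v - bx.Dm (vmin u v) <= real CARD('p) * r" by auto
		moreover have "covB P V A u u + covB P V A v v - 2 * covB P V A u v = (bx.Dm u - bx.Dm (vmin u v)) + (bx.Dm v - bx.Dm (vmin u v)) - (bx.Dm u - bx.Dm v)^2"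
			unfolding covB_Dm vmin_self by (simp add: power2_eq_square algebra_simps)
		moreover have "0 <= (bx.Dm u - bx.Dm v)^2" by simp
		ultimately show ?thesis by linarith
	qed
	have cont: "(%l. covB P V A (dyv l u) (dyv l v)) \<longlonglongrightarrow> covB P V A u v" if u: "u : cube" and v: "v : cube" for u v
		unfolding covB_Dm
	proof (intro tendsto_diff tendsto_mult bx.Dm_tendsto)
		show "vmin (dyv l u) (dyv l v) : cube" for l using u v by (intro vmin_cube dyv_cube)
		show "(%l. vmin (dyv l u) (dyv l v) $ k) \<longlonglongrightarrow> vmin u v $ k" for k
			using tendsto_min[OF dyv_tendsto[of u k] dyv_tendsto[of v k]] by (simp add: vmin_def)
	qed (use u v vmin_cube dyv_cube dyv_tendsto in auto)
	have zero: "u : cube & covB P V A u u = 0 & (ALL l. dyv l u : Zs)" if uz: "u : Zs" for u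
	proof -
		obtain k where k: "u : cube" "u $ k = 0" using uz by (auto simp: Zs_def)
		have "dyv l u : Zs" for l using dyv_cube[OF k(1), of l] k(2) unfolding Zs_def by (auto intro!: exI[of _ k])
		thus ?thesis using k(1) Dm_zero[OF k(2)] by (simp add: covB_Dm vmin_self)
	qed
	show ?thesis
	proof (rule continuous_gaussian_process[where K="covB P V A" and C="2 * real CARD('p)" and Zs=Zs])
		show "covB P V A u v = covB P V A v u" for u v by (rule sym)
		show "0 <= (SUM i<n. SUM j<n. c i * c j * covB P V A (w i) (w j))" for n c and w :: "nat => real^'p"
			by (subst covB_quadratic) auto
		show "covB P V A u u + covB P V A v v - 2 * covB P V A u v <= (2 * real CARD('p)) * r"
			if "u : cube" "v : cube" "ALL k. abs (u $ k - v $ k) <= r" for u v r using that by (rule inc)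
		show "(%l. covB P V A (dyv l u) (dyv l v)) \<longlonglongrightarrow> covB P V A u v" if "u : cube" "v : cube" for u v using that by (rule cont)
		show "u : cube & covB P V A u u = 0 & (ALL l. dyv l u : Zs)" if "u : Zs" for u using that by (rule zero)
		fix B assume "gaussian_proc gsp B (covB P V A)" "!!x. continuous_on cube (B x)" "!!x u. u : Zs ==> B x u = 0"
		thus thesis by (intro that[of B]) (auto simp: Zs_def)
	qed simp
qed

end

section \<open>From grid values to the whole process\<close>

context boot_sample
begin

lemma ZZ_0: "ZZ n 0 om = alp n om" unfolding ZZ_def aw_def by simp

lemma ZZ_bet: "j ~= 0 ==> ZZ n j om = bet (W j) n om" unfolding ZZ_def aw_def by simp

definition cP :: real where "cP = 1 + 2 * real CARD('p) / pAA"

lemma cP_pos: "cP > 0" unfolding cP_def using pA_pos by (simp add: add_pos_nonneg)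

lemma Phi_close:
	assumes "!!u. u : cube ==> abs (b u - b' u) <= d" "u : cube"
	shows "abs (sc.Phi b u - sc.Phi b' u) <= cP * d"
proof -
	have "abs (sc.Phi (%u. b u - b' u) u) <= (1 + 2 * real CARD('p) / pAA) * d" using assms by (intro sc.Phi_bound)
	thus ?thesis unfolding sc.Phi_diff cP_def .
qed

text \<open>The limit map applied to the step function read off a finite vector of grid values. The
  step function is discontinuous, but \<open>Phi\<close> is Lipschitz in the sup norm, so this is a
  Lipschitz image of finitely many coordinates, as the finite-dimensional limit theorem
  requires.\<close>

definition PhiS :: "nat => (nat \<times> (real^'p) => real) => nat => real^'p => real" where
	"PhiS l y = (%j u. if j <= M & u : cube then sc.Phi (gstep M l y j) u else 0)"

lemma PhiS_lspace: "PhiS l y : lspace M"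
proof -
	have S0: "0 <= (SUM s:{..M} \<times> dygrid l. abs (y s))" by (intro sum_nonneg) auto
	have "abs (PhiS l y j u) <= cP * (SUM s:{..M} \<times> dygrid l. abs (y s))" for j u
	proof (cases "j <= M & u : cube")
		case True
		have "abs (sc.Phi (gstep M l y j) u) <= cP * (SUM s:{..M} \<times> dygrid l. abs (y s))"
			unfolding cP_def using True by (intro sc.Phi_bound gstep_bound) auto
		thus ?thesis using True by (simp add: PhiS_def)
	next
		case False
		thus ?thesis using S0 cP_pos by (auto simp: PhiS_def)
	qed
	moreover have "ALL j u. ~ (j <= M & u : cube) --> PhiS l y j u = 0" by (simp add: PhiS_def)
	ultimately show ?thesis unfolding lspace_def by blast
qed

lemma PhiS_close:
	assumes "ALL s:{..M} \<times> dygrid l. abs (y s - y' s) <= d"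
	shows "supdist M (PhiS l y) (PhiS l y') <= cP * d"
proof (rule supdist_le)
	fix j and u :: "real^'p" assume ju: "j <= M" "u : cube"
	have "abs (sc.Phi (gstep M l y j) u - sc.Phi (gstep M l y' j) u) <= cP * d"
		using ju assms dyv_dygrid by (intro Phi_close) (auto simp: gstep_def)
	thus "abs (PhiS l y j u - PhiS l y' j u) <= cP * d" using ju by (simp add: PhiS_def)
qed

text \<open>The constants are taken in the order \<open>C\<close> (regularity), \<open>e\<close>
  (delta method), \<open>dl\<close> (regularity at accuracy \<open>e\<close>), \<open>l0\<close>,
  and \<open>n\<close> last. That \<open>l0\<close> is independent of \<open>n\<close> allows the
  limits in \<open>n\<close> and in \<open>l\<close> to be separated.\<close>

lemma bootproc_close:
	assumes ep: "ep > 0" and et: "et > 0"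
	obtains l0 where "!!l. l >= l0 ==> hp P et (%n om. supdist M (bootproc P V A W M n om) (PhiS l (%s. ZZ n (fst s) om (snd s))) <= ep)"
proof -
	have ep2: "ep / 2 > 0" using ep by simp
	obtain C where C: "C >= 0" and rg: "!!e. e > 0 ==> EX dl>0. hp P et (%n om. generic om & (ALL j<=M. reg (ZZ n j om) C e dl))"
		by (rule regularity[OF et]) blast
	obtain e1 where e1: "e1 > 0" and A1: "!!dl. dl > 0 ==> \<forall>\<^sub>F n in sequentially. ALL al v. reg al C e1 dl --> sc.qrel n al v --> (ALL u:cube. abs (sc.DP n al v u - sc.Phi al u) <= ep / 2)"
		by (rule sc.DP_approx[OF ep2 C]) blast
	obtain e2 where e2: "e2 > 0" and A2: "!!dl. dl > 0 ==> \<forall>\<^sub>F n in sequentially. ALL al be v. reg al C e2 dl --> reg be C e2 dl --> sc.qrel n al v --> (ALL u:cube. abs (sc.Dt n al be v u - sc.Phi be u) <= ep / 2)"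
		by (rule sc.Dt_approx[OF ep2 C]) blast
	define e where "e = min e1 (min e2 (ep / 2 / cP))"
	have e: "e > 0" "e <= e1" "e <= e2" "e <= ep / 2 / cP" using e1 e2 ep2 cP_pos by (auto simp: e_def)
	obtain dl where dl: "dl > 0" and H: "hp P et (%n om. generic om & (ALL j<=M. reg (ZZ n j om) C e dl))" using rg[OF e(1)] by blast
	obtain l0 where l0: "!!l. l >= l0 ==> 1 / 2 ^ l <= dl" using eventually_half_power[OF dl] by (auto simp: eventually_sequentially)
	show ?thesis
	proof (rule that[of l0])
		fix l assume l: "l >= l0"
		have p2: "pAA / 2 > 0" using pA_pos by simp
		have ev: "\<forall>\<^sub>F n in sequentially. ALL om:space P. generic om & (ALL j<=M. reg (ZZ n j om) C e dl) -->
				supdist M (bootproc P V A W M n om) (PhiS l (%s. ZZ n (fst s) om (snd s))) <= ep"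
			using A1[OF dl] A2[OF dl] eventually_ge_at_top[of 1] eventually_div_sqrt_le[OF p2, of C]
		proof eventually_elim
			case (elim n)
			show ?case
			proof (intro ballI impI)
				fix om assume w: "om : space P" and "generic om & (ALL j<=M. reg (ZZ n j om) C e dl)"
				hence g: "generic om" and r: "!!j. j <= M ==> reg (ZZ n j om) C e dl" by auto
				have n: "n >= 1" by (rule elim(3))
				have sn: "rt n > 0" using n by simp
				have ph: "phat V A n om > 0"
				proof -
					have "abs (alp n om (vec 1)) <= C" using r[of 0] one_cube(1) unfolding ZZ_0 reg_def by blast
					hence "abs (alp n om (vec 1) / rt n) <= C / rt n" using sn by (simp add: abs_divide divide_right_mono)
					thus ?thesis unfolding phat_alp[OF n] using elim(4) pA_pos by linarith
				qed
				have q: "sc.qrel n (alp n om) (vq n om)" by (rule qrel_vq[OF g n ph])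
				have r0: "reg (alp n om) C e dl" using r[of 0] by (simp add: ZZ_0)
				have b1: "abs (bootproc P V A W M n om j u - sc.Phi (ZZ n j om) u) <= ep / 2" if ju: "j <= M" "u : cube" for j u
				proof (cases "j = 0")
					case True
					have "abs (sc.DP n (alp n om) (vq n om) u - sc.Phi (alp n om) u) <= ep / 2" using elim(1) reg_mono[OF r0 e(2)] q ju(2) by blast
					thus ?thesis using True ju DbarProc_DP[OF g n ph ju(2)] by (simp add: bootproc_def ZZ_0)
				next
					case False
					have rj: "reg (bet (W j) n om) C e dl" using r[OF ju(1)] by (simp add: ZZ_bet[OF False])
					have "abs (sc.Dt n (alp n om) (bet (W j) n om) (vq n om) u - sc.Phi (bet (W j) n om) u) <= ep / 2"
						using elim(2) reg_mono[OF r0 e(3)] reg_mono[OF rj e(3)] q ju(2) by blast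
					thus ?thesis using False ju Dtilde_Dt[OF g n ph ju(2), of "W j"] by (simp add: bootproc_def ZZ_bet)
				qed
				show "supdist M (bootproc P V A W M n om) (PhiS l (%s. ZZ n (fst s) om (snd s))) <= ep"
				proof (rule supdist_le)
					fix j and u :: "real^'p" assume ju: "j <= M" "u : cube"
					let ?g = "gstep M l (%s. ZZ n (fst s) om (snd s)) j"
					have "abs (ZZ n j om v - ?g v) <= e" if v: "v : cube" for v
					proof -
						have "ALL k. abs (v $ k - dyv l v $ k) <= dl" using dyv_dist[of l v] l0[OF l] by (metis abs_minus_commute order_trans)
						hence "abs (ZZ n j om v - ZZ n j om (dyv l v)) <= e" using r[OF ju(1)] v dyv_cube[OF v] unfolding reg_def by blast
						thus ?thesis using ju v by (simp add: gstep_def)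
					qed
					hence "abs (sc.Phi (ZZ n j om) u - sc.Phi ?g u) <= cP * e" using ju(2) by (intro Phi_close)
					also have "... <= ep / 2" using e(4) cP_pos by (simp add: pos_le_divide_eq mult.commute)
					finally have "abs (sc.Phi (ZZ n j om) u - PhiS l (%s. ZZ n (fst s) om (snd s)) j u) <= ep / 2" using ju by (simp add: PhiS_def)
					thus "abs (bootproc P V A W M n om j u - PhiS l (%s. ZZ n (fst s) om (snd s)) j u) <= ep" using b1[OF ju] by linarith
				qed
			qed
		qed
		show "hp P et (%n om. supdist M (bootproc P V A W M n om) (PhiS l (%s. ZZ n (fst s) om (snd s))) <= ep)"
			by (rule hp_mono[OF H order_refl ev])
	qed
qed

text \<open>Approximation in two stages: for fixed \<open>l\<close> the discretised functionals
  converge as \<open>n\<close> grows, and as \<open>l\<close> grows their limits converge along the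
  continuous Gaussian paths. The exchange is allowed because the discretisation error of the sample
  process is small for each fixed large \<open>l\<close> once \<open>n\<close> is large, off a small
  event.\<close>

theorem bootstrap_limit:
	"EX (Q :: real measure) (B :: nat => real => real^'p => real).
					 prob_space Q
				 & (ALL j<=M. gaussian_proc Q (B j) (covB P V A))
				 & prob_space.indep_sets Q (%j. gen_sigma Q (%u x. B j x u) cube) {..M}
				 & limproc P V A M B : measurable Q (lsp_borel M)
				 & hj_weak_conv M P (bootproc P V A W M) Q (limproc P V A M B)"
proof -
	obtain B1 where B1: "gaussian_proc gsp B1 (covB P V A)" and B1c: "!!x. continuous_on cube (B1 x)"
		and B1z: "!!x u k. u : cube ==> u $ k = 0 ==> B1 x u = 0"
		by (rule gaussian_limit) blast
	have pos: "0 <= (SUM u:S. SUM v:S. c u * c v * covB P V A u v)" if "finite S" "S \<subseteq> cube" for S c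
		using that by (subst covB_quadratic[where w="%u. u"]) auto
	obtain Q :: "real measure" and ps where Q: "prob_space Q"
		and gp: "!!j. j <= M ==> gaussian_proc Q (%x. B1 (ps x j)) (covB P V A)"
		and ind: "prob_space.indep_sets Q (%j. gen_sigma Q (%u x. B1 (ps x j) u) cube) {..M}"
		and ch: "!!S t. finite S ==> S \<subseteq> {..M} \<times> cube ==> (\<integral>x. cis (SUM s:S. t s * B1 (ps x (fst s)) (snd s)) \<partial>Q) =
				cor (exp (- (SUM s:S. SUM s':S. t s * t s' * (if fst s = fst s' then covB P V A (snd s) (snd s') else 0)) / 2))"
		by (rule gaussian_proc_copies[OF B1, where M=M]) (rule pos, assumption+, blast)
	interpret Q: prob_space Q by (rule Q)
	define B where "B j x = B1 (ps x j)" for j x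
	have Bm: "(%x. B j x u) : bm Q" if "j <= M" "u : cube" for j u
		using gp[OF that(1)] that(2) unfolding B_def gaussian_proc_def by blast
	let ?G = "limproc P V A M B"
	have Ge: "?G x j u = (if j <= M & u : cube then sc.Phi (B j x) u else 0)" for x j u
		unfolding limproc_def Dinf_Phi ..
	have Breg: "EX C. C >= 0 & (ALL e>0. EX dl>0. reg (B j x) C e dl)" for j x
	proof (rule continuous_reg[of "B j x"])
		show "continuous_on cube (B j x)" unfolding B_def by (rule B1c)
		show "B j x u = 0" if "u : cube" "u $ k = 0" for u k unfolding B_def using that by (rule B1z)
		fix C assume "C >= 0" "!!e. e > 0 ==> EX dl>0. reg (B j x) C e dl"
		thus "EX C. C >= 0 & (ALL e>0. EX dl>0. reg (B j x) C e dl)" by blast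
	qed
	have Glsp: "?G x : lspace M" for x
	proof -
		have "EX C>=0. ALL u:cube. abs (B j x u) <= C" for j using Breg[of j x] zero_less_one unfolding reg_def by meson
		hence "ALL j. EX C. C >= 0 & (ALL u:cube. abs (B j x u) <= C)" by blast
		from choice[OF this] obtain Cj where Cj: "ALL j. Cj j >= 0 & (ALL u:cube. abs (B j x u) <= Cj j)" by blast
		have S0: "0 <= (SUM j<=M. Cj j)" using Cj by (intro sum_nonneg) auto
		have "abs (?G x j u) <= cP * (SUM j<=M. Cj j)" for j u
		proof (cases "j <= M & u : cube")
			case True
			have "abs (sc.Phi (B j x) u) <= cP * Cj j" unfolding cP_def using True Cj by (intro sc.Phi_bound) auto
			also have "... <= cP * (SUM j<=M. Cj j)" using True Cj cP_pos by (intro mult_left_mono member_le_sum) auto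
			finally show ?thesis using True by (simp add: Ge)
		next
			case False
			thus ?thesis using S0 cP_pos by (auto simp: Ge)
		qed
		moreover have "ALL j u. ~ (j <= M & u : cube) --> ?G x j u = 0" by (simp add: Ge)
		ultimately show ?thesis unfolding lspace_def by blast
	qed
	have Gm: "(%x. ?G x j u) : bm Q" if ju: "j <= M" "u : cube" for j u
	proof -
		have [measurable]: "(%x. B j x u) : bm Q" "(%x. B j x (vec 1)) : bm Q" using ju Bm by auto
		have [measurable]: "(%x. B j x (vupd (vec 1) k (u $ k))) : bm Q" for k
			using ju cubeD[OF ju(2), of k] by (intro Bm vupd_cube) auto
		have "(%x. sc.Phi (B j x) u) : bm Q" unfolding sc.Phi_def sc.cb_def by measurable
		thus ?thesis using ju by (simp add: Ge)
	qed
	have Gu: "EX de>0. ALL j<=M. ALL u:cube. ALL v:cube. (ALL k. abs (u $ k - v $ k) <= de) --> abs (?G x j u - ?G x j v) <= ep" if ep: "ep > 0" for x ep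
	proof -
		have "EX de>0. ALL u:cube. ALL v:cube. (ALL k. abs (u $ k - v $ k) <= de) --> abs (sc.Phi (B j x) u - sc.Phi (B j x) v) <= ep" for j
		proof -
			obtain C where C: "C >= 0" and rg: "!!e. e > 0 ==> EX dl>0. reg (B j x) C e dl" using Breg[of j x] by blast
			obtain e where e: "e > 0" and md: "!!dl. dl > 0 ==> EX de>0. ALL b. reg b C e dl --> (ALL u:cube. ALL v:cube. (ALL i. abs (u $ i - v $ i) <= de) --> abs (sc.Phi b u - sc.Phi b v) <= ep)"
				by (rule sc.Phi_modulus[OF ep C]) blast
			obtain dl where "dl > 0" "reg (B j x) C e dl" using rg[OF e] by blast
			thus ?thesis using md[of dl] by blast
		qed
		hence "ALL j. EX de. de > 0 & (ALL u:cube. ALL v:cube. (ALL k. abs (u $ k - v $ k) <= de) --> abs (sc.Phi (B j x) u - sc.Phi (B j x) v) <= ep)" by blast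
		from choice[OF this] obtain de where de: "ALL j. de j > 0 & (ALL u:cube. ALL v:cube. (ALL k. abs (u $ k - v $ k) <= de j) --> abs (sc.Phi (B j x) u - sc.Phi (B j x) v) <= ep)" by blast
		define dm where "dm = Min (de ` {..M})"
		have dm: "dm > 0" unfolding dm_def using de by (subst Min_gr_iff) auto
		have dml: "dm <= de j" if "j <= M" for j unfolding dm_def using that by (intro Min_le) auto
		show ?thesis
		proof (intro exI[of _ dm] conjI dm allI impI ballI)
			fix j and u v :: "real^'p" assume j: "j <= M" and uv: "u : cube" "v : cube" "ALL k. abs (u $ k - v $ k) <= dm"
			have "ALL k. abs (u $ k - v $ k) <= de j" using uv(3) dml[OF j] order_trans by blast
			hence "abs (sc.Phi (B j x) u - sc.Phi (B j x) v) <= ep" using de uv by blast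
			thus "abs (?G x j u - ?G x j v) <= ep" using j uv by (simp add: Ge)
		qed
	qed
	have Gmeas: "?G : measurable Q (lsp_borel M)" by (rule process_measurable) (rule Glsp, rule Gm, assumption+, rule Gu, assumption)
	have weak: "hj_weak_conv M P (bootproc P V A W M) Q ?G"
	proof (rule hj_weak_conv_lipschitzI[OF prob Q bootproc_lspace Gmeas])
		fix h :: "(nat => real^'p => real) => real" and K L :: real
		assume hK: "!!g. g : lspace M ==> abs (h g) <= K" and hL: "lsp_lipschitz M L h"
		have L0: "0 <= L" and Lip: "!!g g'. g : lspace M ==> g' : lspace M ==> abs (h g - h g') <= L * supdist M g g'"
			using hL unfolding lsp_lipschitz_def by auto
		have K0: "K >= 0" using hK[OF Glsp[of undefined]] by linarith
		define gl where "gl l y = h (PhiS l y)" for l y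
		have glK: "abs (gl l y) <= K" for l y unfolding gl_def by (rule hK[OF PhiS_lspace])
		have glL: "ALL y y' d. (ALL s:{..M} \<times> dygrid l. abs (y s - y' s) <= d) --> 0 <= d --> abs (gl l y - gl l y') <= (L * cP) * d" for l
		proof (intro allI impI)
			fix y y' :: "nat \<times> (real^'p) => real" and d :: real assume "ALL s:{..M} \<times> dygrid l. abs (y s - y' s) <= d"
			hence "L * supdist M (PhiS l y) (PhiS l y') <= L * (cP * d)" using L0 by (intro mult_left_mono PhiS_close) auto
			thus "abs (gl l y - gl l y') <= (L * cP) * d" unfolding gl_def using Lip[OF PhiS_lspace PhiS_lspace, of l y l y'] by (simp add: mult.assoc)
		qed
		have LcP: "0 <= L * cP" using L0 cP_pos by simp
		let ?F = "%n l om. gl l (%s. ZZ n (fst s) om (snd s))" and ?Y = "%l x. gl l (%s. B (fst s) x (snd s))"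
		have fin: "finite ({..M} \<times> (dygrid l :: (real^'p) set))" for l by (simp add: finite_dygrid)
		have Fm: "?F n l : bm P" for n l
			by (rule borel_measurable_lipschitz_finite[where g="gl l" and K=K and L="L * cP" and I="{..M} \<times> dygrid l"])
				(rule fin, rule glK, rule LcP, rule glL, auto intro: ZZ_measurable)
		have Ym: "?Y l : bm Q" for l
			by (rule borel_measurable_lipschitz_finite[where g="gl l" and K=K and L="L * cP" and I="{..M} \<times> dygrid l"])
				(rule fin, rule glK, rule LcP, rule glL, auto intro!: Bm intro: dygrid_cubeD)
		have fidi: "(%n. \<integral>om. ?F n l om \<partial>P) \<longlonglongrightarrow> (\<integral>x. ?Y l x \<partial>Q)" for l
		proof (rule multivariate_levy_continuity[where g="gl l" and K=K and L="L * cP" and X="%n s om. ZZ n (fst s) om (snd s)"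
					and Y="%s x. B (fst s) x (snd s)", OF prob Q fin])
			show "(%om. ZZ n (fst s) om (snd s)) : bm P" if "s : {..M} \<times> dygrid l" for n s using that by (intro ZZ_measurable) auto
			show "(%x. B (fst s) x (snd s)) : bm Q" if "s : {..M} \<times> dygrid l" for s
				using that by (intro Bm) (auto intro: dygrid_cubeD)
		next
			fix t :: "nat \<times> (real^'p) => real"
			have S: "finite ({..M} \<times> (dygrid l :: (real^'p) set))" "{..M} \<times> (dygrid l :: (real^'p) set) \<subseteq> {..M} \<times> cube"
				using fin dygrid_cubeD by auto
			have "(\<integral>x. cis (SUM s:{..M} \<times> dygrid l. t s * B (fst s) x (snd s)) \<partial>Q) =
				cor (exp (- (SUM s:{..M} \<times> dygrid l. SUM s':{..M} \<times> dygrid l. t s * t s' * (if fst s = fst s' then covB P V A (snd s) (snd s') else 0)) / 2))"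
				unfolding B_def by (rule ch[OF S])
			thus "(%n. \<integral>om. cis (SUM s:{..M} \<times> dygrid l. t s * ZZ n (fst s) om (snd s)) \<partial>P) \<longlonglongrightarrow> (\<integral>x. cis (SUM s:{..M} \<times> dygrid l. t s * B (fst s) x (snd s)) \<partial>Q)"
				using char_limit[OF S(1), of t] by auto
		next
			fix s :: "nat \<times> (real^'p)" and e :: real assume s: "s : {..M} \<times> dygrid l" and e: "e > 0"
			have sc: "fst s <= M" "snd s : cube" using s dygrid_cubeD by auto
			\<comment> \<open>Tightness of a single coordinate is read off the bound \<open>C\<close> in
			  \<open>regularity\<close>; the modulus, taken at accuracy 1, is only a vehicle.\<close>
			obtain C where rg: "!!e'. e' > 0 ==> EX dl>0. hp P e (%n om. generic om & (ALL j<=M. reg (ZZ n j om) C e' dl))"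
				by (rule regularity[OF e]) blast
			obtain dl where "hp P e (%n om. generic om & (ALL j<=M. reg (ZZ n j om) C 1 dl))" using rg[of 1] by auto
			hence "\<forall>\<^sub>F n in sequentially. measure P {om : space P. abs (ZZ n (fst s) om (snd s)) > C} < e"
				unfolding hp_def
			proof eventually_elim
				case (elim n)
				then obtain E where E: "E : sets P" "measure P E < e" "!!om. om : space P - E ==> ALL j<=M. reg (ZZ n j om) C 1 dl" by blast
				have "{om : space P. abs (ZZ n (fst s) om (snd s)) > C} \<subseteq> E"
				proof
					fix om assume w: "om : {om : space P. abs (ZZ n (fst s) om (snd s)) > C}"
					show "om : E"
					proof (rule ccontr)
						assume "om \<notin> E"
						hence "reg (ZZ n (fst s) om) C 1 dl" using E(3)[of om] w sc by auto
						thus False using w sc unfolding reg_def by (auto simp: not_le[symmetric])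
					qed
				qed
				hence "measure P {om : space P. abs (ZZ n (fst s) om (snd s)) > C} <= measure P E" using E(1) by (rule P.finite_measure_mono)
				thus ?case using E(2) by linarith
			qed
			thus "EX R. \<forall>\<^sub>F n in sequentially. measure P {om : space P. abs (ZZ n (fst s) om (snd s)) > R} < e" by blast
		qed (rule glK, rule LcP, rule glL)
		have grid: "(%l. \<integral>x. ?Y l x \<partial>Q) \<longlonglongrightarrow> (\<integral>x. h (?G x) \<partial>Q)"
		proof (rule integral_dominated_convergence[where w="%_. K"])
			show "(%x. h (?G x)) : bm Q"
				by (rule lipschitz_process_measurable[where G="limproc P V A M B" and h=h and K=K and L=L and M=M])
					(rule Glsp, rule Gm, assumption+, rule Gu, assumption, rule hK, assumption, rule hL)
			show "AE x in Q. (%l. ?Y l x) \<longlonglongrightarrow> h (?G x)"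
			proof (rule AE_I2, rule LIMSEQ_I)
				fix x and r :: real assume r: "r > 0"
				define e where "e = r / (2 * (L * cP + 1))"
				have e: "e > 0" using r LcP by (simp add: e_def)
				have ex: "ALL j. EX dl. dl > 0 & (ALL u:cube. ALL v:cube. (ALL k. abs (u $ k - v $ k) <= dl) --> abs (B j x u - B j x v) <= e)"
					using Breg[of _ x] e unfolding reg_def by meson
				from choice[OF ex] obtain dl where dl: "ALL j. dl j > 0 & (ALL u:cube. ALL v:cube. (ALL k. abs (u $ k - v $ k) <= dl j) --> abs (B j x u - B j x v) <= e)" by blast
				have "\<forall>\<^sub>F l in sequentially. ALL j:{..M}. 1 / 2 ^ l <= dl j" using dl by (intro eventually_ball_finite ballI eventually_half_power) auto
				hence "\<forall>\<^sub>F l in sequentially. norm (?Y l x - h (?G x)) < r"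
				proof eventually_elim
					case (elim l)
					have "supdist M (PhiS l (%s. B (fst s) x (snd s))) (?G x) <= cP * e"
					proof (rule supdist_le)
						fix j and u :: "real^'p" assume ju: "j <= M" "u : cube"
						have "abs (gstep M l (%s. B (fst s) x (snd s)) j v - B j x v) <= e" if v: "v : cube" for v
						proof -
							have "1 / 2 ^ l <= dl j" using elim ju by auto
							hence "ALL k. abs (dyv l v $ k - v $ k) <= dl j" using dyv_dist order_trans by blast
							hence "abs (B j x (dyv l v) - B j x v) <= e" using dl v dyv_cube by blast
							thus ?thesis using ju v by (simp add: gstep_def)
						qed
						hence "abs (sc.Phi (gstep M l (%s. B (fst s) x (snd s)) j) u - sc.Phi (B j x) u) <= cP * e" using ju(2) by (intro Phi_close)
						thus "abs (PhiS l (%s. B (fst s) x (snd s)) j u - ?G x j u) <= cP * e" using ju by (simp add: PhiS_def Ge)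
					qed
					hence "L * supdist M (PhiS l (%s. B (fst s) x (snd s))) (?G x) <= L * (cP * e)" using L0 by (rule mult_left_mono)
					also have "... <= (L * cP + 1) * e" using e by (simp add: algebra_simps)
					also have "... = r / 2"
					proof -
						obtain c where c: "c = L * cP + 1" "c > 0" using LcP by simp
						show ?thesis unfolding e_def c(1)[symmetric] using c(2) by simp
					qed
					finally show ?case using Lip[OF PhiS_lspace Glsp, of l "%s. B (fst s) x (snd s)" x] r unfolding gl_def by simp
				qed
				thus "EX no. ALL l>=no. norm (?Y l x - h (?G x)) < r" by (simp add: eventually_sequentially)
			qed
		qed (use Ym glK in auto)
		show "(%n. outer_exp P (%om. h (bootproc P V A W M n om))) \<longlonglongrightarrow> (\<integral>x. h (?G x) \<partial>Q)"
		proof (rule LIMSEQ_I)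
			fix r :: real assume r: "r > 0"
			\<comment> \<open>Error budget: \<open>L * ep\<close> and \<open>2 * K * et\<close> are at most
			  \<open>r / 8\<close> each, and the limits in \<open>n\<close> and in \<open>l\<close> cost less
			  than \<open>r / 4\<close> each.\<close>
			define ep where "ep = r / (8 * (L + 1))"
			define et where "et = r / (16 * (K + 1))"
			have ep: "ep > 0" and et: "et > 0" using r L0 K0 by (auto simp: ep_def et_def)
			have Lep: "L * ep <= r / 8"
			proof -
				have "L * ep <= (L + 1) * ep" using ep by (intro mult_right_mono) auto
				also have "... = r / 8"
				proof -
					obtain c where c: "c = L + 1" "c > 0" using L0 by simp
					show ?thesis unfolding ep_def c(1)[symmetric] using c(2) by simp
				qed
				finally show ?thesis .
			qed
			have Ket: "2 * K * et <= r / 8"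
			proof -
				have "2 * K * et <= 2 * (K + 1) * et" using et by (intro mult_right_mono) auto
				also have "... = r / 8"
				proof -
					obtain c where c: "c = K + 1" "c > 0" using K0 by simp
					show ?thesis unfolding et_def c(1)[symmetric] using c(2) by simp
				qed
				finally show ?thesis .
			qed
			obtain l0 where l0: "!!l. l >= l0 ==> hp P et (%n om. supdist M (bootproc P V A W M n om) (PhiS l (%s. ZZ n (fst s) om (snd s))) <= ep)"
				by (rule bootproc_close[OF ep et]) blast
			have "\<forall>\<^sub>F l in sequentially. dist (\<integral>x. ?Y l x \<partial>Q) (\<integral>x. h (?G x) \<partial>Q) < r / 4" using grid r by (intro tendstoD) auto
			hence "\<forall>\<^sub>F l in sequentially. dist (\<integral>x. ?Y l x \<partial>Q) (\<integral>x. h (?G x) \<partial>Q) < r / 4 & l >= l0"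
				using eventually_ge_at_top[of l0] by eventually_elim simp
			then obtain l where l: "dist (\<integral>x. ?Y l x \<partial>Q) (\<integral>x. h (?G x) \<partial>Q) < r / 4" "l >= l0"
				using eventually_happens'[OF sequentially_bot] by blast
			have "\<forall>\<^sub>F n in sequentially. dist (\<integral>om. ?F n l om \<partial>P) (\<integral>x. ?Y l x \<partial>Q) < r / 4" using fidi[of l] r by (intro tendstoD) auto
			with hpD[OF l0[OF l(2)]] have "\<forall>\<^sub>F n in sequentially. norm (outer_exp P (%om. h (bootproc P V A W M n om)) - (\<integral>x. h (?G x) \<partial>Q)) < r"
			proof eventually_elim
				case (elim n)
				then obtain E where E: "E : sets P" "measure P E < et"
					"!!om. om : space P - E ==> supdist M (bootproc P V A W M n om) (PhiS l (%s. ZZ n (fst s) om (snd s))) <= ep" by blast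
				have "abs (outer_exp P (%om. h (bootproc P V A W M n om)) - (\<integral>om. ?F n l om \<partial>P)) <= L * ep + 2 * K * et"
				proof (rule outer_exp_approx[OF prob _ Fm _ E(1)])
					show "abs (h (bootproc P V A W M n om)) <= K" for om by (rule hK[OF bootproc_lspace])
					show "abs (?F n l om) <= K" for om by (rule glK)
					show "measure P E <= et" using E(2) by simp
					show "0 <= L * ep" using L0 ep by simp
					fix om assume "om : space P - E"
					hence "L * supdist M (bootproc P V A W M n om) (PhiS l (%s. ZZ n (fst s) om (snd s))) <= L * ep" using E(3) L0 by (intro mult_left_mono) auto
					thus "abs (h (bootproc P V A W M n om) - ?F n l om) <= L * ep"
						unfolding gl_def using Lip[OF bootproc_lspace PhiS_lspace, of W n om l "%s. ZZ n (fst s) om (snd s)"] by linarith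
				qed
				thus ?case using Lep Ket elim(2) l(1) r unfolding dist_real_def real_norm_def by linarith
			qed
			thus "EX no. ALL n>=no. norm (outer_exp P (%om. h (bootproc P V A W M n om)) - (\<integral>x. h (?G x) \<partial>Q)) < r"
				by (simp add: eventually_sequentially)
		qed
	qed
	show ?thesis
	proof (intro exI[of _ Q] exI[of _ B] conjI Q Gmeas weak)
		show "ALL j<=M. gaussian_proc Q (B j) (covB P V A)" unfolding B_def[abs_def] using gp by blast
		show "Q.indep_sets (%j. gen_sigma Q (%u x. B j x u) cube) {..M}" unfolding B_def by (rule ind)
	qed
qed

end

theorem theorem5:
  fixes P :: "'w measure"
    and V :: "nat \<Rightarrow> 'w \<Rightarrow> (real^'p::finite) \<times> (real^'q::finite)"
    and W :: "nat \<Rightarrow> nat \<Rightarrow> nat \<Rightarrow> 'w \<Rightarrow> real"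
    and A :: "(real^'q) set"
    and M :: nat
  assumes prob: "prob_space P"
    and iid: "prob_space.indep_vars P (\<lambda>_. borel) V UNIV"
             "\<forall>i. distr P borel (V i) = distr P borel (V 0)"
    and A_borel: "A \<in> sets borel"
    and pA_pos: "pA P V A > 0"
    and margins_cont: "\<forall>k. continuous_on UNIV (condF P V A k)"
    and C: "condC P V A"
    and M2: "M \<ge> 2"
    and Wcond: "\<forall>j\<in>{1..M}. exch_weights P (W j) \<and> condW P (W j)"
    and Wcopies: "\<forall>j\<in>{1..M}. \<forall>n.
        distr P (Pi\<^sub>M {..<n} (\<lambda>_. borel)) (\<lambda>\<omega>. \<lambda>i\<in>{..<n}. W j n i \<omega>)
      = distr P (Pi\<^sub>M {..<n} (\<lambda>_. borel)) (\<lambda>\<omega>. \<lambda>i\<in>{..<n}. W 1 n i \<omega>)"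
    and indep: "prob_space.indep_sets P
        (\<lambda>j. if j = 0 then gen_sigma P V UNIV
             else gen_sigma P (\<lambda>(n, i). W j n i) {(n, i). i < n}) {..M}"
  shows "\<exists>(Q :: real measure) (B :: nat \<Rightarrow> real \<Rightarrow> real^'p \<Rightarrow> real).
           prob_space Q
         \<and> (\<forall>j\<le>M. gaussian_proc Q (B j) (covB P V A))
         \<and> prob_space.indep_sets Q (\<lambda>j. gen_sigma Q (\<lambda>u x. B j x u) cube) {..M}
         \<and> limproc P V A M B \<in> measurable Q (lsp_borel M)
         \<and> hj_weak_conv M P (bootproc P V A W M) Q (limproc P V A M B)"
proof -
  interpret boot_sample P V A W M
    by (intro boot_sample.intro copula_data.intro boot_sample_axioms.intro; fact)
  show ?thesis by (rule bootstrap_limit)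
qed

end
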